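(* Let $C$ be an elliptic curve over $\mathbb{C}$ and $\pi\colon S_1\to C$ the stable ruled surface over $C$. Let $\mathbf{W}$ be the singular holomorphic $4$-web on $S_1$ composed of the Riccati foliation $\mathrm{Ric}$, the $2$-web $\mathcal{W}$ of sections of self-intersection $+1$, and the fibration $\pi$, and let $\Delta$ be the discriminant of $\mathcal{W}$. Then there exists a double cover $\varphi\colon C\times C\to S_1$, ramified on $\Delta$, on which the lifted $4$-web $\varphi^*\mathbf{W}$ is parallelizable.
   Context: Let $C$ be an elliptic curve over $\mathbb{C}$ with origin $p_\infty$. A ruled surface over $C$ is a $\mathbb{P}^1$-fibration $\pi\colon S\to C$. It is called stable if every section $\sigma$ has self-intersection $\sigma\cdot\sigma>0$. $S_1=\mathbb{P}(E_1)$, where $E_1$ is the unique nontrivial extension $0\to\mathcal{O}_C\to E_1\to\mathcal{O}_C(p_\infty)\to 0$; up to isomorphism it is the unique stable ruled surface over $C$. The minimal self-intersection of sections of $S_1$ is $1$; sections with self-intersection $1$ are called minimal sections. Through a generic point of $S_1$ there pass exactly two minimal sections, and through every point at least one and at most two; $\mathcal{W}$ is the singular $2$-web whose leaves are the minimal sections. Its discriminant $\Delta$ is the set of points of $S_1$ through which only one minimal section passes. "Ramified on $\Delta$" means that $\Delta\subset S_1$ is the branch locus. The foliation $\mathrm{Ric}$: write $C=\mathbb{C}/\Lambda$ with $\Lambda=\mathbb{Z}+\tau\mathbb{Z}$, and let $\varrho\colon\Lambda\to \mathrm{PSL}_2(\mathbb{C})$ be given by $\varrho(1)=(z\mapsto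 -z)$, $\varrho(\tau)=(z\mapsto 1/z)$. Then $S_1$ is isomorphic, over $C$, to the quotient of $\mathbb{C}\times\mathbb{P}^1$ by the action $\lambda\cdot(x,z)=(x+\lambda,\varrho(\lambda)(z))$ of $\Lambda$, and $\mathrm{Ric}$ is the regular foliation transverse to the fibres of $\pi$ induced by the horizontal foliation of $\mathbb{C}\times\mathbb{P}^1$. A $4$-web is parallelizable if, in suitable local holomorphic coordinates, it is the superposition of four families of parallel straight lines. *)

theory Defs
  imports "HOL-Complex_Analysis.Complex_Analysis"
begin

section \<open>Complex manifolds\<close>

text \<open>Coordinate spaces: finite-dimensional complex vector spaces (here \<open>\<complex>\<close>, \<open>\<complex>\<^sup>2\<close>, \<dots>).\<close>

class complex_space = euclidean_space +
  fixes scaleC :: "complex \<Rightarrow> 'a \<Rightarrow> 'a"  (infixr "*\<^sub>C" 75)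
  assumes scaleC_add_right: "c *\<^sub>C (x + y) = c *\<^sub>C x + c *\<^sub>C y"
    and scaleC_add_left: "(c + d) *\<^sub>C x = c *\<^sub>C x + d *\<^sub>C x"
    and scaleC_scaleC: "c *\<^sub>C d *\<^sub>C x = (c * d) *\<^sub>C x"
    and scaleC_of_real: "complex_of_real r *\<^sub>C x = r *\<^sub>R x"

instantiation complex :: complex_space
begin
definition scaleC_complex :: "complex \<Rightarrow> complex \<Rightarrow> complex"
  where "scaleC_complex c z = c * z"
instance
  by standard (auto simp: scaleC_complex_def algebra_simps scaleR_conv_of_real)
end

instantiation prod :: (complex_space, complex_space) complex_space
begin
definition scaleC_prod :: "complex \<Rightarrow> 'a \<times> 'b \<Rightarrow> 'a \<times> 'b"
  where "scaleC_prod c v = (c *\<^sub>C fst v, c *\<^sub>C snd v)"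
instance
  by standard
    (auto simp: scaleC_prod_def scaleC_add_right scaleC_add_left scaleC_scaleC scaleC_of_real
       scaleR_prod_def)
end

definition cholomorphic_on :: "('a::complex_space \<Rightarrow> 'b::complex_space) \<Rightarrow> 'a set \<Rightarrow> bool"
  where "cholomorphic_on f W \<longleftrightarrow>
    (\<forall>x\<in>W. \<exists>D. (f has_derivative D) (at x) \<and> (\<forall>c v. D (c *\<^sub>C v) = c *\<^sub>C D v))"

text \<open>
  A manifold is given by an atlas; a chart \<open>(U, f)\<close> consists of its domain and the coordinate map,
  whose values outside \<open>U\<close> are irrelevant. The points and the topology are recovered from the atlas.
\<close>

type_synonym ('p, 'e) atlas = "('p set \<times> ('p \<Rightarrow> 'e)) set"

definition points :: "('p, 'e) atlas \<Rightarrow> 'p set"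
  where "points M = \<Union> (fst ` M)"

definition mtop :: "('p, 'e::complex_space) atlas \<Rightarrow> 'p topology"
  where "mtop M = topology (\<lambda>W. W \<subseteq> points M \<and> (\<forall>(U, f)\<in>M. open (f ` (W \<inter> U))))"

definition complex_manifold :: "('p, 'e::complex_space) atlas \<Rightarrow> bool"
  where "complex_manifold M \<longleftrightarrow>
    (\<forall>(U, f)\<in>M. inj_on f U \<and> open (f ` U)) \<and>
    (\<forall>(U, f)\<in>M. \<forall>(V, g)\<in>M.
       open (f ` (U \<inter> V)) \<and> cholomorphic_on (g \<circ> inv_into U f) (f ` (U \<inter> V))) \<and>
    Hausdorff_space (mtop M) \<and> second_countable (mtop M)"

lemma istopology_atlas:
  assumes "\<And>U f. (U, f) \<in> M \<Longrightarrow> inj_on f U"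
  shows "istopology (\<lambda>W. W \<subseteq> points M \<and> (\<forall>(U, f)\<in>M. open (f ` (W \<inter> U))))"
  unfolding istopology_def
proof (intro conjI allI impI)
  fix S T
  assume S: "S \<subseteq> points M \<and> (\<forall>(U, f)\<in>M. open (f ` (S \<inter> U)))"
    and T: "T \<subseteq> points M \<and> (\<forall>(U, f)\<in>M. open (f ` (T \<inter> U)))"
  show "S \<inter> T \<subseteq> points M" using S by blast
  have "open (f ` (S \<inter> T \<inter> U))" if "(U, f) \<in> M" for U f
  proof -
    have "f ` (S \<inter> T \<inter> U) = f ` (S \<inter> U) \<inter> f ` (T \<inter> U)"
      using assms[OF that] by (auto simp: inj_on_def)
    thus ?thesis using S T that by auto
  qed
  thus "\<forall>(U, f)\<in>M. open (f ` (S \<inter> T \<inter> U))" by auto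
next
  fix K
  assume K: "\<forall>S\<in>K. S \<subseteq> points M \<and> (\<forall>(U, f)\<in>M. open (f ` (S \<inter> U)))"
  show "\<Union> K \<subseteq> points M" using K by blast
  have "open (f ` (\<Union> K \<inter> U))" if "(U, f) \<in> M" for U f
  proof -
    have "f ` (\<Union> K \<inter> U) = (\<Union>S\<in>K. f ` (S \<inter> U))" by blast
    moreover have "open (f ` (S \<inter> U))" if "S \<in> K" for S
      using K that \<open>(U, f) \<in> M\<close> by blast
    ultimately show ?thesis by (simp add: open_UN)
  qed
  thus "\<forall>(U, f)\<in>M. open (f ` (\<Union> K \<inter> U))" by auto
qed

lemma openin_mtop:
  assumes "\<And>U f. (U, f) \<in> M \<Longrightarrow> inj_on f U"
  shows "openin (mtop M) W \<longleftrightarrow> W \<subseteq> points M \<and> (\<forall>(U, f)\<in>M. open (f ` (W \<inter> U)))"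
  unfolding mtop_def using topology_inverse'[OF istopology_atlas[OF assms]] by simp

lemma topspace_mtop:
  assumes "complex_manifold M"
  shows "topspace (mtop M) = points M"
proof -
  have inj: "\<And>U f. (U, f) \<in> M \<Longrightarrow> inj_on f U"
    using assms unfolding complex_manifold_def by blast
  have op: "openin (mtop M) W \<longleftrightarrow>
      W \<subseteq> points M \<and> (\<forall>(U, f)\<in>M. open (f ` (W \<inter> U)))" for W
    using inj by (rule openin_mtop)
  have "openin (mtop M) U" if Uf: "(U, f) \<in> M" for U f
    unfolding op
  proof (intro conjI)
    show "U \<subseteq> points M"
      unfolding points_def using Uf by (metis Union_upper fst_conv imageI)
    have "open (g ` (V \<inter> U))" if "(V, g) \<in> M" for V g
      using assms Uf that unfolding complex_manifold_def by blast
    thus "\<forall>(V, g)\<in>M. open (g ` (U \<inter> V))" by (auto simp: Int_commute)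
  qed
  hence "points M \<subseteq> topspace (mtop M)"
    unfolding points_def by (force dest: openin_subset)
  thus ?thesis
    using openin_topspace[of "mtop M"] unfolding op by blast
qed

definition restrict_atlas :: "('p, 'e) atlas \<Rightarrow> 'p set \<Rightarrow> ('p, 'e) atlas"
  where "restrict_atlas M W = (\<lambda>(U, f). (U \<inter> W, f)) ` M"

definition prod_atlas :: "('p, 'e) atlas \<Rightarrow> ('q, 'd) atlas \<Rightarrow> ('p \<times> 'q, 'e \<times> 'd) atlas"
  where "prod_atlas M N = {(U \<times> V, map_prod f g) | U f V g. (U, f) \<in> M \<and> (V, g) \<in> N}"

definition domain_atlas :: "'e set \<Rightarrow> ('e, 'e) atlas"
  where "domain_atlas W = {(W, id)}"

text \<open>
  The quotient of \<open>M\<close> by a free and properly discontinuous action with quotient map \<open>p\<close>: the charts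
  are the charts of \<open>M\<close> transported by the local inverses of \<open>p\<close>.
\<close>

definition quotient_atlas :: "('p, 'e::complex_space) atlas \<Rightarrow> ('p \<Rightarrow> 'q) \<Rightarrow> ('q, 'e) atlas"
  where "quotient_atlas M p =
    {(p ` D, f \<circ> inv_into D p) | D U f.
       (U, f) \<in> M \<and> D \<subseteq> U \<and> openin (mtop M) D \<and> inj_on p D}"

definition holomorphic_map ::
  "('p, 'e::complex_space) atlas \<Rightarrow> ('q, 'd::complex_space) atlas \<Rightarrow> ('p \<Rightarrow> 'q) \<Rightarrow> bool"
  where "holomorphic_map M N h \<longleftrightarrow>
    continuous_map (mtop M) (mtop N) h \<and>
    (\<forall>(U, f)\<in>M. \<forall>(V, g)\<in>N. cholomorphic_on (g \<circ> h \<circ> inv_into U f) (f ` (U \<inter> h -` V)))"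

definition biholomorphic_map ::
  "('p, 'e::complex_space) atlas \<Rightarrow> ('q, 'd::complex_space) atlas \<Rightarrow> ('p \<Rightarrow> 'q) \<Rightarrow> bool"
  where "biholomorphic_map M N h \<longleftrightarrow>
    holomorphic_map M N h \<and>
    (\<exists>k. holomorphic_map N M k \<and> (\<forall>x\<in>points M. k (h x) = x) \<and> (\<forall>y\<in>points N. h (k y) = y))"

definition locally_biholomorphic_at ::
  "('p, 'e::complex_space) atlas \<Rightarrow> ('q, 'd::complex_space) atlas \<Rightarrow> ('p \<Rightarrow> 'q) \<Rightarrow> 'p \<Rightarrow> bool"
  where "locally_biholomorphic_at M N h x \<longleftrightarrow>
    (\<exists>U V. openin (mtop M) U \<and> x \<in> U \<and> openin (mtop N) V \<and>
       biholomorphic_map (restrict_atlas M U) (restrict_atlas N V) h)"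

definition branch_locus ::
  "('p, 'e::complex_space) atlas \<Rightarrow> ('q, 'd::complex_space) atlas \<Rightarrow> ('p \<Rightarrow> 'q) \<Rightarrow> 'q set"
  where "branch_locus M N h = h ` {x\<in>points M. \<not> locally_biholomorphic_at M N h x}"

definition double_cover ::
  "('p, 'e::complex_space) atlas \<Rightarrow> ('q, 'd::complex_space) atlas \<Rightarrow> ('p \<Rightarrow> 'q) \<Rightarrow> bool"
  where "double_cover M N h \<longleftrightarrow>
    holomorphic_map M N h \<and> proper_map (mtop M) (mtop N) h \<and> h ` points M = points N \<and>
    (\<forall>y\<in>points N. finite {x\<in>points M. h x = y}) \<and>
    (\<forall>y\<in>points N - branch_locus M N h. card {x\<in>points M. h x = y} = 2)"


section \<open>The projective line and elliptic curves\<close>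

datatype proj_line = Affine complex | Infinity

definition proj_line_atlas :: "(proj_line, complex) atlas"
  where "proj_line_atlas =
    {(- {Infinity}, \<lambda>z. case z of Affine w \<Rightarrow> w | Infinity \<Rightarrow> 0),
     (- {Affine 0}, \<lambda>z. case z of Affine w \<Rightarrow> 1 / w | Infinity \<Rightarrow> 0)}"

text \<open>The point of \<open>\<complex> / (\<int> + \<tau>\<int>)\<close> represented by \<open>x\<close> is the coset of \<open>x\<close>.\<close>

definition torus_proj :: "complex \<Rightarrow> complex \<Rightarrow> complex set"
  where "torus_proj \<tau> x = {x + of_int m + of_int n * \<tau> | m n. True}"

definition elliptic_curve :: "complex \<Rightarrow> (complex set, complex) atlas"
  where "elliptic_curve \<tau> = quotient_atlas (domain_atlas UNIV) (torus_proj \<tau>)"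


section \<open>Ruled surfaces\<close>

definition ruled_surface ::
  "('c, complex) atlas \<Rightarrow> ('s, complex \<times> complex) atlas \<Rightarrow> ('s \<Rightarrow> 'c) \<Rightarrow> bool"
  where "ruled_surface C S \<pi> \<longleftrightarrow>
    complex_manifold S \<and> holomorphic_map S C \<pi> \<and>
    (\<forall>q\<in>points C. \<exists>V \<Phi>. openin (mtop C) V \<and> q \<in> V \<and>
       biholomorphic_map (restrict_atlas S {p\<in>points S. \<pi> p \<in> V})
         (prod_atlas (restrict_atlas C V) proj_line_atlas) \<Phi> \<and>
       (\<forall>p\<in>points S. \<pi> p \<in> V \<longrightarrow> fst (\<Phi> p) = \<pi> p))"

definition is_section ::
  "('c, complex) atlas \<Rightarrow> ('s, complex \<times> complex) atlas \<Rightarrow> ('s \<Rightarrow> 'c) \<Rightarrow> ('c \<Rightarrow> 's) \<Rightarrow> bool"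
  where "is_section C S \<pi> \<sigma> \<longleftrightarrow> holomorphic_map C S \<sigma> \<and> (\<forall>q\<in>points C. \<pi> (\<sigma> q) = q)"

text \<open>
  The self-intersection of a section \<open>\<sigma>\<close> is the degree of its normal bundle
  \<open>\<sigma>\<^sup>*TS / TC\<close>, i.e. the number of zeros minus the number of poles, with multiplicity, of any nonzero
  meromorphic section of this line bundle. Such a section is represented by a meromorphic section \<open>w\<close>
  of \<open>\<sigma>\<^sup>*TS\<close>, where \<open>w k q\<close> is the vector at \<open>\<sigma> q\<close> written in the chart \<open>k\<close> of \<open>S\<close>; the finite
  set \<open>P\<close> contains the poles, where the value of \<open>w\<close> carries no information.
\<close>

definition meromorphic_field_along ::
  "('c, complex) atlas \<Rightarrow> ('s, complex \<times> complex) atlas \<Rightarrow> ('c \<Rightarrow> 's) \<Rightarrow>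
   ('s set \<times> ('s \<Rightarrow> complex \<times> complex) \<Rightarrow> 'c \<Rightarrow> complex \<times> complex) \<Rightarrow> bool"
  where "meromorphic_field_along C S \<sigma> w \<longleftrightarrow>
    (\<exists>P. finite P \<and>
       (\<forall>k\<in>S. \<forall>k'\<in>S. \<forall>q\<in>points C - P. \<sigma> q \<in> fst k \<inter> fst k' \<longrightarrow>
          w k' q = frechet_derivative (snd k' \<circ> inv_into (fst k) (snd k)) (at (snd k (\<sigma> q))) (w k q))) \<and>
    (\<forall>(V, g)\<in>C. \<forall>k\<in>S.
       (\<lambda>t. fst (w k (inv_into V g t))) meromorphic_on g ` (V \<inter> \<sigma> -` fst k) \<and>
       (\<lambda>t. snd (w k (inv_into V g t))) meromorphic_on g ` (V \<inter> \<sigma> -` fst k))"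

text \<open>
  For a curve in \<open>\<complex>\<^sup>2\<close> with velocity \<open>v\<close>, the determinant of \<open>(w, v)\<close> identifies the class of \<open>w\<close> modulo
  \<open>v\<close> with a number. Changing the charts multiplies it by a nowhere vanishing holomorphic function,
  so that its order is the order of the section of the normal bundle.
\<close>

definition normal_coordinate ::
  "'c set \<times> ('c \<Rightarrow> complex) \<Rightarrow> 's set \<times> ('s \<Rightarrow> complex \<times> complex) \<Rightarrow> ('c \<Rightarrow> 's) \<Rightarrow>
   ('s set \<times> ('s \<Rightarrow> complex \<times> complex) \<Rightarrow> 'c \<Rightarrow> complex \<times> complex) \<Rightarrow> complex \<Rightarrow> complex"
  where "normal_coordinate j k \<sigma> w t =
    (let r = inv_into (fst j) (snd j);
         u = w k (r t);
         v = frechet_derivative (snd k \<circ> \<sigma> \<circ> r) (at t) 1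
     in fst u * snd v - snd u * fst v)"

definition normal_order ::
  "('c, complex) atlas \<Rightarrow> ('s, complex \<times> complex) atlas \<Rightarrow> ('c \<Rightarrow> 's) \<Rightarrow>
   ('s set \<times> ('s \<Rightarrow> complex \<times> complex) \<Rightarrow> 'c \<Rightarrow> complex \<times> complex) \<Rightarrow> 'c \<Rightarrow> int"
  where "normal_order C S \<sigma> w q =
    (THE n. \<forall>j\<in>C. \<forall>k\<in>S. q \<in> fst j \<longrightarrow> \<sigma> q \<in> fst k \<longrightarrow>
       n = zorder (normal_coordinate j k \<sigma> w) (snd j q))"

definition nonzero_normal ::
  "('c, complex) atlas \<Rightarrow> ('s, complex \<times> complex) atlas \<Rightarrow> ('c \<Rightarrow> 's) \<Rightarrow>
   ('s set \<times> ('s \<Rightarrow> complex \<times> complex) \<Rightarrow> 'c \<Rightarrow> complex \<times> complex) \<Rightarrow> bool"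
  where "nonzero_normal C S \<sigma> w \<longleftrightarrow>
    (\<forall>j\<in>C. \<forall>k\<in>S. \<forall>q. q \<in> fst j \<longrightarrow> \<sigma> q \<in> fst k \<longrightarrow>
       (\<forall>\<^sub>F t in at (snd j q). normal_coordinate j k \<sigma> w t \<noteq> 0))"

definition self_intersection ::
  "('c, complex) atlas \<Rightarrow> ('s, complex \<times> complex) atlas \<Rightarrow> ('c \<Rightarrow> 's) \<Rightarrow> int"
  where "self_intersection C S \<sigma> =
    (THE n. \<exists>w. meromorphic_field_along C S \<sigma> w \<and> nonzero_normal C S \<sigma> w \<and>
       n = (\<Sum>q | q \<in> points C \<and> normal_order C S \<sigma> w q \<noteq> 0. normal_order C S \<sigma> w q))"

definition stable_ruled_surface ::
  "('c, complex) atlas \<Rightarrow> ('s, complex \<times> complex) atlas \<Rightarrow> ('s \<Rightarrow> 'c) \<Rightarrow> bool"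
  where "stable_ruled_surface C S \<pi> \<longleftrightarrow>
    ruled_surface C S \<pi> \<and> (\<forall>\<sigma>. is_section C S \<pi> \<sigma> \<longrightarrow> self_intersection C S \<sigma> > 0)"


section \<open>Webs\<close>

text \<open>
  A (singular) web on a surface is represented by the set of its leaves; the superposition of webs is
  then the union of the sets of leaves.
\<close>

type_synonym 's web = "'s set set"

definition fibration_web ::
  "('c, complex) atlas \<Rightarrow> ('s, complex \<times> complex) atlas \<Rightarrow> ('s \<Rightarrow> 'c) \<Rightarrow> 's web"
  where "fibration_web C S \<pi> = {{p\<in>points S. \<pi> p = q} | q. q \<in> points C}"

definition minimal_section_web ::
  "('c, complex) atlas \<Rightarrow> ('s, complex \<times> complex) atlas \<Rightarrow> ('s \<Rightarrow> 'c) \<Rightarrow> 's web"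
  where "minimal_section_web C S \<pi> =
    {\<sigma> ` points C | \<sigma>. is_section C S \<pi> \<sigma> \<and> self_intersection C S \<sigma> = 1}"

definition web_discriminant ::
  "('c, complex) atlas \<Rightarrow> ('s, complex \<times> complex) atlas \<Rightarrow> ('s \<Rightarrow> 'c) \<Rightarrow> 's set"
  where "web_discriminant C S \<pi> = {p\<in>points S. \<exists>!L. L \<in> minimal_section_web C S \<pi> \<and> p \<in> L}"

text \<open>
  The representation \<open>\<rho>\<close> with \<open>\<rho>(1) = (z \<mapsto> -z)\<close> and \<open>\<rho>(\<tau>) = (z \<mapsto> 1/z)\<close>, evaluated at \<open>m + n\<tau>\<close>; the
  two generators act by commuting involutions, so only the parities of \<open>m\<close> and \<open>n\<close> matter.
\<close>

definition proj_neg :: "proj_line \<Rightarrow> proj_line"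
  where "proj_neg z = (case z of Affine w \<Rightarrow> Affine (- w) | Infinity \<Rightarrow> Infinity)"

definition proj_inv :: "proj_line \<Rightarrow> proj_line"
  where "proj_inv z =
    (case z of Affine w \<Rightarrow> (if w = 0 then Infinity else Affine (1 / w)) | Infinity \<Rightarrow> Affine 0)"

definition rho :: "int \<Rightarrow> int \<Rightarrow> proj_line \<Rightarrow> proj_line"
  where "rho m n = (if even m then id else proj_neg) \<circ> (if even n then id else proj_inv)"

definition suspension_proj :: "complex \<Rightarrow> complex \<times> proj_line \<Rightarrow> (complex \<times> proj_line) set"
  where "suspension_proj \<tau> y = {(fst y + of_int m + of_int n * \<tau>, rho m n (snd y)) | m n. True}"

definition suspension :: "complex \<Rightarrow> ((complex \<times> proj_line) set, complex \<times> complex) atlas"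
  where "suspension \<tau> =
    quotient_atlas (prod_atlas (domain_atlas UNIV) proj_line_atlas) (suspension_proj \<tau>)"

text \<open>
  \<open>R\<close> is the foliation on \<open>S\<close> induced by the horizontal foliation of \<open>\<complex> \<times> \<P>\<^sup>1\<close> via an isomorphism over
  \<open>\<complex> / (\<int> + \<tau>\<int>)\<close> between the quotient of \<open>\<complex> \<times> \<P>\<^sup>1\<close> and \<open>S\<close>.
\<close>

definition riccati_foliation ::
  "complex \<Rightarrow> ('s, complex \<times> complex) atlas \<Rightarrow> ('s \<Rightarrow> complex set) \<Rightarrow> 's web \<Rightarrow> bool"
  where "riccati_foliation \<tau> S \<pi> R \<longleftrightarrow>
    (\<exists>\<psi>. biholomorphic_map (suspension \<tau>) S \<psi> \<and>
       (\<forall>x z. \<pi> (\<psi> (suspension_proj \<tau> (x, z))) = torus_proj \<tau> x) \<and>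
       R = {range (\<lambda>x. \<psi> (suspension_proj \<tau> (x, z))) | z. True})"

definition pullback_web :: "('p, 'e) atlas \<Rightarrow> ('p \<Rightarrow> 's) \<Rightarrow> 's web \<Rightarrow> 'p web"
  where "pullback_web M h \<W> = {{x\<in>points M. h x \<in> L} | L. L \<in> \<W>}"

definition complex_line :: "'e::complex_space set \<Rightarrow> bool"
  where "complex_line l \<longleftrightarrow> (\<exists>v. v \<noteq> 0 \<and> l = range (\<lambda>c. c *\<^sub>C v))"

text \<open>
  Plaques of the \<open>k\<close> families of parallel lines with directions in \<open>Ls\<close>, on a coordinate domain \<open>U\<close>
  whose image under the coordinate map \<open>\<zeta>\<close> is convex (so that plaques are connected).
\<close>

definition line_plaques :: "'p set \<Rightarrow> ('p \<Rightarrow> 'e::complex_space) \<Rightarrow> 'e set set \<Rightarrow> 'p set set"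
  where "line_plaques U \<zeta> Ls = {{y\<in>U. \<zeta> y - \<zeta> x \<in> l} | x l. x \<in> U \<and> l \<in> Ls}"

text \<open>
  A leaf may return to \<open>U\<close>, and the preimage of a leaf under a covering may contain several leaves, so
  a member of the web meets \<open>U\<close> in a union of (countably many) plaques.
\<close>

definition parallelizable_web :: "nat \<Rightarrow> ('p, complex \<times> complex) atlas \<Rightarrow> 'p web \<Rightarrow> bool"
  where "parallelizable_web k M \<W> \<longleftrightarrow>
    (\<forall>x\<in>points M. \<exists>U (\<zeta> :: 'p \<Rightarrow> complex \<times> complex) Ls.
       openin (mtop M) U \<and> x \<in> U \<and> open (\<zeta> ` U) \<and> convex (\<zeta> ` U) \<and>
       biholomorphic_map (restrict_atlas M U) (domain_atlas (\<zeta> ` U)) \<zeta> \<and>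
       finite Ls \<and> card Ls = k \<and> (\<forall>l\<in>Ls. complex_line l) \<and>
       (\<forall>L\<in>\<W>. \<exists>\<P>. countable \<P> \<and> \<P> \<subseteq> line_plaques U \<zeta> Ls \<and> L \<inter> U = \<Union> \<P>) \<and>
       (\<forall>P\<in>line_plaques U \<zeta> Ls. \<exists>L\<in>\<W>. P \<subseteq> L))"

end

(*
Write S as the suspension of C x P^1, where C is the quotient of the plane by Lambda = Z + Z tau. A
section is then a holomorphic map f from the plane to P^1 with f(x+1) = -f(x) and
f(x+tau) = 1/f(x). The horizontal field along it is tangent to the section at the critical points
of f, so the self-intersection is the number of critical points modulo Lambda; any other normal
field gives the same number, because the ratio of two of them is an elliptic function, whose orders
sum to 0.

A quotient J of theta functions for the lattice 2 Lambda is an even equivariant map of degree two,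
and its critical points form the single class Lambda. Conversely, let f be equivariant with one
simple critical class a and choose c with J(a+c) = f(a). For g(x) = J(x+c) the expression
(f-g)^2/(f'g') is Moebius invariant, hence elliptic for Lambda. It has at most one simple pole
modulo Lambda, so it is constant, and it vanishes at a; so f = g. Therefore the minimal
sections are x -> [x, J(x+c)].

The double cover is (q,x) -> [x, J(x-2q)]. As J takes equal values at u and v exactly when
u = v or u = -v modulo 2 Lambda, the deck involution is (q,x) -> (x-q,x), with fixed points where x-2q is
in Lambda, which is also where the two minimal sections through a point coincide. The leaves of
the four foliations lift to q = const and x-q = const (minimal sections), x = const (fibres) and
x-2q = const (Ric).
*)
theory Submission
  imports Defs
begin

text \<open>The cover is an incidence correspondence. The parameter c of a minimal section matters
  modulo 2 Lambda, because J has only these periods; with c = -2q the parameter q runs through C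
  itself. A pair (q,x) is a minimal section together with a point of the curve, and it is sent to
  the point of that section over x. The degree is two because two minimal sections pass through a
  generic point. The facts on elliptic functions rest on Liouville's theorem alone. The logarithmic
  derivative of theta has one simple pole per class and an additive period; subtracting its
  translates turns a function with simple poles into an entire one, whose additive period must be 0.
  This gives the sum of the residues, and hence the sum of the orders, without integration. Poles
  need no theory of their own. Translation by tau sends a pole of an equivariant map to a zero, and
  the point at infinity over x is the point 0 over x + tau. So local questions move to finite
  points, and the surface is the image of the plane of pairs (x,w) under a local
  biholomorphism.\<close>

section \<open>Orders of meromorphic functions\<close>

text \<open>Unlike \<open>zorder\<close>, this fails for a function that vanishes near
  \<open>a\<close> or has an essential singularity there, so it carries its own side conditions. The
  value at \<open>a\<close> is ignored, which makes default values at poles harmless.\<close>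

definition has_ord :: "(complex \<Rightarrow> complex) \<Rightarrow> complex \<Rightarrow> int \<Rightarrow> bool"
  where "has_ord f a n \<longleftrightarrow>
    (\<exists>g. g analytic_on {a} \<and> g a \<noteq> 0 \<and> (\<forall>\<^sub>F x in at a. f x = g x * (x - a) powi n))"

lemma eventually_nhds_imp_at: "eventually P (nhds a) \<Longrightarrow> eventually P (at a)"
  by (simp add: eventually_nhds_conv_at)

lemma analytic_at_nonzero_eventually:
  fixes g :: "complex \<Rightarrow> complex"
  assumes "g analytic_on {a}" "g a \<noteq> 0"
  shows "\<forall>\<^sub>F x in nhds a. g x \<noteq> 0"
proof -
  have "isCont g a" using analytic_at_imp_isCont[OF assms(1)] .
  hence "\<forall>\<^sub>F x in at a. g x \<noteq> 0"
    using assms(2) by (metis isCont_def tendsto_imp_eventually_ne)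
  thus ?thesis using assms(2) by (simp add: eventually_nhds_conv_at)
qed

text \<open>A punctured neighbourhood of \<open>a\<close> is open, so the property holds near each
  of its points. This allows an identity that is known only away from \<open>a\<close> to be
  differentiated.\<close>

lemma eventually_at_imp_nhds:
  fixes a :: complex
  assumes "\<forall>\<^sub>F x in at a. P x"
  shows "\<forall>\<^sub>F x in at a. \<forall>\<^sub>F y in nhds x. P y"
proof -
  have "\<forall>\<^sub>F x in nhds a. \<forall>\<^sub>F y in nhds x. y \<noteq> a \<longrightarrow> P y"
    using assms by (simp add: eventually_at_filter eventually_eventually)
  hence "\<forall>\<^sub>F x in nhds a. x \<noteq> a \<longrightarrow> (\<forall>\<^sub>F y in nhds x. P y)"
  proof eventually_elim
    case (elim x)
    show ?case
    proof
      assume "x \<noteq> a"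
      hence "\<forall>\<^sub>F y in nhds x. y \<noteq> a" by (rule t1_space_nhds)
      thus "\<forall>\<^sub>F y in nhds x. P y" using elim by eventually_elim auto
    qed
  qed
  thus ?thesis by (simp add: eventually_at_filter)
qed

lemma analytic_at_eventually_analytic:
  assumes "g analytic_on {a}"
  shows "\<forall>\<^sub>F x in nhds a. g analytic_on {x}"
proof -
  from assms obtain s where s: "open s" "a \<in> s" "g holomorphic_on s"
    using analytic_at by blast
  hence "\<forall>x\<in>s. g analytic_on {x}"
    using analytic_at by blast
  thus ?thesis using s eventually_nhds by blast
qed

lemma eventually_at_shift:
  fixes a c :: complex
  assumes "\<forall>\<^sub>F x in at (a + c). P x"
  shows "\<forall>\<^sub>F x in at a. P (x + c)"
proof -
  from assms obtain d where "d > 0" "\<And>x. x \<noteq> a + c \<Longrightarrow> dist x (a + c) < d \<Longrightarrow> P x"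
    unfolding eventually_at by auto
  thus ?thesis unfolding eventually_at by (intro exI[of _ d]) (auto simp: dist_norm)
qed

lemma analytic_at_shift:
  fixes f :: "complex \<Rightarrow> complex"
  assumes "f analytic_on {a + c}"
  shows "(\<lambda>x. f (x + c)) analytic_on {a}"
proof -
  have "(\<lambda>x. x + c) analytic_on {a}" by (intro analytic_intros)
  from analytic_on_compose_gen[OF this assms] show ?thesis by (simp add: o_def)
qed

lemma has_ordI:
  assumes "g analytic_on {a}" "g a \<noteq> 0" "\<forall>\<^sub>F x in at a. f x = g x * (x - a) powi n"
  shows "has_ord f a n"
  using assms has_ord_def by blast

lemma has_ord_cong:
  assumes "has_ord f a n" "\<forall>\<^sub>F x in at a. h x = f x"
  shows "has_ord h a n"
proof -
  from assms(1) obtain g where g: "g analytic_on {a}" "g a \<noteq> 0"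
    "\<forall>\<^sub>F x in at a. f x = g x * (x - a) powi n" unfolding has_ord_def by blast
  from g(3) assms(2) have "\<forall>\<^sub>F x in at a. h x = g x * (x - a) powi n"
    by eventually_elim simp
  thus ?thesis using g has_ordI by blast
qed

lemma has_ord_imp_zorder: "has_ord f a n \<Longrightarrow> zorder f a = n"
proof -
  assume "has_ord f a n"
  then obtain g where g: "g analytic_on {a}" "g a \<noteq> 0"
    "\<forall>\<^sub>F x in at a. f x = g x * (x - a) powi n" unfolding has_ord_def by blast
  from g(1) obtain s where s: "open s" "a \<in> s" "g holomorphic_on s" using analytic_at by blast
  have "zorder f a = zorder (\<lambda>x. g x * (x - a) powi n) a"
    by (rule zorder_cong) (use g(3) in auto)
  also have "\<dots> = n" by (rule zorder_eqI[OF s g(2)]) auto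
  finally show ?thesis .
qed

lemma has_ord_unique: "has_ord f a n \<Longrightarrow> has_ord f a m \<Longrightarrow> n = m"
  using has_ord_imp_zorder by metis

lemma has_ord_mult:
  assumes "has_ord f a n" "has_ord h a m"
  shows "has_ord (\<lambda>x. f x * h x) a (n + m)"
proof -
  from assms obtain g k where g: "g analytic_on {a}" "g a \<noteq> 0"
    "\<forall>\<^sub>F x in at a. f x = g x * (x - a) powi n"
    and k: "k analytic_on {a}" "k a \<noteq> 0"
    "\<forall>\<^sub>F x in at a. h x = k x * (x - a) powi m" unfolding has_ord_def by blast
  have ne: "\<forall>\<^sub>F x in at a. x \<noteq> a" by (simp add: eventually_at_filter)
  have "\<forall>\<^sub>F x in at a. f x * h x = (g x * k x) * (x - a) powi (n + m)"
    using g(3) k(3) ne by eventually_elim (simp add: power_int_add)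
  moreover have "(\<lambda>x. g x * k x) analytic_on {a}" using g(1) k(1) by (intro analytic_intros)
  ultimately show ?thesis using g(2) k(2) by (intro has_ordI[of "\<lambda>x. g x * k x"]) auto
qed

lemma has_ord_inverse:
  assumes "has_ord f a n"
  shows "has_ord (\<lambda>x. inverse (f x)) a (- n)"
proof -
  from assms obtain g where g: "g analytic_on {a}" "g a \<noteq> 0"
    "\<forall>\<^sub>F x in at a. f x = g x * (x - a) powi n" unfolding has_ord_def by blast
  have "\<forall>\<^sub>F x in at a. inverse (f x) = inverse (g x) * (x - a) powi (- n)"
    using g(3) by eventually_elim (simp add: power_int_minus field_simps)
  moreover have "(\<lambda>x. inverse (g x)) analytic_on {a}"
    using g(1,2) by (intro analytic_intros) auto
  ultimately show ?thesis using g(2) by (intro has_ordI[of "\<lambda>x. inverse (g x)"]) auto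
qed

lemma has_ord_divide:
  assumes "has_ord f a n" "has_ord h a m"
  shows "has_ord (\<lambda>x. f x / h x) a (n - m)"
  using has_ord_mult[OF assms(1) has_ord_inverse[OF assms(2)]] by (simp add: divide_inverse)

lemma has_ord_0:
  assumes "f analytic_on {a}" "f a \<noteq> 0"
  shows "has_ord f a 0"
  by (rule has_ordI[OF assms]) auto

lemma has_ord_minus: "has_ord f a n \<Longrightarrow> has_ord (\<lambda>x. - f x) a n"
  using has_ord_mult[OF has_ord_0[of "\<lambda>_. -1" a]] by auto

lemma has_ord_shift:
  assumes "has_ord f (a + c) n"
  shows "has_ord (\<lambda>x. f (x + c)) a n"
proof -
  from assms obtain g where g: "g analytic_on {a + c}" "g (a + c) \<noteq> 0"
    "\<forall>\<^sub>F x in at (a + c). f x = g x * (x - (a + c)) powi n" unfolding has_ord_def by blast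
  show ?thesis
  proof (rule has_ordI[of "\<lambda>x. g (x + c)"])
    show "\<forall>\<^sub>F x in at a. f (x + c) = g (x + c) * (x - a) powi n"
      using eventually_at_shift[OF g(3)] by eventually_elim simp
  qed (use g analytic_at_shift in auto)
qed

lemma has_ord_nonzero:
  assumes "has_ord f a n"
  shows "\<forall>\<^sub>F x in at a. f x \<noteq> 0"
proof -
  from assms obtain g where g: "g analytic_on {a}" "g a \<noteq> 0"
    "\<forall>\<^sub>F x in at a. f x = g x * (x - a) powi n" unfolding has_ord_def by blast
  have "\<forall>\<^sub>F x in at a. g x \<noteq> 0" "\<forall>\<^sub>F x in at a. x \<noteq> a"
    using eventually_nhds_imp_at[OF analytic_at_nonzero_eventually[OF g(1,2)]]
    by (auto simp: eventually_at_filter)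
  thus ?thesis using g(3) by eventually_elim simp
qed

lemma meromorphic_has_ord:
  assumes "f meromorphic_on {a}" "\<exists>\<^sub>F x in at a. f x \<noteq> 0"
  shows "has_ord f a (zorder f a)"
proof -
  have "isolated_singularity_at f a" "not_essential f a" using assms(1) meromorphic_at_iff by auto
  from zorder_exist[OF this assms(2)] obtain r where r: "zor_poly f a a \<noteq> 0" "r > 0"
    "zor_poly f a holomorphic_on cball a r"
    "\<forall>w\<in>cball a r - {a}. f w = zor_poly f a w * (w - a) powi zorder f a \<and> zor_poly f a w \<noteq> 0"
    by auto
  have "zor_poly f a analytic_on {a}"
    using r(2,3) analytic_at by (meson ball_subset_cball centre_in_ball holomorphic_on_subset open_ball)
  moreover have "\<forall>\<^sub>F x in at a. f x = zor_poly f a x * (x - a) powi zorder f a"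
    using r(2,4) unfolding eventually_at by (intro exI[of _ r]) (auto simp: dist_commute)
  ultimately show ?thesis using r(1) by (intro has_ordI)
qed

lemma has_ord_analytic_ge_0:
  assumes "has_ord f a n" "f analytic_on {a}"
  shows "n \<ge> 0"
proof -
  have "\<forall>\<^sub>F x in at a. f x \<noteq> 0" by (rule has_ord_nonzero[OF assms(1)])
  hence "\<exists>\<^sub>F x in at a. f x \<noteq> 0" by (simp add: eventually_frequently)
  thus ?thesis using zorder_ge_0[OF assms(2)] has_ord_imp_zorder[OF assms(1)] by simp
qed

lemma has_ord_analytic_pos_iff:
  assumes "has_ord f a n" "f analytic_on {a}"
  shows "n > 0 \<longleftrightarrow> f a = 0"
proof -
  have "\<forall>\<^sub>F x in at a. f x \<noteq> 0" by (rule has_ord_nonzero[OF assms(1)])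
  hence "\<exists>\<^sub>F x in at a. f x \<noteq> 0" by (simp add: eventually_frequently)
  thus ?thesis using zorder_pos_iff'[OF assms(2)] has_ord_imp_zorder[OF assms(1)] by simp
qed

lemma analytic_locally_zero_or_has_ord:
  assumes "f analytic_on {a}"
  shows "(\<forall>\<^sub>F x in nhds a. f x = 0) \<or> has_ord f a (zorder f a)"
proof (cases "\<exists>\<^sub>F x in at a. f x \<noteq> 0")
  case True
  thus ?thesis using meromorphic_has_ord[OF analytic_on_imp_meromorphic_on[OF assms]] by blast
next
  case False
  hence ev: "\<forall>\<^sub>F x in at a. f x = 0" by (simp add: frequently_def)
  have "(f \<longlongrightarrow> f a) (at a)" using analytic_at_imp_isCont[OF assms] by (simp add: isCont_def)
  moreover have "(f \<longlongrightarrow> 0) (at a)" using ev by (rule tendsto_eventually)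
  ultimately have "f a = 0" using tendsto_unique[OF at_neq_bot] by blast
  thus ?thesis using ev by (simp add: eventually_nhds_conv_at)
qed

text \<open>The factorization extends to the point \<open>a\<close> itself: for order 0 by
  continuity of both sides, for positive order because both sides vanish there. Derivatives at
  \<open>a\<close> need such a full neighbourhood.\<close>

lemma has_ord_factor:
  assumes "has_ord f a n" "f analytic_on {a}"
  shows "\<exists>g. g analytic_on {a} \<and> g a \<noteq> 0 \<and> (\<forall>\<^sub>F x in nhds a. f x = g x * (x - a) ^ nat n)"
proof -
  from assms obtain g where g: "g analytic_on {a}" "g a \<noteq> 0"
    "\<forall>\<^sub>F x in at a. f x = g x * (x - a) powi n" unfolding has_ord_def by blast
  have n: "n \<ge> 0" by (rule has_ord_analytic_ge_0[OF assms])
  have "\<forall>\<^sub>F x in at a. f x = g x * (x - a) ^ nat n"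
    using g(3) n by (simp add: power_int_def)
  moreover have "f a = g a * (a - a) ^ nat n"
  proof (cases "n = 0")
    case True
    have "(f \<longlongrightarrow> f a) (at a)" "(g \<longlongrightarrow> g a) (at a)"
      using analytic_at_imp_isCont assms(2) g(1) by (auto simp: isCont_def)
    moreover have "\<forall>\<^sub>F x in at a. f x = g x" using g(3) True by simp
    ultimately have "f a = g a"
      using tendsto_unique[OF at_neq_bot] tendsto_cong[of f g "at a"] by blast
    thus ?thesis using True by simp
  next
    case False
    thus ?thesis using has_ord_analytic_pos_iff[OF assms] n by (auto simp: power_0_left)
  qed
  ultimately show ?thesis using g by (auto simp: eventually_nhds_conv_at)
qed

lemma has_ord_deriv_factor:
  assumes "has_ord f a n" "f analytic_on {a}"
  shows "(n = 1 \<longrightarrow> deriv f a \<noteq> 0) \<and> (n \<ge> 2 \<longrightarrow> deriv f a = 0)"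
proof -
  obtain g where g: "g analytic_on {a}" "g a \<noteq> 0" "\<forall>\<^sub>F x in nhds a. f x = g x * (x - a) ^ nat n"
    using has_ord_factor[OF assms] by blast
  have gd: "(g has_field_derivative deriv g a) (at a)"
    using g(1) analytic_derivI by auto
  have "deriv f a = deriv (\<lambda>x. g x * (x - a) ^ nat n) a"
    by (rule deriv_cong_ev) (use g(3) in auto)
  also have "\<dots> = deriv g a * (a - a) ^ nat n + of_nat (nat n) * (a - a) ^ (nat n - 1) * g a"
    by (rule DERIV_imp_deriv) (auto intro!: derivative_eq_intros gd)
  finally have d: "deriv f a = deriv g a * 0 ^ nat n + of_nat (nat n) * 0 ^ (nat n - 1) * g a" by simp
  have "nat n \<noteq> 0" "nat n - 1 \<noteq> 0" if "n \<ge> 2" using that by auto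
  thus ?thesis using d g(2) by (auto simp: power_0_left)
qed

lemma has_ord_1I:
  assumes "f analytic_on {a}" "f a = 0" "deriv f a \<noteq> 0"
  shows "has_ord f a 1"
proof -
  have "\<not> (\<forall>\<^sub>F x in nhds a. f x = 0)"
  proof
    assume "\<forall>\<^sub>F x in nhds a. f x = 0"
    hence "deriv f a = deriv (\<lambda>_. 0) a" by (intro deriv_cong_ev) auto
    thus False using assms(3) by simp
  qed
  hence o: "has_ord f a (zorder f a)" using analytic_locally_zero_or_has_ord[OF assms(1)] by blast
  have "zorder f a > 0" using has_ord_analytic_pos_iff[OF o assms(1)] assms(2) by simp
  moreover have "\<not> zorder f a \<ge> 2" using has_ord_deriv_factor[OF o assms(1)] assms(3) by blast
  ultimately have "zorder f a = 1" by linarith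
  thus ?thesis using o by simp
qed

lemma has_ord_ge_2:
  assumes "has_ord f a n" "f analytic_on {a}" "f a = 0" "deriv f a = 0"
  shows "n \<ge> 2"
  using has_ord_deriv_factor[OF assms(1,2)] has_ord_analytic_pos_iff[OF assms(1,2)] assms(3,4)
  by (cases "n = 1") auto

lemma has_ord_ge_0_analytic:
  assumes "has_ord f a n" "n \<ge> 0"
  shows "\<exists>g. g analytic_on {a} \<and> (\<forall>\<^sub>F x in at a. f x = g x) \<and> (n > 0 \<longrightarrow> g a = 0)"
proof -
  from assms obtain g where g: "g analytic_on {a}" "g a \<noteq> 0"
    "\<forall>\<^sub>F x in at a. f x = g x * (x - a) powi n" unfolding has_ord_def by blast
  show ?thesis
  proof (intro exI[of _ "\<lambda>x. g x * (x - a) ^ nat n"] conjI)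
    show "(\<lambda>x. g x * (x - a) ^ nat n) analytic_on {a}" using g(1) by (intro analytic_intros)
    show "\<forall>\<^sub>F x in at a. f x = g x * (x - a) ^ nat n" using g(3) assms(2) by (simp add: power_int_def)
  qed auto
qed

text \<open>Splits off the principal part. With \<open>f = g / (x - a)\<close> the residue is
  \<open>g a\<close>, and \<open>g - g a\<close> vanishes at \<open>a\<close>, so its quotient by
  \<open>x - a\<close> is regular.\<close>

lemma has_ord_minus_1_pole:
  assumes "has_ord f a (-1)"
  shows "\<exists>g r. g analytic_on {a} \<and> (\<forall>\<^sub>F x in at a. f x = g x + r / (x - a))"
proof -
  from assms obtain g where g: "g analytic_on {a}" "g a \<noteq> 0"
    "\<forall>\<^sub>F x in at a. f x = g x * (x - a) powi (-1)" unfolding has_ord_def by blast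
  have an: "(\<lambda>x. g x - g a) analytic_on {a}" using g(1) by (intro analytic_intros)
  have "\<exists>k. k analytic_on {a} \<and> (\<forall>\<^sub>F x in at a. (g x - g a) / (x - a) = k x)"
  proof (cases "\<forall>\<^sub>F x in nhds a. g x - g a = 0")
    case True
    hence "\<forall>\<^sub>F x in at a. (g x - g a) / (x - a) = 0"
      by (auto dest!: eventually_nhds_imp_at elim: eventually_mono)
    thus ?thesis by (intro exI[of _ "\<lambda>_. 0"]) auto
  next
    case False
    hence o: "has_ord (\<lambda>x. g x - g a) a (zorder (\<lambda>x. g x - g a) a)"
      using analytic_locally_zero_or_has_ord[OF an] by blast
    have p: "zorder (\<lambda>x. g x - g a) a > 0" using has_ord_analytic_pos_iff[OF o an] by simp
    have "has_ord (\<lambda>x. x - a) a 1"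
      by (rule has_ordI[of "\<lambda>_. 1"]) auto
    from has_ord_divide[OF o this] have "has_ord (\<lambda>x. (g x - g a) / (x - a)) a (zorder (\<lambda>x. g x - g a) a - 1)" .
    from has_ord_ge_0_analytic[OF this] p show ?thesis by auto
  qed
  then obtain k where k: "k analytic_on {a}" "\<forall>\<^sub>F x in at a. (g x - g a) / (x - a) = k x" by blast
  have "\<forall>\<^sub>F x in at a. f x = k x + g a / (x - a)"
    using g(3) k(2) by eventually_elim (simp add: field_simps power_int_minus diff_divide_distrib)
  thus ?thesis using k(1) by blast
qed

text \<open>A unit times a power has the logarithmic derivative \<open>g' / g + n / (x - a)\<close>.
  The order becomes a residue, so that statements on residues yield statements on orders.\<close>

lemma has_ord_logderiv:
  assumes "has_ord f a n"
  shows "\<exists>g. g analytic_on {a} \<and> (\<forall>\<^sub>F x in at a. deriv f x / f x = g x + of_int n / (x - a))"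
proof -
  from assms obtain g where g: "g analytic_on {a}" "g a \<noteq> 0"
    "\<forall>\<^sub>F x in at a. f x = g x * (x - a) powi n" unfolding has_ord_def by blast
  have ne: "\<forall>\<^sub>F x in at a. g x \<noteq> 0"
    by (rule eventually_nhds_imp_at[OF analytic_at_nonzero_eventually[OF g(1,2)]])
  have ev: "\<forall>\<^sub>F x in at a. \<forall>\<^sub>F y in nhds x. f y = g y * (y - a) powi n"
    by (rule eventually_at_imp_nhds[OF g(3)])
  have ga: "\<forall>\<^sub>F x in at a. g analytic_on {x}"
    by (rule eventually_nhds_imp_at[OF analytic_at_eventually_analytic[OF g(1)]])
  have na: "\<forall>\<^sub>F x in at a. x \<noteq> a" by (simp add: eventually_at_filter)
  have "\<forall>\<^sub>F x in at a. deriv f x / f x = deriv g x / g x + of_int n / (x - a)"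
    using ne ev ga na
  proof eventually_elim
    case (elim x)
    have gd: "(g has_field_derivative deriv g x) (at x)" using elim(3) analytic_derivI by auto
    have fx: "f x = g x * (x - a) powi n" using elim(2) eventually_nhds_x_imp_x by fast
    have "deriv f x = deriv (\<lambda>y. g y * (y - a) powi n) x"
      by (rule deriv_cong_ev) (use elim(2) in auto)
    also have "\<dots> = deriv g x * (x - a) powi n + (of_int n * (x - a) powi (n - 1)) * g x"
      by (rule DERIV_imp_deriv) (use elim in \<open>auto intro!: derivative_eq_intros gd\<close>)
    also have "(x - a) powi (n - 1) = (x - a) powi n / (x - a)"
      using elim(4) by (simp add: power_int_diff)
    finally have d: "deriv f x = deriv g x * (x - a) powi n + of_int n * ((x - a) powi n / (x - a)) * g x" .
    have p: "(x - a) powi n \<noteq> 0" using elim(4) by simp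
    show ?case unfolding d fx using p elim(1,4)
      by (simp add: add_divide_distrib)
  qed
  moreover have "(\<lambda>x. deriv g x / g x) analytic_on {a}"
    using g(1,2) by (intro analytic_intros) auto
  ultimately show ?thesis by blast
qed

section \<open>A theta function\<close>

definition lattice :: "complex \<Rightarrow> complex set"
  where "lattice \<tau> = {of_int m + of_int n * \<tau> | m n. True}"

lemma lattice_iff: "x \<in> lattice \<tau> \<longleftrightarrow> (\<exists>m n. x = of_int m + of_int n * \<tau>)"
  by (auto simp: lattice_def)

lemma latticeI: "of_int m + of_int n * \<tau> \<in> lattice \<tau>"
  by (auto simp: lattice_def)

lemma lattice_add: "x \<in> lattice \<tau> \<Longrightarrow> y \<in> lattice \<tau> \<Longrightarrow> x + y \<in> lattice \<tau>"
proof -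
  assume "x \<in> lattice \<tau>" "y \<in> lattice \<tau>"
  then obtain m n k l where "x = of_int m + of_int n * \<tau>" "y = of_int k + of_int l * \<tau>"
    unfolding lattice_iff by blast
  hence "x + y = of_int (m + k) + of_int (n + l) * \<tau>" by (simp add: algebra_simps)
  thus ?thesis unfolding lattice_iff by blast
qed

lemma lattice_minus: "x \<in> lattice \<tau> \<Longrightarrow> - x \<in> lattice \<tau>"
proof -
  assume "x \<in> lattice \<tau>"
  then obtain m n where "x = of_int m + of_int n * \<tau>" unfolding lattice_iff by blast
  hence "- x = of_int (- m) + of_int (- n) * \<tau>" by (simp add: algebra_simps)
  thus ?thesis unfolding lattice_iff by blast
qed

lemma lattice_minus_iff: "- x \<in> lattice \<tau> \<longleftrightarrow> x \<in> lattice \<tau>"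
  using lattice_minus[of x \<tau>] lattice_minus[of "- x" \<tau>] by auto

lemma lattice_diff: "x \<in> lattice \<tau> \<Longrightarrow> y \<in> lattice \<tau> \<Longrightarrow> x - y \<in> lattice \<tau>"
  using lattice_add[of x \<tau> "- y"] lattice_minus by auto

lemma lattice_0: "0 \<in> lattice \<tau>" and lattice_1: "1 \<in> lattice \<tau>" and lattice_tau: "\<tau> \<in> lattice \<tau>"
  using latticeI[of 0 0 \<tau>] latticeI[of 1 0 \<tau>] latticeI[of 0 1 \<tau>] by auto

lemma lattice_add_iff: "y \<in> lattice \<tau> \<Longrightarrow> x + y \<in> lattice \<tau> \<longleftrightarrow> x \<in> lattice \<tau>"
  using lattice_add[of x \<tau> y] lattice_diff[of "x + y" \<tau> y] by auto

lemma lattice_zero_iff: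
  assumes "Im \<tau> > 0" "x = of_int m + of_int n * \<tau>" "\<bar>Im x\<bar> < Im \<tau>" "\<bar>Re x\<bar> < 1"
  shows "m = 0 \<and> n = 0"
proof -
  have "\<bar>real_of_int n\<bar> * Im \<tau> < 1 * Im \<tau>" using assms by (simp add: abs_mult)
  hence "\<bar>real_of_int n\<bar> < 1" using assms(1) by (simp add: mult_less_cancel_right)
  hence "n = 0" by linarith
  thus ?thesis using assms(2,4) by auto
qed

text \<open>A nonzero lattice vector has length at least \<open>min 1 (Im \<tau>)\<close>: either
  its imaginary part is at least \<open>Im \<tau>\<close> in absolute value, or it is an integer.
  Half of this bound is the radius of the balls on which the projection to the curve is
  injective.\<close>

lemma lattice_small:
  assumes "Im \<tau> > 0" "x \<in> lattice \<tau>" "norm x < min 1 (Im \<tau>)"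
  shows "x = 0"
proof -
  obtain m n where x: "x = of_int m + of_int n * \<tau>" using assms(2) unfolding lattice_iff by blast
  have "m = 0 \<and> n = 0"
    by (rule lattice_zero_iff[OF assms(1) x])
       (use assms(3) abs_Im_le_cmod[of x] abs_Re_le_cmod[of x] in linarith)+
  thus ?thesis using x by simp
qed

lemma lattice_eventually:
  assumes "Im \<tau> > 0"
  shows "\<forall>\<^sub>F x in at a. x - a \<notin> lattice \<tau>"
  unfolding eventually_at
  by (intro exI[of _ "min 1 (Im \<tau>)"])
     (use assms lattice_small[OF assms] in \<open>force simp: dist_norm\<close>)

lemma lattice_eventually':
  assumes "Im \<tau> > 0"
  shows "\<forall>\<^sub>F x in at a. x \<notin> lattice \<tau>"
proof (cases "a \<in> lattice \<tau>")
  case True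
  show ?thesis using lattice_eventually[OF assms, of a]
    by eventually_elim (use True lattice_diff in blast)
next
  case False
  \<comment> \<open>By the triangle inequality at most one lattice point lies within half the
    minimal length of \<open>a\<close>. If there is one, the radius is shrunk to its distance from
    \<open>a\<close>.\<close>
  show ?thesis
  proof (cases "\<exists>b\<in>lattice \<tau>. norm (b - a) < min 1 (Im \<tau>) / 2")
    case True
    then obtain b where b: "b \<in> lattice \<tau>" "norm (b - a) < min 1 (Im \<tau>) / 2" by blast
    have "b \<noteq> a" using b False by auto
    show ?thesis
      unfolding eventually_at
    proof (intro exI[of _ "min (norm (b - a)) (min 1 (Im \<tau>) / 2)"] conjI ballI impI)
      show "0 < min (norm (b - a)) (min 1 (Im \<tau>) / 2)" using \<open>b \<noteq> a\<close> assms by simp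
      fix x assume x: "x \<noteq> a \<and> dist x a < min (norm (b - a)) (min 1 (Im \<tau>) / 2)"
      show "x \<notin> lattice \<tau>"
      proof
        assume "x \<in> lattice \<tau>"
        hence l: "x - b \<in> lattice \<tau>" using b lattice_diff by blast
        have "norm (x - b) \<le> norm (x - a) + norm (b - a)"
          using norm_triangle_ineq4[of "x - a" "b - a"] by simp
        hence "norm (x - b) < min 1 (Im \<tau>)" using x b(2) by (simp add: dist_norm)
        hence "x = b" using lattice_small[OF assms l] by simp
        thus False using x by (simp add: dist_norm)
      qed
    qed
  next
    case F: False
    show ?thesis unfolding eventually_at
      by (intro exI[of _ "min 1 (Im \<tau>) / 2"]) (use assms F in \<open>force simp: dist_norm\<close>)
  qed
qed

section \<open>The exponential with period 1\<close>

definition cexp :: "complex \<Rightarrow> complex"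
  where "cexp x = exp (2 * of_real pi * \<i> * x)"

lemma cexp_add: "cexp (x + y) = cexp x * cexp y"
  by (simp add: cexp_def exp_add[symmetric] algebra_simps)

lemma cexp_minus: "cexp (- x) = inverse (cexp x)"
  by (simp add: cexp_def exp_minus[symmetric])

lemma cexp_diff: "cexp (x - y) = cexp x / cexp y"
  using cexp_add[of x "- y"] by (simp add: cexp_minus divide_inverse)

lemma cexp_nonzero [simp]: "cexp x \<noteq> 0" by (simp add: cexp_def)

lemma cexp_eq_1_iff: "cexp x = 1 \<longleftrightarrow> (\<exists>m. x = of_int m)"
proof -
  have "cexp x = 1 \<longleftrightarrow> (\<exists>n::int. 2 * of_real pi * \<i> * x = complex_of_real (of_int (2 * n) * pi) * \<i>)"
    unfolding cexp_def exp_eq_1 by (auto simp: complex_eq_iff)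
  also have "\<dots> \<longleftrightarrow> (\<exists>m. x = of_int m)"
    by (intro ex_cong1) (auto simp: field_simps)
  finally show ?thesis .
qed

lemma cexp_of_int [simp]: "cexp (of_int m) = 1"
  using cexp_eq_1_iff by blast

lemma cexp_0 [simp]: "cexp 0 = 1" and cexp_1 [simp]: "cexp 1 = 1"
  using cexp_of_int[of 0] cexp_of_int[of 1] by auto

lemma cexp_of_nat_mult: "cexp (of_nat n * x) = cexp x ^ n"
  by (induction n) (auto simp: algebra_simps cexp_add)

lemma cexp_half: "cexp (1 / 2) = - 1"
  by (simp add: cexp_def)

lemma norm_cexp_less_1: "Im \<tau> > 0 \<Longrightarrow> norm (cexp \<tau>) < 1"
  by (simp add: cexp_def norm_exp_eq_Re)

lemma cexp_has_derivative: "(cexp has_field_derivative (2 * of_real pi * \<i> * cexp x)) (at x)"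
  unfolding cexp_def by (auto intro!: derivative_eq_intros)

lemma cexp_analytic: "cexp analytic_on A"
  unfolding cexp_def by (intro analytic_intros)

section \<open>Euler's product as a power series\<close>

fun euler_coeff :: "complex \<Rightarrow> nat \<Rightarrow> complex" where
  "euler_coeff Q 0 = 1"
| "euler_coeff Q (Suc n) = - (Q ^ n) * euler_coeff Q n / (1 - Q ^ Suc n)"

text \<open>
  By Euler's identity this is the product of the factors \<open>1 - Q\<^sup>n Y\<close> for \<open>n \<ge> 0\<close>; the series makes it
  visibly entire, and the recursion of its coefficients is its functional equation.
\<close>

definition euler_fun :: "complex \<Rightarrow> complex \<Rightarrow> complex"
  where "euler_fun Q Y = (\<Sum>n. euler_coeff Q n * Y ^ n)"

lemma power_neq_1:
  fixes Q :: complex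
  assumes "norm Q < 1"
  shows "1 - Q ^ Suc n \<noteq> 0" "1 - norm Q \<le> norm (1 - Q ^ Suc n)"
proof -
  have "norm (Q ^ Suc n) \<le> norm Q"
    using assms by (simp add: norm_mult norm_power mult_left_le power_le_one)
  moreover have "norm (1 :: complex) - norm (Q ^ Suc n) \<le> norm (1 - Q ^ Suc n)"
    by (rule norm_triangle_ineq2)
  ultimately show *: "1 - norm Q \<le> norm (1 - Q ^ Suc n)" by simp
  hence "norm (1 - Q ^ Suc n) > 0" using assms by linarith
  thus "1 - Q ^ Suc n \<noteq> 0" by simp
qed

lemma euler_summable:
  assumes "norm Q < 1"
  shows "summable (\<lambda>n. euler_coeff Q n * Y ^ n)"
proof -
  \<comment> \<open>This bounds the ratio of consecutive terms. It tends to 0 because the recursion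
    contributes a factor \<open>Q ^ n\<close>, so the series converges for every
    \<open>Y\<close>.\<close>
  have "(\<lambda>n. norm Q ^ n * (norm Y / (1 - norm Q))) \<longlonglongrightarrow> 0"
    by (rule tendsto_mult_left_zero, rule LIMSEQ_power_zero) (use assms in simp)
  hence "\<forall>\<^sub>F n in sequentially. norm Q ^ n * (norm Y / (1 - norm Q)) < 1 / 2"
    by (rule order_tendstoD) simp
  then obtain N where N: "\<And>n. n \<ge> N \<Longrightarrow> norm Q ^ n * (norm Y / (1 - norm Q)) < 1 / 2"
    unfolding eventually_sequentially by blast
  show ?thesis
  proof (rule summable_ratio_test[of "1 / 2" N])
    fix n assume n: "N \<le> n"
    have "norm (euler_coeff Q (Suc n) * Y ^ Suc n) =
        norm Q ^ n * norm Y / norm (1 - Q ^ Suc n) * norm (euler_coeff Q n * Y ^ n)"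
      by (simp add: norm_mult norm_divide norm_power)
    also have "\<dots> \<le> norm Q ^ n * norm Y / (1 - norm Q) * norm (euler_coeff Q n * Y ^ n)"
      using power_neq_1(2)[OF assms, of n] assms
      by (intro mult_right_mono divide_left_mono mult_pos_pos) auto
    also have "\<dots> \<le> 1 / 2 * norm (euler_coeff Q n * Y ^ n)"
      using N[OF n] by (intro mult_right_mono) auto
    finally show "norm (euler_coeff Q (Suc n) * Y ^ Suc n) \<le> 1 / 2 * norm (euler_coeff Q n * Y ^ n)" .
  qed simp
qed

lemma euler_analytic:
  assumes "norm Q < 1"
  shows "euler_fun Q analytic_on A"
proof -
  have "euler_fun Q holomorphic_on UNIV"
  proof (rule holomorphic_onI)
    fix x
    have "((\<lambda>x. \<Sum>n. euler_coeff Q n * x ^ n) has_field_derivative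
        (\<Sum>n. diffs (euler_coeff Q) n * x ^ n)) (at x)"
      by (rule termdiffs_strong_converges_everywhere[OF euler_summable[OF assms]])
    thus "euler_fun Q field_differentiable at x within UNIV"
      unfolding field_differentiable_def euler_fun_def[abs_def] by blast
  qed
  hence "euler_fun Q analytic_on UNIV" by (simp add: analytic_on_open)
  thus ?thesis by (rule analytic_on_subset) simp
qed

lemma euler_fun_0 [simp]: "euler_fun Q 0 = 1"
proof -
  have "(\<lambda>n. euler_coeff Q n * 0 ^ n) = (\<lambda>n. if n = 0 then 1 else 0)"
    by (auto simp: fun_eq_iff power_0_left)
  hence "(\<lambda>n. euler_coeff Q n * 0 ^ n) sums 1" using sums_single[of 0 "\<lambda>_. 1::complex"] by simp
  thus ?thesis unfolding euler_fun_def by (simp add: sums_iff)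
qed

lemma euler_fun_rec:
  assumes "norm Q < 1"
  shows "euler_fun Q Y = (1 - Y) * euler_fun Q (Q * Y)"
proof -
  let ?a = "euler_coeff Q"
  have s: "summable (\<lambda>n. ?a n * Y ^ n)" "summable (\<lambda>n. ?a n * (Q * Y) ^ n)"
    by (rule euler_summable[OF assms])+
  have "euler_fun Q Y - euler_fun Q (Q * Y) = (\<Sum>n. ?a n * Y ^ n - ?a n * (Q * Y) ^ n)"
    unfolding euler_fun_def by (rule suminf_diff[OF s])
  also have "\<dots> = (\<Sum>n. ?a (Suc n) * Y ^ Suc n - ?a (Suc n) * (Q * Y) ^ Suc n)"
    using suminf_split_head[OF summable_diff[OF s]] by simp
  also have "(\<lambda>n. ?a (Suc n) * Y ^ Suc n - ?a (Suc n) * (Q * Y) ^ Suc n) =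
      (\<lambda>n. - Y * (?a n * (Q * Y) ^ n))"
  proof
    fix n
    have "?a (Suc n) * (1 - Q ^ Suc n) = - (Q ^ n) * ?a n"
      using power_neq_1(1)[OF assms, of n] by simp
    hence "?a (Suc n) * (1 - Q ^ Suc n) * Y ^ Suc n = - (Q ^ n) * ?a n * Y ^ Suc n" by simp
    thus "?a (Suc n) * Y ^ Suc n - ?a (Suc n) * (Q * Y) ^ Suc n = - Y * (?a n * (Q * Y) ^ n)"
      by (simp add: algebra_simps power_mult_distrib del: euler_coeff.simps)
  qed
  also have "(\<Sum>n. - Y * (?a n * (Q * Y) ^ n)) = - Y * euler_fun Q (Q * Y)"
    unfolding euler_fun_def by (rule suminf_mult[OF s(2)])
  finally show ?thesis by (simp add: algebra_simps)
qed

text \<open>Iterating the functional equation leaves a finite product times the value at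
  \<open>Q ^ n * Y\<close>. These arguments tend to 0, where the function is 1, so a zero can only
  come from one of the factors.\<close>

lemma euler_fun_zero_iff:
  assumes "norm Q < 1"
  shows "euler_fun Q Y = 0 \<longleftrightarrow> (\<exists>n::nat. Q ^ n * Y = 1)"
proof -
  have prod: "euler_fun Q Y = (\<Prod>k<n. 1 - Q ^ k * Y) * euler_fun Q (Q ^ n * Y)" for n
  proof (induction n)
    case (Suc n)
    show ?case unfolding Suc using euler_fun_rec[OF assms, of "Q ^ n * Y"] by (simp add: mult_ac)
  qed simp
  show ?thesis
  proof
    assume z: "euler_fun Q Y = 0"
    have "isCont (euler_fun Q) 0" by (rule analytic_at_imp_isCont[OF euler_analytic[OF assms]])
    moreover have "(\<lambda>n. Q ^ n * Y) \<longlonglongrightarrow> 0"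
      by (rule tendsto_mult_left_zero, rule LIMSEQ_power_zero[OF assms])
    ultimately have "(\<lambda>n. euler_fun Q (Q ^ n * Y)) \<longlonglongrightarrow> euler_fun Q 0"
      by (rule isCont_tendsto_compose)
    hence "\<forall>\<^sub>F n in sequentially. euler_fun Q (Q ^ n * Y) \<noteq> 0"
      by (rule tendsto_imp_eventually_ne) simp
    then obtain n where "euler_fun Q (Q ^ n * Y) \<noteq> 0"
      unfolding eventually_sequentially by blast
    with z prod[of n] obtain k where "1 - Q ^ k * Y = 0" by auto
    hence "Q ^ k * Y = 1" by (metis right_minus_eq)
    thus "\<exists>n. Q ^ n * Y = 1" by blast
  next
    assume "\<exists>n. Q ^ n * Y = 1"
    then obtain n where "Q ^ n * Y = 1" by blast
    hence z: "(\<Prod>k<Suc n. 1 - Q ^ k * Y) = 0" by simp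
    show "euler_fun Q Y = 0" by (subst prod[of "Suc n"], subst z) simp
  qed
qed

text \<open>Up to a factor without zeros this is the odd Jacobi theta function as a product: with
  \<open>Y = cexp x\<close> and \<open>Q = cexp \<tau>\<close> the factors are
  \<open>1 - Q ^ n * Y\<close> and \<open>1 - Q ^ (n + 1) / Y\<close>. The extra \<open>Q\<close> in
  the second argument keeps the zero at \<open>Y = 1\<close> simple.\<close>

definition theta :: "complex \<Rightarrow> complex \<Rightarrow> complex"
  where "theta \<tau> x = euler_fun (cexp \<tau>) (cexp x) * euler_fun (cexp \<tau>) (cexp \<tau> * cexp (- x))"

lemma theta_analytic:
  assumes "Im \<tau> > 0"
  shows "theta \<tau> analytic_on A"
proof -
  have n: "norm (cexp \<tau>) < 1" by (rule norm_cexp_less_1[OF assms])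
  have "(\<lambda>x. euler_fun (cexp \<tau>) (cexp x)) analytic_on A"
    using analytic_on_compose[OF cexp_analytic euler_analytic[OF n], of A] by (simp add: o_def)
  moreover have "(\<lambda>x. cexp \<tau> * cexp (- x)) analytic_on A"
    unfolding cexp_def by (intro analytic_intros)
  hence "(\<lambda>x. euler_fun (cexp \<tau>) (cexp \<tau> * cexp (- x))) analytic_on A"
    using analytic_on_compose[OF _ euler_analytic[OF n], of "\<lambda>x. cexp \<tau> * cexp (- x)" A]
    by (simp add: o_def)
  ultimately show ?thesis unfolding theta_def by (intro analytic_intros)
qed

lemma theta_plus_1: "theta \<tau> (x + 1) = theta \<tau> x"
  by (simp add: theta_def cexp_add cexp_minus del: minus_add_distrib)

text \<open>The shift replaces \<open>Y\<close> by \<open>Q * Y\<close>: the first product loses the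
  factor \<open>1 - Y\<close>, the second gains \<open>1 - 1 / Y\<close>, and the quotient of the
  two is \<open>- 1 / Y\<close>.\<close>

lemma theta_plus_tau:
  assumes "Im \<tau> > 0"
  shows "theta \<tau> (x + \<tau>) = - cexp (- x) * theta \<tau> x"
proof -
  let ?Q = "cexp \<tau>"
  have n: "norm ?Q < 1" by (rule norm_cexp_less_1[OF assms])
  have 1: "euler_fun ?Q (cexp x) = (1 - cexp x) * euler_fun ?Q (?Q * cexp x)"
    by (rule euler_fun_rec[OF n])
  have 2: "euler_fun ?Q (cexp (- x)) = (1 - cexp (- x)) * euler_fun ?Q (?Q * cexp (- x))"
    by (rule euler_fun_rec[OF n])
  have "theta \<tau> (x + \<tau>) = euler_fun ?Q (?Q * cexp x) * euler_fun ?Q (cexp (- x))"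
    unfolding theta_def cexp_minus[of "x + \<tau>"] cexp_add by (simp add: cexp_minus field_simps)
  also have "\<dots> = euler_fun ?Q (?Q * cexp x) * (1 - cexp (- x)) * euler_fun ?Q (?Q * cexp (- x))"
    by (simp add: 2)
  also have "1 - cexp (- x) = - cexp (- x) * (1 - cexp x)"
    by (simp add: cexp_minus algebra_simps)
  also have "euler_fun ?Q (?Q * cexp x) * (- cexp (- x) * (1 - cexp x)) * euler_fun ?Q (?Q * cexp (- x)) =
     - cexp (- x) * theta \<tau> x"
    unfolding theta_def 1 by (simp add: mult_ac)
  finally show ?thesis .
qed

text \<open>Exchanging \<open>Y\<close> and \<open>1 / Y\<close> exchanges the two products except
  for the factor with exponent 0, which changes by the same quotient \<open>- 1 / Y\<close>.\<close>

lemma theta_minus: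
  assumes "Im \<tau> > 0"
  shows "theta \<tau> (- x) = - cexp (- x) * theta \<tau> x"
proof -
  let ?Q = "cexp \<tau>"
  have n: "norm ?Q < 1" by (rule norm_cexp_less_1[OF assms])
  have 1: "euler_fun ?Q (cexp x) = (1 - cexp x) * euler_fun ?Q (?Q * cexp x)"
    by (rule euler_fun_rec[OF n])
  have 2: "euler_fun ?Q (cexp (- x)) = (1 - cexp (- x)) * euler_fun ?Q (?Q * cexp (- x))"
    by (rule euler_fun_rec[OF n])
  have "1 - cexp (- x) = - cexp (- x) * (1 - cexp x)"
    by (simp add: cexp_minus algebra_simps)
  thus ?thesis unfolding theta_def 1 2 minus_minus by (simp add: mult_ac)
qed

lemma theta_zero_iff:
  assumes "Im \<tau> > 0"
  shows "theta \<tau> x = 0 \<longleftrightarrow> x \<in> lattice \<tau>"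
proof -
  let ?Q = "cexp \<tau>"
  have n: "norm ?Q < 1" by (rule norm_cexp_less_1[OF assms])
  have "theta \<tau> x = 0 \<longleftrightarrow> (\<exists>n::nat. ?Q ^ n * cexp x = 1) \<or> (\<exists>n::nat. ?Q ^ n * (?Q * cexp (- x)) = 1)"
    unfolding theta_def mult_eq_0_iff euler_fun_zero_iff[OF n] ..
  also have "(\<lambda>n::nat. ?Q ^ n * cexp x = 1) = (\<lambda>n. \<exists>m. of_nat n * \<tau> + x = of_int m)"
    by (auto simp: fun_eq_iff cexp_of_nat_mult[symmetric] cexp_add[symmetric] cexp_eq_1_iff)
  also have "(\<lambda>n::nat. ?Q ^ n * (?Q * cexp (- x)) = 1) = (\<lambda>n. \<exists>m. of_nat (Suc n) * \<tau> - x = of_int m)"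
  proof
    fix n
    have "?Q ^ n * (?Q * cexp (- x)) = cexp (of_nat (Suc n) * \<tau> - x)"
      using cexp_of_nat_mult[of "Suc n" \<tau>] by (simp add: cexp_diff cexp_minus divide_inverse mult_ac)
    thus "(?Q ^ n * (?Q * cexp (- x)) = 1) = (\<exists>m. of_nat (Suc n) * \<tau> - x = of_int m)"
      by (simp only: cexp_eq_1_iff)
  qed
  also have "((\<exists>n::nat. \<exists>m. of_nat n * \<tau> + x = of_int m) \<or> (\<exists>n. \<exists>m. of_nat (Suc n) * \<tau> - x = of_int m)) \<longleftrightarrow>
      x \<in> lattice \<tau>" (is "?A \<or> ?B \<longleftrightarrow> _")
  proof
    assume "?A \<or> ?B"
    then consider n m where "of_nat n * \<tau> + x = of_int m" | n m where "of_nat (Suc n) * \<tau> - x = of_int m"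
      by blast
    thus "x \<in> lattice \<tau>"
    proof cases
      case (1 n m)
      hence "x = of_int m + of_int (- int n) * \<tau>" by (simp add: algebra_simps)
      thus ?thesis unfolding lattice_iff by blast
    next
      case (2 n m)
      hence "x = of_int (- m) + of_int (int (Suc n)) * \<tau>" by (simp add: algebra_simps)
      thus ?thesis unfolding lattice_iff by blast
    qed
  next
    assume "x \<in> lattice \<tau>"
    then obtain m k where x: "x = of_int m + of_int k * \<tau>" unfolding lattice_iff by blast
    show "?A \<or> ?B"
    proof (cases "k \<le> 0")
      case True
      hence "of_nat (nat (- k)) * \<tau> + x = of_int m" using x by simp
      thus ?thesis by blast
    next
      case False
      hence "of_nat (Suc (nat (k - 1))) * \<tau> - x = of_int (- m)" using x by (simp add: algebra_simps)
      thus ?thesis by blast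
    qed
  qed
  finally show ?thesis .
qed

text \<open>At 0 only the factor \<open>1 - cexp x\<close> vanishes, to first order. It is split
  off, and the rest is nonzero there.\<close>

lemma theta_deriv_0:
  assumes "Im \<tau> > 0"
  shows "deriv (theta \<tau>) 0 \<noteq> 0"
proof -
  let ?Q = "cexp \<tau>"
  have n: "norm ?Q < 1" by (rule norm_cexp_less_1[OF assms])
  define g where "g x = euler_fun ?Q (?Q * cexp x) * euler_fun ?Q (?Q * cexp (- x))" for x
  have th: "theta \<tau> = (\<lambda>x. (1 - cexp x) * g x)"
    unfolding theta_def g_def by (subst euler_fun_rec[OF n]) (simp add: mult_ac)
  have q: "?Q \<noteq> 0" by simp
  have e: "euler_fun ?Q ?Q \<noteq> 0"
  proof
    assume "euler_fun ?Q ?Q = 0"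
    then obtain k where "?Q ^ Suc k = 1" using euler_fun_zero_iff[OF n, of ?Q] by (auto simp: mult_ac)
    thus False using power_neq_1(1)[OF n, of k] by simp
  qed
  have g0: "g 0 \<noteq> 0" using e by (simp add: g_def)
  have "(\<lambda>x. ?Q * cexp x) analytic_on {0}" "(\<lambda>x. ?Q * cexp (- x)) analytic_on {0}"
    unfolding cexp_def by (intro analytic_intros)+
  hence "(\<lambda>x. euler_fun ?Q (?Q * cexp x)) analytic_on {0}"
      "(\<lambda>x. euler_fun ?Q (?Q * cexp (- x))) analytic_on {0}"
    using analytic_on_compose[OF _ euler_analytic[OF n], of _ "{0}"] by (auto simp: o_def)
  hence "g analytic_on {0}" unfolding g_def by (intro analytic_intros)
  hence gd: "(g has_field_derivative deriv g 0) (at 0)" using analytic_derivI by auto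
  have "deriv (theta \<tau>) 0 = - (2 * of_real pi * \<i> * cexp 0) * g 0"
    unfolding th by (rule DERIV_imp_deriv) (auto intro!: derivative_eq_intros gd cexp_has_derivative)
  thus ?thesis using g0 by simp
qed

lemma theta_ord_0:
  assumes "Im \<tau> > 0"
  shows "has_ord (theta \<tau>) 0 1"
  by (rule has_ord_1I[OF theta_analytic[OF assms]])
     (use theta_deriv_0[OF assms] theta_zero_iff[OF assms] lattice_0 in auto)

text \<open>The automorphy factors have no zeros, so the simple zero at 0 is carried to every
  lattice point by induction on the two coordinates.\<close>

lemma theta_ord:
  assumes "Im \<tau> > 0"
  shows "has_ord (theta \<tau>) a (if a \<in> lattice \<tau> then 1 else 0)"
proof (cases "a \<in> lattice \<tau>")
  case False
  thus ?thesis using has_ord_0[OF theta_analytic[OF assms]] theta_zero_iff[OF assms] by simp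
next
  case True
  have p1: "has_ord (theta \<tau>) (a + 1) 1 \<longleftrightarrow> has_ord (theta \<tau>) a 1" for a
    using has_ord_shift[of "theta \<tau>" a 1 1] has_ord_shift[of "theta \<tau>" "a + 1" "-1" 1]
      theta_plus_1[of \<tau>] theta_plus_1[of \<tau> "_ - 1"] by (auto simp: algebra_simps)
  have unit: "has_ord (\<lambda>x. - cexp (- x)) a 0" "has_ord (\<lambda>x. inverse (- cexp (- x))) a 0" for a
    unfolding cexp_def by (rule has_ord_0; (intro analytic_intros)?; simp)+
  have p2: "has_ord (theta \<tau>) (a + \<tau>) 1 \<longleftrightarrow> has_ord (theta \<tau>) a 1" for a
  proof
    assume "has_ord (theta \<tau>) (a + \<tau>) 1"
    from has_ord_mult[OF unit(2) has_ord_shift[OF this]]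
    show "has_ord (theta \<tau>) a 1" by (simp add: theta_plus_tau[OF assms] mult.assoc[symmetric])
  next
    assume "has_ord (theta \<tau>) a 1"
    from has_ord_mult[OF unit(1) this]
    have "has_ord (\<lambda>x. theta \<tau> (x + \<tau>)) (a + \<tau> + (- \<tau>)) 1" by (simp add: theta_plus_tau[OF assms])
    from has_ord_shift[OF this] show "has_ord (theta \<tau>) (a + \<tau>) 1" by simp
  qed
  obtain m n where a: "a = of_int m + of_int n * \<tau>" using True unfolding lattice_iff by blast
  have "has_ord (theta \<tau>) (of_int m) 1" for m
  proof (induction m rule: int_induct[where k = 0])
    case base thus ?case using theta_ord_0[OF assms] by simp
  next
    case (step1 i) thus ?case using p1 by simp
  next
    case (step2 i) thus ?case using p1[of "of_int i - 1"] by simp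
  qed
  hence "has_ord (theta \<tau>) (of_int m + of_int n * \<tau>) 1"
  proof (induction n rule: int_induct[where k = 0])
    case base thus ?case by simp
  next
    case (step1 i)
    thus ?case using p2[of "of_int m + of_int i * \<tau>"] by (simp add: algebra_simps)
  next
    case (step2 i)
    thus ?case using p2[of "of_int m + of_int (i - 1) * \<tau>"] by (simp add: algebra_simps)
  qed
  thus ?thesis using a True by simp
qed

section \<open>Meromorphic functions on a complex torus\<close>

lemma torus_proj_add_lattice: "l \<in> lattice \<tau> \<Longrightarrow> torus_proj \<tau> (x + l) = torus_proj \<tau> x"
proof -
  have *: "torus_proj \<tau> (x + l) \<subseteq> torus_proj \<tau> x" if "l \<in> lattice \<tau>" for l x
  proof
    fix y assume "y \<in> torus_proj \<tau> (x + l)"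
    then obtain m n where y: "y = x + l + of_int m + of_int n * \<tau>" unfolding torus_proj_def by blast
    from that obtain k j where "l = of_int k + of_int j * \<tau>" unfolding lattice_iff by blast
    hence "y = x + of_int (k + m) + of_int (j + n) * \<tau>" using y by (simp add: algebra_simps)
    thus "y \<in> torus_proj \<tau> x" unfolding torus_proj_def by blast
  qed
  assume l: "l \<in> lattice \<tau>"
  show ?thesis using *[OF l, of x] *[OF lattice_minus[OF l], of "x + l"] by auto
qed

lemma torus_proj_self: "x \<in> torus_proj \<tau> x"
  unfolding torus_proj_def by (rule CollectI, intro exI[of _ 0]) simp

lemma torus_proj_eq_iff: "torus_proj \<tau> x = torus_proj \<tau> y \<longleftrightarrow> x - y \<in> lattice \<tau>"
proof
  assume "torus_proj \<tau> x = torus_proj \<tau> y"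
  hence "x \<in> torus_proj \<tau> y" using torus_proj_self by blast
  then obtain m n where "x = y + of_int m + of_int n * \<tau>" unfolding torus_proj_def by blast
  hence "x - y = of_int m + of_int n * \<tau>" by simp
  thus "x - y \<in> lattice \<tau>" unfolding lattice_iff by blast
next
  assume "x - y \<in> lattice \<tau>"
  from torus_proj_add_lattice[OF this, of y] show "torus_proj \<tau> x = torus_proj \<tau> y" by simp
qed

lemma torus_proj_plus [simp]: "torus_proj \<tau> (x + 1) = torus_proj \<tau> x" "torus_proj \<tau> (x + \<tau>) = torus_proj \<tau> x"
  by (simp_all add: torus_proj_add_lattice lattice_1 lattice_tau)

text \<open>The closed parallelogram: it is compact, at the price of repeated representatives on its
  boundary.\<close>

definition period_cell :: "complex \<Rightarrow> complex set"
  where "period_cell \<tau> = (\<lambda>(s, t). of_real s + of_real t * \<tau>) ` ({0..1} \<times> {0..1})"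

lemma compact_period_cell: "compact (period_cell \<tau>)"
  unfolding period_cell_def
  by (intro compact_continuous_image compact_Times compact_Icc)
     (auto intro!: continuous_intros simp: case_prod_unfold)

lemma period_cell_rep:
  assumes "Im \<tau> > 0"
  shows "\<exists>y\<in>period_cell \<tau>. x - y \<in> lattice \<tau>"
proof -
  define t where "t = Im x / Im \<tau>"
  define s where "s = Re x - t * Re \<tau>"
  have x: "x = of_real s + of_real t * \<tau>"
    using assms by (simp add: complex_eq_iff s_def t_def)
  let ?y = "of_real (frac s) + of_real (frac t) * \<tau>"
  have "?y \<in> period_cell \<tau>"
    unfolding period_cell_def by (rule image_eqI[of _ _ "(frac s, frac t)"])
      (auto simp: frac_ge_0 less_imp_le[OF frac_lt_1])
  moreover have "x - ?y = of_int \<lfloor>s\<rfloor> + of_int \<lfloor>t\<rfloor> * \<tau>"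
    by (simp add: x frac_def algebra_simps)
  hence "x - ?y \<in> lattice \<tau>" unfolding lattice_iff by blast
  ultimately show ?thesis by blast
qed

lemma periodic_lattice:
  assumes "\<And>x. f (x + 1) = f x" "\<And>x. f (x + \<tau>) = f x" "l \<in> lattice \<tau>"
  shows "f (x + l) = f x"
proof -
  obtain m n where l: "l = of_int m + of_int n * \<tau>" using assms(3) unfolding lattice_iff by blast
  have 1: "f (x + of_int m) = f x" for x m
  proof (induction m rule: int_induct[where k = 0])
    case (step1 i) thus ?case using assms(1)[of "x + of_int i"] by (simp add: add_ac)
  next
    case (step2 i) thus ?case using assms(1)[of "x + of_int (i - 1)"] by simp
  qed simp
  have 2: "f (x + of_int n * \<tau>) = f x" for x n
  proof (induction n rule: int_induct[where k = 0])
    case (step1 i) thus ?case using assms(2)[of "x + of_int i * \<tau>"] by (simp add: algebra_simps)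
  next
    case (step2 i) thus ?case using assms(2)[of "x + of_int (i - 1) * \<tau>"] by (simp add: algebra_simps)
  qed simp
  show ?thesis using 1[of x m] 2[of "x + of_int m" n] l by (simp add: add_ac)
qed

lemma entire_periodic_constant:
  assumes "Im \<tau> > 0" "f holomorphic_on UNIV" "\<And>x. f (x + 1) = f x" "\<And>x. f (x + \<tau>) = f x"
  shows "\<exists>c. \<forall>x. f x = c"
proof -
  have "continuous_on (period_cell \<tau>) f"
    using assms(2) holomorphic_on_imp_continuous_on continuous_on_subset by blast
  hence "bounded (f ` period_cell \<tau>)"
    using compact_period_cell compact_continuous_image compact_imp_bounded by blast
  moreover have "range f \<subseteq> f ` period_cell \<tau>"
  proof
    fix z assume "z \<in> range f"
    then obtain x where "z = f x" by blast
    obtain y where y: "y \<in> period_cell \<tau>" "x - y \<in> lattice \<tau>" using period_cell_rep[OF assms(1)] by blast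
    have "f (y + (x - y)) = f y" by (rule periodic_lattice[OF assms(3,4) y(2)])
    thus "z \<in> f ` period_cell \<tau>" using y \<open>z = f x\<close> by auto
  qed
  ultimately have "bounded (range f)" using bounded_subset by blast
  from Liouville_theorem[OF assms(2) this] show ?thesis by (auto simp: constant_on_def)
qed

text \<open>Allowing an additive period \<open>c\<close> is what makes sums of residues accessible.
  The derivative is entire and elliptic, hence constant; the function is affine, the period 1 kills
  its slope, and then \<open>c\<close> must be 0.\<close>

lemma elliptic_constant:
  assumes \<tau>: "Im \<tau> > 0"
    and loc: "\<And>a. \<exists>g. g analytic_on {a} \<and> (\<forall>\<^sub>F x in at a. h x = g x)"
    and p1: "\<And>a. \<forall>\<^sub>F x in at a. h (x + 1) = h x"
    and pt: "\<And>a. \<forall>\<^sub>F x in at a. h (x + \<tau>) = h x + c"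
  shows "c = 0 \<and> (\<exists>C. \<forall>a. \<forall>\<^sub>F x in at a. h x = C)"
proof -
  \<comment> \<open>The hypotheses say nothing at isolated points. Removing the singularities
    replaces \<open>h\<close> by an entire function for which the period relations hold
    everywhere.\<close>
  define L where "L = remove_sings h"
  have L: "L analytic_on {a}" "\<forall>\<^sub>F x in at a. h x = L x" for a
  proof -
    obtain g where g: "g analytic_on {a}" "\<forall>\<^sub>F x in at a. h x = g x" using loc by blast
    have iso: "isolated_singularity_at h a"
      by (rule isolated_singularity_at_cong[THEN iffD2, OF g(2) refl isolated_singularity_at_analytic[OF g(1)]])
    show "\<forall>\<^sub>F x in at a. h x = L x"
      using eventually_remove_sings_eq_at[OF iso] unfolding L_def by eventually_elim simp
    hence e: "\<forall>\<^sub>F x in at a. L x = g x" using g(2) by eventually_elim simp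
    have "(g \<longlongrightarrow> g a) (at a)" using analytic_at_imp_isCont[OF g(1)] by (simp add: isCont_def)
    hence "(h \<longlongrightarrow> g a) (at a)" using tendsto_cong[OF g(2)] by simp
    hence "L a = g a" unfolding L_def by (rule remove_sings_eqI)
    hence "\<forall>\<^sub>F x in nhds a. L x = g x" using e by (simp add: eventually_nhds_conv_at)
    thus "L analytic_on {a}" using g(1) analytic_at_cong[of L g a a] by simp
  qed
  have per: "L (a + d) = L a + k" if "\<And>a. \<forall>\<^sub>F x in at a. h (x + d) = h x + k" for a d k
  proof -
    have "\<forall>\<^sub>F x in at a. h (x + d) = L (x + d)" by (rule eventually_at_shift[OF L(2)])
    hence ev: "\<forall>\<^sub>F x in at a. L (x + d) = L x + k"
      using that[of a] L(2)[of a] by eventually_elim simp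
    have "isCont (\<lambda>x. L (x + d)) a" by (rule analytic_at_imp_isCont[OF analytic_at_shift[OF L(1)]])
    hence "((\<lambda>x. L (x + d)) \<longlongrightarrow> L (a + d)) (at a)" by (simp add: isCont_def)
    moreover have "isCont (\<lambda>x. L x + k) a" using analytic_at_imp_isCont[OF L(1)] by (intro continuous_intros)
    hence "((\<lambda>x. L x + k) \<longlongrightarrow> L a + k) (at a)" by (simp add: isCont_def)
    ultimately show ?thesis using tendsto_unique[OF at_neq_bot] tendsto_cong[OF ev] by blast
  qed
  have L1: "L (x + 1) = L x" for x using per[of 1 0 x] p1 by simp
  have Lt: "L (x + \<tau>) = L x + c" for x using per[of \<tau> c x] pt by simp
  have "L analytic_on UNIV" using L(1) analytic_on_analytic_at by blast
  hence hol: "L holomorphic_on UNIV" by (simp add: analytic_on_open)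
  have Ld: "(L has_field_derivative deriv L x) (at x)" for x using L(1) analytic_derivI by auto
  have d: "deriv L (x + e) = deriv L x" if "\<And>x. L (x + e) = L x + k" for x e k
  proof -
    have "((\<lambda>x. L (x + e)) has_field_derivative deriv L (x + e)) (at x)"
      by (rule DERIV_shift[THEN iffD1, OF Ld])
    moreover have "((\<lambda>x. L x + k) has_field_derivative deriv L x) (at x)"
      by (auto intro!: derivative_eq_intros Ld)
    ultimately show ?thesis using that DERIV_unique by simp
  qed
  have "\<exists>k. \<forall>x. deriv L x = k"
    by (rule entire_periodic_constant[OF \<tau>])
       (use d[of 1 0] d[of \<tau> c] L1 Lt hol in \<open>auto intro!: holomorphic_deriv\<close>)
  then obtain k where k: "\<And>x. deriv L x = k" by blast
  have "\<exists>b. \<forall>x\<in>UNIV. L x - k * x = b"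
  proof (rule has_field_derivative_zero_constant)
    fix x show "((\<lambda>x. L x - k * x) has_field_derivative 0) (at x within UNIV)"
      using Ld[of x] k by (auto intro!: derivative_eq_intros)
  qed auto
  then obtain b where b: "\<And>x. L x = k * x + b" by (metis UNIV_I add.commute diff_add_cancel)
  have "k = 0" using L1[of 0] b[of 0] b[of 1] by simp
  hence "c = 0" using Lt[of 0] b[of 0] b[of \<tau>] by simp
  moreover have "\<forall>a. \<forall>\<^sub>F x in at a. h x = b"
    using L(2) b \<open>k = 0\<close> by simp
  ultimately show ?thesis by blast
qed

text \<open>Plays the role of the Weierstrass zeta function, from which it differs by a polynomial
  of degree at most one: residue 1 at each lattice point, period 1, and an additive period along
  \<open>\<tau>\<close>.\<close>

definition theta_logderiv :: "complex \<Rightarrow> complex \<Rightarrow> complex"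
  where "theta_logderiv \<tau> x = deriv (theta \<tau>) x / theta \<tau> x"

lemma theta_has_derivative:
  assumes "Im \<tau> > 0"
  shows "(theta \<tau> has_field_derivative deriv (theta \<tau>) x) (at x)"
  using theta_analytic[OF assms, of "{x}"] analytic_derivI by auto

lemma theta_logderiv_plus_1:
  assumes "Im \<tau> > 0"
  shows "theta_logderiv \<tau> (x + 1) = theta_logderiv \<tau> x"
proof -
  have "((\<lambda>x. theta \<tau> (x + 1)) has_field_derivative deriv (theta \<tau>) (x + 1)) (at x)"
    using DERIV_shift theta_has_derivative[OF assms] by blast
  hence "deriv (theta \<tau>) (x + 1) = deriv (theta \<tau>) x"
    using DERIV_unique[OF _ theta_has_derivative[OF assms]] by (simp add: theta_plus_1)
  thus ?thesis by (simp add: theta_logderiv_def theta_plus_1)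
qed

lemma theta_logderiv_plus_tau:
  assumes "Im \<tau> > 0" "x \<notin> lattice \<tau>"
  shows "theta_logderiv \<tau> (x + \<tau>) = theta_logderiv \<tau> x - 2 * of_real pi * \<i>"
proof -
  have nz: "theta \<tau> x \<noteq> 0" using theta_zero_iff[OF assms(1)] assms(2) by simp
  have "((\<lambda>x. theta \<tau> (x + \<tau>)) has_field_derivative deriv (theta \<tau>) (x + \<tau>)) (at x)"
    using DERIV_shift theta_has_derivative[OF assms(1)] by blast
  moreover have "((\<lambda>x. - cexp (- x) * theta \<tau> x) has_field_derivative
      (2 * of_real pi * \<i> * cexp (- x) * theta \<tau> x - cexp (- x) * deriv (theta \<tau>) x)) (at x)"
    unfolding cexp_def
    by (rule derivative_eq_intros theta_has_derivative[OF assms(1)] refl | simp)+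
  ultimately have d: "deriv (theta \<tau>) (x + \<tau>) =
      2 * of_real pi * \<i> * cexp (- x) * theta \<tau> x - cexp (- x) * deriv (theta \<tau>) x"
    using DERIV_unique by (simp add: theta_plus_tau[OF assms(1)])
  show ?thesis unfolding theta_logderiv_def d theta_plus_tau[OF assms(1)]
    using nz by (simp add: field_simps)
qed

text \<open>Replaces a contour integral: subtracting
  \<open>r q * theta_logderiv \<tau> (x - s q)\<close> for each class cancels all principal parts.
  What remains has as additive period the sum of the residues times \<open>2 * pi * \<i>\<close>,
  and \<open>elliptic_constant\<close> makes it 0.\<close>

lemma residue_sum_zero:
  assumes \<tau>: "Im \<tau> > 0"
    and loc: "\<And>a. \<exists>g. g analytic_on {a} \<and> (\<forall>\<^sub>F x in at a. h x = g x + r (torus_proj \<tau> a) / (x - a))"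
    and p1: "\<And>a. \<forall>\<^sub>F x in at a. h (x + 1) = h x"
    and pt: "\<And>a. \<forall>\<^sub>F x in at a. h (x + \<tau>) = h x"
    and fin: "finite {q \<in> range (torus_proj \<tau>). r q \<noteq> 0}"
  shows "(\<Sum>q | q \<in> range (torus_proj \<tau>) \<and> r q \<noteq> 0. r q) = 0"
proof -
  define A where "A = {q \<in> range (torus_proj \<tau>). r q \<noteq> 0}"
  define s where "s q = (SOME a. torus_proj \<tau> a = q)" for q
  have s: "torus_proj \<tau> (s q) = q" if "q \<in> A" for q
    unfolding s_def by (rule someI_ex) (use that A_def in auto)
  let ?Z = "theta_logderiv \<tau>"
  define L where "L x = h x - (\<Sum>q\<in>A. r q * ?Z (x - s q))" for x
  have Zloc: "\<exists>g. g analytic_on {a} \<and>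
      (\<forall>\<^sub>F x in at a. r q * ?Z (x - s q) = g x + (if q = torus_proj \<tau> a then r q else 0) / (x - a))"
    if q: "q \<in> A" for a q
  proof -
    have o: "has_ord (theta \<tau>) (a - s q) (if a - s q \<in> lattice \<tau> then 1 else 0)"
      by (rule theta_ord[OF \<tau>])
    have "a - s q \<in> lattice \<tau> \<longleftrightarrow> q = torus_proj \<tau> a"
      using torus_proj_eq_iff[of \<tau> a "s q"] s[OF q] by auto
    with has_ord_logderiv[OF o] obtain g where g: "g analytic_on {a - s q}"
      "\<forall>\<^sub>F x in at (a - s q). ?Z x = g x + (if q = torus_proj \<tau> a then 1 else 0) / (x - (a - s q))"
      unfolding theta_logderiv_def by (auto split: if_splits)
    have g1: "(\<lambda>x. g (x + (- s q))) analytic_on {a}" using analytic_at_shift[of g a "- s q"] g(1) by simp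
    have "\<forall>\<^sub>F x in at a. ?Z (x + (- s q)) =
        g (x + (- s q)) + (if q = torus_proj \<tau> a then 1 else 0) / (x + (- s q) - (a - s q))"
      by (rule eventually_at_shift) (use g(2) in simp)
    hence "\<forall>\<^sub>F x in at a. r q * ?Z (x - s q) =
        r q * g (x + (- s q)) + (if q = torus_proj \<tau> a then r q else 0) / (x - a)"
      by eventually_elim (auto simp: algebra_simps)
    moreover have "(\<lambda>x. r q * g (x + (- s q))) analytic_on {a}" using g1 by (intro analytic_intros)
    ultimately show ?thesis by blast
  qed
  have "(\<Sum>q\<in>A. r q) * (2 * of_real pi * \<i>) = 0 \<and> (\<exists>C. \<forall>a. \<forall>\<^sub>F x in at a. L x = C)"
  proof (rule elliptic_constant[OF \<tau>])
    fix a
    obtain g where g: "g analytic_on {a}" "\<forall>\<^sub>F x in at a. h x = g x + r (torus_proj \<tau> a) / (x - a)"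
      using loc by blast
    obtain k where k: "\<And>q. q \<in> A \<Longrightarrow> k q analytic_on {a} \<and>
      (\<forall>\<^sub>F x in at a. r q * ?Z (x - s q) = k q x + (if q = torus_proj \<tau> a then r q else 0) / (x - a))"
      using Zloc[of _ a] by metis
    have "\<forall>\<^sub>F x in at a. \<forall>q\<in>A. r q * ?Z (x - s q) = k q x + (if q = torus_proj \<tau> a then r q else 0) / (x - a)"
      using k fin by (intro eventually_ball_finite) (auto simp: A_def)
    hence "\<forall>\<^sub>F x in at a. L x = g x - (\<Sum>q\<in>A. k q x)"
      using g(2)
    proof eventually_elim
      case (elim x)
      have "(\<Sum>q\<in>A. r q * ?Z (x - s q)) =
          (\<Sum>q\<in>A. k q x) + (\<Sum>q\<in>A. if q = torus_proj \<tau> a then r q else 0) / (x - a)"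
        using elim(1) by (simp add: sum.distrib sum_divide_distrib)
      also have "(\<Sum>q\<in>A. if q = torus_proj \<tau> a then r q else 0) = r (torus_proj \<tau> a)"
        using fin by (auto simp: A_def sum.delta)
      finally show ?case using elim(2) by (simp add: L_def)
    qed
    moreover have "(\<lambda>x. g x - (\<Sum>q\<in>A. k q x)) analytic_on {a}"
      using g k by (intro analytic_intros) auto
    ultimately show "\<exists>g. g analytic_on {a} \<and> (\<forall>\<^sub>F x in at a. L x = g x)" by blast
  next
    fix a
    show "\<forall>\<^sub>F x in at a. L (x + 1) = L x"
      using p1[of a]
    proof eventually_elim
      case (elim x)
      have "?Z (x + 1 - s q) = ?Z (x - s q)" for q
        using theta_logderiv_plus_1[OF \<tau>, of "x - s q"] by (simp add: algebra_simps)
      thus ?case using elim by (simp add: L_def)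
    qed
    \<comment> \<open>At its poles \<open>theta_logderiv\<close> has the default value 0 of a
      division by 0, which breaks the additive period; points near \<open>a\<close> avoid
      them.\<close>
    have "\<forall>\<^sub>F x in at a. \<forall>q\<in>A. x + (- s q) \<notin> lattice \<tau>"
      using fin by (intro eventually_ball_finite ballI eventually_at_shift lattice_eventually'[OF \<tau>])
        (auto simp: A_def)
    thus "\<forall>\<^sub>F x in at a. L (x + \<tau>) = L x + (\<Sum>q\<in>A. r q) * (2 * of_real pi * \<i>)"
      using pt[of a]
    proof eventually_elim
      case (elim x)
      have "r q * ?Z (x + \<tau> - s q) = r q * ?Z (x - s q) - r q * (2 * of_real pi * \<i>)" if "q \<in> A" for q
      proof -
        have "x - s q \<notin> lattice \<tau>" using elim(1) that by simp
        from theta_logderiv_plus_tau[OF \<tau> this]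
        have "?Z (x + \<tau> - s q) = ?Z (x - s q) - 2 * of_real pi * \<i>" by (simp add: algebra_simps)
        thus ?thesis by (simp add: right_diff_distrib)
      qed
      hence "(\<Sum>q\<in>A. r q * ?Z (x + \<tau> - s q)) =
          (\<Sum>q\<in>A. r q * ?Z (x - s q)) - (\<Sum>q\<in>A. r q) * (2 * of_real pi * \<i>)"
        by (simp add: sum_subtractf sum_distrib_right)
      thus ?case using elim(2) by (simp add: L_def)
    qed
  qed
  thus ?thesis by (simp add: A_def)
qed

lemma has_ord_eventually_0:
  assumes "has_ord f a n"
  shows "\<forall>\<^sub>F x in at a. has_ord f x 0"
proof -
  from assms obtain g where g: "g analytic_on {a}" "g a \<noteq> 0"
    "\<forall>\<^sub>F x in at a. f x = g x * (x - a) powi n" unfolding has_ord_def by blast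
  have "\<forall>\<^sub>F x in at a. g x \<noteq> 0" "\<forall>\<^sub>F x in at a. g analytic_on {x}" "\<forall>\<^sub>F x in at a. x \<noteq> a"
    using eventually_nhds_imp_at[OF analytic_at_nonzero_eventually[OF g(1,2)]]
      eventually_nhds_imp_at[OF analytic_at_eventually_analytic[OF g(1)]]
    by (auto simp: eventually_at_filter)
  thus ?thesis using eventually_at_imp_nhds[OF g(3)]
  proof eventually_elim
    case (elim x)
    have "has_ord (\<lambda>y. g y * (y - a) powi n) x 0"
      by (rule has_ord_0) (use elim in \<open>auto intro!: analytic_intros\<close>)
    thus ?case using has_ord_cong elim(4) eventually_nhds_imp_at by blast
  qed
qed

text \<open>The compact period cell meets every class. Infinitely many points of the support in it
  would accumulate, against the hypothesis.\<close>

lemma finite_torus_support: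
  assumes \<tau>: "Im \<tau> > 0" and ev: "\<And>a. \<forall>\<^sub>F x in at a. n (torus_proj \<tau> x) = 0"
  shows "finite {q \<in> range (torus_proj \<tau>). n q \<noteq> 0}"
proof -
  define B where "B = {x \<in> period_cell \<tau>. n (torus_proj \<tau> x) \<noteq> 0}"
  have "finite B"
  proof (rule ccontr)
    assume "infinite B"
    then obtain a where a: "a islimpt B"
      using compact_period_cell[of \<tau>] unfolding compact_eq_Bolzano_Weierstrass B_def by blast
    have "\<forall>\<^sub>F x in at a. x \<notin> B" using ev[of a] by eventually_elim (simp add: B_def)
    thus False using a by (simp add: islimpt_iff_eventually)
  qed
  moreover have "{q \<in> range (torus_proj \<tau>). n q \<noteq> 0} \<subseteq> torus_proj \<tau> ` B"
  proof
    fix q assume "q \<in> {q \<in> range (torus_proj \<tau>). n q \<noteq> 0}"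
    then obtain x where x: "q = torus_proj \<tau> x" "n q \<noteq> 0" by auto
    obtain y where y: "y \<in> period_cell \<tau>" "x - y \<in> lattice \<tau>" using period_cell_rep[OF \<tau>] by blast
    hence "q = torus_proj \<tau> y" using x torus_proj_eq_iff by auto
    thus "q \<in> torus_proj \<tau> ` B" using x y by (auto simp: B_def)
  qed
  ultimately show ?thesis using finite_surj by blast
qed

text \<open>The logarithmic derivative has the orders as residues. The orders are given as a
  function \<open>n\<close> on the torus, so that each class is counted once.\<close>

lemma degree_zero:
  assumes \<tau>: "Im \<tau> > 0"
    and ord: "\<And>a. has_ord R a (n (torus_proj \<tau> a))"
    and p1: "\<And>a. \<forall>\<^sub>F x in at a. R (x + 1) = R x"
    and pt: "\<And>a. \<forall>\<^sub>F x in at a. R (x + \<tau>) = R x"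
  shows "finite {q \<in> range (torus_proj \<tau>). n q \<noteq> 0}"
    "(\<Sum>q | q \<in> range (torus_proj \<tau>) \<and> n q \<noteq> 0. n q) = 0"
proof -
  show fin: "finite {q \<in> range (torus_proj \<tau>). n q \<noteq> 0}"
  proof (rule finite_torus_support[OF \<tau>])
    show "\<forall>\<^sub>F x in at a. n (torus_proj \<tau> x) = 0" for a
      using has_ord_eventually_0[OF ord[of a]] by eventually_elim (use has_ord_unique ord in blast)
  qed
  have per: "\<forall>\<^sub>F x in at a. deriv R (x + d) / R (x + d) = deriv R x / R x"
    if "\<And>a. \<forall>\<^sub>F x in at a. R (x + d) = R x" for a d
    using that[of a] eventually_at_imp_nhds[OF that[of a]]
  proof eventually_elim
    case (elim x)
    have "deriv R (x + d) = deriv (\<lambda>y. R (y + d)) x"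
      unfolding deriv_def by (simp add: DERIV_shift)
    also have "\<dots> = deriv R x" by (rule deriv_cong_ev) (use elim in auto)
    finally show ?case using elim by simp
  qed
  have "(\<Sum>q | q \<in> range (torus_proj \<tau>) \<and> complex_of_int (n q) \<noteq> 0. complex_of_int (n q)) = 0"
  proof (rule residue_sum_zero[OF \<tau>, where h = "\<lambda>x. deriv R x / R x"])
    show "\<exists>g. g analytic_on {a} \<and> (\<forall>\<^sub>F x in at a. deriv R x / R x =
        g x + complex_of_int (n (torus_proj \<tau> a)) / (x - a))" for a
      by (rule has_ord_logderiv[OF ord])
  qed (use per p1 pt fin in auto)
  thus "(\<Sum>q | q \<in> range (torus_proj \<tau>) \<and> n q \<noteq> 0. n q) = 0"
    by (simp del: of_int_sum add: of_int_sum[symmetric])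
qed

section \<open>Equivariant maps to the projective line\<close>

lemma proj_neg_neg [simp]: "proj_neg (proj_neg z) = z"
  by (cases z) (auto simp: proj_neg_def)

lemma proj_inv_inv [simp]: "proj_inv (proj_inv z) = z"
  by (cases z) (auto simp: proj_inv_def)

lemma proj_neg_inv: "proj_neg (proj_inv z) = proj_inv (proj_neg z)"
  by (cases z) (auto simp: proj_inv_def proj_neg_def)

lemma rho_0 [simp]: "rho 0 0 z = z"
  by (simp add: rho_def)

lemma rho_plus_1: "rho (m + 1) n z = proj_neg (rho m n z)" "rho m (n + 1) z = proj_inv (rho m n z)"
  by (auto simp: rho_def proj_neg_inv)

lemma rho_add: "rho m n (rho k l z) = rho (m + k) (n + l) z"
  by (auto simp: rho_def proj_neg_inv)

lemma rho_minus: "rho (- m) (- n) (rho m n z) = z"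
  by (simp add: rho_add)

lemma eventually_at_imp_nhds_at:
  fixes a :: complex
  assumes "\<forall>\<^sub>F x in at a. P x"
  shows "\<forall>\<^sub>F x in nhds a. \<forall>\<^sub>F y in at x. P y"
proof (rule eventually_nhds_conv_at[THEN iffD2], intro conjI assms)
  show "\<forall>\<^sub>F x in at a. \<forall>\<^sub>F y in at x. P y"
    using eventually_at_imp_nhds[OF assms] by (rule eventually_mono) (rule eventually_nhds_imp_at)
qed

text \<open>Analyticity, not the value, has to tell a pole from a zero: the affine coordinates used
  below take the value 0 at both.\<close>

definition proj_lift :: "(complex \<Rightarrow> complex) \<Rightarrow> complex \<Rightarrow> proj_line"
  where "proj_lift f x = (if f analytic_on {x} then Affine (f x) else Infinity)"

lemma has_ord_deriv:
  assumes "f analytic_on {a}" "has_ord (\<lambda>x. f x - c) a n" "n > 0"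
  shows "has_ord (deriv f) a (n - 1)"
proof -
  have an: "(\<lambda>x. f x - c) analytic_on {a}" using assms(1) by (intro analytic_intros)
  obtain g where g: "g analytic_on {a}" "g a \<noteq> 0" "\<forall>\<^sub>F x in nhds a. f x - c = g x * (x - a) ^ nat n"
    using has_ord_factor[OF assms(2) an] by blast
  define k where "k = nat n - 1"
  have k: "nat n = Suc k" "n - 1 = int k" using assms(3) by (auto simp: k_def)
  have ev: "\<forall>\<^sub>F x in nhds a. \<forall>\<^sub>F y in nhds x. f y = g y * (y - a) ^ Suc k + c"
    using g(3) unfolding k eventually_eventually by eventually_elim (simp add: algebra_simps)
  show ?thesis
  proof (rule has_ordI[of "\<lambda>x. deriv g x * (x - a) + of_nat (Suc k) * g x"])
    show "(\<lambda>x. deriv g x * (x - a) + of_nat (Suc k) * g x) analytic_on {a}"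
      using g(1) by (intro analytic_intros)
    show "deriv g a * (a - a) + of_nat (Suc k) * g a \<noteq> 0" using g(2) by (simp del: of_nat_Suc)
    have "\<forall>\<^sub>F x in nhds a. deriv f x = (deriv g x * (x - a) + of_nat (Suc k) * g x) * (x - a) powi (n - 1)"
      using ev analytic_at_eventually_analytic[OF g(1)]
    proof eventually_elim
      case (elim x)
      have gd: "(g has_field_derivative deriv g x) (at x)" using elim(2) analytic_derivI by auto
      have "deriv f x = deriv (\<lambda>y. g y * (y - a) ^ Suc k + c) x"
        by (rule deriv_cong_ev) (use elim in auto)
      also have "\<dots> = deriv g x * (x - a) ^ Suc k + of_nat (Suc k) * (x - a) ^ k * g x"
        by (rule DERIV_imp_deriv) (rule derivative_eq_intros gd refl | simp)+
      also have "\<dots> = (deriv g x * (x - a) + of_nat (Suc k) * g x) * (x - a) ^ k"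
        by (simp add: algebra_simps)
      finally show ?case by (simp add: k(2))
    qed
    thus "\<forall>\<^sub>F x in at a. deriv f x = (deriv g x * (x - a) + of_nat (Suc k) * g x) * (x - a) powi (n - 1)"
      by (rule eventually_nhds_imp_at)
  qed
qed

text \<open>
  A map to the projective line is encoded by its affine coordinate \<open>f\<close>, with the junk value 0 at the
  poles; since \<open>inverse 0 = 0\<close>, equivariance then holds everywhere. Where \<open>f\<close> has a pole, the
  translate by \<open>\<tau>\<close> is a local coordinate of the map.
\<close>

locale equivariant =
  fixes \<tau> :: complex and f :: "complex \<Rightarrow> complex"
  assumes im_pos: "Im \<tau> > 0"
    and plus_1: "f (x + 1) = - f x"
    and plus_tau: "f (x + \<tau>) = inverse (f x)"
    and regular: "f analytic_on {a} \<or> f analytic_on {a + \<tau>}"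
    and nonzero: "\<forall>\<^sub>F x in at a. f x \<noteq> 0"
begin

lemma plus_2: "f (x + 2) = f x"
  using plus_1[of "x + 1"] plus_1[of x] by (simp add: add_ac)

lemma plus_2_tau: "f (x + 2 * \<tau>) = f x"
proof -
  have "f ((x + \<tau>) + \<tau>) = f x" unfolding plus_tau by simp
  moreover have "(x + \<tau>) + \<tau> = x + 2 * \<tau>" by simp
  ultimately show ?thesis by metis
qed

lemma minus_2: "f (x - 2) = f x" and minus_2_tau: "f (x - 2 * \<tau>) = f x"
  and minus_tau: "inverse (f (x - \<tau>)) = f x"
  using plus_2[of "x - 2"] plus_2_tau[of "x - 2 * \<tau>"] plus_tau[of "x - \<tau>"] by auto

lemma analytic_plus_1: "f analytic_on {x + 1} \<longleftrightarrow> f analytic_on {x}"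
proof -
  have *: "f analytic_on {x}" if "f analytic_on {x + 1}" for x
  proof -
    have "(\<lambda>y. - f (y + 1)) analytic_on {x}" using analytic_at_shift[OF that] by (intro analytic_intros)
    thus ?thesis by (simp add: plus_1)
  qed
  have "f analytic_on {x + 1}" if "f analytic_on {x}"
  proof -
    have "(\<lambda>y. f (y + 2)) analytic_on {x}" using that by (simp add: plus_2)
    moreover have "f analytic_on {x + 1 + 1 + (-2)}" using that by simp
    from analytic_at_shift[OF this] have "f analytic_on {x + 1 + 1}"
      by (simp add: minus_2)
    thus ?thesis using * by blast
  qed
  thus ?thesis using * by blast
qed

lemma analytic_plus_2_tau: "f analytic_on {x + 2 * \<tau>} \<longleftrightarrow> f analytic_on {x}"
proof
  assume "f analytic_on {x + 2 * \<tau>}"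
  from analytic_at_shift[OF this] show "f analytic_on {x}" by (simp add: plus_2_tau)
next
  assume "f analytic_on {x}"
  hence "f analytic_on {(x + 2 * \<tau>) + (- 2 * \<tau>)}" by simp
  from analytic_at_shift[OF this] show "f analytic_on {x + 2 * \<tau>}"
    by (simp add: minus_2_tau)
qed

lemma analytic_plus_tau:
  assumes "f analytic_on {a}" "f a \<noteq> 0"
  shows "f analytic_on {a + \<tau>}"
proof -
  have "(\<lambda>x. inverse (f x)) analytic_on {a}" using assms by (intro analytic_intros) auto
  hence "(\<lambda>x. inverse (f x)) analytic_on {a + \<tau> + (- \<tau>)}" by simp
  from analytic_at_shift[OF this] show ?thesis by (simp add: minus_tau)
qed

text \<open>Near \<open>a\<close> the product of \<open>f x\<close> and
  \<open>f (x + \<tau>)\<close> is 1. If both factors were continuous at a zero of \<open>f\<close>,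
  it would tend to 0. So the translate of a zero is a pole.\<close>

lemma zero_not_analytic_plus_tau:
  assumes "f analytic_on {a}" "f a = 0"
  shows "\<not> f analytic_on {a + \<tau>}"
proof
  assume "f analytic_on {a + \<tau>}"
  from analytic_at_shift[OF this] have "isCont (\<lambda>x. f (x + \<tau>)) a" by (rule analytic_at_imp_isCont)
  moreover have "isCont f a" using assms(1) by (rule analytic_at_imp_isCont)
  ultimately have "isCont (\<lambda>x. f x * f (x + \<tau>)) a" by (intro continuous_intros)
  hence "((\<lambda>x. f x * f (x + \<tau>)) \<longlongrightarrow> 0) (at a)" using assms(2) by (simp add: isCont_def)
  moreover have "((\<lambda>x. f x * f (x + \<tau>)) \<longlongrightarrow> 1) (at a)"
    by (rule tendsto_eventually) (use nonzero[of a] in \<open>eventually_elim, simp add: plus_tau\<close>)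
  ultimately show False using tendsto_unique[OF at_neq_bot] by fastforce
qed

lemma not_analytic:
  assumes "\<not> f analytic_on {a}"
  shows "f analytic_on {a + \<tau>}" "f (a + \<tau>) = 0" "f a = 0"
proof -
  show an: "f analytic_on {a + \<tau>}" using regular assms by blast
  show "f (a + \<tau>) = 0"
  proof (rule ccontr)
    assume "f (a + \<tau>) \<noteq> 0"
    from analytic_plus_tau[OF an this] have "f analytic_on {a + 2 * \<tau>}" by (simp add: add_ac)
    thus False using assms analytic_plus_2_tau by blast
  qed
  thus "f a = 0" using plus_tau[of a] by simp
qed

lemma lift_plus_1: "proj_lift f (x + 1) = proj_neg (proj_lift f x)"
  by (simp add: proj_lift_def analytic_plus_1 proj_neg_def plus_1)

lemma lift_plus_tau: "proj_lift f (x + \<tau>) = proj_inv (proj_lift f x)"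
  using analytic_plus_tau[of x] zero_not_analytic_plus_tau[of x] not_analytic[of x] plus_tau[of x]
  by (auto simp: proj_lift_def proj_inv_def inverse_eq_divide)

lemma lift_plus: "proj_lift f (x + of_int m + of_int n * \<tau>) = rho m n (proj_lift f x)"
proof -
  have 1: "proj_lift f (x + of_int m) = rho m 0 (proj_lift f x)" for x m
  proof (induction m rule: int_induct[where k = 0])
    case base thus ?case by simp
  next
    case (step1 i)
    thus ?case using lift_plus_1[of "x + of_int i"] rho_plus_1(1)[of i 0] by (simp add: add_ac)
  next
    case (step2 i)
    have "proj_neg (proj_lift f (x + of_int (i - 1))) = proj_lift f (x + of_int i)"
      using lift_plus_1[of "x + of_int (i - 1)"] by simp
    also have "\<dots> = proj_neg (rho (i - 1) 0 (proj_lift f x))"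
      using rho_plus_1(1)[of "i - 1" 0] step2 by simp
    finally show ?case by (metis proj_neg_neg)
  qed
  have 2: "proj_lift f (x + of_int n * \<tau>) = rho 0 n (proj_lift f x)" for x n
  proof (induction n rule: int_induct[where k = 0])
    case base thus ?case by simp
  next
    case (step1 i)
    have "x + of_int (i + 1) * \<tau> = x + of_int i * \<tau> + \<tau>" by (simp add: algebra_simps)
    thus ?case using lift_plus_tau[of "x + of_int i * \<tau>"] rho_plus_1(2)[of 0 i] step1 by (simp add: add_ac)
  next
    case (step2 i)
    have "proj_inv (proj_lift f (x + of_int (i - 1) * \<tau>)) = proj_lift f (x + of_int i * \<tau>)"
      using lift_plus_tau[of "x + of_int (i - 1) * \<tau>"] by (simp add: algebra_simps)
    also have "\<dots> = proj_inv (rho 0 (i - 1) (proj_lift f x))"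
      using rho_plus_1(2)[of 0 "i - 1"] step2 by simp
    finally show ?case by (metis proj_inv_inv)
  qed
  show ?thesis unfolding 2 1 rho_add by simp
qed

lemma meromorphic: "f meromorphic_on {a}"
proof (cases "f analytic_on {a}")
  case True thus ?thesis by (rule analytic_on_imp_meromorphic_on)
next
  case False
  have "(\<lambda>x. f (x + \<tau>)) analytic_on {a}" using analytic_at_shift[OF not_analytic(1)[OF False]] .
  hence "(\<lambda>x. inverse (f (x + \<tau>))) meromorphic_on {a}"
    by (intro meromorphic_on_inverse analytic_on_imp_meromorphic_on)
  thus ?thesis by (simp add: plus_tau)
qed

text \<open>The points near which \<open>f\<close> is constantly \<open>c\<close> form an open and
  closed set. If it were the whole plane, the sign change under translation by 1 would give
  \<open>c = - c\<close>, hence \<open>c = 0\<close>, against \<open>nonzero\<close>.\<close>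

lemma not_locally_constant: "\<exists>\<^sub>F x in at a. f x - c \<noteq> 0"
proof -
  define A where "A = {a. \<forall>\<^sub>F x in at a. f x - c = 0}"
  have "open A"
  proof (rule topological_space_class.openI)
    fix a assume "a \<in> A"
    hence e: "\<forall>\<^sub>F x in at a. f x - c = 0" by (simp add: A_def)
    have "\<forall>\<^sub>F x in nhds a. \<forall>\<^sub>F y in at x. f y - c = 0"
      by (rule eventually_at_imp_nhds_at[OF e])
    thus "\<exists>T. open T \<and> a \<in> T \<and> T \<subseteq> A"
      unfolding eventually_nhds A_def by blast
  qed
  moreover have "open (- A)"
  proof (rule topological_space_class.openI)
    fix a assume "a \<in> - A"
    hence fr: "\<exists>\<^sub>F x in at a. f x - c \<noteq> 0" by (simp add: A_def frequently_def)
    have "(\<lambda>x. f x - c) meromorphic_on {a}" using meromorphic by (intro meromorphic_intros)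
    from has_ord_nonzero[OF meromorphic_has_ord[OF this fr]]
    have e: "\<forall>\<^sub>F x in at a. f x - c \<noteq> 0" .
    have "\<forall>\<^sub>F x in nhds a. \<forall>\<^sub>F y in at x. f y - c \<noteq> 0"
      by (rule eventually_at_imp_nhds_at[OF e])
    hence "\<forall>\<^sub>F x in nhds a. x \<in> - A"
    proof eventually_elim
      case (elim x)
      show ?case
      proof
        assume "x \<in> A"
        hence "\<forall>\<^sub>F y in at x. f y - c = 0" by (simp add: A_def)
        hence "\<forall>\<^sub>F y in at x. False" using elim by eventually_elim simp
        thus False by simp
      qed
    qed
    thus "\<exists>T. open T \<and> a \<in> T \<and> T \<subseteq> - A" unfolding eventually_nhds by blast
  qed
  ultimately have "A = {} \<or> A = UNIV" using connected_clopen[of "UNIV :: complex set"]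
    by (simp add: closed_def connected_UNIV)
  moreover have "A \<noteq> UNIV"
  proof
    assume U: "A = UNIV"
    have 1: "\<forall>\<^sub>F x in at 0. f x - c = 0" using U A_def by blast
    have "\<forall>\<^sub>F x in at (0 + 1). f x - c = 0" using U A_def by blast
    from eventually_at_shift[OF this] 1 nonzero[of 0] have "\<forall>\<^sub>F x in at (0::complex). False"
      by eventually_elim (auto simp: plus_1)
    thus False by simp
  qed
  ultimately show ?thesis by (auto simp: A_def frequently_def)
qed

lemma has_ord_diff: "has_ord (\<lambda>x. f x - c) a (zorder (\<lambda>x. f x - c) a)"
  by (rule meromorphic_has_ord[OF _ not_locally_constant]) (use meromorphic in \<open>intro meromorphic_intros\<close>)

text \<open>The ramification index minus one of the map to the projective line. At a pole it is read
  off from the translate, which is the local coordinate \<open>1 / f\<close>.\<close>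

definition crit :: "complex \<Rightarrow> int"
  where "crit x = (if f analytic_on {x} then zorder (deriv f) x else zorder (deriv f) (x + \<tau>))"

lemma has_ord_deriv_crit:
  assumes "f analytic_on {a}"
  shows "has_ord (deriv f) a (crit a)" "crit a \<ge> 0"
proof -
  have "(\<lambda>x. f x - f a) analytic_on {a}" using assms by (intro analytic_intros)
  hence "zorder (\<lambda>x. f x - f a) a > 0" using has_ord_analytic_pos_iff[OF has_ord_diff] by simp
  from has_ord_deriv[OF assms has_ord_diff this]
  have "has_ord (deriv f) a (zorder (\<lambda>x. f x - f a) a - 1)" .
  hence "has_ord (deriv f) a (zorder (deriv f) a)" using has_ord_imp_zorder by metis
  thus o: "has_ord (deriv f) a (crit a)" using assms by (simp add: crit_def)
  have "deriv f analytic_on {a}" using assms by (rule analytic_deriv)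
  thus "crit a \<ge> 0" using has_ord_analytic_ge_0[OF o] by blast
qed

lemma deriv_plus:
  assumes "f analytic_on {x}"
  shows "deriv f (x + 1) = - deriv f x" "f x \<noteq> 0 \<Longrightarrow> deriv f (x + \<tau>) = - (deriv f x / (f x)\<^sup>2)"
    "deriv f (x + 2 * \<tau>) = deriv f x"
proof -
  have d: "(f has_field_derivative deriv f x) (at x)" using assms analytic_derivI by auto
  have e: "deriv f (x + c) = deriv (\<lambda>x. f (x + c)) x" for c
    unfolding deriv_def by (simp add: DERIV_shift)
  show "deriv f (x + 1) = - deriv f x"
    unfolding e plus_1 by (rule DERIV_imp_deriv) (auto intro!: derivative_eq_intros d)
  show "deriv f (x + 2 * \<tau>) = deriv f x"
    unfolding e plus_2_tau by simp
  show "deriv f (x + \<tau>) = - (deriv f x / (f x)\<^sup>2)" if "f x \<noteq> 0"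
    unfolding e plus_tau by (rule DERIV_imp_deriv)
      (use that in \<open>auto intro!: derivative_eq_intros d simp: field_simps power2_eq_square\<close>)
qed

lemma eventually_analytic: "\<forall>\<^sub>F x in at a. f analytic_on {x}"
proof (cases "f analytic_on {a}")
  case True thus ?thesis by (rule eventually_nhds_imp_at[OF analytic_at_eventually_analytic])
next
  case False
  from eventually_nhds_imp_at[OF analytic_at_eventually_analytic[OF not_analytic(1)[OF False]]]
  have "\<forall>\<^sub>F x in at a. f analytic_on {x + \<tau>}" by (rule eventually_at_shift)
  thus ?thesis using nonzero[of a]
  proof eventually_elim
    case (elim x)
    thus ?case using not_analytic(3) by blast
  qed
qed

text \<open>Where \<open>f\<close> is finite and nonzero, inversion multiplies the derivative by a
  unit. At a zero of \<open>f\<close> the definition for \<open>x + \<tau>\<close> looks at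
  \<open>x + 2 * \<tau>\<close>, a period away from \<open>x\<close>; at a pole of \<open>f\<close>
  both sides agree by definition.\<close>

lemma crit_plus_tau: "crit (x + \<tau>) = crit x"
proof (cases "f analytic_on {x} \<and> f x \<noteq> 0")
  case True
  hence an: "f analytic_on {x}" "f analytic_on {x + \<tau>}" "f x \<noteq> 0" using analytic_plus_tau by auto
  have "has_ord (\<lambda>y. - 1 / (f y)\<^sup>2) x 0"
    by (rule has_ord_0) (use an in \<open>auto intro!: analytic_intros\<close>)
  from has_ord_mult[OF this has_ord_deriv_crit(1)[OF an(1)]]
  have 1: "has_ord (\<lambda>y. - 1 / (f y)\<^sup>2 * deriv f y) x (crit x)" by simp
  have "\<forall>\<^sub>F y in at x. deriv f (y + \<tau>) = - 1 / (f y)\<^sup>2 * deriv f y"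
    using eventually_analytic[of x] nonzero[of x] by eventually_elim (simp add: deriv_plus)
  from has_ord_cong[OF 1 this] has_ord_shift[OF has_ord_deriv_crit(1)[OF an(2)]]
  show ?thesis using has_ord_unique by blast
next
  case False
  show ?thesis
  proof (cases "f analytic_on {x}")
    case True
    hence "\<not> f analytic_on {x + \<tau>}" using False zero_not_analytic_plus_tau by blast
    hence "crit (x + \<tau>) = zorder (deriv f) (x + 2 * \<tau>)" by (simp add: crit_def add_ac)
    moreover have "has_ord (deriv f) (x + 2 * \<tau>) (crit (x + 2 * \<tau>))"
      using True analytic_plus_2_tau has_ord_deriv_crit by blast
    from has_ord_shift[OF this] have "has_ord (\<lambda>y. deriv f (y + 2 * \<tau>)) x (crit (x + 2 * \<tau>))" .
    moreover have "\<forall>\<^sub>F y in at x. deriv f y = deriv f (y + 2 * \<tau>)"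
      using eventually_analytic[of x] by eventually_elim (simp add: deriv_plus)
    ultimately have "crit (x + 2 * \<tau>) = crit x"
      using has_ord_cong has_ord_unique has_ord_deriv_crit(1)[OF True] by blast
    thus ?thesis using \<open>has_ord (deriv f) (x + 2 * \<tau>) _\<close> \<open>crit (x + \<tau>) = _\<close> has_ord_imp_zorder by simp
  next
    case F: False
    thus ?thesis using not_analytic(1)[OF F] by (simp add: crit_def)
  qed
qed

lemma crit_plus_1: "crit (x + 1) = crit x"
proof -
  have *: "crit (x + 1) = crit x" if "f analytic_on {x}" for x
  proof -
    have "has_ord (deriv f) (x + 1) (crit (x + 1))"
      using that analytic_plus_1 has_ord_deriv_crit by blast
    from has_ord_shift[OF this] have "has_ord (\<lambda>y. deriv f (y + 1)) x (crit (x + 1))" .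
    hence "has_ord (\<lambda>y. - deriv f (y + 1)) x (crit (x + 1))" by (rule has_ord_minus)
    moreover have "\<forall>\<^sub>F y in at x. deriv f y = - deriv f (y + 1)"
      using eventually_analytic[of x] by eventually_elim (simp add: deriv_plus)
    ultimately show ?thesis using has_ord_cong has_ord_unique has_ord_deriv_crit(1)[OF that] by blast
  qed
  show ?thesis
  proof (cases "f analytic_on {x}")
    case False
    hence "crit (x + \<tau> + 1) = crit (x + \<tau>)" using * not_analytic(1) by blast
    moreover have "x + \<tau> + 1 = (x + 1) + \<tau>" by simp
    ultimately show ?thesis using crit_plus_tau by metis
  qed (use * in blast)
qed

lemma crit_ge_0: "crit a \<ge> 0"
  using has_ord_deriv_crit(2)[of a] has_ord_deriv_crit(2)[of "a + \<tau>"] regular[of a] crit_plus_tau[of a]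
  by auto

lemma crit_lattice: "l \<in> lattice \<tau> \<Longrightarrow> crit (x + l) = crit x"
  by (rule periodic_lattice[OF crit_plus_1 crit_plus_tau])

lemma translate: "equivariant \<tau> (\<lambda>x. f (x + p))"
proof
  show "f (x + 1 + p) = - f (x + p)" for x using plus_1[of "x + p"] by (simp add: add_ac)
  show "f (x + \<tau> + p) = inverse (f (x + p))" for x using plus_tau[of "x + p"] by (simp add: add_ac)
  show "(\<lambda>x. f (x + p)) analytic_on {a} \<or> (\<lambda>x. f (x + p)) analytic_on {a + \<tau>}" for a
  proof -
    have "f analytic_on {a + p} \<or> f analytic_on {a + \<tau> + p}" using regular[of "a + p"] by (simp add: add_ac)
    thus ?thesis using analytic_at_shift by blast
  qed
  show "\<forall>\<^sub>F x in at a. f (x + p) \<noteq> 0" for a by (rule eventually_at_shift[OF nonzero])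
qed (rule im_pos)

end

lemma analytic_at_shift_iff:
  fixes f :: "complex \<Rightarrow> complex"
  shows "(\<lambda>x. f (x + c)) analytic_on {a} \<longleftrightarrow> f analytic_on {a + c}"
proof
  assume "(\<lambda>x. f (x + c)) analytic_on {a}"
  hence "(\<lambda>x. f (x + c)) analytic_on {a + c + (- c)}" by simp
  from analytic_at_shift[OF this] show "f analytic_on {a + c}" by simp
qed (rule analytic_at_shift)

lemma proj_lift_translate: "proj_lift (\<lambda>x. f (x + p)) x = proj_lift f (x + p)"
  by (simp add: proj_lift_def analytic_at_shift_iff)

lemma zorder_translate: "has_ord f (a + c) n \<Longrightarrow> zorder (\<lambda>x. f (x + c)) a = n"
  using has_ord_imp_zorder has_ord_shift by blast

lemma crit_translate:
  assumes "equivariant \<tau> f"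
  shows "equivariant.crit \<tau> (\<lambda>x. f (x + p)) x = equivariant.crit \<tau> f (x + p)"
proof -
  interpret equivariant \<tau> f by fact
  interpret t: equivariant \<tau> "\<lambda>x. f (x + p)" by (rule translate)
  have d: "deriv (\<lambda>x. f (x + p)) = (\<lambda>x. deriv f (x + p))"
    unfolding deriv_def by (simp add: DERIV_shift)
  have "t.crit x = crit (x + p)" if "f analytic_on {x + p}" for x
    using that zorder_translate[OF has_ord_deriv_crit(1)[OF that]]
    by (simp add: t.crit_def analytic_at_shift_iff d)
  moreover have "x + \<tau> + p = x + p + \<tau>" by simp
  ultimately show ?thesis
    using regular[of "x + p"] t.crit_plus_tau[of x] crit_plus_tau[of "x + p"] by metis
qed

section \<open>The equivariant elliptic function of degree two\<close>

text \<open>The lattice of \<open>theta (2 * \<tau>)\<close> is Z + 2 tau Z, and modulo it the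
  quotient has a simple zero at 1/2 + tau and a simple pole at 1/2. The factor
  \<open>cexp (- (x / 2))\<close> changes sign under translation by 1. The square of the constant,
  \<open>cexp (3 * \<tau> / 2)\<close>, is what makes the product of \<open>jac \<tau> x\<close> and
  \<open>jac \<tau> (x + \<tau>)\<close> equal to 1.\<close>

definition jac :: "complex \<Rightarrow> complex \<Rightarrow> complex"
  where "jac \<tau> x = cexp (3 * (\<tau> / 4)) * cexp (- (x / 2)) *
    theta (2 * \<tau>) (x - 1 / 2 - \<tau>) / theta (2 * \<tau>) (x - 1 / 2)"

lemma cexp_minus_half: "cexp (- (1 / 2)) = - 1"
  using cexp_minus[of "1 / 2"] by (simp add: cexp_half)

lemma jac_plus_1: "jac \<tau> (x + 1) = - jac \<tau> x"
proof -
  have "x + 1 - 1 / 2 - \<tau> = (x - 1 / 2 - \<tau>) + 1" "x + 1 - 1 / 2 = (x - 1 / 2) + 1"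
    "- ((x + 1) / 2) = - (x / 2) + - (1 / 2)" by (auto simp: algebra_simps add_divide_distrib)
  thus ?thesis unfolding jac_def theta_plus_1 cexp_add cexp_minus_half
    by (simp only: theta_plus_1 cexp_add cexp_minus_half) simp
qed

lemma theta_double_shift:
  assumes "Im \<tau> > 0"
  shows "theta (2 * \<tau>) (x - 1 / 2 + \<tau>) = cexp (- x) * cexp \<tau> * theta (2 * \<tau>) (x - 1 / 2 - \<tau>)"
proof -
  have "theta (2 * \<tau>) (x - 1 / 2 + \<tau>) = theta (2 * \<tau>) ((x - 1 / 2 - \<tau>) + 2 * \<tau>)"
    by (simp add: add.commute)
  also have "\<dots> = - cexp (- (x - 1 / 2 - \<tau>)) * theta (2 * \<tau>) (x - 1 / 2 - \<tau>)"
    by (rule theta_plus_tau) (use assms in simp)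
  also have "- (x - 1 / 2 - \<tau>) = - x + \<tau> + 1 / 2" by simp
  also have "- cexp (- x + \<tau> + 1 / 2) = cexp (- x) * cexp \<tau>" by (simp only: cexp_add cexp_half) simp
  finally show ?thesis .
qed

lemma jac_plus_tau:
  assumes "Im \<tau> > 0"
  shows "jac \<tau> (x + \<tau>) = inverse (jac \<tau> x)"
proof -
  \<comment> \<open>With \<open>u\<close> and \<open>X\<close> all exponentials become integer
    powers, and the claim is an identity of rational expressions. At zeros and poles both sides are
    the default value 0.\<close>
  define u where "u = cexp (\<tau> / 4)"
  define X where "X = cexp (- (x / 2))"
  define A where "A = theta (2 * \<tau>) (x - 1 / 2 - \<tau>)"
  define B where "B = theta (2 * \<tau>) (x - 1 / 2)"
  have nz: "u \<noteq> 0" "X \<noteq> 0" by (auto simp: u_def X_def)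
  have u: "cexp (3 * (\<tau> / 4)) = u ^ 3" "cexp \<tau> = u ^ 4" "cexp (- (\<tau> / 2)) = inverse (u ^ 2)"
    using cexp_of_nat_mult[of 3 "\<tau> / 4"] cexp_of_nat_mult[of 4 "\<tau> / 4"] cexp_of_nat_mult[of 2 "\<tau> / 4"]
    by (auto simp: u_def cexp_minus)
  have X: "cexp (- x) = X ^ 2" using cexp_of_nat_mult[of 2 "- (x / 2)"] by (simp add: X_def)
  have 1: "x + \<tau> - 1 / 2 - \<tau> = x - 1 / 2" "x + \<tau> - 1 / 2 = x - 1 / 2 + \<tau>"
    "- ((x + \<tau>) / 2) = - (x / 2) + - (\<tau> / 2)" by (auto simp: algebra_simps add_divide_distrib)
  have "jac \<tau> (x + \<tau>) = u ^ 3 * (X * inverse (u ^ 2)) * B / (X ^ 2 * u ^ 4 * A)"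
    unfolding jac_def 1 theta_double_shift[OF assms] cexp_add u X
    by (simp add: X_def A_def B_def)
  also have "\<dots> = inverse (u ^ 3 * X * A / B)"
    using nz by (cases "A = 0") (simp_all add: field_simps power2_eq_square power3_eq_cube power4_eq_xxxx)
  also have "\<dots> = inverse (jac \<tau> x)" unfolding jac_def u by (simp add: X_def A_def B_def)
  finally show ?thesis .
qed

text \<open>What \<open>theta_minus\<close> and \<open>theta_double_shift\<close> contribute to
  numerator and denominator cancels up to the factor \<open>cexp (- x)\<close>, which turns
  \<open>cexp (x / 2)\<close> back into \<open>cexp (- (x / 2))\<close>.\<close>

lemma jac_minus:
  assumes "Im \<tau> > 0"
  shows "jac \<tau> (- x) = jac \<tau> x"
proof -
  let ?t = "theta (2 * \<tau>)"
  have im: "Im (2 * \<tau>) > 0" using assms by simp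
  define X where "X = cexp (- (x / 2))"
  have X: "cexp (- x) = X ^ 2" "X \<noteq> 0" "cexp (x / 2) = inverse X"
    using cexp_of_nat_mult[of 2 "- (x / 2)"] by (auto simp: X_def cexp_minus)
  have 1: "- x - 1 / 2 - \<tau> = - (x - 1 / 2 + \<tau> + 1)" "- x - 1 / 2 = - (x - 1 / 2 + 1)" by auto
  have 2: "- (x - 1 / 2 + \<tau> + 1) = - (x - 1 / 2 + 1) + - \<tau>" by simp
  have t1: "?t (- x - 1 / 2 - \<tau>) = - (cexp (- (x - 1 / 2 + 1)) * cexp (- \<tau>)) * (cexp (- x) * cexp \<tau> * ?t (x - 1 / 2 - \<tau>))"
    unfolding 1(1) theta_minus[OF im] unfolding theta_plus_1 theta_double_shift[OF assms] 2 cexp_add ..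
  have t2: "?t (- x - 1 / 2) = - cexp (- (x - 1 / 2 + 1)) * ?t (x - 1 / 2)"
    unfolding 1(2) theta_minus[OF im] theta_plus_1 ..
  define E where "E = cexp (- (x - 1 / 2 + 1))"
  have E: "E \<noteq> 0" by (simp add: E_def)
  have "jac \<tau> (- x) = cexp (3 * (\<tau> / 4)) * inverse X * (- (E * inverse (cexp \<tau>)) * (X ^ 2 * cexp \<tau> * ?t (x - 1 / 2 - \<tau>))) /
      (- E * ?t (x - 1 / 2))"
    unfolding jac_def t1 t2 E_def[symmetric] X(1)
    using X(3) by (simp add: cexp_minus)
  also have "\<dots> = cexp (3 * (\<tau> / 4)) * X * ?t (x - 1 / 2 - \<tau>) / ?t (x - 1 / 2)"
    using E X(2) by (cases "?t (x - 1 / 2) = 0") (simp_all add: field_simps power2_eq_square)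
  also have "\<dots> = jac \<tau> x" by (simp add: jac_def X_def)
  finally show ?thesis .
qed

text \<open>Keeps the zeros and the poles of \<open>jac\<close> in different classes, as they differ
  by \<open>\<tau>\<close>.\<close>

lemma tau_not_double: "Im \<tau> > 0 \<Longrightarrow> \<tau> \<notin> lattice (2 * \<tau>)"
proof
  assume \<tau>: "Im \<tau> > 0" and "\<tau> \<in> lattice (2 * \<tau>)"
  then obtain m n where "\<tau> = of_int m + of_int n * (2 * \<tau>)" unfolding lattice_iff by blast
  hence "Im \<tau> = Im (of_int m + of_int n * (2 * \<tau>))" by simp
  hence "Im \<tau> * (1 - 2 * real_of_int n) = 0" by (simp add: algebra_simps)
  hence "1 - 2 * real_of_int n = 0" using \<tau> by simp
  hence "real_of_int (1 - 2 * n) = 0" by simp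
  hence "1 - 2 * n = 0" by (simp only: of_int_eq_0_iff)
  thus False by presburger
qed

lemma jac_ord:
  assumes "Im \<tau> > 0"
  shows "has_ord (jac \<tau>) a ((if a - 1 / 2 - \<tau> \<in> lattice (2 * \<tau>) then 1 else 0) -
    (if a - 1 / 2 \<in> lattice (2 * \<tau>) then 1 else 0))"
proof -
  have im: "Im (2 * \<tau>) > 0" using assms by simp
  have 0: "has_ord (\<lambda>x. cexp (3 * (\<tau> / 4)) * cexp (- (x / 2))) a 0"
    by (rule has_ord_0) (auto simp: cexp_def intro!: analytic_intros)
  have 1: "has_ord (\<lambda>x. theta (2 * \<tau>) (x + (- 1 / 2 - \<tau>))) a (if a - 1 / 2 - \<tau> \<in> lattice (2 * \<tau>) then 1 else 0)"
    by (rule has_ord_shift) (use theta_ord[OF im, of "a - 1 / 2 - \<tau>"] in \<open>simp add: algebra_simps\<close>)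
  have 2: "has_ord (\<lambda>x. theta (2 * \<tau>) (x + (- 1 / 2))) a (if a - 1 / 2 \<in> lattice (2 * \<tau>) then 1 else 0)"
    by (rule has_ord_shift) (use theta_ord[OF im, of "a - 1 / 2"] in \<open>simp add: algebra_simps\<close>)
  have e: "(\<lambda>x. cexp (3 * (\<tau> / 4)) * cexp (- (x / 2)) * theta (2 * \<tau>) (x + (- 1 / 2 - \<tau>)) /
      theta (2 * \<tau>) (x + (- 1 / 2))) = jac \<tau>"
    by (auto simp: jac_def fun_eq_iff algebra_simps)
  from has_ord_divide[OF has_ord_mult[OF 0 1] 2] show ?thesis unfolding e by simp
qed

lemma jac_analytic_iff:
  assumes "Im \<tau> > 0"
  shows "jac \<tau> analytic_on {a} \<longleftrightarrow> a - 1 / 2 \<notin> lattice (2 * \<tau>)"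
proof
  assume an: "jac \<tau> analytic_on {a}"
  show "a - 1 / 2 \<notin> lattice (2 * \<tau>)"
  proof
    assume l: "a - 1 / 2 \<in> lattice (2 * \<tau>)"
    have "a - 1 / 2 - \<tau> \<notin> lattice (2 * \<tau>)"
      using lattice_diff[of "a - 1 / 2" "2 * \<tau>" "a - 1 / 2 - \<tau>"] l tau_not_double[OF assms] by auto
    hence "has_ord (jac \<tau>) a (- 1)" using jac_ord[OF assms, of a] l by simp
    from has_ord_analytic_ge_0[OF this an] show False by simp
  qed
next
  assume l: "a - 1 / 2 \<notin> lattice (2 * \<tau>)"
  have im: "Im (2 * \<tau>) > 0" using assms by simp
  have "(\<lambda>x. theta (2 * \<tau>) (x + c)) analytic_on {a}" for c
    by (rule analytic_at_shift[OF theta_analytic[OF im]])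
  from this[of "- 1 / 2"] this[of "- 1 / 2 - \<tau>"]
  have "(\<lambda>x. theta (2 * \<tau>) (x - 1 / 2)) analytic_on {a}" "(\<lambda>x. theta (2 * \<tau>) (x - 1 / 2 - \<tau>)) analytic_on {a}"
    by (simp_all add: algebra_simps)
  moreover have "(\<lambda>x. cexp (- (x / 2))) analytic_on {a}" unfolding cexp_def by (intro analytic_intros) auto
  ultimately show "jac \<tau> analytic_on {a}"
    unfolding jac_def[abs_def] using l theta_zero_iff[OF im] by (intro analytic_intros) auto
qed

lemma jac_equivariant:
  assumes "Im \<tau> > 0"
  shows "equivariant \<tau> (jac \<tau>)"
proof
  show "jac \<tau> analytic_on {a} \<or> jac \<tau> analytic_on {a + \<tau>}" for a
  proof (rule ccontr)
    assume "\<not> ?thesis"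
    hence "a - 1 / 2 \<in> lattice (2 * \<tau>)" "a + \<tau> - 1 / 2 \<in> lattice (2 * \<tau>)"
      by (simp_all add: jac_analytic_iff[OF assms])
    from lattice_diff[OF this(2) this(1)] show False using tau_not_double[OF assms] by simp
  qed
  show "\<forall>\<^sub>F x in at a. jac \<tau> x \<noteq> 0" for a by (rule has_ord_nonzero[OF jac_ord[OF assms]])
qed (use assms jac_plus_1 jac_plus_tau in auto)

lemma eventually_at_scale:
  fixes a c :: complex
  assumes "\<forall>\<^sub>F x in at (c * a). P x" "c \<noteq> 0"
  shows "\<forall>\<^sub>F x in at a. P (c * x)"
proof -
  from assms(1) obtain d where d: "d > 0" "\<And>x. x \<noteq> c * a \<Longrightarrow> dist x (c * a) < d \<Longrightarrow> P x"
    unfolding eventually_at by auto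
  show ?thesis unfolding eventually_at
  proof (intro exI[of _ "d / norm c"] conjI ballI impI)
    show "0 < d / norm c" using d assms(2) by simp
    fix x assume x: "x \<noteq> a \<and> dist x a < d / norm c"
    have "dist (c * x) (c * a) = norm c * dist x a"
      by (simp add: dist_norm norm_mult[symmetric] algebra_simps)
    also have "\<dots> < d" using x assms(2) by (simp add: field_simps)
    finally show "P (c * x)" using d(2) x assms(2) by simp
  qed
qed

lemma has_ord_scale:
  assumes "has_ord f (c * a) n" "c \<noteq> 0"
  shows "has_ord (\<lambda>x. f (c * x)) a n"
proof -
  from assms(1) obtain g where g: "g analytic_on {c * a}" "g (c * a) \<noteq> 0"
    "\<forall>\<^sub>F x in at (c * a). f x = g x * (x - c * a) powi n" unfolding has_ord_def by blast
  have l: "(\<lambda>x. c * x) analytic_on {a}" by (intro analytic_intros)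
  have "g analytic_on ((\<lambda>x. c * x) ` {a})" using g(1) by simp
  from analytic_on_compose[OF l this] have ga: "(\<lambda>x. g (c * x)) analytic_on {a}" by (simp add: o_def)
  show ?thesis
  proof (rule has_ordI[of "\<lambda>x. g (c * x) * c powi n"])
    show "(\<lambda>x. g (c * x) * c powi n) analytic_on {a}" using ga by (intro analytic_intros)
    show "g (c * a) * c powi n \<noteq> 0" using g(2) assms(2) by simp
    show "\<forall>\<^sub>F x in at a. f (c * x) = g (c * x) * c powi n * (x - a) powi n"
      using eventually_at_scale[OF g(3) assms(2)]
      by eventually_elim (simp add: power_int_mult_distrib right_diff_distrib[symmetric] mult.assoc)
  qed
qed

lemma half_not_lattice: "1 / 2 \<notin> lattice \<tau>" if "Im \<tau> > 0"
proof
  assume "1 / 2 \<in> lattice \<tau>"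
  then obtain m n where e: "1 / 2 = of_int m + of_int n * \<tau>" unfolding lattice_iff by blast
  have "m = 0 \<and> n = 0" by (rule lattice_zero_iff[OF that e]) (use that in auto)
  thus False using e by simp
qed

text \<open>Modulo Z + 2 tau Z, doubling does not distinguish \<open>a\<close> from its translate by
  1/2, so the poles of \<open>jac \<tau> (2 * a)\<close> form two classes modulo Lambda.\<close>

lemma pole_class_iff:
  "2 * a - 1 / 2 \<in> lattice (2 * \<tau>) \<longleftrightarrow> a - 1 / 4 \<in> lattice \<tau> \<or> a - 3 / 4 \<in> lattice \<tau>"
proof
  assume "2 * a - 1 / 2 \<in> lattice (2 * \<tau>)"
  then obtain m n where e: "2 * a - 1 / 2 = of_int m + of_int n * (2 * \<tau>)" unfolding lattice_iff by blast
  show "a - 1 / 4 \<in> lattice \<tau> \<or> a - 3 / 4 \<in> lattice \<tau>"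
  proof (cases "even m")
    case True
    then obtain k where "m = 2 * k" by blast
    hence "a - 1 / 4 = of_int k + of_int n * \<tau>" using e by (simp add: field_simps)
    thus ?thesis unfolding lattice_iff by blast
  next
    case False
    then obtain k where "m = 2 * k + 1" by (elim oddE)
    hence "a - 3 / 4 = of_int k + of_int n * \<tau>" using e by (simp add: field_simps)
    thus ?thesis unfolding lattice_iff by blast
  qed
next
  assume "a - 1 / 4 \<in> lattice \<tau> \<or> a - 3 / 4 \<in> lattice \<tau>"
  then consider m n where "a - 1 / 4 = of_int m + of_int n * \<tau>" | m n where "a - 3 / 4 = of_int m + of_int n * \<tau>"
    unfolding lattice_iff by blast
  thus "2 * a - 1 / 2 \<in> lattice (2 * \<tau>)"
  proof cases
    case (1 m n)
    hence "2 * a - 1 / 2 = of_int (2 * m) + of_int n * (2 * \<tau>)" by (simp add: field_simps)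
    thus ?thesis unfolding lattice_iff by blast
  next
    case (2 m n)
    hence "2 * a - 1 / 2 = of_int (2 * m + 1) + of_int n * (2 * \<tau>)" by (simp add: field_simps)
    thus ?thesis unfolding lattice_iff by blast
  qed
qed

text \<open>
  The function \<open>a \<mapsto> jac \<tau> (2 * a)\<close> is elliptic for the lattice of \<open>\<tau>\<close> and has two simple poles; so
  it has degree two, because the orders of an elliptic function sum to zero.
\<close>

lemma jac_value_count:
  assumes \<tau>: "Im \<tau> > 0"
  obtains N where "\<And>a. has_ord (\<lambda>x. jac \<tau> x - z) (2 * a) (N (torus_proj \<tau> a))"
    "finite {q \<in> range (torus_proj \<tau>). N q > 0}"
    "(\<Sum>q | q \<in> range (torus_proj \<tau>) \<and> N q > 0. N q) = 2"
    "\<And>a. N (torus_proj \<tau> a) > 0 \<longleftrightarrow> proj_lift (jac \<tau>) (2 * a) = Affine z"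
proof -
  interpret equivariant \<tau> "jac \<tau>" by (rule jac_equivariant[OF \<tau>])
  let ?p = "torus_proj \<tau>"
  define R where "R y = jac \<tau> (2 * y) - z" for y
  define Z where "Z a = zorder R a" for a
  have R1: "R (y + 1) = R y" "R (y + \<tau>) = R y" for y
    using plus_2[of "2 * y"] plus_2_tau[of "2 * y"] by (simp_all add: R_def algebra_simps)
  have o2: "has_ord (\<lambda>x. jac \<tau> x - z) (2 * a) (zorder (\<lambda>x. jac \<tau> x - z) (2 * a))" for a
    by (rule has_ord_diff)
  from has_ord_scale[OF o2] have oR: "has_ord R a (zorder (\<lambda>x. jac \<tau> x - z) (2 * a))" for a
    by (simp add: R_def[abs_def])
  have Z: "zorder (\<lambda>x. jac \<tau> x - z) (2 * a) = Z a" for a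
    using has_ord_imp_zorder[OF oR] by (simp add: Z_def)
  note oR = oR[unfolded Z] and o2 = o2[unfolded Z]
  have Zp: "Z (a + 1) = Z a" "Z (a + \<tau>) = Z a" for a
    using has_ord_unique[OF has_ord_shift[OF oR[of "a + 1"]], of "Z a"]
      has_ord_unique[OF has_ord_shift[OF oR[of "a + \<tau>"]], of "Z a"] oR[of a] by (simp_all add: R1)
  define N where "N q = Z (SOME a. ?p a = q)" for q
  have N: "N (?p a) = Z a" for a
  proof -
    have "?p (SOME b. ?p b = ?p a) = ?p a" by (rule someI) simp
    hence "(SOME b. ?p b = ?p a) - a \<in> lattice \<tau>" by (simp add: torus_proj_eq_iff)
    from periodic_lattice[of Z, OF Zp this, of a] show ?thesis by (simp add: N_def)
  qed
  have pole: "N (?p a) = - 1" if "2 * a - 1 / 2 \<in> lattice (2 * \<tau>)" for a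
  proof -
    have na: "\<not> jac \<tau> analytic_on {2 * a}" using that jac_analytic_iff[OF \<tau>] by simp
    have "2 * a - 1 / 2 - \<tau> \<notin> lattice (2 * \<tau>)"
      using lattice_diff[of "2 * a - 1 / 2" "2 * \<tau>" "2 * a - 1 / 2 - \<tau>"] that tau_not_double[OF \<tau>] by auto
    hence "has_ord (jac \<tau>) (2 * a) (- 1)" using jac_ord[OF \<tau>, of "2 * a"] that by simp
    then obtain g where g: "g analytic_on {2 * a}" "g (2 * a) \<noteq> 0"
      "\<forall>\<^sub>F x in at (2 * a). jac \<tau> x = g x * (x - 2 * a) powi (- 1)" unfolding has_ord_def by blast
    have ne: "\<forall>\<^sub>F x in at (2 * a). x \<noteq> 2 * a" by (simp add: eventually_at_filter)
    have "has_ord (\<lambda>x. jac \<tau> x - z) (2 * a) (- 1)"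
    proof (rule has_ordI[of "\<lambda>x. g x - z * (x - 2 * a)"])
      show "(\<lambda>x. g x - z * (x - 2 * a)) analytic_on {2 * a}" using g(1) by (intro analytic_intros)
      show "\<forall>\<^sub>F x in at (2 * a). jac \<tau> x - z = (g x - z * (x - 2 * a)) * (x - 2 * a) powi (- 1)"
        using g(3) ne by eventually_elim (simp add: power_int_minus field_simps)
    qed (use g in auto)
    thus ?thesis using o2 has_ord_unique N by metis
  qed
  have val: "N (?p a) \<ge> 0 \<and> (N (?p a) > 0 \<longleftrightarrow> jac \<tau> (2 * a) = z)"
    if "2 * a - 1 / 2 \<notin> lattice (2 * \<tau>)" for a
  proof -
    have "jac \<tau> analytic_on {2 * a}" using that jac_analytic_iff[OF \<tau>] by simp
    hence an: "(\<lambda>x. jac \<tau> x - z) analytic_on {2 * a}" by (intro analytic_intros)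
    from has_ord_analytic_ge_0[OF o2 this] has_ord_analytic_pos_iff[OF o2 this] show ?thesis by (simp add: N)
  qed
  have d: "finite {q \<in> range ?p. N q \<noteq> 0}" "(\<Sum>q | q \<in> range ?p \<and> N q \<noteq> 0. N q) = 0"
    by (rule degree_zero[OF \<tau>, of R N]; use oR N R1 in simp)+
  have neg: "{q \<in> range ?p. N q < 0} = {?p (1 / 4), ?p (3 / 4)}"
  proof -
    have "N (?p a) < 0 \<longleftrightarrow> ?p a = ?p (1 / 4) \<or> ?p a = ?p (3 / 4)" for a
    proof -
      have "N (?p a) < 0 \<longleftrightarrow> 2 * a - 1 / 2 \<in> lattice (2 * \<tau>)"
        using pole[of a] val[of a] by fastforce
      thus ?thesis by (simp add: pole_class_iff torus_proj_eq_iff)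
    qed
    thus ?thesis by auto
  qed
  have dist: "?p (1 / 4) \<noteq> ?p (3 / 4)"
    using half_not_lattice[OF \<tau>] lattice_minus_iff[of "1 / 2" \<tau>] by (simp add: torus_proj_eq_iff)
  have n1: "N (?p (1 / 4)) = - 1" "N (?p (3 / 4)) = - 1"
    by (rule pole, simp only: pole_class_iff, simp add: lattice_0)+
  have split: "{q \<in> range ?p. N q \<noteq> 0} = {q \<in> range ?p. N q > 0} \<union> {q \<in> range ?p. N q < 0}" by auto
  have fin: "finite {q \<in> range ?p. N q > 0}" using d(1) by (rule rev_finite_subset) auto
  have "0 = (\<Sum>q\<in>{q \<in> range ?p. N q > 0} \<union> {q \<in> range ?p. N q < 0}. N q)"
    using d(2) unfolding split by simp
  also have "\<dots> = (\<Sum>q | q \<in> range ?p \<and> N q > 0. N q) + (\<Sum>q | q \<in> range ?p \<and> N q < 0. N q)"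
    by (rule sum.union_disjoint) (use d(1) in \<open>auto elim: rev_finite_subset\<close>)
  also have "(\<Sum>q | q \<in> range ?p \<and> N q < 0. N q) = - 2" unfolding neg using dist n1 by simp
  finally have "(\<Sum>q | q \<in> range ?p \<and> N q > 0. N q) = 2" by simp
  moreover have "N (?p a) > 0 \<longleftrightarrow> proj_lift (jac \<tau>) (2 * a) = Affine z" for a
    using pole[of a] val[of a] by (auto simp: proj_lift_def jac_analytic_iff[OF \<tau>])
  ultimately show thesis using that[of N] fin o2 N by simp
qed

lemma jac_surj:
  assumes "Im \<tau> > 0"
  shows "\<exists>x. proj_lift (jac \<tau>) x = z"
proof (cases z)
  case (Affine w)
  obtain N where "\<And>a. has_ord (\<lambda>x. jac \<tau> x - w) (2 * a) (N (torus_proj \<tau> a))"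
      "finite {q \<in> range (torus_proj \<tau>). N q > 0}"
    and N: "(\<Sum>q | q \<in> range (torus_proj \<tau>) \<and> N q > 0. N q) = 2"
      "\<And>a. N (torus_proj \<tau> a) > 0 \<longleftrightarrow> proj_lift (jac \<tau>) (2 * a) = Affine w"
    by (rule jac_value_count[OF assms, of w]) (rule that)
  have "{q. q \<in> range (torus_proj \<tau>) \<and> N q > 0} \<noteq> {}"
  proof
    assume "{q. q \<in> range (torus_proj \<tau>) \<and> N q > 0} = {}"
    thus False using N(1) by (simp only: sum.empty)
  qed
  then obtain a where "N (torus_proj \<tau> a) > 0" by blast
  thus ?thesis using N(2) Affine by blast
next
  case Infinity
  have "\<not> jac \<tau> analytic_on {1 / 2}" using jac_analytic_iff[OF assms, of "1 / 2"] lattice_0 by simp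
  thus ?thesis using Infinity by (auto simp: proj_lift_def)
qed

lemma jac_lift_minus:
  assumes "Im \<tau> > 0"
  shows "proj_lift (jac \<tau>) (- x) = proj_lift (jac \<tau>) x"
proof -
  have "- x - 1 / 2 = - (x - 1 / 2) - 1" by simp
  hence "- x - 1 / 2 \<in> lattice (2 * \<tau>) \<longleftrightarrow> - (x - 1 / 2) \<in> lattice (2 * \<tau>)"
    using lattice_add_iff[OF lattice_1, of "- x - 1 / 2"] by simp
  thus ?thesis
    by (simp add: proj_lift_def jac_analytic_iff[OF assms] jac_minus[OF assms] lattice_minus_iff del: minus_diff_eq)
qed

lemma jac_lift_periodic:
  assumes "Im \<tau> > 0" "l \<in> lattice \<tau>"
  shows "proj_lift (jac \<tau>) (x + 2 * l) = proj_lift (jac \<tau>) x"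
proof -
  interpret equivariant \<tau> "jac \<tau>" by (rule jac_equivariant[OF assms(1)])
  obtain m n where "l = of_int m + of_int n * \<tau>" using assms(2) unfolding lattice_iff by blast
  hence "x + 2 * l = x + of_int (2 * m) + of_int (2 * n) * \<tau>" by (simp add: algebra_simps)
  thus ?thesis using lift_plus[of x "2 * m" "2 * n"] by (simp add: rho_def add.assoc)
qed

text \<open>Meant for the multiplicities in a fibre of a map of degree two: there are two simple
  points or one double point.\<close>

lemma sum_eq_2_cases:
  fixes N :: "'a \<Rightarrow> int"
  assumes "finite A" "(\<Sum>q\<in>A. N q) = 2" "\<And>q. q \<in> A \<Longrightarrow> N q > 0" "a \<in> A"
  shows "b \<in> A \<Longrightarrow> a \<noteq> b \<Longrightarrow> A = {a, b} \<and> N a = 1 \<and> N b = 1" "N a \<ge> 2 \<Longrightarrow> A = {a} \<and> N a = 2"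
proof -
  show "A = {a, b} \<and> N a = 1 \<and> N b = 1" if b: "b \<in> A" "a \<noteq> b"
  proof -
    have "(\<Sum>q\<in>A. N q) = N a + (N b + (\<Sum>q\<in>A - {a} - {b}. N q))"
      using assms(1,4) b by (simp add: sum.remove[of _ a] sum.remove[of _ b])
    moreover have "(\<Sum>q\<in>A - {a} - {b}. N q) \<ge> (\<Sum>q\<in>A - {a} - {b}. 1)"
      by (intro sum_mono) (use assms(3) in force)
    moreover have "N a \<ge> 1" "N b \<ge> 1" using assms(3,4) b by force+
    ultimately have "card (A - {a} - {b}) = 0" "N a = 1" "N b = 1" using assms(2) by (simp_all del: card_Diff_insert)
    hence "A - {a} - {b} = {}" using assms(1) by auto
    thus ?thesis using b assms(4) \<open>N a = 1\<close> \<open>N b = 1\<close> by blast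
  qed
  show "A = {a} \<and> N a = 2" if "N a \<ge> 2"
  proof -
    have "(\<Sum>q\<in>A. N q) = N a + (\<Sum>q\<in>A - {a}. N q)"
      using assms(1,4) by (simp add: sum.remove[of _ a])
    moreover have "(\<Sum>q\<in>A - {a}. N q) \<ge> (\<Sum>q\<in>A - {a}. 1)"
      by (intro sum_mono) (use assms(3) in force)
    ultimately have "card (A - {a}) = 0" "N a = 2" using assms(2) that by (simp_all del: card_Diff_insert)
    hence "A - {a} = {}" using assms(1) by auto
    thus ?thesis using assms(4) \<open>N a = 2\<close> by blast
  qed
qed

text \<open>Evenness and the period \<open>2 * v\<close> make the function symmetric about
  \<open>v\<close>, and then its derivative equals its own negative at \<open>v\<close>.\<close>

lemma jac_deriv_lattice:
  assumes \<tau>: "Im \<tau> > 0" and "v \<in> lattice \<tau>" "jac \<tau> analytic_on {v}"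
  shows "deriv (jac \<tau>) v = 0"
proof -
  interpret equivariant \<tau> "jac \<tau>" by (rule jac_equivariant[OF \<tau>])
  obtain m n where v: "v = of_int m + of_int n * \<tau>" using assms(2) unfolding lattice_iff by blast
  have sym: "jac \<tau> (2 * v - x) = jac \<tau> x" for x
  proof -
    have "jac \<tau> (- x + 2 * v) = jac \<tau> (- x)"
    proof -
      have "jac \<tau> (2 * (- x / 2 + v)) = jac \<tau> (2 * (- x / 2))"
      proof (rule periodic_lattice[of "\<lambda>y. jac \<tau> (2 * y)", OF _ _ assms(2)])
        show "jac \<tau> (2 * (y + 1)) = jac \<tau> (2 * y)" for y
          using plus_2[of "2 * y"] by (simp add: algebra_simps)
        show "jac \<tau> (2 * (y + \<tau>)) = jac \<tau> (2 * y)" for y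
          using plus_2_tau[of "2 * y"] by (simp add: algebra_simps)
      qed
      thus ?thesis by (simp add: algebra_simps)
    qed
    thus ?thesis using jac_minus[OF \<tau>, of x] by simp
  qed
  have d: "(jac \<tau> has_field_derivative deriv (jac \<tau>) v) (at v)" using assms(3) analytic_derivI by auto
  hence "(jac \<tau> has_field_derivative deriv (jac \<tau>) v) (at (2 * v - v))" by simp
  moreover have "((\<lambda>x. 2 * v - x) has_field_derivative - 1) (at v)"
    by (auto intro!: derivative_eq_intros)
  ultimately have "((\<lambda>x. jac \<tau> (2 * v - x)) has_field_derivative deriv (jac \<tau>) v * (- 1)) (at v)"
    by (rule DERIV_chain2[of "jac \<tau>" _ "\<lambda>x. 2 * v - x" v "- 1" UNIV])
  hence "(jac \<tau> has_field_derivative - deriv (jac \<tau>) v) (at v)" by (simp add: sym)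
  from DERIV_unique[OF d this] show ?thesis by simp
qed

text \<open>The fibre through \<open>v\<close> also contains \<open>- v\<close>. Modulo 2 Lambda the
  two are distinct unless \<open>v\<close> lies in Lambda, and in that case the derivative vanishes
  and \<open>v\<close> counts twice. Either way the degree two is used up. The count is made with
  the classes of \<open>v / 2\<close> and \<open>- v / 2\<close> modulo Lambda.\<close>

lemma jac_fibre:
  assumes \<tau>: "Im \<tau> > 0" and an: "jac \<tau> analytic_on {v}"
  shows "proj_lift (jac \<tau>) u = proj_lift (jac \<tau>) v \<Longrightarrow> (u - v) / 2 \<in> lattice \<tau> \<or> (u + v) / 2 \<in> lattice \<tau>"
    "has_ord (deriv (jac \<tau>)) v (if v \<in> lattice \<tau> then 1 else 0)"
proof -
  interpret equivariant \<tau> "jac \<tau>" by (rule jac_equivariant[OF \<tau>])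
  let ?p = "torus_proj \<tau>" and ?z = "jac \<tau> v"
  have lv: "proj_lift (jac \<tau>) v = Affine ?z" using an by (simp add: proj_lift_def)
  obtain N where
    N: "\<And>a. has_ord (\<lambda>x. jac \<tau> x - ?z) (2 * a) (N (?p a))"
      "finite {q \<in> range ?p. N q > 0}" "(\<Sum>q | q \<in> range ?p \<and> N q > 0. N q) = 2"
      "\<And>a. N (?p a) > 0 \<longleftrightarrow> proj_lift (jac \<tau>) (2 * a) = Affine ?z"
    by (rule jac_value_count[OF \<tau>, of ?z]) (rule that)
  define A where "A = {q \<in> range ?p. N q > 0}"
  have vA: "?p (v / 2) \<in> A" "?p (- v / 2) \<in> A"
    using N(4)[of "v / 2"] N(4)[of "- v / 2"] lv jac_lift_minus[OF \<tau>, of v] by (auto simp: A_def)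
  note cases = sum_eq_2_cases[of A N, OF N(2,3)[folded A_def] _ vA(1)]
  have od: "has_ord (deriv (jac \<tau>)) v (N (?p (v / 2)) - 1)"
    by (rule has_ord_deriv[OF an, of ?z]) (use N(1)[of "v / 2"] vA in \<open>auto simp: A_def\<close>)
  have key: "A = {?p (v / 2), ?p (- v / 2)} \<and> N (?p (v / 2)) = (if v \<in> lattice \<tau> then 2 else 1)"
  proof (cases "v \<in> lattice \<tau>")
    case False
    have "?p (v / 2) \<noteq> ?p (- v / 2)" using False by (simp add: torus_proj_eq_iff)
    from cases(1)[OF _ vA(2) this] False show ?thesis by (auto simp: A_def)
  next
    case True
    have "?p (v / 2) = ?p (- v / 2)" using True by (simp add: torus_proj_eq_iff)
    moreover have "(\<lambda>x. jac \<tau> x - ?z) analytic_on {v}" using an by (intro analytic_intros)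
    moreover have "(jac \<tau> has_field_derivative deriv (jac \<tau>) v) (at v)" using an analytic_derivI by auto
    hence "((\<lambda>x. jac \<tau> x - ?z) has_field_derivative 0) (at v)"
      using jac_deriv_lattice[OF \<tau> True an] by (auto intro!: derivative_eq_intros)
    hence "deriv (\<lambda>x. jac \<tau> x - ?z) v = 0" by (rule DERIV_imp_deriv)
    ultimately have "N (?p (v / 2)) \<ge> 2" using has_ord_ge_2[of _ v] N(1)[of "v / 2"] by simp
    from cases(2)[OF _ this] True \<open>?p (v / 2) = _\<close> show ?thesis by (auto simp: A_def)
  qed
  show "has_ord (deriv (jac \<tau>)) v (if v \<in> lattice \<tau> then 1 else 0)"
    using od key by (simp split: if_splits)
  show "(u - v) / 2 \<in> lattice \<tau> \<or> (u + v) / 2 \<in> lattice \<tau>" if "proj_lift (jac \<tau>) u = proj_lift (jac \<tau>) v"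
  proof -
    have "?p (u / 2) \<in> A" using N(4)[of "u / 2"] that lv by (auto simp: A_def)
    hence "?p (u / 2) = ?p (v / 2) \<or> ?p (u / 2) = ?p (- v / 2)" using key by blast
    thus ?thesis by (simp add: torus_proj_eq_iff diff_divide_distrib add_divide_distrib)
  qed
qed

lemma jac_lift_eq_iff:
  assumes \<tau>: "Im \<tau> > 0"
  shows "proj_lift (jac \<tau>) u = proj_lift (jac \<tau>) v \<longleftrightarrow> (u - v) / 2 \<in> lattice \<tau> \<or> (u + v) / 2 \<in> lattice \<tau>"
proof
  interpret equivariant \<tau> "jac \<tau>" by (rule jac_equivariant[OF \<tau>])
  assume eq: "proj_lift (jac \<tau>) u = proj_lift (jac \<tau>) v"
  show "(u - v) / 2 \<in> lattice \<tau> \<or> (u + v) / 2 \<in> lattice \<tau>"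
  proof (cases "jac \<tau> analytic_on {v}")
    case True thus ?thesis using jac_fibre(1)[OF \<tau> True eq] by simp
  next
    case False
    \<comment> \<open>At a pole the translate by \<open>\<tau>\<close> is finite. The translation
      cancels in the difference and changes the half sum by the lattice vector
      \<open>\<tau>\<close>.\<close>
    have "proj_lift (jac \<tau>) (u + \<tau>) = proj_lift (jac \<tau>) (v + \<tau>)"
      using eq by (simp add: lift_plus_tau)
    from jac_fibre(1)[OF \<tau> not_analytic(1)[OF False] this]
    have "(u - v) / 2 \<in> lattice \<tau> \<or> (u + v) / 2 + \<tau> \<in> lattice \<tau>"
      by (simp add: add_divide_distrib add_ac)
    thus ?thesis using lattice_add_iff[OF lattice_tau] by blast
  qed
next
  assume "(u - v) / 2 \<in> lattice \<tau> \<or> (u + v) / 2 \<in> lattice \<tau>"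
  moreover have "v + 2 * ((u - v) / 2) = u" "- v + 2 * ((u + v) / 2) = u" by (auto simp: field_simps)
  ultimately show "proj_lift (jac \<tau>) u = proj_lift (jac \<tau>) v"
    using jac_lift_periodic[OF \<tau>, of "(u - v) / 2" v] jac_lift_periodic[OF \<tau>, of "(u + v) / 2" "- v"]
      jac_lift_minus[OF \<tau>, of v] by metis
qed

lemma jac_crit:
  assumes \<tau>: "Im \<tau> > 0"
  shows "equivariant.crit \<tau> (jac \<tau>) x = (if x \<in> lattice \<tau> then 1 else 0)"
proof -
  interpret equivariant \<tau> "jac \<tau>" by (rule jac_equivariant[OF \<tau>])
  have *: "crit x = (if x \<in> lattice \<tau> then 1 else 0)" if "jac \<tau> analytic_on {x}" for x
    using has_ord_unique[OF has_ord_deriv_crit(1)[OF that] jac_fibre(2)[OF \<tau> that]] .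
  show ?thesis
    using *[of x] *[of "x + \<tau>"] regular[of x] crit_plus_tau[of x] lattice_add_iff[OF lattice_tau, of x] by auto
qed

section \<open>Equivariant maps with a single critical class\<close>

text \<open>The exceptional points depend on the period, so period relations are added and reversed
  as statements about all base points at once.\<close>

lemma eventually_periodic_lattice:
  fixes h :: "complex \<Rightarrow> complex"
  assumes "\<And>a. \<forall>\<^sub>F x in at a. h (x + 1) = h x" "\<And>a. \<forall>\<^sub>F x in at a. h (x + \<tau>) = h x"
    and "l \<in> lattice \<tau>"
  shows "\<forall>\<^sub>F x in at a. h (x + l) = h x"
proof -
  define P where "P l \<longleftrightarrow> (\<forall>a. \<forall>\<^sub>F x in at a. h (x + l) = h x)" for l
  have add: "P (k + l)" if "P k" "P l" for k l
    unfolding P_def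
  proof
    fix a
    have "\<forall>\<^sub>F x in at (a + k). h (x + l) = h x" using that(2) P_def by blast
    from eventually_at_shift[OF this] have "\<forall>\<^sub>F x in at a. h (x + k + l) = h (x + k)" .
    moreover have "\<forall>\<^sub>F x in at a. h (x + k) = h x" using that(1) P_def by blast
    ultimately show "\<forall>\<^sub>F x in at a. h (x + (k + l)) = h x"
      by eventually_elim (simp add: add.assoc)
  qed
  have minus: "P (- k)" if "P k" for k
    unfolding P_def
  proof
    fix a
    have "\<forall>\<^sub>F x in at (a + (- k)). h (x + k) = h x" using that P_def by blast
    from eventually_at_shift[OF this] show "\<forall>\<^sub>F x in at a. h (x + (- k)) = h x"
      by eventually_elim simp
  qed
  have int: "P (of_int m * k)" if "P k" for k m
  proof (induction m rule: int_induct[where k = 0])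
    case base thus ?case by (simp add: P_def)
  next
    case (step1 i) from add[OF this(2) that] show ?case by (simp add: algebra_simps)
  next
    case (step2 i) from add[OF this(2) minus[OF that]] show ?case by (simp add: algebra_simps)
  qed
  obtain m n where l: "l = of_int m + of_int n * \<tau>" using assms(3) unfolding lattice_iff by blast
  have "P 1" "P \<tau>" using assms P_def by auto
  from add[OF int[OF this(1)] int[OF this(2)], of m n] show ?thesis using l by (simp add: P_def)
qed

text \<open>
  The quotient below does not change if the same Moebius transformation is applied to both functions;
  so it is elliptic for two equivariant functions, and regular where both maps are immersions.
\<close>

definition moebius_quotient :: "(complex \<Rightarrow> complex) \<Rightarrow> (complex \<Rightarrow> complex) \<Rightarrow> complex \<Rightarrow> complex"
  where "moebius_quotient f g x = (f x - g x)\<^sup>2 / (deriv f x * deriv g x)"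

text \<open>If the difference has order \<open>k\<close>, the quotient has order
  \<open>2 * k - p - q\<close>. Equal values give \<open>k \<ge> 1\<close>; if both derivatives
  vanish as well, so does the derivative of the difference, and \<open>k \<ge> 2\<close>.\<close>

lemma moebius_quotient_ord:
  assumes "u analytic_on {a}" "v analytic_on {a}" "has_ord (deriv u) a p" "has_ord (deriv v) a q"
  shows "(\<forall>\<^sub>F x in at a. moebius_quotient u v x = 0) \<or>
    (\<exists>n. has_ord (moebius_quotient u v) a n \<and> n \<ge> - p - q \<and> (u a = v a \<longrightarrow>
       n \<ge> 2 - p - q \<and> (p \<ge> 1 \<and> q \<ge> 1 \<longrightarrow> n \<ge> 4 - p - q)))"
proof -
  define d where "d x = u x - v x" for x
  have an: "d analytic_on {a}" unfolding d_def using assms by (intro analytic_intros)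
  show ?thesis
  proof (cases "\<forall>\<^sub>F x in nhds a. d x = 0")
    case True
    from eventually_nhds_imp_at[OF this] have "\<forall>\<^sub>F x in at a. moebius_quotient u v x = 0"
      by eventually_elim (simp add: moebius_quotient_def d_def)
    thus ?thesis ..
  next
    case False
    define k where "k = zorder d a"
    have o: "has_ord d a k"
      using False analytic_locally_zero_or_has_ord[OF an] k_def by blast
    have k0: "k \<ge> 0" "k > 0 \<longleftrightarrow> d a = 0"
      using has_ord_analytic_ge_0[OF o an] has_ord_analytic_pos_iff[OF o an] by auto
    have e: "moebius_quotient u v = (\<lambda>x. (d x * d x) / (deriv u x * deriv v x))"
      by (auto simp: moebius_quotient_def d_def power2_eq_square)
    have oh: "has_ord (moebius_quotient u v) a (k + k - (p + q))"
      unfolding e by (intro has_ord_divide has_ord_mult o assms(3,4))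
    have "k \<ge> 2" if "u a = v a" "p \<ge> 1" "q \<ge> 1"
    proof -
      have "deriv u analytic_on {a}" "deriv v analytic_on {a}" using assms(1,2) by (auto intro: analytic_deriv)
      hence "deriv u a = 0" "deriv v a = 0"
        using has_ord_analytic_pos_iff[OF assms(3)] has_ord_analytic_pos_iff[OF assms(4)] that by auto
      moreover have "deriv d a = deriv u a - deriv v a"
        unfolding d_def using assms(1,2) analytic_derivI
        by (intro DERIV_imp_deriv derivative_intros) auto
      ultimately show ?thesis using has_ord_ge_2[OF o an] that by (simp add: d_def)
    qed
    thus ?thesis using oh k0 by (intro disjI2 exI[of _ "k + k - (p + q)"]) (auto simp: d_def)
  qed
qed

locale equivariant_pair = F: equivariant \<tau> f + G: equivariant \<tau> g for \<tau> f g
begin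

abbreviation "h \<equiv> moebius_quotient f g"

lemma eventually_good:
  "\<forall>\<^sub>F x in at a. f analytic_on {x} \<and> g analytic_on {x} \<and> f x \<noteq> 0 \<and> g x \<noteq> 0"
  using F.eventually_analytic[of a] G.eventually_analytic[of a] F.nonzero[of a] G.nonzero[of a]
  by eventually_elim simp

lemma h_plus_1: "\<forall>\<^sub>F x in at a. h (x + 1) = h x"
  using eventually_good[of a]
proof eventually_elim
  case (elim x)
  have "(- f x - - g x)\<^sup>2 = (f x - g x)\<^sup>2" by (simp add: power2_commute)
  thus ?case using elim by (simp add: moebius_quotient_def F.plus_1 G.plus_1 F.deriv_plus G.deriv_plus)
qed

lemma h_plus_tau: "\<forall>\<^sub>F x in at a. h (x + \<tau>) = h x"
  using eventually_good[of a]
proof eventually_elim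
  case (elim x)
  have "(inverse (f x) - inverse (g x))\<^sup>2 = (f x - g x)\<^sup>2 / ((f x)\<^sup>2 * (g x)\<^sup>2)"
    using elim by (simp add: field_simps power2_eq_square)
  moreover have "- (deriv f x / (f x)\<^sup>2) * - (deriv g x / (g x)\<^sup>2) = deriv f x * deriv g x / ((f x)\<^sup>2 * (g x)\<^sup>2)"
    by simp
  ultimately show ?case using elim
    by (simp add: moebius_quotient_def F.plus_tau G.plus_tau F.deriv_plus G.deriv_plus)
qed

text \<open>The estimates of \<open>moebius_quotient_ord\<close>, with the values compared on the
  projective line so that they make sense at poles too.\<close>

definition crit_bound :: "complex \<Rightarrow> int \<Rightarrow> bool"
  where "crit_bound a n \<longleftrightarrow> n \<ge> - F.crit a - G.crit a \<and> (proj_lift f a = proj_lift g a \<longrightarrow>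
    n \<ge> 2 - F.crit a - G.crit a \<and> (F.crit a \<ge> 1 \<and> G.crit a \<ge> 1 \<longrightarrow> n \<ge> 4 - F.crit a - G.crit a))"

text \<open>Moebius invariance removes the pole of \<open>g\<close>: with \<open>k = 1 / g\<close>
  the quotient is \<open>- (f * k - 1)^2 / (f' * k')\<close>. Its numerator is -1 at
  \<open>a\<close>, because \<open>k\<close> vanishes there, so only the denominator contributes to
  the order.\<close>

lemma mixed:
  assumes "f analytic_on {a}" "\<not> g analytic_on {a}"
  shows "has_ord h a (- F.crit a - G.crit a)"
proof -
  define k where "k x = g (x + \<tau>)" for x
  have ga: "g analytic_on {a + \<tau>}" "g (a + \<tau>) = 0" using G.not_analytic[OF assms(2)] by auto
  have ka: "k analytic_on {a}" unfolding k_def by (rule analytic_at_shift[OF ga(1)])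
  have "deriv k = (\<lambda>x. deriv g (x + \<tau>))" unfolding k_def deriv_def by (simp add: DERIV_shift)
  hence kd: "has_ord (deriv k) a (G.crit a)"
    using has_ord_shift[OF G.has_ord_deriv_crit(1)[OF ga(1)]] by (simp add: G.crit_plus_tau)
  have an: "(\<lambda>x. - (f x * k x - 1)\<^sup>2) analytic_on {a}" using assms(1) ka by (intro analytic_intros)
  have "has_ord (\<lambda>x. - (f x * k x - 1)\<^sup>2) a 0"
    by (rule has_ord_0[OF an]) (simp add: k_def ga(2))
  from has_ord_divide[OF this has_ord_mult[OF F.has_ord_deriv_crit(1)[OF assms(1)] kd]]
  have o: "has_ord (\<lambda>x. - (f x * k x - 1)\<^sup>2 / (deriv f x * deriv k x)) a (- F.crit a - G.crit a)" by simp
  have "\<forall>\<^sub>F x in at a. h x = - (f x * k x - 1)\<^sup>2 / (deriv f x * deriv k x)"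
    using eventually_good[of a] eventually_at_imp_nhds[OF eventually_nhds_imp_at[OF analytic_at_eventually_analytic[OF ka]]]
  proof eventually_elim
    case (elim x)
    have kx: "k x = inverse (g x)" by (simp add: k_def G.plus_tau)
    have "deriv k x = deriv g (x + \<tau>)" unfolding k_def deriv_def by (simp add: DERIV_shift)
    also have "\<dots> = - (deriv g x / (g x)\<^sup>2)" using elim by (simp add: G.deriv_plus)
    finally have dk: "deriv k x = - (deriv g x / (g x)\<^sup>2)" .
    have "(f x * k x - 1)\<^sup>2 = (f x - g x)\<^sup>2 / (g x)\<^sup>2"
      using elim(1) by (simp add: kx field_simps power2_eq_square)
    thus ?case using elim(1) by (simp add: moebius_quotient_def dk)
  qed
  from has_ord_cong[OF o this] show ?thesis .
qed

end

lemma moebius_quotient_commute: "moebius_quotient f g = moebius_quotient g f"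
  by (auto simp: moebius_quotient_def fun_eq_iff power2_commute mult.commute)

context equivariant_pair
begin

lemma h_ord: "(\<forall>\<^sub>F x in at a. h x = 0) \<or> (\<exists>n. has_ord h a n \<and> crit_bound a n)"
proof -
  have both: "(\<forall>\<^sub>F x in at a. h x = 0) \<or> (\<exists>n. has_ord h a n \<and> crit_bound a n)"
    if "f analytic_on {a}" "g analytic_on {a}" for a
    using moebius_quotient_ord[OF that F.has_ord_deriv_crit(1)[OF that(1)] G.has_ord_deriv_crit(1)[OF that(2)]] that
    by (simp add: crit_bound_def proj_lift_def)
  consider "f analytic_on {a}" "g analytic_on {a}" | "f analytic_on {a}" "\<not> g analytic_on {a}"
    | "\<not> f analytic_on {a}" "g analytic_on {a}" | "\<not> f analytic_on {a}" "\<not> g analytic_on {a}" by blast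
  thus ?thesis
  proof cases
    case 1 thus ?thesis by (rule both)
  next
    case 2
    have "crit_bound a (- F.crit a - G.crit a)" using 2 by (simp add: crit_bound_def proj_lift_def)
    thus ?thesis using mixed[OF 2] by blast
  next
    case 3
    interpret S: equivariant_pair \<tau> g f ..
    have "crit_bound a (- F.crit a - G.crit a)" using 3 by (simp add: crit_bound_def proj_lift_def)
    moreover have "- G.crit a - F.crit a = - F.crit a - G.crit a" by simp
    with S.mixed[OF 3(2,1)] have "has_ord h a (- F.crit a - G.crit a)"
      unfolding moebius_quotient_commute[of g f] by metis
    ultimately show ?thesis by blast
  next
    case 4
    \<comment> \<open>Common poles are moved by \<open>\<tau>\<close> to common zeros, where the
      finite case applies; the quotient and the bounds are invariant under this translation.\<close>
    have eq: "proj_lift f (a + \<tau>) = proj_lift g (a + \<tau>)" "proj_lift f a = proj_lift g a"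
      using F.not_analytic[OF 4(1)] G.not_analytic[OF 4(2)] 4 by (auto simp: proj_lift_def)
    have c: "crit_bound (a + \<tau>) n = crit_bound a n" for n
      using eq by (simp add: crit_bound_def F.crit_plus_tau G.crit_plus_tau)
    have sym: "\<forall>\<^sub>F x in at a. h x = h (x + \<tau>)" using h_plus_tau[of a] by eventually_elim simp
    from both[OF F.not_analytic(1)[OF 4(1)] G.not_analytic(1)[OF 4(2)]]
    show ?thesis
    proof
      assume "\<forall>\<^sub>F x in at (a + \<tau>). h x = 0"
      from eventually_at_shift[OF this] sym have "\<forall>\<^sub>F x in at a. h x = 0" by eventually_elim simp
      thus ?thesis ..
    next
      assume "\<exists>n. has_ord h (a + \<tau>) n \<and> crit_bound (a + \<tau>) n"
      then obtain n where "has_ord h (a + \<tau>) n" "crit_bound a n" using c by blast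
      from has_ord_cong[OF has_ord_shift[OF this(1)] sym] this(2) show ?thesis by blast
    qed
  qed
qed

text \<open>If \<open>g\<close> had a pole at \<open>y\<close>, then
  \<open>f x * g (x + \<tau>)\<close> would tend to 0 there, since the second factor vanishes at
  \<open>y\<close>; but it equals 1 nearby.\<close>

lemma analytic_transfer:
  assumes "\<And>a. \<forall>\<^sub>F x in at a. f x = g x" "f analytic_on {y}"
  shows "g analytic_on {y}"
proof (rule ccontr)
  assume n: "\<not> g analytic_on {y}"
  have ga: "g analytic_on {y + \<tau>}" "g (y + \<tau>) = 0" using G.not_analytic[OF n] by auto
  from analytic_at_shift[OF ga(1)] have "isCont (\<lambda>x. g (x + \<tau>)) y" by (rule analytic_at_imp_isCont)
  moreover have "isCont f y" using assms(2) by (rule analytic_at_imp_isCont)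
  ultimately have "isCont (\<lambda>x. f x * g (x + \<tau>)) y" by (intro continuous_intros)
  hence "((\<lambda>x. f x * g (x + \<tau>)) \<longlongrightarrow> 0) (at y)" using ga(2) by (simp add: isCont_def)
  moreover have "\<forall>\<^sub>F x in at y. f x * g (x + \<tau>) = 1"
    using assms(1)[of y] G.nonzero[of y] by eventually_elim (simp add: G.plus_tau)
  hence "((\<lambda>x. f x * g (x + \<tau>)) \<longlongrightarrow> 1) (at y)" by (rule tendsto_eventually)
  ultimately show False using tendsto_unique[OF at_neq_bot] by fastforce
qed

end

text \<open>The two functions have the same poles by \<open>analytic_transfer\<close>. There both
  carry the default value 0, and elsewhere continuity decides.\<close>

lemma (in equivariant_pair) eventually_eq_imp_eq:
  assumes ev: "\<And>a. \<forall>\<^sub>F x in at a. f x = g x"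
  shows "f = g"
proof
  fix x
  interpret S: equivariant_pair \<tau> g f ..
  have ev': "\<forall>\<^sub>F x in at a. g x = f x" for a using ev[of a] by eventually_elim simp
  show "f x = g x"
  proof (cases "f analytic_on {x}")
    case True
    hence "g analytic_on {x}" by (rule analytic_transfer[OF ev])
    hence "(f \<longlongrightarrow> f x) (at x)" "(g \<longlongrightarrow> g x) (at x)"
      using True analytic_at_imp_isCont by (auto simp: isCont_def)
    thus ?thesis using tendsto_unique[OF at_neq_bot] tendsto_cong[OF ev[of x]] by blast
  next
    case False
    hence "\<not> g analytic_on {x}" using S.analytic_transfer[OF ev'] by blast
    thus ?thesis using False F.not_analytic(3) G.not_analytic(3) by simp
  qed
qed

lemma (in equivariant_pair) eq_of_single_critical_classes:
  assumes fa: "\<And>x. F.crit x = (if x - a \<in> lattice \<tau> then 1 else 0)"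
    and gb: "\<And>x. G.crit x = (if x - b \<in> lattice \<tau> then 1 else 0)"
    and eq: "proj_lift f a = proj_lift g a"
  shows "f = g"
proof -
  let ?p = "torus_proj \<tau>"
  have eql: "proj_lift f x = proj_lift g x" if l: "x - a \<in> lattice \<tau>" for x
  proof -
    obtain m n where "x - a = of_int m + of_int n * \<tau>" using l unfolding lattice_iff by blast
    hence "x = a + of_int m + of_int n * \<tau>" by (simp add: algebra_simps)
    thus ?thesis using F.lift_plus[of a m n] G.lift_plus[of a m n] eq by simp
  qed
  \<comment> \<open>In the class of \<open>a\<close> the values agree, so the order is at least 2 -
    1 = 1 if \<open>b\<close> lies in another class and at least 4 - 2 = 2 if it does not. In the
    class of \<open>b\<close>, when different, the bound is -1.\<close>
  have bound: "n \<ge> (if x - a \<in> lattice \<tau> then 1 else if x - b \<in> lattice \<tau> then -1 else 0)"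
    if "crit_bound x n" for x n
    using that eql[of x] fa[of x] gb[of x] unfolding crit_bound_def by (auto split: if_splits)
  have locreg: "\<exists>k. k analytic_on {x} \<and> (\<forall>\<^sub>F y in at x. h y = k y) \<and> (x - a \<in> lattice \<tau> \<longrightarrow> k x = 0)"
    if "x - b \<notin> lattice \<tau> \<or> x - a \<in> lattice \<tau>" for x
  proof -
    from h_ord[of x] show ?thesis
    proof
      assume "\<forall>\<^sub>F y in at x. h y = 0"
      thus ?thesis by (intro exI[of _ "\<lambda>_. 0"]) auto
    next
      assume "\<exists>n. has_ord h x n \<and> crit_bound x n"
      then obtain n where n: "has_ord h x n" "crit_bound x n" by blast
      from bound[OF n(2)] that have "n \<ge> 0" "x - a \<in> lattice \<tau> \<longrightarrow> n > 0" by (auto split: if_splits)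
      with has_ord_ge_0_analytic[OF n(1)] show ?thesis by blast
    qed
  qed
  have polar: "\<exists>k r. k analytic_on {b} \<and> (\<forall>\<^sub>F y in at b. h y = k y + r / (y - b))"
  proof -
    from h_ord[of b] show ?thesis
    proof
      assume "\<forall>\<^sub>F y in at b. h y = 0"
      thus ?thesis by (intro exI[of _ "\<lambda>_. 0"] exI[of _ 0]) auto
    next
      assume "\<exists>n. has_ord h b n \<and> crit_bound b n"
      then obtain n where n: "has_ord h b n" "crit_bound b n" by blast
      from bound[OF n(2)] have "n \<ge> - 1" by (auto split: if_splits)
      hence "n = - 1 \<or> n \<ge> 0" by linarith
      thus ?thesis
      proof
        assume "n = - 1" thus ?thesis using has_ord_minus_1_pole n(1) by blast
      next
        assume "n \<ge> 0"
        with has_ord_ge_0_analytic[OF n(1)] obtain k where "k analytic_on {b}" "\<forall>\<^sub>F y in at b. h y = k y" by blast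
        thus ?thesis by (intro exI[of _ k] exI[of _ 0]) auto
      qed
    qed
  qed
  then obtain k r where k: "k analytic_on {b}" "\<forall>\<^sub>F y in at b. h y = k y + r / (y - b)" by blast
  have polar': "\<exists>k. k analytic_on {x} \<and> (\<forall>\<^sub>F y in at x. h y = k y + r / (y - x))"
    if l: "x - b \<in> lattice \<tau>" for x
  proof (intro exI[of _ "\<lambda>y. k (y + (b - x))"] conjI)
    show "(\<lambda>y. k (y + (b - x))) analytic_on {x}" by (rule analytic_at_shift) (use k(1) in simp)
    have "\<forall>\<^sub>F y in at x. h (y + (b - x)) = k (y + (b - x)) + r / (y + (b - x) - b)"
      by (rule eventually_at_shift) (use k(2) in simp)
    moreover have "\<forall>\<^sub>F y in at x. h (y + (b - x)) = h y"
      by (rule eventually_periodic_lattice[OF h_plus_1 h_plus_tau])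
         (use lattice_minus[OF l] in simp)
    ultimately show "\<forall>\<^sub>F y in at x. h y = k (y + (b - x)) + r / (y - x)"
      by eventually_elim simp
  qed
  have hC: "\<exists>C. \<forall>a. \<forall>\<^sub>F x in at a. h x = C"
  proof -
    \<comment> \<open>The only possible residue is \<open>r\<close>, in the class of
      \<open>b\<close>. If \<open>a\<close> lies in the same class, the quotient is regular there
      and the residue is 0.\<close>
    define R where "R q = (if q = ?p b \<and> ?p a \<noteq> ?p b then r else 0)" for q
    have loc: "\<exists>g. g analytic_on {x} \<and> (\<forall>\<^sub>F y in at x. h y = g y + R (?p x) / (y - x))" for x
    proof (cases "x - b \<notin> lattice \<tau> \<or> x - a \<in> lattice \<tau>")
      case True
      have "R (?p x) = 0"
      proof (cases "x - b \<in> lattice \<tau>")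
        case False thus ?thesis by (simp add: R_def torus_proj_eq_iff)
      next
        case b: True
        hence "?p x = ?p b" "?p x = ?p a" using True by (auto simp: torus_proj_eq_iff)
        thus ?thesis by (simp add: R_def)
      qed
      thus ?thesis using locreg[OF True] by auto
    next
      case False
      hence "?p x = ?p b" "?p x \<noteq> ?p a" by (auto simp: torus_proj_eq_iff)
      hence "R (?p x) = r" by (simp add: R_def)
      thus ?thesis using polar'[of x] False by auto
    qed
    have sub: "{q \<in> range ?p. R q \<noteq> 0} \<subseteq> {?p b}" by (auto simp: R_def)
    have fin: "finite {q \<in> range ?p. R q \<noteq> 0}" by (rule finite_subset[OF sub]) simp
    have s: "(\<Sum>q | q \<in> range ?p \<and> R q \<noteq> 0. R q) = 0"
      by (rule residue_sum_zero[OF F.im_pos loc h_plus_1 h_plus_tau fin])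
    have "R (?p b) = 0"
    proof (rule ccontr)
      assume "R (?p b) \<noteq> 0"
      hence "{q. q \<in> range ?p \<and> R q \<noteq> 0} = {?p b}" using sub by auto
      thus False using s \<open>R (?p b) \<noteq> 0\<close> by simp
    qed
    hence R0: "R q = 0" for q by (cases "q = ?p b") (auto simp only: R_def if_False HOL.simp_thms)
    have "(0::complex) = 0 \<and> (\<exists>C. \<forall>a. \<forall>\<^sub>F x in at a. h x = C)"
      by (rule elliptic_constant[OF F.im_pos, where c = 0]) (use loc R0 h_plus_1 h_plus_tau in auto)
    thus ?thesis by blast
  qed
  then obtain C where C: "\<And>a. \<forall>\<^sub>F x in at a. h x = C" by blast
  obtain k0 where k0: "k0 analytic_on {a}" "\<forall>\<^sub>F y in at a. h y = k0 y" "k0 a = 0"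
    using locreg[of a] lattice_0 by auto
  have "(k0 \<longlongrightarrow> 0) (at a)" using analytic_at_imp_isCont[OF k0(1)] k0(3) by (simp add: isCont_def)
  moreover have "\<forall>\<^sub>F y in at a. k0 y = C" using k0(2) C[of a] by eventually_elim simp
  hence "(k0 \<longlongrightarrow> C) (at a)" by (rule tendsto_eventually)
  ultimately have "C = 0" using tendsto_unique[OF at_neq_bot] by blast
  \<comment> \<open>A vanishing quotient means \<open>f = g\<close> wherever the denominator is
    nonzero, which is the case off isolated points.\<close>
  have "\<forall>\<^sub>F x in at y. f x = g x" for y
  proof -
    have nz: "\<forall>\<^sub>F x in at y. deriv f x \<noteq> 0" if "equivariant \<tau> f" for f
    proof -
      interpret E: equivariant \<tau> f by fact
      show ?thesis
      proof (cases "f analytic_on {y}")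
        case True from has_ord_nonzero[OF E.has_ord_deriv_crit(1)[OF True]] show ?thesis .
      next
        case False
        from eventually_at_shift[OF has_ord_nonzero[OF E.has_ord_deriv_crit(1)[OF E.not_analytic(1)[OF False]]]]
        have "\<forall>\<^sub>F x in at y. deriv f (x + \<tau>) \<noteq> 0" .
        thus ?thesis using E.eventually_analytic[of y] E.nonzero[of y]
          by eventually_elim (auto simp: E.deriv_plus)
      qed
    qed
    show ?thesis
      using C[of y] nz[OF F.equivariant_axioms] nz[OF G.equivariant_axioms]
      by eventually_elim (auto simp: moebius_quotient_def \<open>C = 0\<close>)
  qed
  thus ?thesis by (rule eventually_eq_imp_eq)
qed

lemma equivariant_single_critical_class:
  assumes "equivariant \<tau> f" "\<And>x. equivariant.crit \<tau> f x = (if x - a \<in> lattice \<tau> then 1 else 0)"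
  shows "\<exists>p. f = (\<lambda>x. jac \<tau> (x + p))"
proof -
  interpret F: equivariant \<tau> f by fact
  have \<tau>: "Im \<tau> > 0" by (rule F.im_pos)
  obtain y where y: "proj_lift (jac \<tau>) y = proj_lift f a" using jac_surj[OF \<tau>] by blast
  define p where "p = y - a"
  define g where "g x = jac \<tau> (x + p)" for x
  interpret G: equivariant \<tau> g
    unfolding g_def by (rule equivariant.translate[OF jac_equivariant[OF \<tau>]])
  interpret equivariant_pair \<tau> f g ..
  have "f = g"
  proof (rule eq_of_single_critical_classes)
    show "F.crit x = (if x - a \<in> lattice \<tau> then 1 else 0)" for x by (rule assms(2))
    show "G.crit x = (if x - (- p) \<in> lattice \<tau> then 1 else 0)" for x
      using crit_translate[OF jac_equivariant[OF \<tau>], of p x] jac_crit[OF \<tau>, of "x + p"]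
      by (simp add: g_def[abs_def])
    show "proj_lift f a = proj_lift g a"
      using y by (simp add: g_def[abs_def] proj_lift_translate p_def)
  qed
  hence "f = (\<lambda>x. jac \<tau> (x + p))" by (simp add: g_def fun_eq_iff)
  thus ?thesis by blast
qed

section \<open>Uniformizations of complex manifolds\<close>

definition cdiff_at :: "('a::complex_space \<Rightarrow> 'b::complex_space) \<Rightarrow> 'a \<Rightarrow> bool"
  where "cdiff_at f x \<longleftrightarrow> (\<exists>D. (f has_derivative D) (at x) \<and> (\<forall>c v. D (c *\<^sub>C v) = c *\<^sub>C D v))"

lemma cholomorphic_on_iff: "cholomorphic_on f W \<longleftrightarrow> (\<forall>x\<in>W. cdiff_at f x)"
  by (simp add: cholomorphic_on_def cdiff_at_def)

lemma cholomorphic_on_subset: "cholomorphic_on f W \<Longrightarrow> V \<subseteq> W \<Longrightarrow> cholomorphic_on f V"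
  unfolding cholomorphic_on_iff by blast

lemma cdiff_atI:
  "(f has_derivative D) (at x) \<Longrightarrow> (\<And>c v. D (c *\<^sub>C v) = c *\<^sub>C D v) \<Longrightarrow> cdiff_at f x"
  unfolding cdiff_at_def by blast

lemma cdiff_at_isCont: "cdiff_at f x \<Longrightarrow> isCont f x"
  unfolding cdiff_at_def using has_derivative_continuous by blast

lemma cholomorphic_on_continuous: "cholomorphic_on f W \<Longrightarrow> continuous_on W f"
  unfolding cholomorphic_on_iff using cdiff_at_isCont continuous_at_imp_continuous_on by blast

lemma cdiff_at_compose:
  assumes "cdiff_at g x" "cdiff_at f (g x)"
  shows "cdiff_at (\<lambda>x. f (g x)) x"
proof -
  obtain D where D: "(g has_derivative D) (at x)" "\<And>c v. D (c *\<^sub>C v) = c *\<^sub>C D v"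
    using assms(1) unfolding cdiff_at_def by blast
  obtain D' where D': "(f has_derivative D') (at (g x))" "\<And>c v. D' (c *\<^sub>C v) = c *\<^sub>C D' v"
    using assms(2) unfolding cdiff_at_def by blast
  show ?thesis
    by (rule cdiff_atI[OF has_derivative_compose[OF D(1) D'(1)]]) (simp add: D(2) D'(2))
qed

lemma cdiff_at_cong:
  assumes "\<forall>\<^sub>F y in nhds x. f y = g y" "cdiff_at f x"
  shows "cdiff_at g x"
proof -
  obtain D where D: "(f has_derivative D) (at x)" "\<And>c v. D (c *\<^sub>C v) = c *\<^sub>C D v"
    using assms(2) unfolding cdiff_at_def by blast
  obtain S where S: "open S" "x \<in> S" "\<And>y. y \<in> S \<Longrightarrow> f y = g y"
    using assms(1) unfolding eventually_nhds by blast
  have "(g has_derivative D) (at x)"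
    by (rule has_derivative_transform_within_open[OF D(1) S(1,2)]) (rule S(3))
  thus ?thesis by (rule cdiff_atI) (rule D(2))
qed

lemma cdiff_at_cong_open:
  assumes "cdiff_at f x" "open S" "x \<in> S" "\<And>y. y \<in> S \<Longrightarrow> f y = g y"
  shows "cdiff_at g x"
  using cdiff_at_cong[OF _ assms(1), of g] assms(2-4) eventually_nhds by blast

lemma cdiff_at_ident: "cdiff_at (\<lambda>x. x) x"
  by (rule cdiff_atI[OF has_derivative_ident]) simp

lemma cdiff_at_id: "cdiff_at id x"
  unfolding id_def by (rule cdiff_at_ident)

lemma scaleC_zero: "c *\<^sub>C (0 :: 'a::complex_space) = 0"
  using scaleC_add_right[of c "0::'a" 0] by simp

lemma cdiff_at_const: "cdiff_at (\<lambda>x. c) x"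
  by (rule cdiff_atI[OF has_derivative_const]) (simp add: scaleC_zero)

lemma cdiff_at_Pair:
  assumes "cdiff_at f x" "cdiff_at g x"
  shows "cdiff_at (\<lambda>x. (f x, g x)) x"
proof -
  obtain D where D: "(f has_derivative D) (at x)" "\<And>c v. D (c *\<^sub>C v) = c *\<^sub>C D v"
    using assms(1) unfolding cdiff_at_def by blast
  obtain D' where D': "(g has_derivative D') (at x)" "\<And>c v. D' (c *\<^sub>C v) = c *\<^sub>C D' v"
    using assms(2) unfolding cdiff_at_def by blast
  show ?thesis
    by (rule cdiff_atI[OF has_derivative_Pair[OF D(1) D'(1)]]) (simp add: D(2) D'(2) scaleC_prod_def)
qed

lemma cdiff_at_fst: "cdiff_at fst x" and cdiff_at_snd: "cdiff_at snd x"
  by (rule cdiff_atI[OF has_derivative_fst[OF has_derivative_ident]], simp add: scaleC_prod_def)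
     (rule cdiff_atI[OF has_derivative_snd[OF has_derivative_ident]], simp add: scaleC_prod_def)

lemma cdiff_at_add: "cdiff_at f x \<Longrightarrow> cdiff_at g x \<Longrightarrow> cdiff_at (\<lambda>x. f x + g x) x"
proof -
  assume "cdiff_at f x" "cdiff_at g x"
  then obtain D D' where D: "(f has_derivative D) (at x)" "\<And>c v. D (c *\<^sub>C v) = c *\<^sub>C D v"
    and D': "(g has_derivative D') (at x)" "\<And>c v. D' (c *\<^sub>C v) = c *\<^sub>C D' v"
    unfolding cdiff_at_def by blast
  show ?thesis
    by (rule cdiff_atI[OF has_derivative_add[OF D(1) D'(1)]]) (simp add: D(2) D'(2) scaleC_add_right)
qed

lemma cdiff_at_complex_iff:
  fixes f :: "complex \<Rightarrow> complex"
  shows "cdiff_at f x \<longleftrightarrow> f field_differentiable (at x)"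
proof
  assume "cdiff_at f x"
  then obtain D where D: "(f has_derivative D) (at x)" "\<And>c v. D (c * v) = c * D v"
    unfolding cdiff_at_def scaleC_complex_def by blast
  have "D z = D 1 * z" for z using D(2)[of z 1] by (simp add: mult.commute)
  hence "D = (*) (D 1)" by (rule ext)
  hence "(f has_field_derivative D 1) (at x)" using D(1) by (simp add: has_field_derivative_def)
  thus "f field_differentiable (at x)" unfolding field_differentiable_def by blast
next
  assume "f field_differentiable (at x)"
  then obtain d where "(f has_derivative (*) d) (at x)"
    unfolding field_differentiable_def has_field_derivative_def by blast
  thus "cdiff_at f x" by (rule cdiff_atI) (simp add: scaleC_complex_def)
qed

lemma cdiff_at_analytic: "f analytic_on {x} \<Longrightarrow> cdiff_at f x"
  using cdiff_at_complex_iff analytic_on_imp_differentiable_at by blast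

lemma cdiff_at_cmult:
  fixes f :: "'a::complex_space \<Rightarrow> complex"
  assumes "cdiff_at f x"
  shows "cdiff_at (\<lambda>x. c * f x) x"
  by (rule cdiff_at_compose[OF assms, where f = "\<lambda>z. c * z"])
     (simp add: cdiff_at_complex_iff field_differentiable_def, auto intro!: derivative_eq_intros exI)

lemma cdiff_at_diff:
  fixes f g :: "'a::complex_space \<Rightarrow> complex"
  assumes "cdiff_at f x" "cdiff_at g x"
  shows "cdiff_at (\<lambda>x. f x - g x) x"
  using cdiff_at_add[OF assms(1) cdiff_at_cmult[OF assms(2), of "- 1"]] by simp

lemmas cdiff_intros = cdiff_at_ident cdiff_at_const cdiff_at_Pair cdiff_at_fst cdiff_at_snd
  cdiff_at_add cdiff_at_cmult cdiff_at_diff cdiff_at_compose[OF _ cdiff_at_fst] cdiff_at_compose[OF _ cdiff_at_snd]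

text \<open>
  A surjective local biholomorphism from the coordinate space allows holomorphy of maps between
  manifolds to be tested on local lifts, without reference to the charts.
\<close>

definition uniformizes :: "('p, 'e::complex_space) atlas \<Rightarrow> ('e \<Rightarrow> 'p) \<Rightarrow> 'e set \<Rightarrow> bool"
  where "uniformizes M E D \<longleftrightarrow> open D \<and> E ` D = points M \<and>
    (\<forall>(U, f)\<in>M. inj_on f U \<and> open (D \<inter> E -` U) \<and> cholomorphic_on (\<lambda>x. f (E x)) (D \<inter> E -` U) \<and>
      (\<forall>a\<in>D \<inter> E -` U. \<exists>B k. open B \<and> a \<in> B \<and> B \<subseteq> D \<inter> E -` U \<and> open ((\<lambda>x. f (E x)) ` B) \<and>
         cholomorphic_on k ((\<lambda>x. f (E x)) ` B) \<and> (\<forall>x\<in>B. k (f (E x)) = x)))"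

context
  fixes M :: "('p, 'e::complex_space) atlas" and E D
  assumes uni: "uniformizes M E D"
begin

lemma uniformizes_basic:
  "open D" "E ` D = points M" "\<And>U f. (U, f) \<in> M \<Longrightarrow> inj_on f U"
  "\<And>U f. (U, f) \<in> M \<Longrightarrow> open (D \<inter> E -` U)"
  "\<And>U f x. (U, f) \<in> M \<Longrightarrow> x \<in> D \<Longrightarrow> E x \<in> U \<Longrightarrow> cdiff_at (\<lambda>x. f (E x)) x"
proof -
  show "open D" "E ` D = points M" using uni unfolding uniformizes_def by simp_all
  fix U f assume U: "(U, f) \<in> M"
  from uni have "\<forall>(U, f)\<in>M. inj_on f U \<and> open (D \<inter> E -` U) \<and> cholomorphic_on (\<lambda>x. f (E x)) (D \<inter> E -` U)"
    unfolding uniformizes_def by force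
  from bspec[OF this U] show "inj_on f U" "open (D \<inter> E -` U)"
    "\<And>x. x \<in> D \<Longrightarrow> E x \<in> U \<Longrightarrow> cdiff_at (\<lambda>x. f (E x)) x"
    by (simp_all add: cholomorphic_on_iff)
qed

lemma uniformizes_local_inverse:
  assumes "(U, f) \<in> M" "a \<in> D" "E a \<in> U"
  obtains B k where "open B" "a \<in> B" "B \<subseteq> D \<inter> E -` U" "open ((\<lambda>x. f (E x)) ` B)"
    "cholomorphic_on k ((\<lambda>x. f (E x)) ` B)" "\<And>x. x \<in> B \<Longrightarrow> k (f (E x)) = x"
proof -
  from uni have "\<forall>(U, f)\<in>M. \<forall>a\<in>D \<inter> E -` U. \<exists>B k. open B \<and> a \<in> B \<and> B \<subseteq> D \<inter> E -` U \<and> open ((\<lambda>x. f (E x)) ` B) \<and>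
         cholomorphic_on k ((\<lambda>x. f (E x)) ` B) \<and> (\<forall>x\<in>B. k (f (E x)) = x)"
    unfolding uniformizes_def by force
  from bspec[OF this assms(1)] assms(2,3) have "\<exists>B k. open B \<and> a \<in> B \<and> B \<subseteq> D \<inter> E -` U \<and> open ((\<lambda>x. f (E x)) ` B) \<and>
         cholomorphic_on k ((\<lambda>x. f (E x)) ` B) \<and> (\<forall>x\<in>B. k (f (E x)) = x)" by simp
  thus ?thesis using that by blast
qed

lemma uniformizes_chart:
  assumes "a \<in> D"
  obtains U f where "(U, f) \<in> M" "E a \<in> U"
proof -
  have "E a \<in> points M" using uniformizes_basic(2) assms by blast
  thus ?thesis using that unfolding points_def by auto
qed

text \<open>Near each of its points the image contains the preimage of \<open>W\<close> under a
  continuous local inverse.\<close>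

lemma uniformizes_chart_image_open:
  assumes "(U, f) \<in> M" "open W" "W \<subseteq> D \<inter> E -` U"
  shows "open ((\<lambda>x. f (E x)) ` W)"
proof (rule topological_space_class.openI)
  fix y assume "y \<in> (\<lambda>x. f (E x)) ` W"
  then obtain a where a: "a \<in> W" "y = f (E a)" by blast
  obtain B k where B: "open B" "a \<in> B" "B \<subseteq> D \<inter> E -` U" "open ((\<lambda>x. f (E x)) ` B)"
    "cholomorphic_on k ((\<lambda>x. f (E x)) ` B)" "\<And>x. x \<in> B \<Longrightarrow> k (f (E x)) = x"
    using uniformizes_local_inverse[OF assms(1), of a] a(1) assms(3) by blast
  let ?T = "(\<lambda>x. f (E x)) ` B"
  have "open (?T \<inter> k -` W)"
    using continuous_open_preimage[OF cholomorphic_on_continuous[OF B(5)] B(4) assms(2)] .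
  moreover have "y \<in> ?T \<inter> k -` W" using a B by auto
  moreover have "?T \<inter> k -` W \<subseteq> (\<lambda>x. f (E x)) ` W" using B(6) by auto
  ultimately show "\<exists>T. open T \<and> y \<in> T \<and> T \<subseteq> (\<lambda>x. f (E x)) ` W" by blast
qed

text \<open>The topology recovered from the atlas is the quotient topology of \<open>E\<close>, so
  openness can be checked in the coordinate space.\<close>

lemma uniformizes_openin: "openin (mtop M) W \<longleftrightarrow> W \<subseteq> points M \<and> open (D \<inter> E -` W)"
proof -
  have op: "openin (mtop M) W \<longleftrightarrow> W \<subseteq> points M \<and> (\<forall>(U, f)\<in>M. open (f ` (W \<inter> U)))"
    by (rule openin_mtop) (rule uniformizes_basic(3))
  show ?thesis
  proof
    assume "openin (mtop M) W"
    hence W: "W \<subseteq> points M" "\<And>U f. (U, f) \<in> M \<Longrightarrow> open (f ` (W \<inter> U))" using op by auto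
    have "open (D \<inter> E -` W)"
    proof (rule topological_space_class.openI)
      fix a assume a: "a \<in> D \<inter> E -` W"
      obtain U f where U: "(U, f) \<in> M" "E a \<in> U" using uniformizes_chart a by blast
      have "continuous_on (D \<inter> E -` U) (\<lambda>x. f (E x))"
        by (rule cholomorphic_on_continuous) (use uniformizes_basic(5)[OF U(1)] in \<open>auto simp: cholomorphic_on_iff\<close>)
      from continuous_open_preimage[OF this uniformizes_basic(4)[OF U(1)] W(2)[OF U(1)]]
      have "open (D \<inter> E -` U \<inter> (\<lambda>x. f (E x)) -` f ` (W \<inter> U))" .
      moreover have "a \<in> D \<inter> E -` U \<inter> (\<lambda>x. f (E x)) -` f ` (W \<inter> U)" using a U by auto
      moreover have "D \<inter> E -` U \<inter> (\<lambda>x. f (E x)) -` f ` (W \<inter> U) \<subseteq> D \<inter> E -` W"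
        using uniformizes_basic(3)[OF U(1)] by (auto simp: inj_on_def)
      ultimately show "\<exists>T. open T \<and> a \<in> T \<and> T \<subseteq> D \<inter> E -` W" by blast
    qed
    thus "W \<subseteq> points M \<and> open (D \<inter> E -` W)" using W by blast
  next
    assume W: "W \<subseteq> points M \<and> open (D \<inter> E -` W)"
    have "open (f ` (W \<inter> U))" if U: "(U, f) \<in> M" for U f
    proof -
      have "open ((\<lambda>x. f (E x)) ` (D \<inter> E -` W \<inter> (D \<inter> E -` U)))"
        by (rule uniformizes_chart_image_open[OF U]) (use W uniformizes_basic(4)[OF U] in auto)
      moreover have "(\<lambda>x. f (E x)) ` (D \<inter> E -` W \<inter> (D \<inter> E -` U)) = f ` (W \<inter> U)"
      proof
        show "f ` (W \<inter> U) \<subseteq> (\<lambda>x. f (E x)) ` (D \<inter> E -` W \<inter> (D \<inter> E -` U))"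
        proof
          fix y assume "y \<in> f ` (W \<inter> U)"
          then obtain p where p: "p \<in> W" "p \<in> U" "y = f p" by blast
          then obtain x where "x \<in> D" "p = E x" using W uniformizes_basic(2) by blast
          thus "y \<in> (\<lambda>x. f (E x)) ` (D \<inter> E -` W \<inter> (D \<inter> E -` U))" using p by auto
        qed
      qed auto
      ultimately show ?thesis by simp
    qed
    thus "openin (mtop M) W" using op W by blast
  qed
qed

lemma uniformizes_topspace: "topspace (mtop M) = points M"
proof -
  have "openin (mtop M) (points M)"
    unfolding uniformizes_openin using uniformizes_basic(1,2)
    by (metis Int_absorb2 image_subset_iff_subset_vimage order_refl)
  moreover have "topspace (mtop M) \<subseteq> points M"
    using openin_topspace[of "mtop M"] unfolding uniformizes_openin by blast
  ultimately show ?thesis using openin_subset by blast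
qed

lemma uniformizes_open_map:
  assumes "open W" "W \<subseteq> D"
  shows "openin (mtop M) (E ` W)"
proof -
  have op: "openin (mtop M) (E ` W) \<longleftrightarrow> E ` W \<subseteq> points M \<and> (\<forall>(U, f)\<in>M. open (f ` (E ` W \<inter> U)))"
    by (rule openin_mtop) (rule uniformizes_basic(3))
  have "open (f ` (E ` W \<inter> U))" if U: "(U, f) \<in> M" for U f
  proof -
    have "open ((\<lambda>x. f (E x)) ` (W \<inter> (D \<inter> E -` U)))"
      by (rule uniformizes_chart_image_open[OF U]) (use assms uniformizes_basic(4)[OF U] in auto)
    moreover have "(\<lambda>x. f (E x)) ` (W \<inter> (D \<inter> E -` U)) = f ` (E ` W \<inter> U)" using assms(2) by auto
    ultimately show ?thesis by simp
  qed
  thus ?thesis using op assms(2) uniformizes_basic(2) by blast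
qed

lemma uniformizes_locally_inj:
  assumes "a \<in> D"
  obtains B where "open B" "a \<in> B" "B \<subseteq> D" "inj_on E B"
proof -
  obtain U f where U: "(U, f) \<in> M" "E a \<in> U" using uniformizes_chart assms by blast
  obtain B k where B: "open B" "a \<in> B" "B \<subseteq> D \<inter> E -` U" "open ((\<lambda>x. f (E x)) ` B)"
    "cholomorphic_on k ((\<lambda>x. f (E x)) ` B)" "\<And>x. x \<in> B \<Longrightarrow> k (f (E x)) = x"
    using uniformizes_local_inverse[OF U(1) assms U(2)] by blast
  show ?thesis by (rule that[of B]) (use B in \<open>auto intro: inj_on_inverseI[of _ "\<lambda>p. k (f p)"]\<close>)
qed

lemma uniformizes_restrict:
  assumes "open W" "W \<subseteq> D"
  shows "uniformizes (restrict_atlas M (E ` W)) E W"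
  unfolding uniformizes_def
proof (intro conjI ballI)
  have "points (restrict_atlas M (E ` W)) = points M \<inter> E ` W"
    unfolding points_def restrict_atlas_def by force
  thus "E ` W = points (restrict_atlas M (E ` W))"
    using assms(2) uniformizes_basic(2) by auto
  fix X assume "X \<in> restrict_atlas M (E ` W)"
  then obtain U f where X: "X = (U \<inter> E ` W, f)" and U: "(U, f) \<in> M" unfolding restrict_atlas_def by auto
  have W: "W \<inter> E -` (U \<inter> E ` W) = W \<inter> (D \<inter> E -` U)" using assms(2) by auto
  have oW: "open (W \<inter> (D \<inter> E -` U))" using assms(1) uniformizes_basic(4)[OF U] by blast
  have loc: "\<exists>B k. open B \<and> a \<in> B \<and> B \<subseteq> W \<inter> (D \<inter> E -` U) \<and> open ((\<lambda>x. f (E x)) ` B) \<and>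
         cholomorphic_on k ((\<lambda>x. f (E x)) ` B) \<and> (\<forall>x\<in>B. k (f (E x)) = x)"
    if a: "a \<in> W \<inter> (D \<inter> E -` U)" for a
  proof -
    obtain B k where B: "open B" "a \<in> B" "B \<subseteq> D \<inter> E -` U" "open ((\<lambda>x. f (E x)) ` B)"
      "cholomorphic_on k ((\<lambda>x. f (E x)) ` B)" "\<And>x. x \<in> B \<Longrightarrow> k (f (E x)) = x"
      using uniformizes_local_inverse[OF U, of a] a by blast
    show ?thesis
    proof (intro exI[of _ "B \<inter> W"] exI[of _ k] conjI ballI)
      show "open (B \<inter> W)" using B assms by blast
      show "open ((\<lambda>x. f (E x)) ` (B \<inter> W))"
        by (rule uniformizes_chart_image_open[OF U]) (use B assms in auto)
      show "cholomorphic_on k ((\<lambda>x. f (E x)) ` (B \<inter> W))"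
        by (rule cholomorphic_on_subset[OF B(5)]) auto
    qed (use a B in auto)
  qed
  show "case X of (U, f) \<Rightarrow> inj_on f U \<and> open (W \<inter> E -` U) \<and> cholomorphic_on (\<lambda>x. f (E x)) (W \<inter> E -` U) \<and>
      (\<forall>a\<in>W \<inter> E -` U. \<exists>B k. open B \<and> a \<in> B \<and> B \<subseteq> W \<inter> E -` U \<and> open ((\<lambda>x. f (E x)) ` B) \<and>
         cholomorphic_on k ((\<lambda>x. f (E x)) ` B) \<and> (\<forall>x\<in>B. k (f (E x)) = x))"
    unfolding X prod.case W
  proof (intro conjI ballI)
    show "inj_on f (U \<inter> E ` W)" by (rule inj_on_subset[OF uniformizes_basic(3)[OF U]]) blast
    show "cholomorphic_on (\<lambda>x. f (E x)) (W \<inter> (D \<inter> E -` U))"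
      unfolding cholomorphic_on_iff using uniformizes_basic(5)[OF U] by blast
    show "open (W \<inter> (D \<inter> E -` U))" by (rule oW)
  qed (rule loc)
qed (use assms in auto)

end

lemma uniformizes_domain:
  assumes "open W"
  shows "uniformizes (domain_atlas W) id W"
proof -
  have "\<exists>B k. open B \<and> a \<in> B \<and> B \<subseteq> W \<and> open ((\<lambda>x. x) ` B) \<and>
      cholomorphic_on k ((\<lambda>x. x) ` B) \<and> (\<forall>x\<in>B. k x = x)" if "a \<in> W" for a
    by (rule exI[of _ W], rule exI[of _ id]) (use assms that in \<open>auto simp: cholomorphic_on_iff cdiff_at_id\<close>)
  thus ?thesis using assms
    by (auto simp: uniformizes_def domain_atlas_def points_def cholomorphic_on_iff cdiff_at_ident cdiff_at_id)
qed

section \<open>Holomorphic maps through local lifts\<close>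

definition has_local_lifts :: "('e::complex_space \<Rightarrow> 'p) \<Rightarrow> 'e set \<Rightarrow> ('d::complex_space \<Rightarrow> 'q) \<Rightarrow> 'd set \<Rightarrow> ('p \<Rightarrow> 'q) \<Rightarrow> bool"
  where "has_local_lifts E D E' D' h \<longleftrightarrow> (\<forall>a\<in>D. \<exists>B G. open B \<and> a \<in> B \<and> B \<subseteq> D \<and> G ` B \<subseteq> D' \<and>
    cholomorphic_on G B \<and> (\<forall>x\<in>B. h (E x) = E' (G x)))"

lemma has_local_liftsD:
  assumes "has_local_lifts E D E' D' h" "a \<in> D"
  obtains B G where "open B" "a \<in> B" "B \<subseteq> D" "G ` B \<subseteq> D'" "cholomorphic_on G B" "\<And>x. x \<in> B \<Longrightarrow> h (E x) = E' (G x)"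
  using assms unfolding has_local_lifts_def by meson

text \<open>Near a point the chart expression of \<open>h\<close> is composed of a local inverse of
  \<open>f \<circ> E\<close>, the lift \<open>G\<close> and the map \<open>g \<circ> E'\<close>, all
  holomorphic. Continuity of \<open>h\<close> comes from that of the lifts, by the description of
  open sets through \<open>E\<close> and \<open>E'\<close>.\<close>

lemma holomorphic_mapI:
  assumes M: "uniformizes M E D" and N: "uniformizes N E' D'" and h: "has_local_lifts E D E' D' h"
  shows "holomorphic_map M N h"
proof -
  note bM = uniformizes_basic[OF M] and bN = uniformizes_basic[OF N]
  have cont: "continuous_map (mtop M) (mtop N) h"
    unfolding continuous_map_def uniformizes_topspace[OF M] uniformizes_topspace[OF N]
  proof (intro conjI allI impI)
    show "h \<in> points M \<rightarrow> points N"
    proof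
      fix p assume "p \<in> points M"
      then obtain a where a: "a \<in> D" "p = E a" using bM(2) by blast
      obtain B G where "a \<in> B" "G ` B \<subseteq> D'" "\<And>x. x \<in> B \<Longrightarrow> h (E x) = E' (G x)"
        using has_local_liftsD[OF h a(1)] by metis
      thus "h p \<in> points N" using a(2) bN(2) by blast
    qed
    fix V assume "openin (mtop N) V"
    hence V: "open (D' \<inter> E' -` V)" unfolding uniformizes_openin[OF N] by blast
    have "open (D \<inter> E -` {x \<in> points M. h x \<in> V})"
    proof (rule topological_space_class.openI)
      fix a assume a: "a \<in> D \<inter> E -` {x \<in> points M. h x \<in> V}"
      obtain B G where B: "open B" "a \<in> B" "B \<subseteq> D" "G ` B \<subseteq> D'" "cholomorphic_on G B" "\<And>x. x \<in> B \<Longrightarrow> h (E x) = E' (G x)"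
        using has_local_liftsD[OF h, of a] a by blast
      have "open (B \<inter> G -` (D' \<inter> E' -` V))"
        by (rule continuous_open_preimage[OF cholomorphic_on_continuous[OF B(5)] B(1) V])
      moreover have "a \<in> B \<inter> G -` (D' \<inter> E' -` V)" using a B by auto
      moreover have "E ` B \<subseteq> points M" using B(3) bM(2) by blast
      hence "B \<inter> G -` (D' \<inter> E' -` V) \<subseteq> D \<inter> E -` {x \<in> points M. h x \<in> V}"
        using B(3,6) by auto
      ultimately show "\<exists>T. open T \<and> a \<in> T \<and> T \<subseteq> D \<inter> E -` {x \<in> points M. h x \<in> V}" by blast
    qed
    thus "openin (mtop M) {x \<in> points M. h x \<in> V}" unfolding uniformizes_openin[OF M] by blast
  qed
  have "cholomorphic_on (g \<circ> h \<circ> inv_into U f) (f ` (U \<inter> h -` V))"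
    if U: "(U, f) \<in> M" and V: "(V, g) \<in> N" for U f V g
    unfolding cholomorphic_on_iff
  proof
    fix y assume "y \<in> f ` (U \<inter> h -` V)"
    then obtain p where p: "p \<in> U" "h p \<in> V" "y = f p" by blast
    hence "p \<in> points M" using U unfolding points_def by force
    then obtain a where a: "a \<in> D" "p = E a" using bM(2) by blast
    obtain B G where B: "open B" "a \<in> B" "B \<subseteq> D" "G ` B \<subseteq> D'" "cholomorphic_on G B" "\<And>x. x \<in> B \<Longrightarrow> h (E x) = E' (G x)"
      using has_local_liftsD[OF h a(1)] by blast
    obtain C k where C: "open C" "a \<in> C" "C \<subseteq> D \<inter> E -` U" "open ((\<lambda>x. f (E x)) ` C)"
      "cholomorphic_on k ((\<lambda>x. f (E x)) ` C)" "\<And>x. x \<in> C \<Longrightarrow> k (f (E x)) = x"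
      using uniformizes_local_inverse[OF M U a(1)] a(2) p(1) by blast
    have ky: "k y = a" using C p a by simp
    have "cdiff_at k y" using C(2,5) p a unfolding cholomorphic_on_iff by auto
    moreover have "cdiff_at G (k y)" using B(2,5) ky unfolding cholomorphic_on_iff by auto
    moreover have "cdiff_at (\<lambda>x. g (E' x)) (G (k y))"
      unfolding ky by (rule bN(5)[OF V]) (use B p a in auto)
    ultimately have cd: "cdiff_at (\<lambda>z. g (E' (G (k z)))) y"
      using cdiff_at_compose[of "\<lambda>z. G (k z)" y "\<lambda>x. g (E' x)"] cdiff_at_compose[of k y G] by blast
    show "cdiff_at (g \<circ> h \<circ> inv_into U f) y"
    proof (rule cdiff_at_cong_open[OF cd])
      show "open ((\<lambda>x. f (E x)) ` (C \<inter> B))"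
        by (rule uniformizes_chart_image_open[OF M U]) (use C B in auto)
      show "y \<in> (\<lambda>x. f (E x)) ` (C \<inter> B)" using C B p a by auto
      fix z assume "z \<in> (\<lambda>x. f (E x)) ` (C \<inter> B)"
      then obtain x where x: "x \<in> C" "x \<in> B" "z = f (E x)" by blast
      have "inv_into U f z = E x" using x C(3) bM(3)[OF U] by (auto intro: inv_into_f_eq)
      thus "g (E' (G (k z))) = (g \<circ> h \<circ> inv_into U f) z" using x C(6) B(6) by simp
    qed
  qed
  thus ?thesis unfolding holomorphic_map_def using cont by blast
qed

text \<open>Composes the chart expression of \<open>h\<close> with a local inverse of
  \<open>g \<circ> E'\<close> at \<open>b\<close>. The choice of \<open>b\<close> over the image of
  \<open>a\<close> selects the branch, so that \<open>G a = b\<close>.\<close>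

lemma holomorphic_map_lift:
  assumes M: "uniformizes M E D" and N: "uniformizes N E' D'" and h: "holomorphic_map M N h"
    and a: "a \<in> D" "b \<in> D'" "h (E a) = E' b"
  obtains B G where "open B" "a \<in> B" "B \<subseteq> D" "G ` B \<subseteq> D'" "cholomorphic_on G B" "G a = b"
    "\<And>x. x \<in> B \<Longrightarrow> h (E x) = E' (G x)"
proof -
  note bM = uniformizes_basic[OF M] and bN = uniformizes_basic[OF N]
  obtain U f where U: "(U, f) \<in> M" "E a \<in> U" using uniformizes_chart[OF M a(1)] by blast
  obtain V g where V: "(V, g) \<in> N" "E' b \<in> V" using uniformizes_chart[OF N a(2)] by blast
  obtain C k where C: "open C" "b \<in> C" "C \<subseteq> D' \<inter> E' -` V" "open ((\<lambda>x. g (E' x)) ` C)"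
    "cholomorphic_on k ((\<lambda>x. g (E' x)) ` C)" "\<And>x. x \<in> C \<Longrightarrow> k (g (E' x)) = x"
    using uniformizes_local_inverse[OF N V(1) a(2) V(2)] by blast
  define O1 where "O1 = D \<inter> E -` (U \<inter> h -` V)"
  have VN: "V \<subseteq> points N" using V unfolding points_def by force
  have "openin (mtop N) V" unfolding uniformizes_openin[OF N] using bN(4)[OF V(1)] VN by blast
  hence "openin (mtop M) {x \<in> topspace (mtop M). h x \<in> V}"
    using h unfolding holomorphic_map_def continuous_map_def by blast
  hence "open (D \<inter> E -` {x \<in> points M. h x \<in> V})"
    unfolding uniformizes_topspace[OF M] uniformizes_openin[OF M] by blast
  moreover have "O1 = (D \<inter> E -` U) \<inter> (D \<inter> E -` {x \<in> points M. h x \<in> V})"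
    using bM(2) by (auto simp: O1_def)
  ultimately have oO: "open O1" using bM(4)[OF U(1)] by auto
  define u where "u x = g (h (E x))" for x
  have cu: "cdiff_at u x" if x: "x \<in> O1" for x
  proof -
    have "cdiff_at (\<lambda>x. f (E x)) x" by (rule bM(5)[OF U(1)]) (use x O1_def in auto)
    moreover have "cdiff_at (g \<circ> h \<circ> inv_into U f) (f (E x))"
      using h U(1) V(1) x unfolding holomorphic_map_def cholomorphic_on_iff O1_def by fast
    ultimately have "cdiff_at (\<lambda>x. (g \<circ> h \<circ> inv_into U f) (f (E x))) x" by (rule cdiff_at_compose)
    thus ?thesis
      by (rule cdiff_at_cong_open[OF _ oO x]) (use bM(3)[OF U(1)] in \<open>auto simp: O1_def u_def\<close>)
  qed
  have uc: "continuous_on O1 u"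
    using cu cdiff_at_isCont continuous_at_imp_continuous_on by blast
  define B where "B = O1 \<inter> u -` ((\<lambda>x. g (E' x)) ` C)"
  have B: "\<exists>y\<in>C. u x = g (E' y) \<and> k (u x) = y \<and> h (E x) = E' y" if "x \<in> B" for x
  proof -
    from that obtain y where y: "y \<in> C" "u x = g (E' y)" unfolding B_def by blast
    have "h (E x) \<in> V" "E' y \<in> V" using that y C(3) by (auto simp: B_def O1_def)
    hence "h (E x) = E' y" using y(2) bN(3)[OF V(1)] unfolding u_def inj_on_def by blast
    thus ?thesis using y C(6) by auto
  qed
  show ?thesis
  proof (rule that[of B "\<lambda>x. k (u x)"])
    show "open B" unfolding B_def by (rule continuous_open_preimage[OF uc oO C(4)])
    show aB: "a \<in> B" using a U V C by (auto simp: B_def O1_def u_def)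
    show "k (u a) = b" using a C by (simp add: u_def)
    show "B \<subseteq> D" by (auto simp: B_def O1_def)
    show "(\<lambda>x. k (u x)) ` B \<subseteq> D'" using B C(3) by fastforce
    show "h (E x) = E' (k (u x))" if "x \<in> B" for x using B[OF that] by auto
    show "cholomorphic_on (\<lambda>x. k (u x)) B"
      unfolding cholomorphic_on_iff
    proof
      fix x assume x: "x \<in> B"
      show "cdiff_at (\<lambda>x. k (u x)) x"
        by (rule cdiff_at_compose[OF cu]) (use x C(5) in \<open>auto simp: B_def cholomorphic_on_iff\<close>)
    qed
  qed
qed

lemma biholomorphic_mapI:
  assumes M: "uniformizes M E D" and N: "uniformizes N E' D'"
    and h: "has_local_lifts E D E' D' h" and k: "has_local_lifts E' D' E D k"
    and "\<And>x. x \<in> D \<Longrightarrow> k (h (E x)) = E x" "\<And>y. y \<in> D' \<Longrightarrow> h (k (E' y)) = E' y"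
  shows "biholomorphic_map M N h"
  unfolding biholomorphic_map_def
proof (intro conjI exI[of _ k] ballI)
  show "holomorphic_map M N h" by (rule holomorphic_mapI[OF M N h])
  show "holomorphic_map N M k" by (rule holomorphic_mapI[OF N M k])
  show "k (h x) = x" if "x \<in> points M" for x
    using that assms(5) unfolding uniformizes_basic(2)[OF M, symmetric] by blast
  show "h (k y) = y" if "y \<in> points N" for y
    using that assms(6) unfolding uniformizes_basic(2)[OF N, symmetric] by blast
qed

lemma locally_biholomorphicI:
  assumes M: "uniformizes M E D" and N: "uniformizes N E' D'"
    and B: "open B" "a \<in> B" "B \<subseteq> D" and G: "cholomorphic_on G B" "G ` B \<subseteq> D'"
    and hG: "\<And>x. x \<in> B \<Longrightarrow> h (E x) = E' (G x)"
    and K: "open (G ` B)" "cholomorphic_on K (G ` B)" "\<And>x. x \<in> B \<Longrightarrow> K (G x) = x"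
  shows "locally_biholomorphic_at M N h (E a)"
proof -
  \<comment> \<open>On a small neighbourhood of \<open>G a\<close> the map \<open>E'\<close> is
    injective, so the inverse of \<open>G\<close> descends to an inverse of
    \<open>h\<close>.\<close>
  obtain C where C: "open C" "G a \<in> C" "C \<subseteq> D'" "inj_on E' C"
    using uniformizes_locally_inj[OF N, of "G a"] G(2) B(2) by blast
  define A where "A = B \<inter> G -` C"
  have oA: "open A" unfolding A_def
    by (rule continuous_open_preimage[OF cholomorphic_on_continuous[OF G(1)] B(1) C(1)])
  have GA: "G ` A = G ` B \<inter> C" by (auto simp: A_def)
  have oGA: "open (G ` A)" unfolding GA using K(1) C(1) by blast
  have AD: "A \<subseteq> D" "G ` A \<subseteq> D'" using B C by (auto simp: A_def)
  have inj: "inj_on E' (G ` A)" unfolding GA using C(4) by (rule inj_on_subset) blast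
  define k where "k q = E (K (inv_into (G ` A) E' q))" for q
  have kE: "k (E' y) = E (K y)" if "y \<in> G ` A" for y
    using inv_into_f_f[OF inj that] by (simp add: k_def)
  have KG: "K ` (G ` A) \<subseteq> A" using K(3) by (auto simp: A_def)
  have "biholomorphic_map (restrict_atlas M (E ` A)) (restrict_atlas N (E' ` (G ` A))) h"
  proof (rule biholomorphic_mapI[OF uniformizes_restrict[OF M oA AD(1)] uniformizes_restrict[OF N oGA AD(2)]])
    show "has_local_lifts E A E' (G ` A) h"
      unfolding has_local_lifts_def
    proof
      fix a assume "a \<in> A"
      thus "\<exists>B' F. open B' \<and> a \<in> B' \<and> B' \<subseteq> A \<and> F ` B' \<subseteq> G ` A \<and> cholomorphic_on F B' \<and> (\<forall>x\<in>B'. h (E x) = E' (F x))"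
        using oA G(1) hG by (intro exI[of _ A] exI[of _ G]) (auto simp: A_def cholomorphic_on_iff)
    qed
    show "has_local_lifts E' (G ` A) E A k"
      unfolding has_local_lifts_def
    proof
      fix b assume "b \<in> G ` A"
      moreover have "cholomorphic_on K (G ` A)" by (rule cholomorphic_on_subset[OF K(2)]) (auto simp: A_def)
      ultimately show "\<exists>B' F. open B' \<and> b \<in> B' \<and> B' \<subseteq> G ` A \<and> F ` B' \<subseteq> A \<and> cholomorphic_on F B' \<and> (\<forall>x\<in>B'. k (E' x) = E (F x))"
        using oGA KG kE by (intro exI[of _ "G ` A"] exI[of _ K]) blast
    qed
    show "k (h (E x)) = E x" if "x \<in> A" for x
      using that hG[of x] kE[of "G x"] K(3)[of x] by (auto simp: A_def)
    show "h (k (E' y)) = E' y" if "y \<in> G ` A" for y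
    proof -
      from that obtain x where x: "x \<in> A" "y = G x" by blast
      thus ?thesis using kE[OF that] K(3)[of x] hG[of x] by (auto simp: A_def)
    qed
  qed
  moreover have "E a \<in> E ` A" using B(2) C(2) by (auto simp: A_def)
  ultimately show ?thesis unfolding locally_biholomorphic_at_def
    using uniformizes_open_map[OF M oA AD(1)] uniformizes_open_map[OF N oGA AD(2)] by blast
qed

lemma uniformizes_prod:
  assumes M: "uniformizes M E D" and N: "uniformizes N E' D'"
  shows "uniformizes (prod_atlas M N) (map_prod E E') (D \<times> D')"
  unfolding uniformizes_def
proof (intro conjI ballI)
  note bM = uniformizes_basic[OF M] and bN = uniformizes_basic[OF N]
  show "open (D \<times> D')" using bM(1) bN(1) by (rule open_Times)
  have "points (prod_atlas M N) = points M \<times> points N"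
    unfolding points_def prod_atlas_def by force
  thus "map_prod E E' ` (D \<times> D') = points (prod_atlas M N)"
    using bM(2) bN(2) by (simp add: map_prod_surj_on)
  fix X assume "X \<in> prod_atlas M N"
  then obtain U f V g where X: "X = (U \<times> V, map_prod f g)" and U: "(U, f) \<in> M" and V: "(V, g) \<in> N"
    unfolding prod_atlas_def by blast
  have W: "D \<times> D' \<inter> map_prod E E' -` (U \<times> V) = (D \<inter> E -` U) \<times> (D' \<inter> E' -` V)" by auto
  have cd: "cdiff_at (\<lambda>x. map_prod f g (map_prod E E' x)) x" if "x \<in> (D \<inter> E -` U) \<times> (D' \<inter> E' -` V)" for x
  proof -
    have "cdiff_at (\<lambda>x. f (E (fst x))) x"
      by (rule cdiff_at_compose[OF cdiff_at_fst, where f = "\<lambda>x. f (E x)"]) (rule bM(5)[OF U]; use that in auto)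
    moreover have "cdiff_at (\<lambda>x. g (E' (snd x))) x"
      by (rule cdiff_at_compose[OF cdiff_at_snd, where f = "\<lambda>x. g (E' x)"]) (rule bN(5)[OF V]; use that in auto)
    ultimately have "cdiff_at (\<lambda>x. (f (E (fst x)), g (E' (snd x)))) x" by (rule cdiff_at_Pair)
    thus ?thesis by (simp add: map_prod_def case_prod_unfold)
  qed
  have loc: "\<exists>B k. open B \<and> a \<in> B \<and> B \<subseteq> (D \<inter> E -` U) \<times> (D' \<inter> E' -` V) \<and> open ((\<lambda>x. map_prod f g (map_prod E E' x)) ` B) \<and>
      cholomorphic_on k ((\<lambda>x. map_prod f g (map_prod E E' x)) ` B) \<and> (\<forall>x\<in>B. k (map_prod f g (map_prod E E' x)) = x)"
    if a: "a \<in> (D \<inter> E -` U) \<times> (D' \<inter> E' -` V)" for a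
  proof -
    obtain B k where B: "open B" "fst a \<in> B" "B \<subseteq> D \<inter> E -` U" "open ((\<lambda>x. f (E x)) ` B)"
      "cholomorphic_on k ((\<lambda>x. f (E x)) ` B)" "\<And>x. x \<in> B \<Longrightarrow> k (f (E x)) = x"
      by (rule uniformizes_local_inverse[OF M U, of "fst a"]) (use a in auto)
    obtain B' k' where B': "open B'" "snd a \<in> B'" "B' \<subseteq> D' \<inter> E' -` V" "open ((\<lambda>x. g (E' x)) ` B')"
      "cholomorphic_on k' ((\<lambda>x. g (E' x)) ` B')" "\<And>x. x \<in> B' \<Longrightarrow> k' (g (E' x)) = x"
      by (rule uniformizes_local_inverse[OF N V, of "snd a"]) (use a in auto)
    have im: "(\<lambda>x. map_prod f g (map_prod E E' x)) ` (B \<times> B') = (\<lambda>x. f (E x)) ` B \<times> (\<lambda>x. g (E' x)) ` B'"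
      by force
    show ?thesis
    proof (intro exI[of _ "B \<times> B'"] exI[of _ "\<lambda>x. (k (fst x), k' (snd x))"] conjI ballI)
      show "open (B \<times> B')" using B B' open_Times by blast
      show "open ((\<lambda>x. map_prod f g (map_prod E E' x)) ` (B \<times> B'))"
        unfolding im using B B' open_Times by blast
      show "cholomorphic_on (\<lambda>x. (k (fst x), k' (snd x))) ((\<lambda>x. map_prod f g (map_prod E E' x)) ` (B \<times> B'))"
        unfolding im cholomorphic_on_iff
      proof
        fix z assume z: "z \<in> (\<lambda>x. f (E x)) ` B \<times> (\<lambda>x. g (E' x)) ` B'"
        have "cdiff_at (\<lambda>x. k (fst x)) z"
          by (rule cdiff_at_compose[OF cdiff_at_fst]) (use z B(5) in \<open>auto simp: cholomorphic_on_iff\<close>)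
        moreover have "cdiff_at (\<lambda>x. k' (snd x)) z"
          by (rule cdiff_at_compose[OF cdiff_at_snd]) (use z B'(5) in \<open>auto simp: cholomorphic_on_iff\<close>)
        ultimately show "cdiff_at (\<lambda>x. (k (fst x), k' (snd x))) z" by (rule cdiff_at_Pair)
      qed
    qed (use B B' in \<open>auto simp: mem_Times_iff\<close>)
  qed
  have inj: "inj_on (map_prod f g) (U \<times> V)" using bM(3)[OF U] bN(3)[OF V] by (rule map_prod_inj_on)
  have op: "open ((D \<inter> E -` U) \<times> (D' \<inter> E' -` V))" using bM(4)[OF U] bN(4)[OF V] by (rule open_Times)
  show "case X of (U, f) \<Rightarrow> inj_on f U \<and> open (D \<times> D' \<inter> map_prod E E' -` U) \<and>
      cholomorphic_on (\<lambda>x. f (map_prod E E' x)) (D \<times> D' \<inter> map_prod E E' -` U) \<and>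
      (\<forall>a\<in>D \<times> D' \<inter> map_prod E E' -` U. \<exists>B k. open B \<and> a \<in> B \<and> B \<subseteq> D \<times> D' \<inter> map_prod E E' -` U \<and> open ((\<lambda>x. f (map_prod E E' x)) ` B) \<and>
         cholomorphic_on k ((\<lambda>x. f (map_prod E E' x)) ` B) \<and> (\<forall>x\<in>B. k (f (map_prod E E' x)) = x))"
    unfolding X prod.case W
  proof (intro conjI ballI inj op)
    show "cholomorphic_on (\<lambda>x. map_prod f g (map_prod E E' x)) ((D \<inter> E -` U) \<times> (D' \<inter> E' -` V))"
      unfolding cholomorphic_on_iff using cd by blast
  qed (rule loc)
qed

section \<open>The elliptic curve and the ruled surface\<close>

lemma torus_proj_inj_on_ball:
  assumes "Im \<tau> > 0" "r \<le> min 1 (Im \<tau>) / 2"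
  shows "inj_on (torus_proj \<tau>) (ball x r)"
proof (rule inj_onI)
  fix y z assume yz: "y \<in> ball x r" "z \<in> ball x r" "torus_proj \<tau> y = torus_proj \<tau> z"
  have "dist y z \<le> dist x y + dist x z" by (rule dist_triangle3)
  also have "\<dots> < 2 * r" using yz by simp
  finally have n: "norm (y - z) < min 1 (Im \<tau>)" using assms(2) by (simp add: dist_norm)
  have "y - z \<in> lattice \<tau>" using yz(3) by (simp add: torus_proj_eq_iff)
  from lattice_small[OF assms(1) this n] show "y = z" by simp
qed

lemma elliptic_curve_chart_iff:
  "(U, f) \<in> elliptic_curve \<tau> \<longleftrightarrow> (\<exists>D. open D \<and> inj_on (torus_proj \<tau>) D \<and>
    U = torus_proj \<tau> ` D \<and> f = inv_into D (torus_proj \<tau>))"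
proof -
  have "openin (mtop (domain_atlas (UNIV :: complex set))) D \<longleftrightarrow> open D" for D
    using uniformizes_openin[OF uniformizes_domain[OF open_UNIV], of D]
    by (simp add: domain_atlas_def points_def)
  thus ?thesis unfolding elliptic_curve_def quotient_atlas_def domain_atlas_def by auto
qed

text \<open>A chart is a local inverse of \<open>torus_proj\<close>, so composed with
  \<open>torus_proj\<close> it is locally a translation by a lattice vector, and the local inverse
  required is the opposite translation.\<close>

lemma uniformizes_elliptic_curve:
  assumes "Im \<tau> > 0"
  shows "uniformizes (elliptic_curve \<tau>) (torus_proj \<tau>) UNIV"
  unfolding uniformizes_def
proof (intro conjI ballI)
  let ?p = "torus_proj \<tau>"
  have "?p x \<in> points (elliptic_curve \<tau>)" for x
  proof -
    define D where "D = ball x (min 1 (Im \<tau>) / 2)"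
    have "(?p ` D, inv_into D ?p) \<in> elliptic_curve \<tau>"
      unfolding elliptic_curve_chart_iff
      by (intro exI[of _ D]) (use torus_proj_inj_on_ball[OF assms] in \<open>auto simp: D_def\<close>)
    moreover have "x \<in> D" using assms by (simp add: D_def)
    ultimately show ?thesis unfolding points_def by force
  qed
  moreover have "points (elliptic_curve \<tau>) \<subseteq> range ?p"
    unfolding points_def using elliptic_curve_chart_iff by fastforce
  ultimately show "range ?p = points (elliptic_curve \<tau>)" by blast
  fix X assume "X \<in> elliptic_curve \<tau>"
  hence "(fst X, snd X) \<in> elliptic_curve \<tau>" by simp
  then obtain D where D: "open D" "inj_on ?p D" "fst X = ?p ` D" "snd X = inv_into D ?p"
    unfolding elliptic_curve_chart_iff by blast
  have X: "X = (?p ` D, inv_into D ?p)" using D(3,4) by (simp add: prod_eq_iff)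
  have inj: "inj_on (inv_into D ?p) (?p ` D)" by (rule inj_on_inv_into) simp
  have loc: "\<exists>l. a \<in> (\<lambda>x. x + l) -` D \<and> open ((\<lambda>x. x + l) -` D) \<and> (\<lambda>x. x + l) -` D \<subseteq> ?p -` (?p ` D) \<and>
      (\<forall>x\<in>(\<lambda>x. x + l) -` D. inv_into D ?p (?p x) = x + l)" if "?p a \<in> ?p ` D" for a
  proof -
    from that obtain b where b: "b \<in> D" "?p a = ?p b" by blast
    have l: "b - a \<in> lattice \<tau>" using torus_proj_eq_iff[of \<tau> b a] b(2) by simp
    have e: "?p (x + (b - a)) = ?p x" for x by (rule torus_proj_add_lattice[OF l])
    have "open ((\<lambda>x. x + (b - a)) -` D)"
      by (rule open_vimage[OF D(1)]) (intro continuous_intros)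
    moreover have "inv_into D ?p (?p x) = x + (b - a)" if "x + (b - a) \<in> D" for x
      using inv_into_f_f[OF D(2) that] e by simp
    moreover have "(\<lambda>x. x + (b - a)) -` D \<subseteq> ?p -` (?p ` D)"
      using e by (metis image_eqI subsetI vimage_eq)
    ultimately show ?thesis using b by (intro exI[of _ "b - a"]) auto
  qed
  have op: "open (UNIV \<inter> ?p -` (?p ` D))"
  proof (rule topological_space_class.openI)
    fix a assume "a \<in> UNIV \<inter> ?p -` (?p ` D)"
    hence "?p a \<in> ?p ` D" by simp
    from loc[OF this] show "\<exists>T. open T \<and> a \<in> T \<and> T \<subseteq> UNIV \<inter> ?p -` (?p ` D)" by auto
  qed
  have cd: "cdiff_at (\<lambda>x. inv_into D ?p (?p x)) a" if a: "?p a \<in> ?p ` D" for a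
  proof -
    obtain l where l: "a \<in> (\<lambda>x. x + l) -` D" "open ((\<lambda>x. x + l) -` D)"
      "\<forall>x\<in>(\<lambda>x. x + l) -` D. inv_into D ?p (?p x) = x + l" using loc[OF a] by blast
    have "cdiff_at (\<lambda>x. x + l) a" by (intro cdiff_intros)
    thus ?thesis by (rule cdiff_at_cong_open[OF _ l(2,1)]) (use l(3) in auto)
  qed
  have inv: "\<exists>B k. open B \<and> a \<in> B \<and> B \<subseteq> UNIV \<inter> ?p -` (?p ` D) \<and> open ((\<lambda>x. inv_into D ?p (?p x)) ` B) \<and>
      cholomorphic_on k ((\<lambda>x. inv_into D ?p (?p x)) ` B) \<and> (\<forall>x\<in>B. k (inv_into D ?p (?p x)) = x)"
    if a: "a \<in> UNIV \<inter> ?p -` (?p ` D)" for a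
  proof -
    obtain l where l: "a \<in> (\<lambda>x. x + l) -` D" "open ((\<lambda>x. x + l) -` D)"
      "(\<lambda>x. x + l) -` D \<subseteq> ?p -` (?p ` D)"
      "\<forall>x\<in>(\<lambda>x. x + l) -` D. inv_into D ?p (?p x) = x + l" using loc[of a] a by blast
    have im: "(\<lambda>x. inv_into D ?p (?p x)) ` ((\<lambda>x. x + l) -` D) = D"
    proof -
      have "(\<lambda>x. inv_into D ?p (?p x)) ` ((\<lambda>x. x + l) -` D) = (\<lambda>x. x + l) ` ((\<lambda>x. x + l) -` D)"
        by (rule image_cong) (use l(4) in auto)
      also have "\<dots> = D" by (rule surj_image_vimage_eq) (metis diff_add_cancel surjI)
      finally show ?thesis .
    qed
    show ?thesis
      by (rule exI[of _ "(\<lambda>x. x + l) -` D"], rule exI[of _ "\<lambda>z. z + (- l)"])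
        (use l D(1) in \<open>auto simp: im cholomorphic_on_iff intro!: cdiff_intros\<close>)
  qed
  show "case X of (U, f) \<Rightarrow> inj_on f U \<and> open (UNIV \<inter> ?p -` U) \<and> cholomorphic_on (\<lambda>x. f (?p x)) (UNIV \<inter> ?p -` U) \<and>
      (\<forall>a\<in>UNIV \<inter> ?p -` U. \<exists>B k. open B \<and> a \<in> B \<and> B \<subseteq> UNIV \<inter> ?p -` U \<and> open ((\<lambda>x. f (?p x)) ` B) \<and>
         cholomorphic_on k ((\<lambda>x. f (?p x)) ` B) \<and> (\<forall>x\<in>B. k (f (?p x)) = x))"
    unfolding X prod.case
  proof (intro conjI ballI inj op)
    show "cholomorphic_on (\<lambda>x. inv_into D ?p (?p x)) (UNIV \<inter> ?p -` (?p ` D))"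
      unfolding cholomorphic_on_iff using cd by blast
  qed (rule inv)
qed simp

section \<open>The suspension and its affine uniformization\<close>

lemma suspension_proj_eq_iff:
  "suspension_proj \<tau> (x, z) = suspension_proj \<tau> (x', z') \<longleftrightarrow>
    (\<exists>m n. x' = x + of_int m + of_int n * \<tau> \<and> z' = rho m n z)"
proof
  assume "suspension_proj \<tau> (x, z) = suspension_proj \<tau> (x', z')"
  moreover have "(x', z') \<in> suspension_proj \<tau> (x', z')"
    unfolding suspension_proj_def by (rule CollectI, rule exI[of _ 0], rule exI[of _ 0]) simp
  ultimately have "(x', z') \<in> suspension_proj \<tau> (x, z)" by simp
  thus "\<exists>m n. x' = x + of_int m + of_int n * \<tau> \<and> z' = rho m n z"
    unfolding suspension_proj_def by auto
next
  have sub: "suspension_proj \<tau> (x', z') \<subseteq> suspension_proj \<tau> (x, z)"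
    if "x' = x + of_int m + of_int n * \<tau>" "z' = rho m n z" for x z x' z' m n
  proof
    fix y assume "y \<in> suspension_proj \<tau> (x', z')"
    then obtain k l where "y = (x' + of_int k + of_int l * \<tau>, rho k l z')"
      unfolding suspension_proj_def by auto
    hence "y = (x + of_int (k + m) + of_int (l + n) * \<tau>, rho (k + m) (l + n) z)"
      using that by (simp add: rho_add algebra_simps)
    thus "y \<in> suspension_proj \<tau> (x, z)" unfolding suspension_proj_def fst_conv snd_conv by blast
  qed
  assume "\<exists>m n. x' = x + of_int m + of_int n * \<tau> \<and> z' = rho m n z"
  then obtain m n where mn: "x' = x + of_int m + of_int n * \<tau>" "z' = rho m n z" by blast
  have "x = x' + of_int (- m) + of_int (- n) * \<tau>" "z = rho (- m) (- n) z'"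
    using mn by (auto simp: rho_minus)
  from sub[OF mn] sub[OF this] show "suspension_proj \<tau> (x, z) = suspension_proj \<tau> (x', z')" by blast
qed

lemma rho_eq_Infinity_iff: "rho m n z = Infinity \<longleftrightarrow> z = (if even n then Infinity else Affine 0)"
  by (cases z) (auto simp: rho_def proj_neg_def proj_inv_def)

lemma neq_Infinity_iff: "z \<noteq> Infinity \<longleftrightarrow> (\<exists>w. z = Affine w)"
  by (cases z) auto

definition affine_coord :: "proj_line \<Rightarrow> complex"
  where "affine_coord z = (case z of Affine w \<Rightarrow> w | Infinity \<Rightarrow> 0)"

definition inverse_coord :: "proj_line \<Rightarrow> complex"
  where "inverse_coord z = (case z of Affine w \<Rightarrow> 1 / w | Infinity \<Rightarrow> 0)"

lemma affine_coord_simps [simp]: "affine_coord (Affine w) = w" "affine_coord Infinity = 0"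
  by (auto simp: affine_coord_def)

lemma inverse_coord_simps [simp]: "inverse_coord (Affine w) = 1 / w" "inverse_coord Infinity = 0"
  by (auto simp: inverse_coord_def)

definition cylinder :: "(complex \<times> proj_line, complex \<times> complex) atlas"
  where "cylinder = prod_atlas (domain_atlas UNIV) proj_line_atlas"

lemma cylinder_eq: "cylinder = {(UNIV \<times> - {Infinity}, map_prod id affine_coord),
  (UNIV \<times> - {Affine 0}, map_prod id inverse_coord)}"
  by (auto simp: cylinder_def prod_atlas_def domain_atlas_def proj_line_atlas_def affine_coord_def[abs_def]
    inverse_coord_def[abs_def])

lemma inj_on_affine_coord: "inj_on affine_coord (- {Infinity})"
  by (auto simp: inj_on_def neq_Infinity_iff)

lemma inj_on_inverse_coord: "inj_on inverse_coord (- {Affine 0})"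
  by (auto simp: inj_on_def inverse_coord_def split: proj_line.splits)

lemma cylinder_chart_inj: "(U, f) \<in> cylinder \<Longrightarrow> inj_on f U"
  using inj_on_affine_coord inj_on_inverse_coord
  by (auto simp: cylinder_eq intro!: map_prod_inj_on inj_on_id)

lemma openin_cylinder:
  "openin (mtop cylinder) W \<longleftrightarrow> open (map_prod id affine_coord ` (W \<inter> UNIV \<times> - {Infinity})) \<and>
     open (map_prod id inverse_coord ` (W \<inter> UNIV \<times> - {Affine 0}))"
proof -
  have "points cylinder = UNIV" by (auto simp: cylinder_eq points_def)
  thus ?thesis using openin_mtop[of cylinder W, OF cylinder_chart_inj] by (auto simp: cylinder_eq)
qed

lemma affine_coord_image: "affine_coord ` (- {Infinity}) = UNIV" "affine_coord ` (- {Affine 0} \<inter> - {Infinity}) = - {0}"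
  by (force simp: image_iff neq_Infinity_iff)+

lemma inverse_coord_image: "inverse_coord ` (- {Affine 0}) = UNIV" "inverse_coord ` (- {Infinity} \<inter> - {Affine 0}) = - {0}"
proof -
  have "w \<in> inverse_coord ` (- {Affine 0})" for w
    by (rule image_eqI[of _ _ "if w = 0 then Infinity else Affine (1 / w)"]) auto
  thus "inverse_coord ` (- {Affine 0}) = UNIV" by blast
  have "w \<in> inverse_coord ` (- {Infinity} \<inter> - {Affine 0})" if "w \<noteq> 0" for w
    by (rule image_eqI[of _ _ "Affine (1 / w)"]) (use that in auto)
  thus "inverse_coord ` (- {Infinity} \<inter> - {Affine 0}) = - {0}"
    by (auto simp: neq_Infinity_iff)
qed

lemma openin_cylinder_boxes:
  assumes "open B"
  shows "openin (mtop cylinder) (B \<times> - {Infinity})" "openin (mtop cylinder) (B \<times> - {Affine 0})"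
  using assms by (auto simp: openin_cylinder Times_Int_Times map_prod_surj_on[OF refl refl]
    affine_coord_image inverse_coord_image intro!: open_Times)

lemma holomorphic_mapD:
  assumes "holomorphic_map M N h" "(U, f) \<in> M" "(V, g) \<in> N"
  shows "cholomorphic_on (g \<circ> h \<circ> inv_into U f) (f ` (U \<inter> h -` V))"
proof -
  from assms(1) have "\<forall>(U, f)\<in>M. \<forall>(V, g)\<in>N. cholomorphic_on (g \<circ> h \<circ> inv_into U f) (f ` (U \<inter> h -` V))"
    unfolding holomorphic_map_def by simp
  from bspec[OF this assms(2)]
  have "\<forall>(V, g)\<in>N. cholomorphic_on (g \<circ> h \<circ> inv_into U f) (f ` (U \<inter> h -` V))" by simp
  from bspec[OF this assms(3)] show ?thesis by simp
qed

lemma inv_into_image_Int: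
  assumes "inj_on p D"
  shows "inv_into D p ` (A \<inter> p ` D) = {y \<in> D. p y \<in> A}"
proof
  show "inv_into D p ` (A \<inter> p ` D) \<subseteq> {y \<in> D. p y \<in> A}"
    using inv_into_f_f[OF assms] by auto
  show "{y \<in> D. p y \<in> A} \<subseteq> inv_into D p ` (A \<inter> p ` D)"
    using inv_into_f_f[OF assms] by (force simp: image_iff)
qed

text \<open>The manifold axioms are known for \<open>S\<close>. They are combined with the charts of
  the suspension on boxes, through \<open>\<psi>\<close> and its inverse, to give affine coordinates
  on \<open>S\<close>.\<close>

locale suspended_surface =
  fixes \<tau> :: complex and S :: "('s, complex \<times> complex) atlas" and \<pi> :: "'s \<Rightarrow> complex set"
    and \<psi> :: "(complex \<times> proj_line) set \<Rightarrow> 's"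
  assumes im_pos: "Im \<tau> > 0"
    and manifold: "complex_manifold S"
    and biholomorphic: "biholomorphic_map (suspension \<tau>) S \<psi>"
    and proj: "\<pi> (\<psi> (suspension_proj \<tau> (x, z))) = torus_proj \<tau> x"
begin

definition Psi :: "complex \<Rightarrow> proj_line \<Rightarrow> 's"
  where "Psi x z = \<psi> (suspension_proj \<tau> (x, z))"

text \<open>Only the affine points of the fibres are parametrized, yet this map is onto: the
  generator \<open>\<tau>\<close> exchanges 0 and infinity, so the point at infinity over
  \<open>x\<close> is the point 0 over \<open>x + \<tau>\<close>.\<close>

definition E :: "complex \<times> complex \<Rightarrow> 's"
  where "E v = Psi (fst v) (Affine (snd v))"

abbreviation "sp \<equiv> suspension_proj \<tau>"

definition box :: "complex \<Rightarrow> (complex \<times> proj_line) set"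
  where "box x = ball x (min 1 (Im \<tau>) / 2) \<times> - {Infinity}"

definition box_chart :: "complex \<Rightarrow> (complex \<times> proj_line) set \<Rightarrow> complex \<times> complex"
  where "box_chart x = map_prod id affine_coord \<circ> inv_into (box x) sp"

lemma inj_on_box: "inj_on sp (box x)"
proof (rule inj_onI)
  fix y y' assume y: "y \<in> box x" "y' \<in> box x" "sp y = sp y'"
  obtain a z a' z' where e: "y = (a, z)" "y' = (a', z')" by (metis surj_pair)
  from y(3) e obtain m n where mn: "a' = a + of_int m + of_int n * \<tau>" "z' = rho m n z"
    using suspension_proj_eq_iff by blast
  have "torus_proj \<tau> a' = torus_proj \<tau> a" using mn by (simp add: torus_proj_eq_iff latticeI add.assoc)
  hence "a' = a"
    by (rule inj_onD[OF torus_proj_inj_on_ball[OF im_pos order_refl]])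
       (use y e in \<open>auto simp: box_def\<close>)
  hence "0 = of_int m + of_int n * \<tau>" using mn by simp
  from lattice_zero_iff[OF im_pos this] have "m = 0 \<and> n = 0" using im_pos by simp
  thus "y = y'" using mn e by simp
qed

lemma box_chart_in: "(sp ` box x, box_chart x) \<in> suspension \<tau>"
proof -
  have "openin (mtop cylinder) (box x)" unfolding box_def by (rule openin_cylinder_boxes) simp
  moreover have "(UNIV \<times> - {Infinity}, map_prod id affine_coord) \<in> cylinder" by (simp add: cylinder_eq)
  moreover have "box x \<subseteq> UNIV \<times> - {Infinity}" by (auto simp: box_def)
  ultimately show ?thesis
    unfolding suspension_def quotient_atlas_def box_chart_def cylinder_def using inj_on_box by blast
qed

lemma suspension_chart_inj: "(U, f) \<in> suspension \<tau> \<Longrightarrow> inj_on f U"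
proof -
  assume "(U, f) \<in> suspension \<tau>"
  then obtain D U' f' where D: "U = sp ` D" "f = f' \<circ> inv_into D sp" "(U', f') \<in> cylinder" "D \<subseteq> U'" "inj_on sp D"
    unfolding suspension_def quotient_atlas_def cylinder_def by blast
  have "inv_into D sp ` (sp ` D) \<subseteq> D" by (rule image_subsetI) (rule inv_into_into)
  hence "inj_on f' (inv_into D sp ` (sp ` D))"
    using cylinder_chart_inj[OF D(3)] D(4) by (meson inj_on_subset order_trans)
  thus ?thesis unfolding D by (intro comp_inj_on inj_on_inv_into) auto
qed

lemma openin_suspension:
  "openin (mtop (suspension \<tau>)) W \<longleftrightarrow> W \<subseteq> points (suspension \<tau>) \<and> (\<forall>(U, f)\<in>suspension \<tau>. open (f ` (W \<inter> U)))"
  by (rule openin_mtop) (rule suspension_chart_inj)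

lemma openin_box: "openin (mtop (suspension \<tau>)) (sp ` box x)"
  unfolding openin_suspension
proof (intro conjI ballI)
  show "sp ` box x \<subseteq> points (suspension \<tau>)" unfolding points_def using box_chart_in by force
  fix X assume "X \<in> suspension \<tau>"
  then obtain D U f where D: "X = (sp ` D, f \<circ> inv_into D sp)" "(U, f) \<in> cylinder" "D \<subseteq> U"
    "openin (mtop cylinder) D" "inj_on sp D"
    unfolding suspension_def quotient_atlas_def cylinder_def by blast
  \<comment> \<open>The preimage under \<open>sp\<close> of the image of the box is the union of its
    translates. Each translate leaves out either infinity or 0 in the fibres, so it is open in the
    cylinder.\<close>
  define T where "T = (\<Union>(m, n)\<in>UNIV. {(a, z). a + of_int m + of_int n * \<tau> \<in> ball x (min 1 (Im \<tau>) / 2) \<and> rho m n z \<noteq> Infinity})"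
  have "openin (mtop cylinder) {(a, z). a + of_int m + of_int n * \<tau> \<in> ball x (min 1 (Im \<tau>) / 2) \<and> rho m n z \<noteq> Infinity}" for m n
  proof -
    define B where "B = {a. a + of_int m + of_int n * \<tau> \<in> ball x (min 1 (Im \<tau>) / 2)}"
    have "open ((\<lambda>a. a + of_int m + of_int n * \<tau>) -` ball x (min 1 (Im \<tau>) / 2))"
      by (rule open_vimage[OF open_ball]) (intro continuous_intros)
    hence "open B" by (simp add: B_def vimage_def)
    moreover have "{(a, z). a + of_int m + of_int n * \<tau> \<in> ball x (min 1 (Im \<tau>) / 2) \<and> rho m n z \<noteq> Infinity} =
        B \<times> - {if even n then Infinity else Affine 0}"
      by (auto simp: B_def rho_eq_Infinity_iff split: if_splits)
    ultimately show ?thesis using openin_cylinder_boxes[of B] by simp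
  qed
  hence "openin (mtop cylinder) T" unfolding T_def by (intro openin_Union) auto
  hence "openin (mtop cylinder) (D \<inter> T)" using D(4) by (rule openin_Int[rotated])
  hence "open (f ` (D \<inter> T \<inter> U))"
    using D(2) openin_mtop[of cylinder, OF cylinder_chart_inj] by blast
  moreover have "D \<inter> T \<inter> U = inv_into D sp ` (sp ` box x \<inter> sp ` D)"
  proof -
    have "inv_into D sp ` (sp ` box x \<inter> sp ` D) = {y \<in> D. sp y \<in> sp ` box x}"
      by (rule inv_into_image_Int[OF D(5)])
    moreover have "sp (a, z) \<in> sp ` box x \<longleftrightarrow> (a, z) \<in> T" for a z
      unfolding image_iff T_def box_def by (force simp: suspension_proj_eq_iff)
    hence "{y \<in> D. sp y \<in> sp ` box x} = D \<inter> T" by auto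
    ultimately show ?thesis using D(3) by auto
  qed
  ultimately show "case X of (U, f) \<Rightarrow> open (f ` (sp ` box x \<inter> U))"
    unfolding D(1) prod.case by (simp add: image_comp)
qed

lemma points_suspension: "points (suspension \<tau>) = range sp" "topspace (mtop (suspension \<tau>)) = range sp"
proof -
  have "points (suspension \<tau>) \<subseteq> range sp" unfolding points_def suspension_def quotient_atlas_def by auto
  moreover have top: "topspace (mtop (suspension \<tau>)) \<subseteq> points (suspension \<tau>)"
    using openin_topspace[of "mtop (suspension \<tau>)"] unfolding openin_suspension by blast
  moreover have "sp y \<in> topspace (mtop (suspension \<tau>))" for y
  proof -
    have aff: "sp (a, Affine w) \<in> topspace (mtop (suspension \<tau>))" for a w
      using openin_subset[OF openin_box[of a]] im_pos by (auto simp: box_def)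
    obtain a z where y: "y = (a, z)" by (metis surj_pair)
    show ?thesis
    proof (cases z)
      case (Affine w) thus ?thesis using aff y by simp
    next
      case Infinity
      have "sp (a, Infinity) = sp (a + \<tau>, Affine 0)"
        unfolding suspension_proj_eq_iff by (intro exI[of _ 0] exI[of _ 1]) (simp add: rho_def proj_inv_def)
      thus ?thesis using aff y Infinity by simp
    qed
  qed
  ultimately show "points (suspension \<tau>) = range sp" "topspace (mtop (suspension \<tau>)) = range sp" by auto
qed

lemma inverse_psi:
  obtains \<kappa> where "holomorphic_map S (suspension \<tau>) \<kappa>" "\<And>y. \<kappa> (\<psi> (sp y)) = sp y" "\<And>p. p \<in> points S \<Longrightarrow> \<psi> (\<kappa> p) = p"
proof -
  from biholomorphic obtain \<kappa> where "holomorphic_map S (suspension \<tau>) \<kappa>"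
    "\<forall>x\<in>points (suspension \<tau>). \<kappa> (\<psi> x) = x" "\<forall>y\<in>points S. \<psi> (\<kappa> y) = y"
    unfolding biholomorphic_map_def by blast
  note k = this[unfolded points_suspension]
  show ?thesis by (rule that[OF k(1)]) (use k(2,3) in blast)+
qed

lemma Psi_eq_iff: "Psi x z = Psi x' z' \<longleftrightarrow> (\<exists>m n. x' = x + of_int m + of_int n * \<tau> \<and> z' = rho m n z)"
proof -
  obtain \<kappa> where "holomorphic_map S (suspension \<tau>) \<kappa>" and k: "\<And>y. \<kappa> (\<psi> (sp y)) = sp y"
    and "\<And>p. p \<in> points S \<Longrightarrow> \<psi> (\<kappa> p) = p" by (rule inverse_psi) (rule that)
  have "Psi x z = Psi x' z' \<longleftrightarrow> sp (x, z) = sp (x', z')"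
  proof
    assume "Psi x z = Psi x' z'"
    hence "\<kappa> (\<psi> (sp (x, z))) = \<kappa> (\<psi> (sp (x', z')))" by (simp only: Psi_def)
    thus "sp (x, z) = sp (x', z')" by (simp only: k)
  qed (simp only: Psi_def)
  thus ?thesis unfolding suspension_proj_eq_iff .
qed

lemma Psi_shift: "Psi (x + of_int m + of_int n * \<tau>) (rho m n z) = Psi x z"
  using Psi_eq_iff[of x z "x + of_int m + of_int n * \<tau>" "rho m n z"] by auto

lemma Psi_inj: "Psi x z = Psi x z' \<Longrightarrow> z = z'"
proof -
  assume "Psi x z = Psi x z'"
  then obtain m n where mn: "x = x + of_int m + of_int n * \<tau>" "z' = rho m n z" using Psi_eq_iff by blast
  hence "0 = of_int m + of_int n * \<tau>" by simp
  from lattice_zero_iff[OF im_pos this] have "m = 0 \<and> n = 0" using im_pos by simp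
  thus ?thesis using mn by simp
qed

lemma Psi_Infinity: "Psi x Infinity = E (x + \<tau>, 0)"
  unfolding E_def using Psi_shift[of x 0 1 Infinity] by (simp add: rho_def proj_inv_def)

lemma proj_Psi: "\<pi> (Psi x z) = torus_proj \<tau> x"
  unfolding Psi_def by (rule proj)

lemma range_E: "range E = points S" "Psi x z \<in> points S"
proof -
  obtain \<kappa> where \<kappa>: "holomorphic_map S (suspension \<tau>) \<kappa>" "\<And>y. \<kappa> (\<psi> (sp y)) = sp y" "\<And>p. p \<in> points S \<Longrightarrow> \<psi> (\<kappa> p) = p"
    by (rule inverse_psi) (rule that)
  have "continuous_map (mtop (suspension \<tau>)) (mtop S) \<psi>"
    using biholomorphic unfolding biholomorphic_map_def holomorphic_map_def by simp
  hence "\<psi> ` topspace (mtop (suspension \<tau>)) \<subseteq> topspace (mtop S)"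
    by (rule continuous_map_image_subset_topspace)
  hence "\<psi> ` range sp \<subseteq> points S" unfolding points_suspension topspace_mtop[OF manifold] .
  thus in_S: "Psi x z \<in> points S" for x z unfolding Psi_def by blast
  have "continuous_map (mtop S) (mtop (suspension \<tau>)) \<kappa>"
    using \<kappa>(1) unfolding holomorphic_map_def by simp
  hence "\<kappa> ` topspace (mtop S) \<subseteq> topspace (mtop (suspension \<tau>))"
    by (rule continuous_map_image_subset_topspace)
  hence \<kappa>S: "\<kappa> ` points S \<subseteq> range sp" unfolding points_suspension topspace_mtop[OF manifold] .
  have "p \<in> range E" if p: "p \<in> points S" for p
  proof -
    have "\<kappa> p \<in> range sp" using \<kappa>S p by blast
    then obtain x z where "\<kappa> p = sp (x, z)" by auto
    hence pe: "p = Psi x z" using \<kappa>(3)[OF p] by (simp add: Psi_def)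
    show ?thesis
    proof (cases z)
      case (Affine w)
      hence "p = E (x, w)" using pe by (simp add: E_def)
      thus ?thesis by blast
    next
      case Infinity thus ?thesis using pe Psi_Infinity by simp
    qed
  qed
  thus "range E = points S" using in_S by (auto simp: E_def)
qed

lemma box_chart_sp: "v \<in> ball x (min 1 (Im \<tau>) / 2) \<times> UNIV \<Longrightarrow> box_chart x (sp (fst v, Affine (snd v))) = v"
  unfolding box_chart_def using inv_into_f_f[OF inj_on_box, of "(fst v, Affine (snd v))" x]
  by (auto simp: box_def)

lemma chart_inj: "(V, g) \<in> S \<Longrightarrow> inj_on g V"
proof -
  assume V: "(V, g) \<in> S"
  from manifold have "\<forall>(U, f)\<in>S. inj_on f U \<and> open (f ` U)" unfolding complex_manifold_def by simp
  from bspec[OF this V] show ?thesis by simp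
qed

lemma transition:
  assumes "(U, f) \<in> S" "(V, g) \<in> S"
  shows "open (f ` (U \<inter> V))" "cholomorphic_on (g \<circ> inv_into U f) (f ` (U \<inter> V))"
proof -
  from manifold have "\<forall>(U, f)\<in>S. \<forall>(V, g)\<in>S. open (f ` (U \<inter> V)) \<and> cholomorphic_on (g \<circ> inv_into U f) (f ` (U \<inter> V))"
    unfolding complex_manifold_def by simp
  from bspec[OF this assms(1)]
  have "\<forall>(V, g)\<in>S. open (f ` (U \<inter> V)) \<and> cholomorphic_on (g \<circ> inv_into U f) (f ` (U \<inter> V))" by simp
  from bspec[OF this assms(2)] show "open (f ` (U \<inter> V))" "cholomorphic_on (g \<circ> inv_into U f) (f ` (U \<inter> V))"
    by simp_all
qed

lemma chart_openin: "(V, g) \<in> S \<Longrightarrow> openin (mtop S) V"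
proof -
  assume V: "(V, g) \<in> S"
  have "openin (mtop S) W \<longleftrightarrow> W \<subseteq> points S \<and> (\<forall>(U, f)\<in>S. open (f ` (W \<inter> U)))" for W
    by (rule openin_mtop) (rule chart_inj)
  moreover have "V \<subseteq> points S" using V unfolding points_def by force
  moreover have "open (f ` (V \<inter> U))" if "(U, f) \<in> S" for U f
    using transition(1)[OF that V] by (simp add: Int_commute)
  ultimately show ?thesis by blast
qed

text \<open>On a box the map \<open>g \<circ> E\<close> is a chart expression of
  \<open>\<psi>\<close>, hence holomorphic. It has a holomorphic left inverse, the chart expression
  of the inverse of \<open>\<psi>\<close>, and its image is open by invariance of domain.\<close>

lemma uniformizes_surface: "uniformizes S E UNIV"
proof -
  obtain \<kappa> where \<kappa>: "holomorphic_map S (suspension \<tau>) \<kappa>" "\<And>y. \<kappa> (\<psi> (sp y)) = sp y" "\<And>p. p \<in> points S \<Longrightarrow> \<psi> (\<kappa> p) = p"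
    by (rule inverse_psi) (rule that)
  have \<psi>: "holomorphic_map (suspension \<tau>) S \<psi>" using biholomorphic unfolding biholomorphic_map_def by blast
  have loc: "\<exists>B k. open B \<and> a \<in> B \<and> B \<subseteq> E -` V \<and> (\<forall>x\<in>B. cdiff_at (\<lambda>x. g (E x)) x) \<and> open ((\<lambda>x. g (E x)) ` B) \<and>
      cholomorphic_on k ((\<lambda>x. g (E x)) ` B) \<and> (\<forall>x\<in>B. k (g (E x)) = x)"
    if V: "(V, g) \<in> S" and a: "E a \<in> V" for V g a
  proof -
    have gV: "inj_on g V" by (rule chart_inj[OF V])
    define x where "x = fst a"
    define B0 where "B0 = ball x (min 1 (Im \<tau>) / 2) \<times> (UNIV :: complex set)"
    define B where "B = B0 \<inter> E -` V"
    have cs: "box_chart x (sp (fst v, Affine (snd v))) = v" if "v \<in> B0" for v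
      by (rule box_chart_sp) (use that in \<open>simp add: B0_def\<close>)
    have bx: "box x = (\<lambda>v. (fst v, Affine (snd v))) ` B0"
    proof
      show "box x \<subseteq> (\<lambda>v. (fst v, Affine (snd v))) ` B0"
      proof
        fix y assume y: "y \<in> box x"
        hence "snd y \<noteq> Infinity" by (auto simp: box_def)
        then obtain w where "snd y = Affine w" unfolding neq_Infinity_iff by blast
        hence "y = (fst (fst y, w), Affine (snd (fst y, w)))" by (simp add: prod_eq_iff)
        moreover have "(fst y, w) \<in> B0" using y by (auto simp: box_def B0_def)
        ultimately show "y \<in> (\<lambda>v. (fst v, Affine (snd v))) ` B0" by (rule image_eqI)
      qed
    qed (auto simp: box_def B0_def)
    have "openin (mtop S) V" by (rule chart_openin[OF V])
    moreover have "continuous_map (mtop (suspension \<tau>)) (mtop S) \<psi>"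
      using \<psi> unfolding holomorphic_map_def by simp
    ultimately have "openin (mtop (suspension \<tau>)) {y \<in> topspace (mtop (suspension \<tau>)). \<psi> y \<in> V}"
      by (rule openin_continuous_map_preimage[rotated])
    hence "openin (mtop (suspension \<tau>)) {y \<in> range sp. \<psi> y \<in> V}"
      unfolding points_suspension .
    hence "\<forall>(U, f)\<in>suspension \<tau>. open (f ` ({y \<in> range sp. \<psi> y \<in> V} \<inter> U))"
      unfolding openin_suspension by (rule conjunct2)
    from bspec[OF this box_chart_in[of x]]
    have "open (box_chart x ` ({y \<in> range sp. \<psi> y \<in> V} \<inter> sp ` box x))" by simp
    moreover have im: "box_chart x ` ({y \<in> range sp. \<psi> y \<in> V} \<inter> sp ` box x) = B"
    proof -
      have "{y \<in> range sp. \<psi> y \<in> V} \<inter> sp ` box x = (\<lambda>v. sp (fst v, Affine (snd v))) ` B"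
        unfolding bx B_def E_def Psi_def by auto
      hence "box_chart x ` ({y \<in> range sp. \<psi> y \<in> V} \<inter> sp ` box x) = (\<lambda>v. box_chart x (sp (fst v, Affine (snd v)))) ` B"
        by (simp add: image_comp o_def)
      also have "\<dots> = (\<lambda>v. v) ` B" by (rule image_cong) (use cs in \<open>auto simp: B_def\<close>)
      finally show ?thesis by simp
    qed
    ultimately have oB: "open B" by simp
    have aB: "a \<in> B" using a im_pos by (auto simp: B_def B0_def x_def mem_Times_iff)
    have iv: "inv_into (sp ` box x) (box_chart x) v = sp (fst v, Affine (snd v))" if "v \<in> B0" for v
      by (rule inv_into_f_eq[OF suspension_chart_inj[OF box_chart_in]]) (use that cs bx in auto)
    have cd: "cdiff_at (\<lambda>v. g (E v)) v" if v: "v \<in> B" for v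
    proof -
      have "cholomorphic_on (g \<circ> \<psi> \<circ> inv_into (sp ` box x) (box_chart x)) (box_chart x ` (sp ` box x \<inter> \<psi> -` V))"
        by (rule holomorphic_mapD[OF \<psi> box_chart_in V])
      moreover have "v \<in> box_chart x ` (sp ` box x \<inter> \<psi> -` V)" using v im by blast
      ultimately have "cdiff_at (g \<circ> \<psi> \<circ> inv_into (sp ` box x) (box_chart x)) v" unfolding cholomorphic_on_iff by blast
      thus ?thesis by (rule cdiff_at_cong_open[OF _ oB v]) (auto simp: B_def iv E_def Psi_def)
    qed
    define k where "k = box_chart x \<circ> \<kappa> \<circ> inv_into V g"
    have kg: "k (g (E v)) = v" if "v \<in> B" for v
      using that gV cs \<kappa>(2) by (auto simp: k_def B_def E_def Psi_def)
    have "inj_on (\<lambda>v. g (E v)) B" by (rule inj_on_inverseI[of _ k]) (rule kg)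
    moreover have "continuous_on B (\<lambda>v. g (E v))"
      using cd cdiff_at_isCont continuous_at_imp_continuous_on by blast
    ultimately have oT: "open ((\<lambda>v. g (E v)) ` B)" using oB by (intro invariance_of_domain)
    have "(\<lambda>v. g (E v)) ` B \<subseteq> g ` (V \<inter> \<kappa> -` (sp ` box x))"
    proof (rule image_subsetI)
      fix v assume v: "v \<in> B"
      have "\<kappa> (E v) = sp (fst v, Affine (snd v))" using \<kappa>(2) by (simp add: E_def Psi_def)
      moreover have "(fst v, Affine (snd v)) \<in> box x" using v bx by (auto simp: B_def)
      ultimately have "E v \<in> V \<inter> \<kappa> -` (sp ` box x)" using v by (simp add: B_def)
      thus "g (E v) \<in> g ` (V \<inter> \<kappa> -` (sp ` box x))" by (rule imageI)
    qed
    moreover have "cholomorphic_on k (g ` (V \<inter> \<kappa> -` (sp ` box x)))"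
      unfolding k_def by (rule holomorphic_mapD[OF \<kappa>(1) V box_chart_in])
    ultimately have "cholomorphic_on k ((\<lambda>v. g (E v)) ` B)" using cholomorphic_on_subset by blast
    moreover have "B \<subseteq> E -` V" by (auto simp: B_def)
    ultimately show ?thesis using oB aB cd oT kg by (intro exI[of _ B] exI[of _ k] conjI ballI) assumption+
  qed
  show ?thesis
    unfolding uniformizes_def
  proof (intro conjI ballI)
    show "range E = points S" by (rule range_E)
    fix X assume "X \<in> S"
    then obtain V g where X: "X = (V, g)" and V: "(V, g) \<in> S" by (cases X) auto
    have op: "open (UNIV \<inter> E -` V)"
    proof (rule topological_space_class.openI)
      fix a assume "a \<in> UNIV \<inter> E -` V"
      hence "E a \<in> V" by simp
      from loc[OF V this] obtain B where "open B" "a \<in> B" "B \<subseteq> E -` V" by (elim exE conjE)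
      thus "\<exists>T. open T \<and> a \<in> T \<and> T \<subseteq> UNIV \<inter> E -` V" by auto
    qed
    have inj: "inj_on g V" by (rule chart_inj[OF V])
    show "case X of (U, f) \<Rightarrow> inj_on f U \<and> open (UNIV \<inter> E -` U) \<and> cholomorphic_on (\<lambda>x. f (E x)) (UNIV \<inter> E -` U) \<and>
      (\<forall>a\<in>UNIV \<inter> E -` U. \<exists>B k. open B \<and> a \<in> B \<and> B \<subseteq> UNIV \<inter> E -` U \<and> open ((\<lambda>x. f (E x)) ` B) \<and>
         cholomorphic_on k ((\<lambda>x. f (E x)) ` B) \<and> (\<forall>x\<in>B. k (f (E x)) = x))"
      unfolding X prod.case
    proof (intro conjI ballI inj op)
      show "cholomorphic_on (\<lambda>x. g (E x)) (UNIV \<inter> E -` V)"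
        unfolding cholomorphic_on_iff
      proof
        fix a assume "a \<in> UNIV \<inter> E -` V"
        hence "E a \<in> V" by simp
        from loc[OF V this] obtain B where "a \<in> B" "\<forall>x\<in>B. cdiff_at (\<lambda>x. g (E x)) x" by (elim exE conjE)
        thus "cdiff_at (\<lambda>x. g (E x)) a" by blast
      qed
      fix a assume "a \<in> UNIV \<inter> E -` V"
      hence "E a \<in> V" by simp
      from loc[OF V this] show "\<exists>B k. open B \<and> a \<in> B \<and> B \<subseteq> UNIV \<inter> E -` V \<and> open ((\<lambda>x. g (E x)) ` B) \<and>
         cholomorphic_on k ((\<lambda>x. g (E x)) ` B) \<and> (\<forall>x\<in>B. k (g (E x)) = x)"
        by (elim exE conjE, intro exI conjI) (assumption | simp)+
    qed
  qed simp
qed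

end

section \<open>Sections of the ruled surface\<close>

text \<open>Both alternatives describe open sets of base points. These are disjoint because
  punctured neighbourhoods are never empty, and the plane is connected.\<close>

lemma eventually_dichotomy:
  fixes P :: "complex \<Rightarrow> bool"
  assumes "\<And>a. (\<forall>\<^sub>F x in at a. P x) \<or> (\<forall>\<^sub>F x in at a. \<not> P x)"
  shows "(\<forall>a. \<forall>\<^sub>F x in at a. P x) \<or> (\<forall>a. \<forall>\<^sub>F x in at a. \<not> P x)"
proof -
  define A where "A = {a. \<forall>\<^sub>F x in at a. P x}"
  have nA: "- A = {a. \<forall>\<^sub>F x in at a. \<not> P x}"
  proof -
    have "\<not> ((\<forall>\<^sub>F x in at a. P x) \<and> (\<forall>\<^sub>F x in at a. \<not> P x))" for a
    proof
      assume "(\<forall>\<^sub>F x in at a. P x) \<and> (\<forall>\<^sub>F x in at a. \<not> P x)"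
      hence "\<forall>\<^sub>F x in at a. P x" "\<forall>\<^sub>F x in at a. \<not> P x" by blast+
      hence "\<forall>\<^sub>F x in at a. False" by eventually_elim simp
      thus False by simp
    qed
    thus ?thesis using assms unfolding A_def by blast
  qed
  have op: "open {a. \<forall>\<^sub>F x in at a. Q x}" for Q :: "complex \<Rightarrow> bool"
  proof (rule topological_space_class.openI)
    fix a assume "a \<in> {a. \<forall>\<^sub>F x in at a. Q x}"
    hence "\<forall>\<^sub>F x in nhds a. \<forall>\<^sub>F y in at x. Q y" by (intro eventually_at_imp_nhds_at) simp
    thus "\<exists>T. open T \<and> a \<in> T \<and> T \<subseteq> {a. \<forall>\<^sub>F x in at a. Q x}" unfolding eventually_nhds by blast
  qed
  have "open A" "open (- A)" unfolding nA unfolding A_def by (rule op)+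
  hence "A = {} \<or> A = UNIV" using connected_clopen[of "UNIV :: complex set"]
    by (simp add: closed_def connected_UNIV)
  thus ?thesis using nA unfolding A_def by blast
qed

lemma affine_coord_neg: "affine_coord (proj_neg z) = - affine_coord z"
  by (cases z) (auto simp: proj_neg_def)

lemma affine_coord_inv: "affine_coord (proj_inv z) = inverse (affine_coord z)"
  by (cases z) (auto simp: proj_inv_def inverse_eq_divide)

lemma cholomorphic_imp_analytic:
  fixes f :: "complex \<Rightarrow> complex"
  assumes "open B" "a \<in> B" "cholomorphic_on f B"
  shows "f analytic_on {a}"
proof -
  have "f holomorphic_on B"
    unfolding holomorphic_on_def
  proof
    fix x assume "x \<in> B"
    hence "cdiff_at f x" using assms(3) by (simp add: cholomorphic_on_iff)
    hence "f field_differentiable at x" by (simp add: cdiff_at_complex_iff)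
    thus "f field_differentiable at x within B" by (rule field_differentiable_at_within)
  qed
  thus ?thesis using assms analytic_at by blast
qed

context suspended_surface
begin

abbreviation "p \<equiv> torus_proj \<tau>"
abbreviation "C \<equiv> elliptic_curve \<tau>"

lemmas uniformizes_C = uniformizes_elliptic_curve[OF im_pos]

lemma points_C: "points C = range p"
  using uniformizes_basic(2)[OF uniformizes_C] by simp

lemma Psi_plus_1: "Psi (x + 1) (proj_neg z) = Psi x z"
  using Psi_shift[of x 1 0 z] by (simp add: rho_def)

lemma Psi_plus_tau: "Psi (x + \<tau>) (proj_inv z) = Psi x z"
  using Psi_shift[of x 0 1 z] by (simp add: rho_def)

definition is_graph :: "(complex \<Rightarrow> complex) \<Rightarrow> (complex set \<Rightarrow> 's) \<Rightarrow> bool"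
  where "is_graph f \<sigma> \<longleftrightarrow> equivariant \<tau> f \<and> (\<forall>x. \<sigma> (p x) = Psi x (proj_lift f x))"

lemma is_graph_exists:
  assumes "equivariant \<tau> f"
  shows "\<exists>\<sigma>. is_graph f \<sigma>"
proof -
  interpret equivariant \<tau> f by fact
  define \<sigma> where "\<sigma> q = (let x = SOME x. p x = q in Psi x (proj_lift f x))" for q
  have "\<sigma> (p x) = Psi x (proj_lift f x)" for x
  proof -
    define y where "y = (SOME y. p y = p x)"
    have "p y = p x" unfolding y_def by (rule someI) simp
    then obtain m n where "y - x = of_int m + of_int n * \<tau>"
      unfolding torus_proj_eq_iff lattice_iff by blast
    hence y: "y = x + of_int m + of_int n * \<tau>" by (simp add: algebra_simps)
    have "\<sigma> (p x) = Psi y (proj_lift f y)" by (simp add: \<sigma>_def y_def Let_def)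
    thus ?thesis unfolding y lift_plus Psi_shift .
  qed
  thus ?thesis using assms unfolding is_graph_def by blast
qed

lemma graph_local:
  assumes "is_graph f \<sigma>" "f analytic_on {a}"
  obtains B where "open B" "a \<in> B" "\<And>x. x \<in> B \<Longrightarrow> f analytic_on {x}" "\<And>x. x \<in> B \<Longrightarrow> \<sigma> (p x) = E (x, f x)"
proof -
  from analytic_at_eventually_analytic[OF assms(2)] obtain B where B: "open B" "a \<in> B" "\<And>x. x \<in> B \<Longrightarrow> f analytic_on {x}"
    unfolding eventually_nhds by blast
  moreover have "\<sigma> (p x) = E (x, f x)" if "x \<in> B" for x
    using B(3)[OF that] assms(1) by (simp add: is_graph_def proj_lift_def E_def)
  ultimately show ?thesis using that by blast
qed

lemma graph_is_section:
  assumes g: "is_graph f \<sigma>"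
  shows "is_section C S \<pi> \<sigma>"
proof -
  interpret equivariant \<tau> f using g by (simp add: is_graph_def)
  have lift: "\<exists>B G. open B \<and> a \<in> B \<and> cholomorphic_on G B \<and> (\<forall>x\<in>B. \<sigma> (p x) = E (G x))" if "f analytic_on {a}" for a
  proof -
    obtain B where B: "open B" "a \<in> B" "\<And>x. x \<in> B \<Longrightarrow> f analytic_on {x}" "\<And>x. x \<in> B \<Longrightarrow> \<sigma> (p x) = E (x, f x)"
      using graph_local[OF g \<open>f analytic_on {a}\<close>] by metis
    have "cholomorphic_on (\<lambda>x. (x, f x)) B"
      unfolding cholomorphic_on_iff by (intro ballI cdiff_at_Pair cdiff_at_ident cdiff_at_analytic B(3))
    thus ?thesis using B by blast
  qed
  have "has_local_lifts p UNIV E UNIV \<sigma>"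
    unfolding has_local_lifts_def
  proof
    fix a
    show "\<exists>B G. open B \<and> a \<in> B \<and> B \<subseteq> UNIV \<and> G ` B \<subseteq> UNIV \<and> cholomorphic_on G B \<and> (\<forall>x\<in>B. \<sigma> (p x) = E (G x))"
    proof (cases "f analytic_on {a}")
      case True thus ?thesis using lift[OF True] by simp
    next
      case False
      \<comment> \<open>At a pole the lift is taken at the translate, where the function is finite;
        the translate represents the same point of the curve.\<close>
      obtain B G where B: "open B" "a + \<tau> \<in> B" "cholomorphic_on G B" "\<forall>x\<in>B. \<sigma> (p x) = E (G x)"
        using lift[OF not_analytic(1)[OF False]] by blast
      have "open ((\<lambda>x. x + \<tau>) -` B)" by (rule open_vimage[OF B(1)]) (intro continuous_intros)
      moreover have "cholomorphic_on (\<lambda>x. G (x + \<tau>)) ((\<lambda>x. x + \<tau>) -` B)"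
        unfolding cholomorphic_on_iff
      proof
        fix x assume "x \<in> (\<lambda>x. x + \<tau>) -` B"
        hence "cdiff_at G (x + \<tau>)" using B(3) by (simp add: cholomorphic_on_iff)
        moreover have "cdiff_at (\<lambda>x. x + \<tau>) x" by (intro cdiff_intros)
        ultimately show "cdiff_at (\<lambda>x. G (x + \<tau>)) x" using cdiff_at_compose by blast
      qed
      moreover have "\<forall>x\<in>(\<lambda>x. x + \<tau>) -` B. \<sigma> (p x) = E (G (x + \<tau>))"
        using B(4) by (metis torus_proj_plus(2) vimage_eq)
      ultimately show ?thesis using B(2)
        by (intro exI[of _ "(\<lambda>x. x + \<tau>) -` B"] exI[of _ "\<lambda>x. G (x + \<tau>)"]) simp
    qed
  qed
  hence "holomorphic_map C S \<sigma>" by (rule holomorphic_mapI[OF uniformizes_C uniformizes_surface])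
  moreover have "\<pi> (\<sigma> q) = q" if "q \<in> points C" for q
    using that g unfolding points_C by (auto simp: is_graph_def proj_Psi)
  ultimately show ?thesis unfolding is_section_def by blast
qed

lemma surface_point_over:
  assumes "s \<in> points S" "\<pi> s = p x"
  shows "\<exists>z. s = Psi x z"
proof -
  obtain v where v: "s = E v" using assms(1) range_E(1) by blast
  hence "p (fst v) = p x" using assms(2) by (simp add: E_def proj_Psi)
  hence "x - fst v \<in> lattice \<tau>" using torus_proj_eq_iff[of \<tau> x "fst v"] by simp
  then obtain m n where "x - fst v = of_int m + of_int n * \<tau>" unfolding lattice_iff by blast
  hence "x = fst v + of_int m + of_int n * \<tau>" by (simp add: algebra_simps)
  hence "s = Psi x (rho m n (Affine (snd v)))" using v by (simp add: E_def Psi_shift)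
  thus ?thesis by blast
qed

text \<open>Injectivity of \<open>Psi x\<close> determines a coordinate \<open>F\<close> of the
  section over the plane, and by uniqueness it is equivariant. What has to be shown is that
  \<open>F\<close> is holomorphic where it is finite and that its affine coordinate does not vanish
  identically.\<close>

lemma section_is_graph:
  assumes sec: "is_section C S \<pi> \<sigma>"
  shows "\<exists>f. is_graph f \<sigma>"
proof -
  have hol: "holomorphic_map C S \<sigma>" and over: "\<And>x. \<pi> (\<sigma> (p x)) = p x"
    using sec unfolding is_section_def points_C by auto
  have "continuous_map (mtop C) (mtop S) \<sigma>" using hol unfolding holomorphic_map_def by simp
  hence "\<sigma> ` topspace (mtop C) \<subseteq> topspace (mtop S)" by (rule continuous_map_image_subset_topspace)
  hence inS: "\<sigma> (p x) \<in> points S" for x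
    unfolding uniformizes_topspace[OF uniformizes_C] uniformizes_topspace[OF uniformizes_surface] points_C by blast
  have "\<forall>x. \<exists>z. \<sigma> (p x) = Psi x z" using surface_point_over[OF inS over] by blast
  then obtain F where F: "\<And>x. \<sigma> (p x) = Psi x (F x)" by metis
  have F1: "F (x + 1) = proj_neg (F x)" for x
  proof (rule Psi_inj)
    show "Psi (x + 1) (F (x + 1)) = Psi (x + 1) (proj_neg (F x))"
      unfolding Psi_plus_1 F[symmetric] by simp
  qed
  have Ft: "F (x + \<tau>) = proj_inv (F x)" for x
  proof (rule Psi_inj)
    show "Psi (x + \<tau>) (F (x + \<tau>)) = Psi (x + \<tau>) (proj_inv (F x))"
      unfolding Psi_plus_tau F[symmetric] by simp
  qed
  define f where "f x = affine_coord (F x)" for x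
  have loc: "f analytic_on {a} \<and> (\<forall>\<^sub>F x in nhds a. F x = Affine (f x))" if fin: "F a \<noteq> Infinity" for a
  proof -
    have "\<sigma> (p a) = E (a, f a)" using fin F[of a] by (auto simp: E_def f_def neq_Infinity_iff)
    then obtain B G where B: "open B" "a \<in> B" "cholomorphic_on G B" "G a = (a, f a)" "\<And>x. x \<in> B \<Longrightarrow> \<sigma> (p x) = E (G x)"
      using holomorphic_map_lift[OF uniformizes_C uniformizes_surface hol, of a "(a, f a)"] by auto
    \<comment> \<open>The first coordinate of a lift through \<open>E\<close> agrees with
      \<open>x\<close> only modulo Lambda. By continuity the difference is small near
      \<open>a\<close>, hence 0, and so the second coordinate of the lift is the affine coordinate
      of \<open>F\<close>.\<close>
    have "isCont G a" using B(2,3) cdiff_at_isCont unfolding cholomorphic_on_iff by blast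
    hence "isCont (\<lambda>x. fst (G x) - x) a" by (intro continuous_intros)
    hence "((\<lambda>x. fst (G x) - x) \<longlongrightarrow> 0) (at a)" using B(4) by (simp add: isCont_def)
    hence "\<forall>\<^sub>F x in at a. dist (fst (G x) - x) 0 < min 1 (Im \<tau>)"
      by (rule tendstoD) (use im_pos in simp)
    hence "\<forall>\<^sub>F x in nhds a. norm (fst (G x) - x) < min 1 (Im \<tau>)"
      using B(4) im_pos by (simp add: eventually_nhds_conv_at)
    moreover have "\<forall>\<^sub>F x in nhds a. x \<in> B" using B(1,2) by (rule eventually_nhds_in_open)
    ultimately have ev: "\<forall>\<^sub>F x in nhds a. F x = Affine (snd (G x))"
    proof eventually_elim
      case (elim x)
      have "p (fst (G x)) = p x" using over[of x] B(5)[OF elim(2)] by (simp add: E_def proj_Psi)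
      hence "fst (G x) - x \<in> lattice \<tau>" by (simp add: torus_proj_eq_iff)
      from lattice_small[OF im_pos this elim(1)] have "fst (G x) = x" by simp
      hence "Psi x (F x) = Psi x (Affine (snd (G x)))" using B(5)[OF elim(2)] F[of x] by (simp add: E_def)
      thus ?case by (rule Psi_inj)
    qed
    hence evf: "\<forall>\<^sub>F x in nhds a. f x = snd (G x)" by eventually_elim (simp add: f_def)
    have "(\<lambda>x. snd (G x)) analytic_on {a}"
    proof (rule cholomorphic_imp_analytic[OF B(1,2)])
      show "cholomorphic_on (\<lambda>x. snd (G x)) B"
        unfolding cholomorphic_on_iff
      proof
        fix x assume "x \<in> B"
        hence "cdiff_at G x" using B(3) by (simp add: cholomorphic_on_iff)
        thus "cdiff_at (\<lambda>x. snd (G x)) x" by (rule cdiff_at_compose) (rule cdiff_at_snd)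
      qed
    qed
    hence "f analytic_on {a}" using analytic_at_cong[OF evf refl] by simp
    moreover have "\<forall>\<^sub>F x in nhds a. F x = Affine (f x)" using ev evf by eventually_elim simp
    ultimately show ?thesis by blast
  qed
  have f1: "f (x + 1) = - f x" for x by (simp add: f_def F1 affine_coord_neg)
  have ft: "f (x + \<tau>) = inverse (f x)" for x by (simp add: f_def Ft affine_coord_inv)
  have shift_fin: "F (a + \<tau>) = Affine 0" if "F a = Infinity" for a using that Ft by (simp add: proj_inv_def)
  have reg: "f analytic_on {a} \<or> f analytic_on {a + \<tau>}" for a
  proof (cases "F a = Infinity")
    case True thus ?thesis using loc[of "a + \<tau>"] shift_fin by simp
  next
    case False thus ?thesis using loc by blast
  qed
  have dich: "(\<forall>\<^sub>F x in at a. f x = 0) \<or> (\<forall>\<^sub>F x in at a. f x \<noteq> 0)" for a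
  proof -
    have *: "(\<forall>\<^sub>F x in at a. f x = 0) \<or> (\<forall>\<^sub>F x in at a. f x \<noteq> 0)" if "f analytic_on {a}" for a
      using analytic_locally_zero_or_has_ord[OF that] has_ord_nonzero eventually_nhds_imp_at by blast
    show ?thesis
    proof (cases "f analytic_on {a}")
      case False
      hence "f analytic_on {a + \<tau>}" using reg by blast
      from *[OF this] have "(\<forall>\<^sub>F x in at a. f (x + \<tau>) = 0) \<or> (\<forall>\<^sub>F x in at a. f (x + \<tau>) \<noteq> 0)"
        using eventually_at_shift by blast
      thus ?thesis by (simp add: ft)
    qed (use * in blast)
  qed
  have nz: "\<forall>\<^sub>F x in at a. f x \<noteq> 0" for a
  proof (rule ccontr)
    assume "\<not> (\<forall>\<^sub>F x in at a. f x \<noteq> 0)"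
    hence z: "\<forall>\<^sub>F x in at a. f x = 0" for a using eventually_dichotomy[of "\<lambda>x. f x = 0", OF dich] by blast
    have F0: "F a = Affine 0" if "F a \<noteq> Infinity" for a
    proof -
      have "f analytic_on {a}" using loc[OF that] by blast
      from analytic_locally_zero_or_has_ord[OF this] have "f a = 0"
      proof
        assume "\<forall>\<^sub>F x in nhds a. f x = 0" thus ?thesis by (rule eventually_nhds_x_imp_x)
      next
        assume "has_ord f a (zorder f a)"
        from has_ord_nonzero[OF this] z[of a] have "\<forall>\<^sub>F x in at a. False" by eventually_elim simp
        thus ?thesis by simp
      qed
      thus ?thesis using that by (auto simp: f_def neq_Infinity_iff)
    qed
    \<comment> \<open>Now \<open>F\<close> takes only the values 0 and infinity, which translation
      by \<open>\<tau>\<close> exchanges. So \<open>A\<close> and its complement would both be open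
      and nonempty, against connectedness.\<close>
    define A where "A = {a. F a \<noteq> Infinity}"
    have oA: "open A"
    proof (rule topological_space_class.openI)
      fix a assume "a \<in> A"
      hence "\<forall>\<^sub>F x in nhds a. F x = Affine (f x)" using loc unfolding A_def by blast
      hence "\<forall>\<^sub>F x in nhds a. x \<in> A" by eventually_elim (simp add: A_def)
      thus "\<exists>T. open T \<and> a \<in> T \<and> T \<subseteq> A" unfolding eventually_nhds by blast
    qed
    have sA: "x + \<tau> \<in> A \<longleftrightarrow> x \<notin> A" for x
    proof (cases "F x = Infinity")
      case True thus ?thesis using shift_fin by (simp add: A_def)
    next
      case False
      hence "F x = Affine 0" by (rule F0)
      hence "F (x + \<tau>) = Infinity" by (simp add: Ft proj_inv_def)
      thus ?thesis using False by (simp add: A_def)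
    qed
    have "- A = (\<lambda>x. x + \<tau>) -` A" using sA by auto
    moreover have "open ((\<lambda>x. x + \<tau>) -` A)" by (rule open_vimage[OF oA]) (intro continuous_intros)
    ultimately have "open (- A)" by simp
    hence "A = {} \<or> A = UNIV" using connected_clopen[of "UNIV :: complex set"] oA
      by (simp add: closed_def connected_UNIV)
    thus False using sA[of 0] by auto
  qed
  have eq: "equivariant \<tau> f"
    by standard (use im_pos f1 ft reg nz in auto)
  interpret equivariant \<tau> f by (rule eq)
  have "proj_lift f x = F x" for x
  proof (cases "F x = Infinity")
    case True
    hence "f analytic_on {x + \<tau>}" "f (x + \<tau>) = 0" using shift_fin[OF True] loc[of "x + \<tau>"] by (auto simp: f_def)
    moreover have "f x = 0" by (simp add: f_def True)
    ultimately have "\<not> f analytic_on {x}" using zero_not_analytic_plus_tau[of x] by blast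
    thus ?thesis using True by (simp add: proj_lift_def)
  next
    case False
    hence "f analytic_on {x}" "F x = Affine (f x)" using loc[OF False] eventually_nhds_x_imp_x by blast+
    thus ?thesis by (simp add: proj_lift_def)
  qed
  thus ?thesis using eq F unfolding is_graph_def by auto
qed

end

section \<open>Holomorphic dependence of derivatives on parameters\<close>

text \<open>The bound depends on \<open>u\<close> only through \<open>M\<close> and
  \<open>R\<close>, so it is uniform when \<open>u\<close> varies with a parameter. The factor 32 is
  2! times 4^2, from Cauchy's estimate of the second derivative on balls of radius
  \<open>R / 4\<close>.\<close>

lemma difference_quotient_estimate:
  fixes u :: "complex \<Rightarrow> complex"
  assumes u: "u holomorphic_on ball 0 R" and M: "\<And>h. h \<in> ball 0 R \<Longrightarrow> norm (u h) < M"
    and R: "R > 0" and h: "norm h < R / 4" "h \<noteq> 0"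
  shows "norm ((u h - u 0) / h - deriv u 0) \<le> 32 * M / R\<^sup>2 * norm h"
proof -
  have cb: "norm ((deriv ^^ 2) u x) \<le> 32 * M / R\<^sup>2" if x: "x \<in> ball 0 (R / 4)" for x
  proof -
    have sub: "cball x (R / 4) \<subseteq> ball 0 R" "ball x (R / 4) \<subseteq> ball 0 R"
    proof -
      show "cball x (R / 4) \<subseteq> ball 0 R"
      proof
        fix y assume "y \<in> cball x (R / 4)"
        hence "norm y \<le> norm x + R / 4" using norm_triangle_sub[of y x] by (simp add: dist_norm norm_minus_commute)
        thus "y \<in> ball 0 R" using x R by simp
      qed
      thus "ball x (R / 4) \<subseteq> ball 0 R" using ball_subset_cball by blast
    qed
    have "norm ((deriv ^^ 2) u x) \<le> fact 2 * M / (R / 4) ^ 2"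
    proof (rule Cauchy_higher_deriv_bound[where y = 0])
      show "u holomorphic_on ball x (R / 4)" using u sub by (rule_tac holomorphic_on_subset)
      show "continuous_on (cball x (R / 4)) u"
        using u sub holomorphic_on_imp_continuous_on continuous_on_subset by blast
      show "u w \<in> ball 0 M" if "w \<in> ball x (R / 4)" for w using M sub(2) that by auto
    qed (use R in auto)
    also have "\<dots> = 32 * M / R\<^sup>2" by (simp add: power2_eq_square)
    finally show ?thesis .
  qed
  have "norm ((deriv ^^ 0) u h - (\<Sum>i\<le>1. (deriv ^^ i) u 0 * (h - 0) ^ i / fact i)) \<le>
      32 * M / R\<^sup>2 * norm (h - 0) ^ Suc 1 / fact 1"
  proof (rule complex_Taylor[of "ball 0 (R / 4)"])
    fix i and x :: complex assume "x \<in> ball 0 (R / 4)" "i \<le> (1::nat)"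
    hence x: "x \<in> ball 0 R" using R by auto
    have "(deriv ^^ i) u holomorphic_on ball 0 R" by (rule holomorphic_higher_deriv[OF u]) simp
    hence "((deriv ^^ i) u has_field_derivative deriv ((deriv ^^ i) u) x) (at x)"
      using x by (intro holomorphic_derivI) auto
    thus "((deriv ^^ i) u has_field_derivative (deriv ^^ Suc i) u x) (at x within ball 0 (R / 4))"
      by (simp add: has_field_derivative_at_within)
  next
    fix x :: complex assume "x \<in> ball 0 (R / 4)"
    thus "norm ((deriv ^^ Suc 1) u x) \<le> 32 * M / R\<^sup>2" using cb by (simp add: numeral_2_eq_2)
  qed (use R h in auto)
  hence e: "norm (u h - u 0 - deriv u 0 * h) \<le> 32 * M / R\<^sup>2 * norm h * norm h"
    by (simp add: algebra_simps)
  have "(u h - u 0) / h - deriv u 0 = (u h - u 0 - deriv u 0 * h) / h" using h by (simp add: field_simps)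
  hence "norm ((u h - u 0) / h - deriv u 0) = norm (u h - u 0 - deriv u 0 * h) / norm h"
    by (simp add: norm_divide)
  also have "\<dots> \<le> (32 * M / R\<^sup>2 * norm h * norm h) / norm h" using e by (rule divide_right_mono) simp
  finally show ?thesis using h by simp
qed

text \<open>Differentiability of \<open>F\<close> is given at first order only. The derivative in
  \<open>h\<close> depends analytically on \<open>t\<close> because it is a locally uniform limit of
  difference quotients, each of which is holomorphic in \<open>t\<close>.\<close>

lemma deriv_parameter_analytic:
  fixes F :: "complex \<times> complex \<Rightarrow> complex"
  assumes O: "open W" "(a, 0) \<in> W" and F: "\<And>v. v \<in> W \<Longrightarrow> cdiff_at F v"
  shows "(\<lambda>t. deriv (\<lambda>h. F (t, h)) 0) analytic_on {a}"
proof -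
  obtain A B where "open A" "open B" "(a, 0) \<in> A \<times> B" "A \<times> B \<subseteq> W"
    using open_prod_elim[OF O] by metis
  hence AB: "open A" "open B" "a \<in> A" "0 \<in> B" "A \<times> B \<subseteq> W" by auto
  obtain r1 where r1: "r1 > 0" "cball a r1 \<subseteq> A" using AB open_contains_cball by blast
  obtain r2 where r2: "r2 > 0" "cball 0 r2 \<subseteq> B" using AB open_contains_cball by blast
  have sub: "cball a r1 \<times> cball 0 r2 \<subseteq> W" using AB r1 r2 by blast
  have "continuous_on (cball a r1 \<times> cball 0 r2) F"
    using sub F cdiff_at_isCont continuous_at_imp_continuous_on by blast
  hence "bounded (F ` (cball a r1 \<times> cball 0 r2))"
    by (intro compact_imp_bounded compact_continuous_image compact_Times compact_cball)
  then obtain M where M: "\<And>v. v \<in> cball a r1 \<times> cball 0 r2 \<Longrightarrow> norm (F v) < M"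
    unfolding bounded_pos_less by blast
  have hh: "(\<lambda>h. F (t, h)) holomorphic_on ball 0 r2" if "t \<in> cball a r1" for t
    unfolding holomorphic_on_def
  proof
    fix h :: complex assume h: "h \<in> ball 0 r2"
    have "cdiff_at (\<lambda>h. (t, h)) h" by (intro cdiff_intros)
    moreover have "(t, h) \<in> cball a r1 \<times> cball 0 r2" using that h by simp
    hence "cdiff_at F (t, h)" using F sub by blast
    ultimately have "cdiff_at (\<lambda>h. F (t, h)) h" by (rule cdiff_at_compose)
    thus "(\<lambda>h. F (t, h)) field_differentiable at h within ball 0 r2"
      by (simp add: cdiff_at_complex_iff field_differentiable_at_within)
  qed
  have ht: "(\<lambda>t. F (t, h)) holomorphic_on ball a r1" if "h \<in> cball 0 r2" for h
    unfolding holomorphic_on_def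
  proof
    fix t assume t: "t \<in> ball a r1"
    have "cdiff_at (\<lambda>t. (t, h)) t" by (intro cdiff_intros)
    moreover have "(t, h) \<in> cball a r1 \<times> cball 0 r2" using that t by simp
    hence "cdiff_at F (t, h)" using F sub by blast
    ultimately have "cdiff_at (\<lambda>t. F (t, h)) t" by (rule cdiff_at_compose)
    thus "(\<lambda>t. F (t, h)) field_differentiable at t within ball a r1"
      by (simp add: cdiff_at_complex_iff field_differentiable_at_within)
  qed
  \<comment> \<open>Step sizes that tend to 0 and stay below \<open>r2 / 4\<close>, as the estimate
    demands.\<close>
  define e where "e n = complex_of_real (r2 / 8 / real (Suc n))" for n
  have e: "e n \<noteq> 0" "norm (e n) < r2 / 4" "norm (e n) = r2 / 8 / real (Suc n)" for n
  proof -
    have "r2 / 8 / real (Suc n) \<noteq> 0" using r2 by simp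
    thus "e n \<noteq> 0" unfolding e_def of_real_eq_0_iff .
    show ne: "norm (e n) = r2 / 8 / real (Suc n)" using r2 unfolding e_def norm_of_real by simp
    have "r2 / 8 / real (Suc n) \<le> r2 / 8" using r2 by (simp add: field_simps)
    hence "norm (e n) \<le> r2 / 8" by (simp only: ne)
    thus "norm (e n) < r2 / 4" using r2(1) by linarith
  qed
  define d where "d n t = (F (t, e n) - F (t, 0)) / e n" for n t
  define K where "K = 32 * M / r2\<^sup>2"
  have est: "norm (d n t - deriv (\<lambda>h. F (t, h)) 0) \<le> K * norm (e n)" if t: "t \<in> cball a r1" for n t
    unfolding d_def K_def
  proof (rule difference_quotient_estimate[of "\<lambda>h. F (t, h)"])
    show "norm (F (t, h)) < M" if "h \<in> ball 0 r2" for h using M t that by auto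
  qed (use hh[OF t] r2 e in auto)
  have "(\<lambda>n. K * norm (e n)) \<longlonglongrightarrow> K * 0"
  proof (intro tendsto_mult tendsto_const)
    have "(\<lambda>n. r2 / 8 / real (Suc n)) \<longlonglongrightarrow> 0"
      by (rule LIMSEQ_Suc[where f = "\<lambda>n. r2 / 8 / real n", OF lim_const_over_n])
    thus "(\<lambda>n. norm (e n)) \<longlonglongrightarrow> 0" unfolding e(3) .
  qed
  hence lim: "(\<lambda>n. K * norm (e n)) \<longlonglongrightarrow> 0" by simp
  have "uniform_limit (cball a r1) d (\<lambda>t. deriv (\<lambda>h. F (t, h)) 0) sequentially"
  proof (rule uniform_limitI)
    fix \<epsilon> :: real assume "\<epsilon> > 0"
    hence "\<forall>\<^sub>F n in sequentially. K * norm (e n) < \<epsilon>" using lim by (rule_tac order_tendstoD(2))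
    thus "\<forall>\<^sub>F n in sequentially. \<forall>t\<in>cball a r1. dist (d n t) (deriv (\<lambda>h. F (t, h)) 0) < \<epsilon>"
    proof eventually_elim
      case (elim n)
      show ?case
      proof
        fix t assume "t \<in> cball a r1"
        from est[OF this, of n] elim show "dist (d n t) (deriv (\<lambda>h. F (t, h)) 0) < \<epsilon>"
          unfolding dist_norm by linarith
      qed
    qed
  qed
  hence ul: "uniform_limit (ball a r1) d (\<lambda>t. deriv (\<lambda>h. F (t, h)) 0) sequentially"
    by (rule uniform_limit_on_subset) (rule ball_subset_cball)
  have "(\<lambda>t. deriv (\<lambda>h. F (t, h)) 0) holomorphic_on ball a r1"
  proof (rule holomorphic_uniform_sequence[of _ d])
    show "d n holomorphic_on ball a r1" for n
    proof -
      have "e n \<in> cball 0 r2" using e(2)[of n] r2 by (simp add: dist_norm)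
      thus ?thesis unfolding d_def using e(1) r2 by (intro holomorphic_intros ht) auto
    qed
    fix x assume "x \<in> ball a r1"
    then obtain s where s: "s > 0" "cball x s \<subseteq> ball a r1" using open_contains_cball open_ball by blast
    thus "\<exists>s>0. cball x s \<subseteq> ball a r1 \<and> uniform_limit (cball x s) d (\<lambda>t. deriv (\<lambda>h. F (t, h)) 0) sequentially"
      using uniform_limit_on_subset[OF ul] by blast
  qed simp
  thus ?thesis using r1 analytic_at by (metis centre_in_ball open_ball)
qed

section \<open>Complex-linear maps of the plane\<close>

definition det2 :: "complex \<times> complex \<Rightarrow> complex \<times> complex \<Rightarrow> complex"
  where "det2 u v = fst u * snd v - snd u * fst v"

definition clinear2 :: "(complex \<times> complex \<Rightarrow> complex \<times> complex) \<Rightarrow> bool"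
  where "clinear2 L \<longleftrightarrow> (\<forall>u v. L (u + v) = L u + L v) \<and> (\<forall>c v. L (c *\<^sub>C v) = c *\<^sub>C L v)"

lemma clinear2_expand:
  assumes "clinear2 L"
  shows "L (x, y) = x *\<^sub>C L (1, 0) + y *\<^sub>C L (0, 1)"
proof -
  have "(x, y) = x *\<^sub>C (1, 0) + y *\<^sub>C ((0, 1) :: complex \<times> complex)"
    by (simp add: scaleC_prod_def scaleC_complex_def)
  thus ?thesis using assms unfolding clinear2_def by metis
qed

lemma clinear2_det:
  assumes "clinear2 L"
  shows "det2 (L u) (L v) = det2 (L (1, 0)) (L (0, 1)) * det2 u v"
proof -
  obtain x y x' y' where uv: "u = (x, y)" "v = (x', y')" by (metis surj_pair)
  show ?thesis unfolding uv clinear2_expand[OF assms, of x y] clinear2_expand[OF assms, of x' y']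
    by (simp add: det2_def scaleC_prod_def scaleC_complex_def algebra_simps)
qed

lemma clinear2_det_nonzero:
  assumes "clinear2 L" "\<And>v. L v = 0 \<Longrightarrow> v = 0"
  shows "det2 (L (1, 0)) (L (0, 1)) \<noteq> 0"
proof
  obtain a b c d where L: "L (1, 0) = (a, b)" "L (0, 1) = (c, d)" by (metis surj_pair)
  assume "det2 (L (1, 0)) (L (0, 1)) = 0"
  hence ad: "a * d = b * c" by (simp add: L det2_def)
  have Lxy: "L (x, y) = (x * a + y * c, x * b + y * d)" for x y
    unfolding clinear2_expand[OF assms(1), of x y] L by (simp add: scaleC_prod_def scaleC_complex_def)
  \<comment> \<open>If the columns of the matrix are dependent, these two vectors lie in the kernel;
    so all entries vanish.\<close>
  have "L (c, - a) = 0" "L (d, - b) = 0" using ad by (simp_all add: Lxy zero_prod_def algebra_simps)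
  hence "(c, - a) = 0" "(d, - b) = 0" using assms(2) by blast+
  hence "L (1, 0) = 0" by (simp add: L zero_prod_def)
  hence "((1, 0) :: complex \<times> complex) = 0" using assms(2) by blast
  thus False by (simp add: zero_prod_def)
qed

lemma cdiff_frechet:
  assumes "cdiff_at f x"
  shows "(f has_derivative frechet_derivative f (at x)) (at x)"
    "frechet_derivative f (at x) (c *\<^sub>C v) = c *\<^sub>C frechet_derivative f (at x) v"
    "frechet_derivative f (at x) (u + v) = frechet_derivative f (at x) u + frechet_derivative f (at x) v"
proof -
  obtain D where D: "(f has_derivative D) (at x)" "\<And>c v. D (c *\<^sub>C v) = c *\<^sub>C D v"
    using assms unfolding cdiff_at_def by blast
  have e: "frechet_derivative f (at x) = D" using frechet_derivative_at[OF D(1)] by simp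
  show "(f has_derivative frechet_derivative f (at x)) (at x)" unfolding e by (rule D(1))
  show "frechet_derivative f (at x) (c *\<^sub>C v) = c *\<^sub>C frechet_derivative f (at x) v" unfolding e by (rule D(2))
  show "frechet_derivative f (at x) (u + v) = frechet_derivative f (at x) u + frechet_derivative f (at x) v"
    unfolding e using has_derivative_linear[OF D(1)] by (rule linear_add)
qed

lemma cdiff_frechet_clinear2: "cdiff_at f x \<Longrightarrow> clinear2 (frechet_derivative f (at x))"
  unfolding clinear2_def using cdiff_frechet(2,3) by blast

lemma cdiff_frechet_chain:
  assumes "cdiff_at g x" "cdiff_at f (g x)"
  shows "frechet_derivative (\<lambda>x. f (g x)) (at x) v = frechet_derivative f (at (g x)) (frechet_derivative g (at x) v)"
  using frechet_derivative_at[OF has_derivative_compose[OF cdiff_frechet(1)[OF assms(1)] cdiff_frechet(1)[OF assms(2)]]]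
  by (metis (no_types, lifting))

text \<open>Both derivatives are chosen by the same predicate, so the equality also covers points
  where no derivative exists.\<close>

lemma frechet_derivative_cong_ev:
  assumes "\<forall>\<^sub>F y in nhds x. f y = g y"
  shows "frechet_derivative f (at x) = frechet_derivative g (at x)"
proof -
  have *: "(v has_derivative D) (at x)" if "(u has_derivative D) (at x)" "\<forall>\<^sub>F y in nhds x. u y = v y" for u v D
    by (rule has_derivative_transform_eventually[OF that(1) eventually_nhds_imp_at[OF that(2)]
          eventually_nhds_x_imp_x[OF that(2)]]) simp
  have "\<forall>\<^sub>F y in nhds x. g y = f y" using assms by eventually_elim simp
  hence "(f has_derivative D) (at x) \<longleftrightarrow> (g has_derivative D) (at x)" for D
    using *[of f D g] *[of g D f] assms by blast
  thus ?thesis unfolding frechet_derivative_def by simp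
qed

lemma frechet_derivative_shift:
  fixes F :: "complex \<Rightarrow> 'a::real_normed_vector"
  shows "frechet_derivative F (at (t + c)) = frechet_derivative (\<lambda>s. F (s + c)) (at t)"
proof -
  have *: "((\<lambda>s. F (s + c)) has_derivative D) (at t)" if "(F has_derivative D) (at (t + c))" for F :: "complex \<Rightarrow> 'a" and t c D
  proof -
    have "((\<lambda>s. s + c) has_derivative (\<lambda>h. h)) (at t)" by (auto intro!: derivative_eq_intros)
    from has_derivative_compose[OF this that] show ?thesis by simp
  qed
  have "(F has_derivative D) (at (t + c)) \<longleftrightarrow> ((\<lambda>s. F (s + c)) has_derivative D) (at t)" for D
    using *[of F D t c] *[of "\<lambda>s. F (s + c)" D "t + c" "- c"] by auto
  thus ?thesis unfolding frechet_derivative_def by simp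
qed

lemma frechet_derivative_components:
  fixes f :: "complex \<Rightarrow> complex \<times> complex"
  assumes "cdiff_at f t"
  shows "fst (frechet_derivative f (at t) 1) = deriv (\<lambda>s. fst (f s)) t"
    "snd (frechet_derivative f (at t) 1) = deriv (\<lambda>s. snd (f s)) t"
proof -
  have d: "(g has_field_derivative D 1) (at t)" if "(g has_derivative D) (at t)" "\<And>c v. D (c * v) = c * D v"
    for g :: "complex \<Rightarrow> complex" and D
  proof -
    have "D = (*) (D 1)"
    proof
      fix z show "D z = D 1 * z" using that(2)[of z 1] by (simp add: mult.commute)
    qed
    thus ?thesis using that(1) by (simp add: has_field_derivative_def)
  qed
  let ?D = "frechet_derivative f (at t)"
  have lin: "?D (c * v) = c *\<^sub>C ?D v" for c v
    using cdiff_frechet(2)[OF assms, of c v] by (simp add: scaleC_complex_def)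
  have "((\<lambda>s. fst (f s)) has_field_derivative fst (?D 1)) (at t)"
    by (rule d[OF has_derivative_fst[OF cdiff_frechet(1)[OF assms]]]) (simp add: lin scaleC_prod_def scaleC_complex_def)
  thus "fst (?D 1) = deriv (\<lambda>s. fst (f s)) t" by (simp add: DERIV_imp_deriv)
  have "((\<lambda>s. snd (f s)) has_field_derivative snd (?D 1)) (at t)"
    by (rule d[OF has_derivative_snd[OF cdiff_frechet(1)[OF assms]]]) (simp add: lin scaleC_prod_def scaleC_complex_def)
  thus "snd (?D 1) = deriv (\<lambda>s. snd (f s)) t" by (simp add: DERIV_imp_deriv)
qed

section \<open>Self-intersection of sections\<close>

lemma analytic_at_transform:
  assumes "f analytic_on {a}" "\<forall>\<^sub>F x in nhds a. f x = g x"
  shows "g analytic_on {a}"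
  using analytic_at_cong[OF assms(2) refl] assms(1) by simp

locale surface_section = suspended_surface \<tau> S \<pi> \<psi> + F: equivariant \<tau> f
  for \<tau> :: complex and S :: "('s, complex \<times> complex) atlas" and \<pi> :: "'s \<Rightarrow> complex set"
    and \<psi> :: "(complex \<times> proj_line) set \<Rightarrow> 's" and f :: "complex \<Rightarrow> complex" +
  fixes \<sigma> :: "complex set \<Rightarrow> 's"
  assumes graph: "is_graph f \<sigma>"
begin

definition velocity :: "'s set \<times> ('s \<Rightarrow> complex \<times> complex) \<Rightarrow> complex \<Rightarrow> complex \<times> complex"
  where "velocity k t = frechet_derivative (\<lambda>s. snd k (\<sigma> (p s))) (at t) 1"

text \<open>The normal coordinate, taken with the coordinate of the plane instead of a chart of the
  curve. This makes it a lattice-periodic function of \<open>t\<close> for each chart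
  \<open>k\<close>.\<close>

definition normal_part ::
  "('s set \<times> ('s \<Rightarrow> complex \<times> complex) \<Rightarrow> complex set \<Rightarrow> complex \<times> complex) \<Rightarrow>
   's set \<times> ('s \<Rightarrow> complex \<times> complex) \<Rightarrow> complex \<Rightarrow> complex"
  where "normal_part w k t = det2 (w k (p t)) (velocity k t)"

lemma velocity_periodic: "l \<in> lattice \<tau> \<Longrightarrow> velocity k (t + l) = velocity k t"
  unfolding velocity_def frechet_derivative_shift by (simp add: torus_proj_add_lattice)

lemma normal_part_periodic: "l \<in> lattice \<tau> \<Longrightarrow> normal_part w k (t + l) = normal_part w k t"
  by (simp add: normal_part_def velocity_periodic torus_proj_add_lattice)

lemma curve_local:
  assumes "f analytic_on {a}"
  obtains B where "open B" "a \<in> B" "\<And>x. x \<in> B \<Longrightarrow> f analytic_on {x}" "\<And>x. x \<in> B \<Longrightarrow> \<sigma> (p x) = E (x, f x)"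
  by (rule graph_local[OF graph assms]) (rule that)

lemma finite_representative:
  obtains b where "p b = p a" "f analytic_on {b}" "b - a \<in> lattice \<tau>"
proof (cases "f analytic_on {a}")
  case True thus ?thesis using that[of a] lattice_0 by simp
next
  case False thus ?thesis using that[of "a + \<tau>"] F.not_analytic(1)[OF False] lattice_tau by simp
qed

lemma chart_E: "(V, g) \<in> S \<Longrightarrow> E v \<in> V \<Longrightarrow> cdiff_at (\<lambda>v. g (E v)) v"
  using uniformizes_basic(5)[OF uniformizes_surface] by blast

lemma chart_E_open: "(V, g) \<in> S \<Longrightarrow> open (E -` V)"
  using uniformizes_basic(4)[OF uniformizes_surface] by simp

lemma curve_chart:
  assumes V: "(V, g) \<in> S" and a: "f analytic_on {a}" "\<sigma> (p a) \<in> V"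
  obtains B where "open B" "a \<in> B" "\<And>x. x \<in> B \<Longrightarrow> f analytic_on {x}" "\<And>x. x \<in> B \<Longrightarrow> \<sigma> (p x) = E (x, f x)"
    "\<And>x. x \<in> B \<Longrightarrow> E (x, f x) \<in> V" "\<And>x. x \<in> B \<Longrightarrow> cdiff_at (\<lambda>x. (x, f x)) x"
proof -
  obtain B where B: "open B" "a \<in> B" "\<And>x. x \<in> B \<Longrightarrow> f analytic_on {x}" "\<And>x. x \<in> B \<Longrightarrow> \<sigma> (p x) = E (x, f x)"
    by (rule curve_local[OF a(1)]) (rule that)
  have cd: "cdiff_at (\<lambda>x. (x, f x)) x" if "x \<in> B" for x
    by (intro cdiff_at_Pair cdiff_at_ident cdiff_at_analytic B(3)[OF that])
  have "continuous_on B (\<lambda>x. (x, f x))"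
    using cd cdiff_at_isCont continuous_at_imp_continuous_on by blast
  from continuous_open_preimage[OF this B(1) chart_E_open[OF V]]
  have "open (B \<inter> (\<lambda>x. (x, f x)) -` (E -` V))" .
  moreover have "E (a, f a) \<in> V" using a(2) B(4)[OF B(2)] by simp
  hence "a \<in> B \<inter> (\<lambda>x. (x, f x)) -` (E -` V)" using B(2) by simp
  ultimately show ?thesis
    by (rule that) (use B(3,4) cd in auto)
qed

lemma velocity_eq:
  assumes V: "(V, g) \<in> S" and a: "f analytic_on {a}" "\<sigma> (p a) \<in> V"
  shows "velocity (V, g) a = frechet_derivative (\<lambda>v. g (E v)) (at (a, f a)) (1, deriv f a)"
    "cdiff_at (\<lambda>s. g (\<sigma> (p s))) a"
proof -
  obtain B where B: "open B" "a \<in> B" "\<And>x. x \<in> B \<Longrightarrow> f analytic_on {x}" "\<And>x. x \<in> B \<Longrightarrow> \<sigma> (p x) = E (x, f x)"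
    "\<And>x. x \<in> B \<Longrightarrow> E (x, f x) \<in> V" "\<And>x. x \<in> B \<Longrightarrow> cdiff_at (\<lambda>x. (x, f x)) x"
    by (rule curve_chart[OF assms]) (rule that)
  have cg: "cdiff_at (\<lambda>v. g (E v)) (a, f a)" by (rule chart_E[OF V B(5)[OF B(2)]])
  have c: "cdiff_at (\<lambda>s. g (E (s, f s))) a"
    by (rule cdiff_at_compose[OF B(6)[OF B(2)] cg])
  show "cdiff_at (\<lambda>s. g (\<sigma> (p s))) a"
    by (rule cdiff_at_cong_open[OF c B(1,2)]) (simp add: B(4))
  have ev: "\<forall>\<^sub>F s in nhds a. g (\<sigma> (p s)) = g (E (s, f s))"
    using eventually_nhds_in_open[OF B(1,2)] by eventually_elim (simp add: B(4))
  have "(f has_field_derivative deriv f a) (at a)" using a(1) analytic_derivI by auto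
  hence "((\<lambda>x. (x, f x)) has_derivative (\<lambda>h. (h, deriv f a * h))) (at a)"
    by (intro has_derivative_Pair has_derivative_ident) (simp add: has_field_derivative_def)
  hence "frechet_derivative (\<lambda>x. (x, f x)) (at a) = (\<lambda>h. (h, deriv f a * h))"
    by (rule frechet_derivative_at[symmetric])
  thus "velocity (V, g) a = frechet_derivative (\<lambda>v. g (E v)) (at (a, f a)) (1, deriv f a)"
    unfolding velocity_def snd_conv frechet_derivative_cong_ev[OF ev] cdiff_frechet_chain[OF B(6)[OF B(2)] cg]
    by simp
qed

lemma curve_cdiff:
  assumes V: "(V, g) \<in> S" and a: "\<sigma> (p a) \<in> V"
  shows "cdiff_at (\<lambda>s. g (\<sigma> (p s))) a"
proof -
  obtain b where b: "p b = p a" "f analytic_on {b}" "b - a \<in> lattice \<tau>" by (rule finite_representative) (rule that)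
  have "cdiff_at (\<lambda>s. g (\<sigma> (p s))) b" by (rule velocity_eq(2)[OF V b(2)]) (use a b in simp)
  hence "cdiff_at (\<lambda>s. g (\<sigma> (p s))) (a + (b - a))" by simp
  moreover have "cdiff_at (\<lambda>s. s + (b - a)) a" by (intro cdiff_intros)
  ultimately have "cdiff_at (\<lambda>s. g (\<sigma> (p (s + (b - a))))) a"
    by (rule_tac cdiff_at_compose[where f = "\<lambda>s. g (\<sigma> (p s))" and g = "\<lambda>s. s + (b - a)"])
  thus ?thesis by (simp add: torus_proj_add_lattice[OF b(3)])
qed

text \<open>
  The horizontal field of the suspension gives, along every section, a field with which the
  self-intersection can be computed.
\<close>

definition horizontal :: "'s set \<times> ('s \<Rightarrow> complex \<times> complex) \<Rightarrow> 's \<Rightarrow> complex \<times> complex"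
  where "horizontal k s = (let v = SOME v. E v = s in
    frechet_derivative (\<lambda>h::complex. snd k (E (fst v + h, snd v))) (at 0) 1)"

text \<open>Two choices of \<open>v\<close> differ by a translation of \<open>x\<close> and a map
  \<open>rho m n\<close> of the fibre that does not depend on \<open>x\<close>, so the horizontal
  curves through them have the same image in the surface.\<close>

lemma horizontal_E: "horizontal k (E v) = frechet_derivative (\<lambda>h::complex. snd k (E (fst v + h, snd v))) (at 0) 1"
proof -
  define u where "u = (SOME u. E u = E v)"
  have "E u = E v" unfolding u_def by (rule someI) simp
  then obtain m n where mn: "fst v = fst u + of_int m + of_int n * \<tau>" "Affine (snd v) = rho m n (Affine (snd u))"
    unfolding E_def Psi_eq_iff by blast
  have "E (fst v + h, snd v) = E (fst u + h, snd u)" for h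
  proof -
    have "fst v + h = (fst u + h) + of_int m + of_int n * \<tau>" using mn(1) by simp
    thus ?thesis unfolding E_def fst_conv snd_conv mn(2) by (simp only: Psi_shift)
  qed
  thus ?thesis by (simp add: horizontal_def u_def[symmetric] Let_def)
qed

lemma horizontal_eq:
  assumes V: "(V, g) \<in> S" "E v \<in> V"
  shows "horizontal (V, g) (E v) = frechet_derivative (\<lambda>v. g (E v)) (at v) (1, 0)"
proof -
  have c: "cdiff_at (\<lambda>h. (fst v + h, snd v)) 0" by (intro cdiff_intros)
  have c2: "cdiff_at (\<lambda>v. g (E v)) (fst v + 0, snd v)" using chart_E[OF V] by simp
  have "((\<lambda>h. (fst v + h, snd v)) has_derivative (\<lambda>h. (h, 0))) (at 0)"
    by (auto intro!: derivative_eq_intros)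
  hence "frechet_derivative (\<lambda>h. (fst v + h, snd v)) (at 0) = (\<lambda>h. (h, 0))"
    by (rule frechet_derivative_at[symmetric])
  thus ?thesis unfolding horizontal_E snd_conv
    using cdiff_frechet_chain[OF c c2, of 1] by simp
qed

lemma transition_cdiff:
  assumes "(V, g) \<in> S" "(V', g') \<in> S" "s \<in> V" "s \<in> V'"
  shows "cdiff_at (g' \<circ> inv_into V g) (g s)"
  using transition(2)[OF assms(1,2)] assms(3,4) unfolding cholomorphic_on_iff by blast

lemma transition_apply:
  assumes V: "(V, g) \<in> S" and V': "(V', g') \<in> S" and c: "continuous (at t) c" "c t \<in> E -` V"
  shows "\<forall>\<^sub>F s in nhds t. g' (E (c s)) = (g' \<circ> inv_into V g) (g (E (c s)))"
proof -
  have "\<forall>\<^sub>F s in nhds t. c s \<in> E -` V"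
    using c(1) c(2) chart_E_open[OF V] unfolding continuous_at_open eventually_nhds by metis
  thus ?thesis by eventually_elim (use chart_inj[OF V] in simp)
qed

lemma horizontal_transition:
  assumes V: "(V, g) \<in> S" and V': "(V', g') \<in> S" and s: "s \<in> V" "s \<in> V'" "s \<in> points S"
  shows "horizontal (V', g') s = frechet_derivative (g' \<circ> inv_into V g) (at (g s)) (horizontal (V, g) s)"
proof -
  obtain v where v: "s = E v" using s(3) range_E(1) by blast
  have cg: "cdiff_at (\<lambda>v. g (E v)) v" by (rule chart_E[OF V]) (use s v in simp)
  have ct: "cdiff_at (g' \<circ> inv_into V g) (g (E v))" using transition_cdiff[OF V V' s(1,2)] v by simp
  have "\<forall>\<^sub>F u in nhds v. g' (E u) = (g' \<circ> inv_into V g) (g (E u))"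
    by (rule transition_apply[OF V V', where c = "\<lambda>u. u"]) (use s v in auto)
  hence "frechet_derivative (\<lambda>u. g' (E u)) (at v) = frechet_derivative (\<lambda>u. (g' \<circ> inv_into V g) (g (E u))) (at v)"
    by (rule frechet_derivative_cong_ev)
  thus ?thesis using horizontal_eq[OF V', of v] horizontal_eq[OF V, of v] s v
      cdiff_frechet_chain[OF cg ct, of "(1, 0)"] by (simp add: o_def)
qed

lemma velocity_transition:
  assumes V: "(V, g) \<in> S" and V': "(V', g') \<in> S" and s: "\<sigma> (p t) \<in> V" "\<sigma> (p t) \<in> V'"
  shows "velocity (V', g') t = frechet_derivative (g' \<circ> inv_into V g) (at (g (\<sigma> (p t)))) (velocity (V, g) t)"
proof -
  obtain b where b: "p b = p t" "f analytic_on {b}" "b - t \<in> lattice \<tau>" by (rule finite_representative) (rule that)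
  have vb: "velocity k b = velocity k t" for k using velocity_periodic[OF b(3), of k t] by simp
  have sb: "\<sigma> (p b) \<in> V" "\<sigma> (p b) \<in> V'" using s b by simp_all
  obtain B where B: "open B" "b \<in> B" "\<And>x. x \<in> B \<Longrightarrow> f analytic_on {x}" "\<And>x. x \<in> B \<Longrightarrow> \<sigma> (p x) = E (x, f x)"
    "\<And>x. x \<in> B \<Longrightarrow> E (x, f x) \<in> V" "\<And>x. x \<in> B \<Longrightarrow> cdiff_at (\<lambda>x. (x, f x)) x"
    by (rule curve_chart[OF V b(2) sb(1)]) (rule that)
  have "\<forall>\<^sub>F x in nhds b. g' (\<sigma> (p x)) = (g' \<circ> inv_into V g) (g (\<sigma> (p x)))"
    using eventually_nhds_in_open[OF B(1,2)]
    by eventually_elim (use B(4,5) chart_inj[OF V] in simp)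
  hence "velocity (V', g') b = frechet_derivative (\<lambda>x. (g' \<circ> inv_into V g) (g (\<sigma> (p x)))) (at b) 1"
    unfolding velocity_def snd_conv by (simp only: frechet_derivative_cong_ev)
  also have "\<dots> = frechet_derivative (g' \<circ> inv_into V g) (at (g (\<sigma> (p b)))) (velocity (V, g) b)"
    unfolding velocity_def snd_conv
    by (rule cdiff_frechet_chain[OF curve_cdiff[OF V sb(1)] transition_cdiff[OF V V' sb]])
  finally show ?thesis unfolding vb b(1) .
qed

definition transition_det :: "'s set \<times> ('s \<Rightarrow> complex \<times> complex) \<Rightarrow> 's set \<times> ('s \<Rightarrow> complex \<times> complex) \<Rightarrow> complex \<Rightarrow> complex"
  where "transition_det k k' t = (let T = frechet_derivative (snd k' \<circ> inv_into (fst k) (snd k)) (at (snd k (\<sigma> (p t))))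
    in det2 (T (1, 0)) (T (0, 1)))"

text \<open>Field and velocity are transformed by the same linear map, so their determinant is
  multiplied by the determinant of that map. This factor cancels in the ratio of two fields.\<close>

lemma normal_part_transition:
  assumes k: "k \<in> S" "k' \<in> S" "\<sigma> (p t) \<in> fst k" "\<sigma> (p t) \<in> fst k'"
    and w: "w k' (p t) = frechet_derivative (snd k' \<circ> inv_into (fst k) (snd k)) (at (snd k (\<sigma> (p t)))) (w k (p t))"
  shows "normal_part w k' t = transition_det k k' t * normal_part w k t"
proof -
  obtain V g V' g' where e: "k = (V, g)" "k' = (V', g')" by (metis surj_pair)
  have V: "(V, g) \<in> S" "(V', g') \<in> S" "\<sigma> (p t) \<in> V" "\<sigma> (p t) \<in> V'" using k e by auto
  have "clinear2 (frechet_derivative (g' \<circ> inv_into V g) (at (g (\<sigma> (p t)))))"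
    by (rule cdiff_frechet_clinear2[OF transition_cdiff[OF V]])
  from clinear2_det[OF this, of "w k (p t)" "velocity k t"] show ?thesis
    using velocity_transition[OF V] w
    by (simp add: normal_part_def transition_det_def e Let_def)
qed

text \<open>The directional derivative along the graph is the derivative at \<open>h = 0\<close> of
  a holomorphic function of the pair \<open>(t, h)\<close>, to which
  \<open>deriv_parameter_analytic\<close> applies.\<close>

lemma partial_analytic:
  assumes V: "(V, g) \<in> S" and a: "f analytic_on {a}" "\<sigma> (p a) \<in> V"
  shows "(\<lambda>t. fst (frechet_derivative (\<lambda>v. g (E v)) (at (t, f t)) (x, y))) analytic_on {a}"
    "(\<lambda>t. snd (frechet_derivative (\<lambda>v. g (E v)) (at (t, f t)) (x, y))) analytic_on {a}"
proof -
  obtain B where B: "open B" "a \<in> B" "\<And>x. x \<in> B \<Longrightarrow> f analytic_on {x}" "\<And>x. x \<in> B \<Longrightarrow> \<sigma> (p x) = E (x, f x)"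
    "\<And>x. x \<in> B \<Longrightarrow> E (x, f x) \<in> V" "\<And>x. x \<in> B \<Longrightarrow> cdiff_at (\<lambda>x. (x, f x)) x"
    by (rule curve_chart[OF assms]) (rule that)
  \<comment> \<open>For fixed \<open>t\<close> this parametrizes the line through
    \<open>(t, f t)\<close> with direction \<open>(x, y)\<close>.\<close>
  define c where "c u = (fst u + x * snd u, f (fst u) + y * snd u)" for u :: "complex \<times> complex"
  have cc: "cdiff_at c u" if "u \<in> B \<times> UNIV" for u
  proof -
    have "cdiff_at (\<lambda>u. f (fst u)) u"
      by (rule cdiff_at_compose[OF cdiff_at_fst, where f = f]) (use that B(3) in \<open>auto intro: cdiff_at_analytic\<close>)
    thus ?thesis unfolding c_def by (intro cdiff_intros)
  qed
  define W where "W = (B \<times> UNIV) \<inter> c -` (E -` V)"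
  have "continuous_on (B \<times> UNIV) c"
    using cc cdiff_at_isCont continuous_at_imp_continuous_on by blast
  hence oW: "open W" unfolding W_def
    by (rule continuous_open_preimage) (use B(1) chart_E_open[OF V] in \<open>auto intro: open_Times\<close>)
  have aW: "(a, 0) \<in> W" using B(2,5) by (simp add: W_def c_def)
  have cF: "cdiff_at (\<lambda>u. g (E (c u))) u" if "u \<in> W" for u
    by (rule cdiff_at_compose[OF cc]) (use that in \<open>auto simp: W_def intro: chart_E[OF V]\<close>)
  have eq: "frechet_derivative (\<lambda>v. g (E v)) (at (t, f t)) (x, y) = frechet_derivative (\<lambda>h. g (E (c (t, h)))) (at 0) 1"
    and cl: "cdiff_at (\<lambda>h. g (E (c (t, h)))) 0" if "t \<in> B" for t
  proof -
    have c0: "c (t, 0) = (t, f t)" by (simp add: c_def)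
    have d: "cdiff_at (\<lambda>h. c (t, h)) 0" unfolding c_def fst_conv snd_conv by (intro cdiff_intros)
    have d2: "cdiff_at (\<lambda>v. g (E v)) (c (t, 0))" unfolding c0 by (rule chart_E[OF V B(5)[OF that]])
    show "cdiff_at (\<lambda>h. g (E (c (t, h)))) 0" by (rule cdiff_at_compose[OF d d2])
    have "((\<lambda>h. c (t, h)) has_derivative (\<lambda>h. (x * h, y * h))) (at 0)"
      unfolding c_def fst_conv snd_conv by (auto intro!: derivative_eq_intros)
    hence "frechet_derivative (\<lambda>h. c (t, h)) (at 0) = (\<lambda>h. (x * h, y * h))"
      by (rule frechet_derivative_at[symmetric])
    thus "frechet_derivative (\<lambda>v. g (E v)) (at (t, f t)) (x, y) = frechet_derivative (\<lambda>h. g (E (c (t, h)))) (at 0) 1"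
      using cdiff_frechet_chain[OF d d2, of 1] by (simp add: c0)
  qed
  have ev: "\<forall>\<^sub>F t in nhds a. t \<in> B" by (rule eventually_nhds_in_open[OF B(1,2)])
  have "(\<lambda>t. deriv (\<lambda>h. fst (g (E (c (t, h))))) 0) analytic_on {a}"
    by (rule deriv_parameter_analytic[OF oW aW, where F = "\<lambda>u. fst (g (E (c u)))"])
       (rule cdiff_at_compose[OF cF cdiff_at_fst])
  moreover have "\<forall>\<^sub>F t in nhds a. deriv (\<lambda>h. fst (g (E (c (t, h))))) 0 = fst (frechet_derivative (\<lambda>v. g (E v)) (at (t, f t)) (x, y))"
    using ev by eventually_elim (simp add: eq frechet_derivative_components(1)[OF cl])
  ultimately show "(\<lambda>t. fst (frechet_derivative (\<lambda>v. g (E v)) (at (t, f t)) (x, y))) analytic_on {a}"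
    by (rule analytic_at_transform)
  have "(\<lambda>t. deriv (\<lambda>h. snd (g (E (c (t, h))))) 0) analytic_on {a}"
    by (rule deriv_parameter_analytic[OF oW aW, where F = "\<lambda>u. snd (g (E (c u)))"])
       (rule cdiff_at_compose[OF cF cdiff_at_snd])
  moreover have "\<forall>\<^sub>F t in nhds a. deriv (\<lambda>h. snd (g (E (c (t, h))))) 0 = snd (frechet_derivative (\<lambda>v. g (E v)) (at (t, f t)) (x, y))"
    using ev by eventually_elim (simp add: eq frechet_derivative_components(2)[OF cl])
  ultimately show "(\<lambda>t. snd (frechet_derivative (\<lambda>v. g (E v)) (at (t, f t)) (x, y))) analytic_on {a}"
    by (rule analytic_at_transform)
qed

abbreviation "w0 \<equiv> \<lambda>k q. horizontal k (\<sigma> q)"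

text \<open>In the coordinates of \<open>E\<close> the horizontal field is \<open>(1, 0)\<close> and
  the velocity is \<open>(1, deriv f t)\<close>, with determinant \<open>deriv f t\<close>. The
  chart multiplies this by its Jacobian determinant, which is analytic and nonzero.\<close>

lemma horizontal_normal_ord_finite:
  assumes V: "(V, g) \<in> S" and a: "f analytic_on {a}" "\<sigma> (p a) \<in> V"
  shows "has_ord (normal_part w0 (V, g)) a (F.crit a)"
proof -
  obtain B where B: "open B" "a \<in> B" "\<And>x. x \<in> B \<Longrightarrow> f analytic_on {x}" "\<And>x. x \<in> B \<Longrightarrow> \<sigma> (p x) = E (x, f x)"
    "\<And>x. x \<in> B \<Longrightarrow> E (x, f x) \<in> V" "\<And>x. x \<in> B \<Longrightarrow> cdiff_at (\<lambda>x. (x, f x)) x"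
    by (rule curve_chart[OF assms]) (rule that)
  define L where "L t = frechet_derivative (\<lambda>v. g (E v)) (at (t, f t))" for t
  define J where "J t = det2 (L t (1, 0)) (L t (0, 1))" for t
  have lin: "clinear2 (L t)" if "t \<in> B" for t
    unfolding L_def by (rule cdiff_frechet_clinear2[OF chart_E[OF V B(5)[OF that]]])
  have N: "normal_part w0 (V, g) t = J t * deriv f t" if t: "t \<in> B" for t
  proof -
    have "w0 (V, g) (p t) = L t (1, 0)"
      using horizontal_eq[OF V B(5)[OF t]] B(4)[OF t] by (simp add: L_def)
    moreover have "velocity (V, g) t = L t (1, deriv f t)"
      unfolding L_def by (rule velocity_eq(1)[OF V B(3)[OF t]]) (use B(4,5)[OF t] in simp)
    ultimately show ?thesis
      using clinear2_det[OF lin[OF t], of "(1, 0)" "(1, deriv f t)"]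
      by (simp add: normal_part_def J_def det2_def)
  qed
  have "J analytic_on {a}"
    unfolding J_def L_def det2_def by (intro analytic_intros partial_analytic[OF assms])
  moreover have "J a \<noteq> 0"
    unfolding J_def
  proof (rule clinear2_det_nonzero[OF lin[OF B(2)]])
    \<comment> \<open>A local inverse of the chart expression shows that the derivative of the
      latter has trivial kernel.\<close>
    obtain A k where A: "open A" "(a, f a) \<in> A" "A \<subseteq> UNIV \<inter> E -` V" "open ((\<lambda>x. g (E x)) ` A)"
      "cholomorphic_on k ((\<lambda>x. g (E x)) ` A)" "\<And>x. x \<in> A \<Longrightarrow> k (g (E x)) = x"
      using uniformizes_local_inverse[OF uniformizes_surface V, of "(a, f a)"] B(5)[OF B(2)] by auto
    have cg: "cdiff_at (\<lambda>v. g (E v)) (a, f a)" by (rule chart_E[OF V B(5)[OF B(2)]])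
    have ck: "cdiff_at k (g (E (a, f a)))" using A(2,5) by (auto simp: cholomorphic_on_iff)
    have "\<forall>\<^sub>F v in nhds (a, f a). k (g (E v)) = v"
      using eventually_nhds_in_open[OF A(1,2)] by eventually_elim (rule A(6))
    from frechet_derivative_cong_ev[OF this]
    have id: "frechet_derivative (\<lambda>v. k (g (E v))) (at (a, f a)) = (\<lambda>v. v)"
      using frechet_derivative_at[OF has_derivative_ident, of "(a, f a)"] by simp
    fix v assume "L a v = 0"
    hence "frechet_derivative (\<lambda>v. k (g (E v))) (at (a, f a)) v = frechet_derivative k (at (g (E (a, f a)))) 0"
      using cdiff_frechet_chain[OF cg ck, of v] by (simp add: L_def)
    also have "\<dots> = 0" using has_derivative_linear[OF cdiff_frechet(1)[OF ck]] by (rule linear_0)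
    finally show "v = 0" by (simp add: id)
  qed
  ultimately have "has_ord J a 0" by (rule has_ord_0)
  from has_ord_mult[OF this F.has_ord_deriv_crit(1)[OF a(1)]]
  have "has_ord (\<lambda>t. J t * deriv f t) a (F.crit a)" by simp
  moreover have "\<forall>\<^sub>F t in at a. normal_part w0 (V, g) t = J t * deriv f t"
    using eventually_nhds_imp_at[OF eventually_nhds_in_open[OF B(1,2)]] by eventually_elim (rule N)
  ultimately show ?thesis by (rule has_ord_cong)
qed

lemma has_ord_normal_part_shift:
  assumes "has_ord (normal_part w k) b n" "b - a \<in> lattice \<tau>"
  shows "has_ord (normal_part w k) a n"
proof -
  have "has_ord (normal_part w k) (a + (b - a)) n" using assms(1) by simp
  from has_ord_shift[OF this] show ?thesis by (simp add: normal_part_periodic[OF assms(2)])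
qed

lemma horizontal_normal_ord:
  assumes V: "k \<in> S" and a: "\<sigma> (p a) \<in> fst k"
  shows "has_ord (normal_part w0 k) a (F.crit a)"
proof -
  obtain b where b: "p b = p a" "f analytic_on {b}" "b - a \<in> lattice \<tau>" by (rule finite_representative) (rule that)
  obtain W g where k: "k = (W, g)" by (metis surj_pair)
  have "has_ord (normal_part w0 (W, g)) b (F.crit b)"
    by (rule horizontal_normal_ord_finite) (use V a b k in auto)
  moreover have "F.crit b = F.crit a" using F.crit_lattice[OF b(3), of a] by simp
  ultimately show ?thesis using has_ord_normal_part_shift[OF _ b(3)] k by simp
qed

lemma velocity_analytic:
  assumes V: "(V, g) \<in> S" and a: "\<sigma> (p a) \<in> V"
  shows "(\<lambda>t. fst (velocity (V, g) t)) analytic_on {a}" "(\<lambda>t. snd (velocity (V, g) t)) analytic_on {a}"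
proof -
  have *: "(\<lambda>t. fst (velocity (V, g) t)) analytic_on {b} \<and> (\<lambda>t. snd (velocity (V, g) t)) analytic_on {b}"
    if b: "f analytic_on {b}" "\<sigma> (p b) \<in> V" for b
  proof -
    obtain B where B: "open B" "b \<in> B" "\<And>x. x \<in> B \<Longrightarrow> f analytic_on {x}" "\<And>x. x \<in> B \<Longrightarrow> \<sigma> (p x) = E (x, f x)"
      "\<And>x. x \<in> B \<Longrightarrow> E (x, f x) \<in> V" "\<And>x. x \<in> B \<Longrightarrow> cdiff_at (\<lambda>x. (x, f x)) x"
      by (rule curve_chart[OF V b]) (rule that)
    have cd: "cdiff_at (\<lambda>s. g (\<sigma> (p s))) x" if "x \<in> B" for x
      by (rule curve_cdiff[OF V]) (use B(4,5)[OF that] in simp)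
    have ev: "\<forall>\<^sub>F t in nhds b. t \<in> B" by (rule eventually_nhds_in_open[OF B(1,2)])
    have "(\<lambda>s. fst (g (\<sigma> (p s)))) analytic_on {b}" "(\<lambda>s. snd (g (\<sigma> (p s)))) analytic_on {b}"
      by (rule cholomorphic_imp_analytic[OF B(1,2)];
          use cdiff_at_compose[OF cd cdiff_at_fst] cdiff_at_compose[OF cd cdiff_at_snd] in \<open>simp add: cholomorphic_on_iff\<close>)+
    hence "deriv (\<lambda>s. fst (g (\<sigma> (p s)))) analytic_on {b}" "deriv (\<lambda>s. snd (g (\<sigma> (p s)))) analytic_on {b}"
      by (auto intro: analytic_deriv)
    moreover have "\<forall>\<^sub>F t in nhds b. deriv (\<lambda>s. fst (g (\<sigma> (p s)))) t = fst (velocity (V, g) t)"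
      using ev by eventually_elim (simp add: velocity_def frechet_derivative_components(1)[OF cd])
    moreover have "\<forall>\<^sub>F t in nhds b. deriv (\<lambda>s. snd (g (\<sigma> (p s)))) t = snd (velocity (V, g) t)"
      using ev by eventually_elim (simp add: velocity_def frechet_derivative_components(2)[OF cd])
    ultimately show ?thesis by (blast intro: analytic_at_transform)
  qed
  obtain b where b: "p b = p a" "f analytic_on {b}" "b - a \<in> lattice \<tau>" by (rule finite_representative) (rule that)
  have "(\<lambda>t. fst (velocity (V, g) t)) analytic_on {a + (b - a)}" "(\<lambda>t. snd (velocity (V, g) t)) analytic_on {a + (b - a)}"
    using *[OF b(2)] a b by simp_all
  from analytic_at_shift[OF this(1)] analytic_at_shift[OF this(2)]
  show "(\<lambda>t. fst (velocity (V, g) t)) analytic_on {a}" "(\<lambda>t. snd (velocity (V, g) t)) analytic_on {a}"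
    by (simp_all add: velocity_periodic[OF b(3)])
qed

lemma horizontal_analytic:
  assumes V: "(V, g) \<in> S" and a: "\<sigma> (p a) \<in> V"
  shows "(\<lambda>t. fst (w0 (V, g) (p t))) analytic_on {a}" "(\<lambda>t. snd (w0 (V, g) (p t))) analytic_on {a}"
proof -
  obtain b where b: "p b = p a" "f analytic_on {b}" "b - a \<in> lattice \<tau>" by (rule finite_representative) (rule that)
  have sb: "\<sigma> (p b) \<in> V" using a b by simp
  obtain B where B: "open B" "b \<in> B" "\<And>x. x \<in> B \<Longrightarrow> f analytic_on {x}" "\<And>x. x \<in> B \<Longrightarrow> \<sigma> (p x) = E (x, f x)"
    "\<And>x. x \<in> B \<Longrightarrow> E (x, f x) \<in> V" "\<And>x. x \<in> B \<Longrightarrow> cdiff_at (\<lambda>x. (x, f x)) x"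
    by (rule curve_chart[OF V b(2) sb]) (rule that)
  have ev: "\<forall>\<^sub>F t in nhds b. frechet_derivative (\<lambda>v. g (E v)) (at (t, f t)) (1, 0) = w0 (V, g) (p t)"
    using eventually_nhds_in_open[OF B(1,2)]
    by eventually_elim (use horizontal_eq[OF V] B(4,5) in simp)
  have "\<forall>\<^sub>F t in nhds b. fst (frechet_derivative (\<lambda>v. g (E v)) (at (t, f t)) (1, 0)) = fst (w0 (V, g) (p t))"
    "\<forall>\<^sub>F t in nhds b. snd (frechet_derivative (\<lambda>v. g (E v)) (at (t, f t)) (1, 0)) = snd (w0 (V, g) (p t))"
    by (use ev in eventually_elim, simp)+
  hence "(\<lambda>t. fst (w0 (V, g) (p t))) analytic_on {a + (b - a)}" "(\<lambda>t. snd (w0 (V, g) (p t))) analytic_on {a + (b - a)}"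
    using analytic_at_transform[OF partial_analytic(1)[OF V b(2) sb, of 1 0]]
      analytic_at_transform[OF partial_analytic(2)[OF V b(2) sb, of 1 0]] by simp_all
  from analytic_at_shift[OF this(1)] analytic_at_shift[OF this(2)]
  show "(\<lambda>t. fst (w0 (V, g) (p t))) analytic_on {a}" "(\<lambda>t. snd (w0 (V, g) (p t))) analytic_on {a}"
    by (simp_all add: torus_proj_add_lattice[OF b(3)])
qed

end

context suspended_surface
begin

lemma C_chartE:
  assumes "j \<in> C"
  obtains D where "open D" "inj_on p D" "j = (p ` D, inv_into D p)"
proof -
  have "(fst j, snd j) \<in> C" using assms by simp
  then obtain D where "open D" "inj_on p D" "fst j = p ` D" "snd j = inv_into D p"
    unfolding elliptic_curve_chart_iff by blast
  thus ?thesis using that[of D] by (simp add: prod_eq_iff)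
qed

lemma C_chart_at:
  obtains D where "open D" "inj_on p D" "(a::complex) \<in> D" "(p ` D, inv_into D p) \<in> C"
proof -
  define D where "D = ball a (min 1 (Im \<tau>) / 2)"
  have "inj_on p D" unfolding D_def by (rule torus_proj_inj_on_ball[OF im_pos order_refl])
  moreover from this have "(p ` D, inv_into D p) \<in> C"
    unfolding elliptic_curve_chart_iff by (intro exI[of _ D]) (simp add: D_def)
  ultimately show ?thesis using that[of D] im_pos by (simp add: D_def)
qed

lemma C_chart_inverse:
  assumes "inj_on p D" "t \<in> D"
  shows "inv_into (p ` D) (inv_into D p) t = p t"
  by (rule inv_into_f_eq) (use assms in \<open>auto intro: inj_on_inv_into\<close>)

lemma eventually_not_in_finite:
  assumes "finite P"
  shows "\<forall>\<^sub>F t in at a. p t \<notin> P"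
proof -
  have "\<forall>\<^sub>F t in at a. p t \<noteq> q" for q
  proof (cases "q \<in> range p")
    case True
    then obtain b where b: "q = p b" by blast
    have "\<forall>\<^sub>F t in at a. t + (- b) \<notin> lattice \<tau>"
      by (rule eventually_at_shift[OF lattice_eventually'[OF im_pos]])
    thus ?thesis by eventually_elim (simp add: b torus_proj_eq_iff)
  next
    case False
    thus ?thesis by (intro always_eventually) blast
  qed
  hence "\<forall>\<^sub>F t in at a. \<forall>q\<in>P. p t \<noteq> q" using assms by (intro eventually_ball_finite) auto
  thus ?thesis by eventually_elim blast
qed

end

context surface_section
begin

section \<open>Orders of normal fields and the degree of the normal bundle\<close>

lemma section_preimage_open: "(V, g) \<in> S \<Longrightarrow> open {t. \<sigma> (p t) \<in> V}"
proof -
  assume V: "(V, g) \<in> S"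
  have "holomorphic_map C S \<sigma>" using graph_is_section[OF graph] by (simp add: is_section_def)
  hence "continuous_map (mtop C) (mtop S) \<sigma>" unfolding holomorphic_map_def by simp
  from openin_continuous_map_preimage[OF this chart_openin[OF V]]
  have "openin (mtop C) {q \<in> points C. \<sigma> q \<in> V}"
    unfolding uniformizes_topspace[OF uniformizes_C] .
  hence "open (UNIV \<inter> p -` {q \<in> points C. \<sigma> q \<in> V})"
    unfolding uniformizes_openin[OF uniformizes_C] by blast
  moreover have "UNIV \<inter> p -` {q \<in> points C. \<sigma> q \<in> V} = {t. \<sigma> (p t) \<in> V}" by (auto simp: points_C)
  ultimately show ?thesis by simp
qed

lemma eventually_in_chart:
  assumes "k \<in> S" "\<sigma> (p a) \<in> fst k"
  shows "\<forall>\<^sub>F t in nhds a. \<sigma> (p t) \<in> fst k"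
proof -
  have "open {t. \<sigma> (p t) \<in> fst k}" using section_preimage_open[of "fst k" "snd k"] assms(1) by simp
  from eventually_nhds_in_open[OF this] assms(2) show ?thesis by simp
qed

lemma normal_coordinate_eq:
  assumes "open D" "inj_on p D" "t \<in> D"
  shows "normal_coordinate (p ` D, inv_into D p) k \<sigma> w t = normal_part w k t"
proof -
  have "\<forall>\<^sub>F s in nhds t. (snd k \<circ> \<sigma> \<circ> inv_into (p ` D) (inv_into D p)) s = snd k (\<sigma> (p s))"
    using eventually_nhds_in_open[OF assms(1,3)]
    by eventually_elim (simp add: C_chart_inverse[OF assms(2)])
  from frechet_derivative_cong_ev[OF this] show ?thesis
    by (simp add: normal_coordinate_def normal_part_def det2_def velocity_def Let_def
        C_chart_inverse[OF assms(2,3)] o_def)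
qed

definition torus_crit :: "complex set \<Rightarrow> int"
  where "torus_crit q = F.crit (SOME a. p a = q)"

lemma torus_crit_eq: "torus_crit (p a) = F.crit a"
proof -
  have "p (SOME b. p b = p a) = p a" by (rule someI) simp
  hence "(SOME b. p b = p a) - a \<in> lattice \<tau>" by (simp add: torus_proj_eq_iff)
  from F.crit_lattice[OF this, of a] show ?thesis by (simp add: torus_crit_def)
qed

lemma finite_torus_crit: "finite {q \<in> range p. torus_crit q \<noteq> 0}"
proof (rule finite_torus_support[OF im_pos])
  fix a
  obtain b where b: "p b = p a" "f analytic_on {b}" "b - a \<in> lattice \<tau>"
    by (rule finite_representative) (rule that)
  have "\<forall>\<^sub>F x in at b. F.crit x = 0"
    using has_ord_eventually_0[OF F.has_ord_deriv_crit(1)[OF b(2)]] F.eventually_analytic[of b]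
    by eventually_elim (use F.has_ord_deriv_crit(1) has_ord_unique in blast)
  hence "\<forall>\<^sub>F x in at (a + (b - a)). F.crit x = 0" by simp
  from eventually_at_shift[OF this] show "\<forall>\<^sub>F x in at a. torus_crit (p x) = 0"
    by (simp add: torus_crit_eq F.crit_lattice[OF b(3)])
qed

lemma chart_at_point: "\<exists>k\<in>S. \<sigma> (p a) \<in> fst k"
proof -
  have "\<sigma> (p a) \<in> points S" using graph range_E(2) by (simp add: is_graph_def)
  thus ?thesis unfolding points_def by auto
qed

text \<open>The quotient of two sections of the normal bundle is a function on the curve. The chart
  \<open>k\<close> may change from point to point, since for the fields in question the quotient
  does not depend on it off finitely many classes.\<close>

definition field_ratio ::
  "('s set \<times> ('s \<Rightarrow> complex \<times> complex) \<Rightarrow> complex set \<Rightarrow> complex \<times> complex) \<Rightarrow> complex \<Rightarrow> complex"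
  where "field_ratio w t = (let k = SOME k. k \<in> S \<and> \<sigma> (p t) \<in> fst k in normal_part w k t / normal_part w0 k t)"

lemma field_ratio_periodic: "l \<in> lattice \<tau> \<Longrightarrow> field_ratio w (t + l) = field_ratio w t"
  by (simp add: field_ratio_def normal_part_periodic torus_proj_add_lattice)

lemma horizontal_transition':
  assumes "k \<in> S" "k' \<in> S" "\<sigma> (p t) \<in> fst k" "\<sigma> (p t) \<in> fst k'"
  shows "w0 k' (p t) = frechet_derivative (snd k' \<circ> inv_into (fst k) (snd k)) (at (snd k (\<sigma> (p t)))) (w0 k (p t))"
proof -
  have "\<sigma> (p t) \<in> points S" using graph range_E(2) by (simp add: is_graph_def)
  thus ?thesis using horizontal_transition[of "fst k" "snd k" "fst k'" "snd k'" "\<sigma> (p t)"] assms by simp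
qed

context
  fixes w
  assumes mer: "meromorphic_field_along C S \<sigma> w" and nz: "nonzero_normal C S \<sigma> w"
begin

lemma normal_part_has_ord:
  assumes k: "k \<in> S" "\<sigma> (p a) \<in> fst k"
  shows "has_ord (normal_part w k) a (zorder (normal_part w k) a)"
proof (rule meromorphic_has_ord)
  obtain D where D: "open D" "inj_on p D" "a \<in> D" "(p ` D, inv_into D p) \<in> C" by (rule C_chart_at) (rule that)
  have ia: "inv_into D p (p a) = a" by (rule inv_into_f_f[OF D(2,3)])
  have nD: "\<forall>\<^sub>F t in at a. t \<in> D" by (rule eventually_nhds_imp_at[OF eventually_nhds_in_open[OF D(1,3)]])
  from mer have "\<forall>(V, g)\<in>C. \<forall>k\<in>S.
       (\<lambda>t. fst (w k (inv_into V g t))) meromorphic_on g ` (V \<inter> \<sigma> -` fst k) \<and>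
       (\<lambda>t. snd (w k (inv_into V g t))) meromorphic_on g ` (V \<inter> \<sigma> -` fst k)"
    unfolding meromorphic_field_along_def by (rule conjunct2)
  from bspec[OF this D(4)] k(1)
  have m: "(\<lambda>t. fst (w k (inv_into (p ` D) (inv_into D p) t))) meromorphic_on inv_into D p ` (p ` D \<inter> \<sigma> -` fst k)"
    "(\<lambda>t. snd (w k (inv_into (p ` D) (inv_into D p) t))) meromorphic_on inv_into D p ` (p ` D \<inter> \<sigma> -` fst k)"
    by simp_all
  have "a \<in> inv_into D p ` (p ` D \<inter> \<sigma> -` fst k)"
    using ia k(2) D(3) by (intro image_eqI[of _ _ "p a"]) auto
  hence sub: "{a} \<subseteq> inv_into D p ` (p ` D \<inter> \<sigma> -` fst k)" by blast
  have ev: "\<forall>\<^sub>F t in at a. w k (inv_into (p ` D) (inv_into D p) t) = w k (p t)"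
    using nD by eventually_elim (simp add: C_chart_inverse[OF D(2)])
  have ev1: "\<forall>\<^sub>F t in at a. fst (w k (inv_into (p ` D) (inv_into D p) t)) = fst (w k (p t))"
    and ev2: "\<forall>\<^sub>F t in at a. snd (w k (inv_into (p ` D) (inv_into D p) t)) = snd (w k (p t))"
    by (use ev in eventually_elim, simp)+
  have "(\<lambda>t. fst (w k (p t))) meromorphic_on {a}"
    using meromorphic_on_subset[OF m(1) sub] meromorphic_on_cong[of "{a}", OF _ refl] ev1 by auto
  moreover have "(\<lambda>t. snd (w k (p t))) meromorphic_on {a}"
    using meromorphic_on_subset[OF m(2) sub] meromorphic_on_cong[of "{a}", OF _ refl] ev2 by auto
  moreover have "(\<lambda>t. fst (velocity k t)) meromorphic_on {a}" "(\<lambda>t. snd (velocity k t)) meromorphic_on {a}"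
    using velocity_analytic[of "fst k" "snd k" a] k by (auto intro: analytic_on_imp_meromorphic_on)
  ultimately show "normal_part w k meromorphic_on {a}"
    unfolding normal_part_def det2_def by (intro meromorphic_intros)
  have "p a \<in> fst (p ` D, inv_into D p)" using D(3) by simp
  from nz[unfolded nonzero_normal_def, rule_format, OF D(4) k(1) this k(2)]
  have "\<forall>\<^sub>F t in at (snd (p ` D, inv_into D p) (p a)). normal_coordinate (p ` D, inv_into D p) k \<sigma> w t \<noteq> 0" .
  hence "\<forall>\<^sub>F t in at a. normal_coordinate (p ` D, inv_into D p) k \<sigma> w t \<noteq> 0" by (simp add: ia)
  hence "\<forall>\<^sub>F t in at a. normal_part w k t \<noteq> 0"
    using nD by eventually_elim (simp add: normal_coordinate_eq[OF D(1,2)])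
  thus "\<exists>\<^sub>F t in at a. normal_part w k t \<noteq> 0" by (simp add: eventually_frequently)
qed

text \<open>The chart selected in \<open>field_ratio\<close> may vary with \<open>t\<close>, but the
  transition determinant is a common factor of numerator and denominator, so near \<open>a\<close>
  the ratio can be computed in the fixed chart \<open>k\<close>.\<close>

lemma field_ratio_ord:
  assumes k: "k \<in> S" "\<sigma> (p a) \<in> fst k" and n: "has_ord (normal_part w k) a n"
  shows "has_ord (field_ratio w) a (n - F.crit a)"
proof -
  from mer obtain P where P: "finite P" and T: "\<forall>k\<in>S. \<forall>k'\<in>S. \<forall>q\<in>points C - P. \<sigma> q \<in> fst k \<inter> fst k' \<longrightarrow>
      w k' q = frechet_derivative (snd k' \<circ> inv_into (fst k) (snd k)) (at (snd k (\<sigma> q))) (w k q)"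
    unfolding meromorphic_field_along_def by blast
  have "has_ord (\<lambda>t. normal_part w k t / normal_part w0 k t) a (n - F.crit a)"
    by (rule has_ord_divide[OF n horizontal_normal_ord[OF k]])
  moreover have "\<forall>\<^sub>F t in at a. field_ratio w t = normal_part w k t / normal_part w0 k t"
    using eventually_nhds_imp_at[OF eventually_in_chart[OF k]] has_ord_nonzero[OF horizontal_normal_ord[OF k]]
      eventually_not_in_finite[OF P, of a]
  proof eventually_elim
    case (elim t)
    define k' where "k' = (SOME k. k \<in> S \<and> \<sigma> (p t) \<in> fst k)"
    have k': "k' \<in> S" "\<sigma> (p t) \<in> fst k'"
      using someI_ex[of "\<lambda>k. k \<in> S \<and> \<sigma> (p t) \<in> fst k"] chart_at_point[of t] unfolding k'_def by blast+
    have pt: "p t \<in> points C - P" using elim(3) by (simp add: points_C)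
    have "\<sigma> (p t) \<in> fst k' \<inter> fst k" using k'(2) elim(1) by (rule IntI)
    note tr = T[rule_format, OF k'(1) k(1) pt this]
    have "normal_part w k t = transition_det k' k t * normal_part w k' t"
      by (rule normal_part_transition[where w = w, OF k'(1) k(1) k'(2) elim(1) tr])
    moreover have 0: "normal_part w0 k t = transition_det k' k t * normal_part w0 k' t"
      by (rule normal_part_transition[where w = w0, OF k'(1) k(1) k'(2) elim(1) horizontal_transition'[OF k'(1) k(1) k'(2) elim(1)]])
    \<comment> \<open>The normal part of the horizontal field is nonzero here, and the determinant
      is one of its factors.\<close>
    moreover have "transition_det k' k t \<noteq> 0" using 0 elim(2) by auto
    ultimately show ?case by (simp add: field_ratio_def k'_def[symmetric] Let_def)
  qed
  ultimately show ?thesis by (rule has_ord_cong)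
qed

text \<open>Expresses the order without reference to charts, which gives the definite description in
  \<open>normal_order\<close> its value: every pair of charts yields the same number.\<close>

lemma normal_order_eq: "normal_order C S \<sigma> w (p a) = zorder (field_ratio w) a + F.crit a"
  unfolding normal_order_def
proof (rule the_equality)
  have z: "zorder (normal_coordinate j k \<sigma> w) (snd j (p a)) = zorder (field_ratio w) a + F.crit a"
    if j: "j \<in> C" and k: "k \<in> S" and q: "p a \<in> fst j" "\<sigma> (p a) \<in> fst k" for j k
  proof -
    obtain D where D: "open D" "inj_on p D" "j = (p ` D, inv_into D p)" by (rule C_chartE[OF j]) (rule that)
    define b where "b = inv_into D p (p a)"
    have b: "b \<in> D" "p b = p a" using q(1) D(3) by (auto simp: b_def inv_into_into f_inv_into_f)
    have l: "b - a \<in> lattice \<tau>" using b(2) by (simp add: torus_proj_eq_iff)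
    have o: "has_ord (normal_part w k) b (zorder (normal_part w k) b)"
      by (rule normal_part_has_ord[OF k]) (use q b in simp)
    have "\<forall>\<^sub>F t in at b. normal_coordinate j k \<sigma> w t = normal_part w k t"
      using eventually_nhds_imp_at[OF eventually_nhds_in_open[OF D(1) b(1)]]
      by eventually_elim (simp add: D(3) normal_coordinate_eq[OF D(1,2)])
    from has_ord_imp_zorder[OF has_ord_cong[OF o this]]
    have 1: "zorder (normal_coordinate j k \<sigma> w) b = zorder (normal_part w k) b" .
    have "has_ord (normal_part w k) a (zorder (normal_part w k) b)"
      by (rule has_ord_normal_part_shift[OF o l])
    from has_ord_imp_zorder[OF field_ratio_ord[OF k q(2) this]]
    show ?thesis using 1 by (simp add: D(3) b_def)
  qed
  show "\<forall>j\<in>C. \<forall>k\<in>S. p a \<in> fst j \<longrightarrow> \<sigma> (p a) \<in> fst k \<longrightarrow>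
      zorder (field_ratio w) a + F.crit a = zorder (normal_coordinate j k \<sigma> w) (snd j (p a))"
    using z by simp
  fix n assume n: "\<forall>j\<in>C. \<forall>k\<in>S. p a \<in> fst j \<longrightarrow> \<sigma> (p a) \<in> fst k \<longrightarrow> n = zorder (normal_coordinate j k \<sigma> w) (snd j (p a))"
  obtain D where D: "open D" "inj_on p D" "a \<in> D" "(p ` D, inv_into D p) \<in> C" by (rule C_chart_at) (rule that)
  obtain k where k: "k \<in> S" "\<sigma> (p a) \<in> fst k" using chart_at_point by blast
  have pa: "p a \<in> fst (p ` D, inv_into D p)" using D(3) by simp
  from n[rule_format, OF D(4) k(1) pa k(2)] z[OF D(4) k(1) pa k(2)]
  show "n = zorder (field_ratio w) a + F.crit a" by simp
qed

text \<open>The two divisors differ by the divisor of \<open>field_ratio w\<close>, an elliptic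
  function, whose degree is 0. So every admissible field gives the same sum.\<close>

lemma sum_normal_order:
  "(\<Sum>q | q \<in> points C \<and> normal_order C S \<sigma> w q \<noteq> 0. normal_order C S \<sigma> w q) =
   (\<Sum>q | q \<in> range p \<and> torus_crit q \<noteq> 0. torus_crit q)"
proof -
  let ?m = "normal_order C S \<sigma> w"
  define n where "n q = ?m q - torus_crit q" for q
  have "has_ord (field_ratio w) a (n (p a))" for a
  proof -
    obtain k where k: "k \<in> S" "\<sigma> (p a) \<in> fst k" using chart_at_point by blast
    have "has_ord (field_ratio w) a (zorder (normal_part w k) a - F.crit a)"
      by (rule field_ratio_ord[OF k normal_part_has_ord[OF k]])
    hence "has_ord (field_ratio w) a (zorder (field_ratio w) a)" using has_ord_imp_zorder by metis
    thus ?thesis by (simp add: n_def normal_order_eq torus_crit_eq)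
  qed
  note d = degree_zero[OF im_pos, of "field_ratio w" n, OF this]
  have per: "\<forall>\<^sub>F x in at a. field_ratio w (x + 1) = field_ratio w x"
    "\<forall>\<^sub>F x in at a. field_ratio w (x + \<tau>) = field_ratio w x" for a
    by (simp_all add: field_ratio_periodic lattice_1 lattice_tau)
  have fn: "finite {q \<in> range p. n q \<noteq> 0}" and sn: "(\<Sum>q | q \<in> range p \<and> n q \<noteq> 0. n q) = 0"
    using d[OF per] by auto
  \<comment> \<open>One finite set that contains all three supports, so that the sums can be
    subtracted.\<close>
  define A where "A = {q \<in> range p. n q \<noteq> 0} \<union> {q \<in> range p. torus_crit q \<noteq> 0}"
  have fA: "finite A" unfolding A_def using fn finite_torus_crit by blast
  have "0 = (\<Sum>q\<in>A. n q)"
  proof -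
    have "(\<Sum>q | q \<in> range p \<and> n q \<noteq> 0. n q) = (\<Sum>q\<in>A. n q)"
      by (rule sum.mono_neutral_left[OF fA]) (auto simp: A_def)
    thus ?thesis using sn by simp
  qed
  also have "\<dots> = (\<Sum>q\<in>A. ?m q) - (\<Sum>q\<in>A. torus_crit q)" by (simp add: n_def sum_subtractf)
  also have "(\<Sum>q\<in>A. ?m q) = (\<Sum>q | q \<in> points C \<and> ?m q \<noteq> 0. ?m q)"
    by (rule sum.mono_neutral_right[OF fA]) (auto simp: A_def n_def points_C)
  also have "(\<Sum>q\<in>A. torus_crit q) = (\<Sum>q | q \<in> range p \<and> torus_crit q \<noteq> 0. torus_crit q)"
    by (rule sum.mono_neutral_right[OF fA]) (auto simp: A_def)
  finally show ?thesis by simp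
qed

end

lemma horizontal_meromorphic_field: "meromorphic_field_along C S \<sigma> w0"
  unfolding meromorphic_field_along_def
proof (intro conjI exI[of _ "{}"] ballI impI)
  fix k k' q assume kq: "k \<in> S" "k' \<in> S" "q \<in> points C - {}" "\<sigma> q \<in> fst k \<inter> fst k'"
  from kq(3) obtain x where x: "q = p x" by (auto simp: points_C)
  show "w0 k' q = frechet_derivative (snd k' \<circ> inv_into (fst k) (snd k)) (at (snd k (\<sigma> q))) (w0 k q)"
    unfolding x by (rule horizontal_transition') (use kq x in auto)
next
  fix j assume j: "j \<in> C"
  obtain D where D: "open D" "inj_on p D" "j = (p ` D, inv_into D p)" by (rule C_chartE[OF j]) (rule that)
  have loc: "(\<lambda>t. fst (w0 k (inv_into (p ` D) (inv_into D p) t))) meromorphic_on {t} \<and>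
      (\<lambda>t. snd (w0 k (inv_into (p ` D) (inv_into D p) t))) meromorphic_on {t}"
    if k: "k \<in> S" and t: "t \<in> inv_into D p ` (p ` D \<inter> \<sigma> -` fst k)" for k t
  proof -
    from t obtain s where s: "s \<in> D" "\<sigma> (p s) \<in> fst k" "t = inv_into D p (p s)" by blast
    hence ts: "t = s" using inv_into_f_f[OF D(2)] by simp
    have ev: "\<forall>\<^sub>F u in nhds t. w0 k (p u) = w0 k (inv_into (p ` D) (inv_into D p) u)"
      using eventually_nhds_in_open[OF D(1), of t] s(1) ts
      by (auto elim!: eventually_mono simp: C_chart_inverse[OF D(2)])
    have "\<forall>\<^sub>F u in nhds t. fst (w0 k (p u)) = fst (w0 k (inv_into (p ` D) (inv_into D p) u))"
      "\<forall>\<^sub>F u in nhds t. snd (w0 k (p u)) = snd (w0 k (inv_into (p ` D) (inv_into D p) u))"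
      by (use ev in eventually_elim, simp)+
    from analytic_at_transform[OF _ this(1)] analytic_at_transform[OF _ this(2)]
    show ?thesis
      using horizontal_analytic[of "fst k" "snd k" t] k s ts by (auto intro!: analytic_on_imp_meromorphic_on)
  qed
  show "case j of (V, g) \<Rightarrow> \<forall>k\<in>S.
       (\<lambda>t. fst (w0 k (inv_into V g t))) meromorphic_on g ` (V \<inter> \<sigma> -` fst k) \<and>
       (\<lambda>t. snd (w0 k (inv_into V g t))) meromorphic_on g ` (V \<inter> \<sigma> -` fst k)"
    unfolding D(3) prod.case
  proof (intro ballI conjI)
    fix k assume k: "k \<in> S"
    show "(\<lambda>t. fst (w0 k (inv_into (p ` D) (inv_into D p) t))) meromorphic_on inv_into D p ` (p ` D \<inter> \<sigma> -` fst k)"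
      by (subst meromorphic_on_meromorphic_at) (rule ballI, rule conjunct1[OF loc[OF k]])
    show "(\<lambda>t. snd (w0 k (inv_into (p ` D) (inv_into D p) t))) meromorphic_on inv_into D p ` (p ` D \<inter> \<sigma> -` fst k)"
      by (subst meromorphic_on_meromorphic_at) (rule ballI, rule conjunct2[OF loc[OF k]])
  qed
qed simp

lemma horizontal_nonzero_normal: "nonzero_normal C S \<sigma> w0"
  unfolding nonzero_normal_def
proof (intro ballI allI impI)
  fix j k q assume j: "j \<in> C" and k: "k \<in> S" and q: "q \<in> fst j" "\<sigma> q \<in> fst k"
  obtain D where D: "open D" "inj_on p D" "j = (p ` D, inv_into D p)" by (rule C_chartE[OF j]) (rule that)
  define b where "b = inv_into D p q"
  have b: "b \<in> D" "p b = q" using q(1) D(3) by (auto simp: b_def inv_into_into f_inv_into_f)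
  have "\<forall>\<^sub>F t in at b. normal_part w0 k t \<noteq> 0"
    by (rule has_ord_nonzero[OF horizontal_normal_ord[OF k]]) (use q b in simp)
  thus "\<forall>\<^sub>F t in at (snd j q). normal_coordinate j k \<sigma> w0 t \<noteq> 0"
    using eventually_nhds_imp_at[OF eventually_nhds_in_open[OF D(1) b(1)]]
    unfolding D(3) snd_conv b_def[symmetric]
    by eventually_elim (simp add: normal_coordinate_eq[OF D(1,2)])
qed

lemma self_intersection_eq:
  "self_intersection C S \<sigma> = (\<Sum>q | q \<in> range p \<and> torus_crit q \<noteq> 0. torus_crit q)"
  unfolding self_intersection_def
proof (rule the_equality)
  show "\<exists>w. meromorphic_field_along C S \<sigma> w \<and> nonzero_normal C S \<sigma> w \<and>
      (\<Sum>q | q \<in> range p \<and> torus_crit q \<noteq> 0. torus_crit q) =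
      (\<Sum>q | q \<in> points C \<and> normal_order C S \<sigma> w q \<noteq> 0. normal_order C S \<sigma> w q)"
    using horizontal_meromorphic_field horizontal_nonzero_normal
      sum_normal_order[OF horizontal_meromorphic_field horizontal_nonzero_normal, symmetric] by blast
  show "n = (\<Sum>q | q \<in> range p \<and> torus_crit q \<noteq> 0. torus_crit q)"
    if "\<exists>w. meromorphic_field_along C S \<sigma> w \<and> nonzero_normal C S \<sigma> w \<and>
      n = (\<Sum>q | q \<in> points C \<and> normal_order C S \<sigma> w q \<noteq> 0. normal_order C S \<sigma> w q)" for n
  proof -
    from that obtain w where w: "meromorphic_field_along C S \<sigma> w" "nonzero_normal C S \<sigma> w"
      "n = (\<Sum>q | q \<in> points C \<and> normal_order C S \<sigma> w q \<noteq> 0. normal_order C S \<sigma> w q)" by blast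
    show ?thesis unfolding w(3) by (rule sum_normal_order[OF w(1,2)])
  qed
qed

text \<open>The critical multiplicities are nonnegative integers, so a sum of 1 leaves room for one
  class of multiplicity one and no other.\<close>

lemma self_intersection_eq_1_iff:
  "self_intersection C S \<sigma> = 1 \<longleftrightarrow> (\<exists>a. \<forall>x. F.crit x = (if x - a \<in> lattice \<tau> then 1 else 0))"
proof
  define A where "A = {q. q \<in> range p \<and> torus_crit q \<noteq> 0}"
  have fA: "finite A" using finite_torus_crit by (simp add: A_def)
  have pos: "torus_crit q \<ge> 1" if "q \<in> A" for q
  proof -
    from that obtain a where "q = p a" "torus_crit q \<noteq> 0" by (auto simp: A_def)
    thus ?thesis using F.crit_ge_0[of a] by (simp add: torus_crit_eq)
  qed
  have si: "self_intersection C S \<sigma> = (\<Sum>q\<in>A. torus_crit q)" by (simp add: self_intersection_eq A_def)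
  assume "self_intersection C S \<sigma> = 1"
  hence s: "(\<Sum>q\<in>A. torus_crit q) = 1" using si by simp
  hence "A \<noteq> {}" by auto
  then obtain q0 where q0: "q0 \<in> A" by blast
  then obtain a where a: "q0 = p a" by (auto simp: A_def)
  define B where "B = A - {q0}"
  have "(\<Sum>q\<in>A. torus_crit q) = torus_crit q0 + (\<Sum>q\<in>B. torus_crit q)"
    unfolding B_def using fA q0 by (rule sum.remove)
  moreover have "(\<Sum>q\<in>B. torus_crit q) \<ge> (\<Sum>q\<in>B. 1)"
    by (intro sum_mono) (use pos B_def in blast)
  ultimately have "card B = 0" "torus_crit q0 = 1" using s pos[OF q0] by simp_all
  hence "B = {}" using fA B_def by simp
  hence "A = {q0}" using q0 unfolding B_def by blast
  have "F.crit x = (if x - a \<in> lattice \<tau> then 1 else 0)" for x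
  proof (cases "x - a \<in> lattice \<tau>")
    case True
    hence "p x = q0" by (simp add: a torus_proj_eq_iff)
    thus ?thesis using True \<open>torus_crit q0 = 1\<close> torus_crit_eq[of x] by simp
  next
    case False
    hence "p x \<notin> A" using \<open>A = {q0}\<close> by (simp add: a torus_proj_eq_iff)
    hence "torus_crit (p x) = 0" by (simp add: A_def)
    thus ?thesis using False by (simp add: torus_crit_eq)
  qed
  thus "\<exists>a. \<forall>x. F.crit x = (if x - a \<in> lattice \<tau> then 1 else 0)" by blast
next
  assume "\<exists>a. \<forall>x. F.crit x = (if x - a \<in> lattice \<tau> then 1 else 0)"
  then obtain a where a: "\<And>x. F.crit x = (if x - a \<in> lattice \<tau> then 1 else 0)" by blast
  have "{q. q \<in> range p \<and> torus_crit q \<noteq> 0} = {p a}"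
  proof -
    have "torus_crit (p x) \<noteq> 0 \<longleftrightarrow> p x = p a" for x
      using a[of x] by (simp add: torus_crit_eq torus_proj_eq_iff)
    thus ?thesis by blast
  qed
  moreover have "torus_crit (p a) = 1" using a[of a] by (simp add: torus_crit_eq lattice_0)
  ultimately show "self_intersection C S \<sigma> = 1" by (simp add: self_intersection_eq)
qed

end

context suspended_surface
begin

definition minimal_leaf :: "complex \<Rightarrow> 's set"
  where "minimal_leaf c = range (\<lambda>x. Psi x (proj_lift (jac \<tau>) (x + c)))"

lemma minimal_section_web_eq: "minimal_section_web C S \<pi> = range minimal_leaf"
proof
  show "minimal_section_web C S \<pi> \<subseteq> range minimal_leaf"
  proof
    fix L assume "L \<in> minimal_section_web C S \<pi>"
    then obtain \<sigma> where L: "L = \<sigma> ` points C" and \<sigma>: "is_section C S \<pi> \<sigma>" "self_intersection C S \<sigma> = 1"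
      unfolding minimal_section_web_def by blast
    obtain f where g: "is_graph f \<sigma>" using section_is_graph[OF \<sigma>(1)] by blast
    interpret equivariant \<tau> f using g by (simp add: is_graph_def)
    interpret surface_section \<tau> S \<pi> \<psi> f \<sigma> by unfold_locales (rule g)
    obtain a where "\<And>x. crit x = (if x - a \<in> lattice \<tau> then 1 else 0)"
      using \<sigma>(2) unfolding self_intersection_eq_1_iff by blast
    from equivariant_single_critical_class[OF equivariant_axioms this]
    obtain c where c: "f = (\<lambda>x. jac \<tau> (x + c))" by blast
    have "\<sigma> (p x) = Psi x (proj_lift (jac \<tau>) (x + c))" for x
      using g by (simp add: is_graph_def c proj_lift_translate)
    hence "L = minimal_leaf c" unfolding L points_C minimal_leaf_def by (auto simp: image_image)
    thus "L \<in> range minimal_leaf" by blast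
  qed
  show "range minimal_leaf \<subseteq> minimal_section_web C S \<pi>"
  proof
    fix L assume "L \<in> range minimal_leaf"
    then obtain c where L: "L = minimal_leaf c" by blast
    define f where "f x = jac \<tau> (x + c)" for x
    interpret f: equivariant \<tau> f
      unfolding f_def by (rule equivariant.translate[OF jac_equivariant[OF im_pos]])
    obtain \<sigma> where g: "is_graph f \<sigma>" using is_graph_exists[OF f.equivariant_axioms] by blast
    interpret surface_section \<tau> S \<pi> \<psi> f \<sigma> by unfold_locales (rule g)
    have "f.crit x = (if x - (- c) \<in> lattice \<tau> then 1 else 0)" for x
      using crit_translate[OF jac_equivariant[OF im_pos], of c x] jac_crit[OF im_pos, of "x + c"]
      by (simp add: f_def[abs_def])
    hence "self_intersection C S \<sigma> = 1" unfolding self_intersection_eq_1_iff by blast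
    moreover have "\<sigma> (p x) = Psi x (proj_lift (jac \<tau>) (x + c))" for x
      using g by (simp add: is_graph_def f_def[abs_def] proj_lift_translate)
    hence "L = \<sigma> ` points C" unfolding L points_C minimal_leaf_def by (auto simp: image_image)
    ultimately show "L \<in> minimal_section_web C S \<pi>"
      unfolding minimal_section_web_def using graph_is_section[OF g] by blast
  qed
qed

end

section \<open>Parallel webs\<close>

definition linear_form :: "complex \<times> complex \<Rightarrow> complex \<times> complex \<Rightarrow> complex"
  where "linear_form w d = fst w * fst d + snd w * snd d"

definition kernel_line :: "complex \<times> complex \<Rightarrow> (complex \<times> complex) set"
  where "kernel_line w = {d. linear_form w d = 0}"

lemma complex_line_kernel:
  assumes "w \<noteq> 0"
  shows "complex_line (kernel_line w)"
  unfolding complex_line_def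
proof (intro exI[of _ "(snd w, - fst w)"] conjI)
  show "(snd w, - fst w) \<noteq> 0" using assms by (auto simp: prod_eq_iff)
  show "kernel_line w = range (\<lambda>c. c *\<^sub>C (snd w, - fst w))"
  proof
    show "range (\<lambda>c. c *\<^sub>C (snd w, - fst w)) \<subseteq> kernel_line w"
      by (auto simp: kernel_line_def linear_form_def scaleC_prod_def scaleC_complex_def)
    show "kernel_line w \<subseteq> range (\<lambda>c. c *\<^sub>C (snd w, - fst w))"
    proof
      fix d assume "d \<in> kernel_line w"
      hence e: "fst w * fst d + snd w * snd d = 0" by (simp add: kernel_line_def linear_form_def)
      show "d \<in> range (\<lambda>c. c *\<^sub>C (snd w, - fst w))"
      proof (cases "snd w = 0")
        case False
        have "snd w * snd d = - (fst w * fst d)" using e by (simp add: eq_neg_iff_add_eq_0 add.commute)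
        hence "snd d = (fst d / snd w) * (- fst w)" using False by (simp add: field_simps)
        hence "d = (fst d / snd w) *\<^sub>C (snd w, - fst w)"
          using False by (simp add: prod_eq_iff scaleC_prod_def scaleC_complex_def)
        thus ?thesis by blast
      next
        case True
        hence "fst w \<noteq> 0" using assms by (auto simp: prod_eq_iff)
        hence "d = (- snd d / fst w) *\<^sub>C (snd w, - fst w)"
          using e True by (simp add: prod_eq_iff scaleC_prod_def scaleC_complex_def)
        thus ?thesis by blast
      qed
    qed
  qed
qed

lemma linear_form_diff: "linear_form w (d - b) = linear_form w d - linear_form w b"
  by (simp add: linear_form_def algebra_simps)

text \<open>Everything is stated in the uniformizing coordinates. On a ball on which
  \<open>E\<close> is injective the local inverse of \<open>E\<close> is the chart required, its
  image is convex, and the plaques are the pieces of the level lines of the forms in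
  \<open>F\<close>; \<open>A w\<close> is the set of levels of \<open>w\<close> that make up a
  leaf.\<close>

lemma parallelizable_webI:
  fixes M :: "('p, complex \<times> complex) atlas"
  assumes M: "uniformizes M E UNIV"
    and F: "finite F" "card (kernel_line ` F) = k" "0 \<notin> F"
    and leaves: "\<And>L. L \<in> \<W> \<Longrightarrow> \<exists>A. (\<forall>w\<in>F. countable (A w)) \<and> (\<forall>d. E d \<in> L \<longleftrightarrow> (\<exists>w\<in>F. linear_form w d \<in> A w))"
    and cover: "\<And>w \<alpha>. w \<in> F \<Longrightarrow> \<exists>L\<in>\<W>. \<forall>d. linear_form w d = \<alpha> \<longrightarrow> E d \<in> L"
  shows "parallelizable_web k M \<W>"
  unfolding parallelizable_web_def
proof
  fix x assume "x \<in> points M"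
  then obtain a where a: "x = E a" using uniformizes_basic(2)[OF M] by blast
  obtain B where B: "open B" "a \<in> B" "B \<subseteq> UNIV" "inj_on E B"
    by (rule uniformizes_locally_inj[OF M, of a]) (simp, rule that)
  obtain r where r: "r > 0" "ball a r \<subseteq> B" using B(1,2) open_contains_ball by blast
  define D where "D = ball a r"
  have D: "open D" "convex D" "a \<in> D" "inj_on E D"
    using r B(4) by (auto simp: D_def intro: inj_on_subset)
  define U where "U = E ` D"
  define \<zeta> where "\<zeta> = inv_into D E"
  have \<zeta>: "\<zeta> (E d) = d" if "d \<in> D" for d unfolding \<zeta>_def by (rule inv_into_f_f[OF D(4) that])
  have \<zeta>U: "\<zeta> ` U = D" using \<zeta> by (force simp: U_def image_image)
  let ?Ls = "kernel_line ` F"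
  have plaque: "{y \<in> U. \<zeta> y - \<zeta> (E b) \<in> kernel_line w} = E ` {d \<in> D. linear_form w d = linear_form w b}"
    if "b \<in> D" for b w
    unfolding U_def using \<zeta> that by (auto simp: kernel_line_def linear_form_diff)
  have bih: "biholomorphic_map (restrict_atlas M U) (domain_atlas (\<zeta> ` U)) \<zeta>"
    unfolding \<zeta>U unfolding U_def
  proof (rule biholomorphic_mapI[OF uniformizes_restrict[OF M D(1)] uniformizes_domain[OF D(1)], where k = E])
    have idc: "cholomorphic_on (\<lambda>d. d) D" by (simp add: cholomorphic_on_iff cdiff_at_ident)
    show "has_local_lifts E D id D \<zeta>"
      unfolding has_local_lifts_def
      by (intro ballI exI[of _ D] exI[of _ "\<lambda>d. d"]) (use D idc \<zeta> in auto)
    show "has_local_lifts id D E D E"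
      unfolding has_local_lifts_def
      by (intro ballI exI[of _ D] exI[of _ "\<lambda>d. d"]) (use D idc in auto)
  qed (use \<zeta> in auto)
  show "\<exists>U (\<zeta> :: 'p \<Rightarrow> complex \<times> complex) Ls.
       openin (mtop M) U \<and> x \<in> U \<and> open (\<zeta> ` U) \<and> convex (\<zeta> ` U) \<and>
       biholomorphic_map (restrict_atlas M U) (domain_atlas (\<zeta> ` U)) \<zeta> \<and>
       finite Ls \<and> card Ls = k \<and> (\<forall>l\<in>Ls. complex_line l) \<and>
       (\<forall>L\<in>\<W>. \<exists>\<P>. countable \<P> \<and> \<P> \<subseteq> line_plaques U \<zeta> Ls \<and> L \<inter> U = \<Union> \<P>) \<and>
       (\<forall>P\<in>line_plaques U \<zeta> Ls. \<exists>L\<in>\<W>. P \<subseteq> L)"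
  proof (intro exI[of _ U] exI[of _ \<zeta>] exI[of _ ?Ls] conjI ballI)
    show "openin (mtop M) U" unfolding U_def by (rule uniformizes_open_map[OF M D(1)]) simp
    show "x \<in> U" using a D(3) by (simp add: U_def)
    show "open (\<zeta> ` U)" "convex (\<zeta> ` U)" unfolding \<zeta>U by (rule D)+
    show "biholomorphic_map (restrict_atlas M U) (domain_atlas (\<zeta> ` U)) \<zeta>" by (rule bih)
    show "finite ?Ls" "card ?Ls = k" using F by auto
    show "complex_line l" if l: "l \<in> ?Ls" for l
    proof -
      obtain w where w: "w \<in> F" "l = kernel_line w" using l by blast
      hence "w \<noteq> 0" using F(3) by metis
      thus ?thesis unfolding w(2) by (rule complex_line_kernel)
    qed
    show "\<exists>\<P>. countable \<P> \<and> \<P> \<subseteq> line_plaques U \<zeta> ?Ls \<and> L \<inter> U = \<Union> \<P>" if L: "L \<in> \<W>" for L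
    proof -
      obtain A where A: "\<forall>w\<in>F. countable (A w)" "\<forall>d. E d \<in> L \<longleftrightarrow> (\<exists>w\<in>F. linear_form w d \<in> A w)"
        using leaves[OF L] by (elim exE conjE)
      \<comment> \<open>One plaque for each form and each level of the leaf that is attained in the
        ball.\<close>
      define \<P> where "\<P> = (\<Union>w\<in>F. (\<lambda>\<alpha>. E ` {d \<in> D. linear_form w d = \<alpha>}) ` (A w \<inter> linear_form w ` D))"
      have "countable \<P>" unfolding \<P>_def using F(1) A(1)
        by (intro countable_UN countable_image countable_Int1) (auto simp: countable_finite)
      moreover have "\<P> \<subseteq> line_plaques U \<zeta> ?Ls"
      proof
        fix P assume "P \<in> \<P>"
        then obtain w b where wb: "w \<in> F" "b \<in> D" "P = E ` {d \<in> D. linear_form w d = linear_form w b}"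
          unfolding \<P>_def by blast
        have "P = {y \<in> U. \<zeta> y - \<zeta> (E b) \<in> kernel_line w}" unfolding plaque[OF wb(2)] by (rule wb(3))
        moreover have "E b \<in> U" using wb(2) by (simp add: U_def)
        ultimately show "P \<in> line_plaques U \<zeta> ?Ls" using wb(1) unfolding line_plaques_def by blast
      qed
      moreover have "L \<inter> U = \<Union> \<P>"
      proof
        show "L \<inter> U \<subseteq> \<Union> \<P>"
        proof
          fix y assume "y \<in> L \<inter> U"
          then obtain d where d: "d \<in> D" "y = E d" "E d \<in> L" by (auto simp: U_def)
          then obtain w where w: "w \<in> F" "linear_form w d \<in> A w" using A(2) by blast
          have "y \<in> E ` {d' \<in> D. linear_form w d' = linear_form w d}" using d by blast
          thus "y \<in> \<Union> \<P>" unfolding \<P>_def using w d(1) by blast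
        qed
        show "\<Union> \<P> \<subseteq> L \<inter> U"
        proof
          fix y assume "y \<in> \<Union> \<P>"
          then obtain w d where wd: "w \<in> F" "d \<in> D" "linear_form w d \<in> A w" "y = E d" unfolding \<P>_def by blast
          hence "E d \<in> L" using A(2) by blast
          thus "y \<in> L \<inter> U" using wd by (simp add: U_def)
        qed
      qed
      ultimately show ?thesis by blast
    qed
    show "\<exists>L\<in>\<W>. P \<subseteq> L" if "P \<in> line_plaques U \<zeta> ?Ls" for P
    proof -
      from that obtain y w where y: "y \<in> U" "w \<in> F" "P = {z \<in> U. \<zeta> z - \<zeta> y \<in> kernel_line w}"
        unfolding line_plaques_def by blast
      obtain b where b: "b \<in> D" "y = E b" using y(1) by (auto simp: U_def)
      have "P = E ` {d \<in> D. linear_form w d = linear_form w b}" unfolding y(3) b(2) by (rule plaque[OF b(1)])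
      moreover obtain L where "L \<in> \<W>" "\<forall>d. linear_form w d = linear_form w b \<longrightarrow> E d \<in> L"
        using cover[OF y(2), of "linear_form w b"] by (elim bexE)
      ultimately show ?thesis by blast
    qed
  qed
qed

section \<open>The double cover\<close>

context suspended_surface
begin

abbreviation "J \<equiv> proj_lift (jac \<tau>)"
abbreviation "CC \<equiv> prod_atlas C C"
abbreviation "pp \<equiv> map_prod p p"

lemmas J_eq_iff = jac_lift_eq_iff[OF im_pos]

lemma J_shift: "J (x + of_int m + of_int n * \<tau>) = rho m n (J x)"
  by (rule equivariant.lift_plus[OF jac_equivariant[OF im_pos]])

lemma uniformizes_CC: "uniformizes CC pp UNIV"
  using uniformizes_prod[OF uniformizes_C uniformizes_C] by simp

lemma points_CC: "points CC = range pp"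
  using uniformizes_basic(2)[OF uniformizes_CC] by simp

text \<open>Any representative may be chosen. A lattice vector added to the first coordinate changes
  the argument of \<open>J\<close> by twice that vector, which is a period; one added to the second
  is absorbed by the equivariance of \<open>J\<close>.\<close>

definition \<phi> :: "complex set \<times> complex set \<Rightarrow> 's"
  where "\<phi> y = (let u = SOME u. pp u = y in Psi (snd u) (J (snd u - 2 * fst u)))"

lemma phi_eq: "\<phi> (p q, p x) = Psi x (J (x - 2 * q))"
proof -
  define u where "u = (SOME u. pp u = (p q, p x))"
  have "pp u = (p q, p x)" unfolding u_def by (rule someI[of _ "(q, x)"]) simp
  hence "p (fst u) = p q" "p (snd u) = p x" by (auto simp: map_prod_def case_prod_unfold)
  hence l: "fst u - q \<in> lattice \<tau>" "snd u - x \<in> lattice \<tau>" by (simp_all add: torus_proj_eq_iff)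
  obtain m n where mn: "snd u = x + of_int m + of_int n * \<tau>"
    using l(2) unfolding lattice_iff by (auto simp: algebra_simps)
  have "J (snd u - 2 * fst u) = J (snd u - 2 * fst u + 2 * (fst u - q))"
    by (rule jac_lift_periodic[OF im_pos l(1), symmetric])
  also have "snd u - 2 * fst u + 2 * (fst u - q) = (x - 2 * q) + of_int m + of_int n * \<tau>"
    using mn by (simp add: algebra_simps)
  also have "J \<dots> = rho m n (J (x - 2 * q))" by (rule J_shift)
  finally have "\<phi> (p q, p x) = Psi (x + of_int m + of_int n * \<tau>) (rho m n (J (x - 2 * q)))"
    by (simp add: \<phi>_def u_def[symmetric] Let_def mn)
  thus ?thesis by (simp only: Psi_shift)
qed

lemma phi_pp: "\<phi> (pp d) = Psi (snd d) (J (snd d - 2 * fst d))"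
  using phi_eq[of "fst d" "snd d"] by (simp add: map_prod_def case_prod_unfold)

lemma phi_eq_iff: "\<phi> (p q, p x) = \<phi> (p q', p x) \<longleftrightarrow> q - q' \<in> lattice \<tau> \<or> x - q - q' \<in> lattice \<tau>"
proof -
  have "\<phi> (p q, p x) = \<phi> (p q', p x) \<longleftrightarrow> J (x - 2 * q) = J (x - 2 * q')"
    unfolding phi_eq using Psi_inj by auto
  also have "\<dots> \<longleftrightarrow> q' - q \<in> lattice \<tau> \<or> x - q - q' \<in> lattice \<tau>"
  proof -
    have e: "(x - 2 * q - (x - 2 * q')) / 2 = q' - q" "(x - 2 * q + (x - 2 * q')) / 2 = x - q - q'"
      by (simp_all add: field_simps)
    show ?thesis unfolding J_eq_iff e ..
  qed
  also have "q' - q \<in> lattice \<tau> \<longleftrightarrow> q - q' \<in> lattice \<tau>" using lattice_minus_iff[of "q - q'" \<tau>] by simp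
  finally show ?thesis .
qed

lemma surface_pointE:
  assumes "y \<in> points S"
  obtains x q where "y = \<phi> (p q, p x)"
proof -
  obtain v where "y = E v" using assms range_E(1) by blast
  moreover obtain u where "J u = Affine (snd v)" using jac_surj[OF im_pos] by blast
  ultimately have "y = \<phi> (p ((fst v - u) / 2), p (fst v))" unfolding phi_eq E_def by (simp add: field_simps)
  thus ?thesis using that by blast
qed

lemma phi_fibre: "{z \<in> points CC. \<phi> z = \<phi> (p q, p x)} = {(p q, p x), (p (x - q), p x)}"
proof
  show "{(p q, p x), (p (x - q), p x)} \<subseteq> {z \<in> points CC. \<phi> z = \<phi> (p q, p x)}"
  proof -
    have "\<phi> (p (x - q), p x) = \<phi> (p q, p x)" unfolding phi_eq_iff by (simp add: lattice_0)
    moreover have "(p q, p x) = pp (q, x)" "(p (x - q), p x) = pp (x - q, x)" by simp_all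
    hence "(p q, p x) \<in> points CC" "(p (x - q), p x) \<in> points CC" unfolding points_CC by blast+
    ultimately show ?thesis by simp
  qed
  show "{z \<in> points CC. \<phi> z = \<phi> (p q, p x)} \<subseteq> {(p q, p x), (p (x - q), p x)}"
  proof
    fix z assume "z \<in> {z \<in> points CC. \<phi> z = \<phi> (p q, p x)}"
    then obtain a b where z: "z = (p a, p b)" "\<phi> (p a, p b) = \<phi> (p q, p x)" unfolding points_CC by auto
    hence "\<pi> (\<phi> (p a, p b)) = \<pi> (\<phi> (p q, p x))" by simp
    hence pb: "p b = p x" by (simp add: phi_eq proj_Psi)
    hence "\<phi> (p a, p x) = \<phi> (p q, p x)" using z(2) by simp
    hence "p a = p q \<or> p a = p (x - q)"
    proof (subst (asm) phi_eq_iff, elim disjE)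
      assume "x - a - q \<in> lattice \<tau>"
      hence "- (x - a - q) \<in> lattice \<tau>" by (rule lattice_minus)
      thus ?thesis by (simp add: torus_proj_eq_iff algebra_simps)
    qed (simp add: torus_proj_eq_iff)
    thus "z \<in> {(p q, p x), (p (x - q), p x)}" using z(1) pb by auto
  qed
qed

lemma phi_lift:
  assumes "jac \<tau> analytic_on {x - 2 * q}"
  shows "\<exists>B. open B \<and> (q, x) \<in> B \<and> cholomorphic_on (\<lambda>d. (snd d, jac \<tau> (snd d - 2 * fst d))) B \<and>
    (\<forall>d\<in>B. \<phi> (pp d) = E (snd d, jac \<tau> (snd d - 2 * fst d)))"
proof -
  from analytic_at_eventually_analytic[OF assms] obtain N where
    N: "open N" "x - 2 * q \<in> N" "\<And>u. u \<in> N \<Longrightarrow> jac \<tau> analytic_on {u}"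
    unfolding eventually_nhds by blast
  define B where "B = (\<lambda>d::complex \<times> complex. snd d - 2 * fst d) -` N"
  have "open B" unfolding B_def by (rule open_vimage[OF N(1)]) (intro continuous_intros)
  moreover have "(q, x) \<in> B" using N(2) by (simp add: B_def)
  moreover have "cholomorphic_on (\<lambda>d. (snd d, jac \<tau> (snd d - 2 * fst d))) B"
    unfolding cholomorphic_on_iff
  proof
    fix d assume "d \<in> B"
    hence "cdiff_at (jac \<tau>) (snd d - 2 * fst d)" by (intro cdiff_at_analytic N(3)) (simp add: B_def)
    moreover have "cdiff_at (\<lambda>d. snd d - 2 * fst d) d" by (intro cdiff_intros)
    ultimately have "cdiff_at (\<lambda>d. jac \<tau> (snd d - 2 * fst d)) d"
      by (rule_tac cdiff_at_compose[where f = "jac \<tau>" and g = "\<lambda>d. snd d - 2 * fst d"])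
    thus "cdiff_at (\<lambda>d. (snd d, jac \<tau> (snd d - 2 * fst d))) d" by (intro cdiff_at_Pair cdiff_at_snd)
  qed
  moreover have "\<forall>d\<in>B. \<phi> (pp d) = E (snd d, jac \<tau> (snd d - 2 * fst d))"
  proof
    fix d assume "d \<in> B"
    hence "jac \<tau> analytic_on {snd d - 2 * fst d}" by (intro N(3)) (simp add: B_def)
    thus "\<phi> (pp d) = E (snd d, jac \<tau> (snd d - 2 * fst d))" by (simp add: phi_pp E_def proj_lift_def)
  qed
  ultimately show ?thesis by blast
qed

lemma finite_branch_rep:
  obtains x' where "p x' = p x" "jac \<tau> analytic_on {x' - 2 * q}" "x' - x \<in> lattice \<tau>"
proof (cases "jac \<tau> analytic_on {x - 2 * q}")
  case True thus ?thesis using that[of x] lattice_0 by simp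
next
  case False
  have "jac \<tau> analytic_on {x - 2 * q + \<tau>}"
    by (rule equivariant.not_analytic(1)[OF jac_equivariant[OF im_pos] False])
  moreover have "x - 2 * q + \<tau> = x + \<tau> - 2 * q" by simp
  ultimately show ?thesis using that[of "x + \<tau>"] lattice_tau by simp
qed

lemma phi_holomorphic: "holomorphic_map CC S \<phi>"
proof (rule holomorphic_mapI[OF uniformizes_CC uniformizes_surface])
  show "has_local_lifts pp UNIV E UNIV \<phi>"
    unfolding has_local_lifts_def
  proof
    fix a :: "complex \<times> complex"
    obtain x' where x': "p x' = p (snd a)" "jac \<tau> analytic_on {x' - 2 * fst a}" "x' - snd a \<in> lattice \<tau>"
      by (rule finite_branch_rep) (rule that)
    define l where "l = x' - snd a"
    from phi_lift[OF x'(2)] obtain B where B: "open B" "(fst a, x') \<in> B"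
      "cholomorphic_on (\<lambda>d. (snd d, jac \<tau> (snd d - 2 * fst d))) B"
      "\<forall>d\<in>B. \<phi> (pp d) = E (snd d, jac \<tau> (snd d - 2 * fst d))" by (elim exE conjE)
    \<comment> \<open>The lift is constructed at the representative \<open>x'\<close>, where
      \<open>jac\<close> is finite, and carried back by a lattice translation, which does not change
      the point of the product of curves.\<close>
    define s where "s d = (fst d, snd d + l)" for d :: "complex \<times> complex"
    have os: "open (s -` B)" unfolding s_def by (rule open_vimage[OF B(1)]) (intro continuous_intros)
    have "a \<in> s -` B" using B(2) by (simp add: s_def l_def)
    moreover have "cholomorphic_on (\<lambda>d. (snd (s d), jac \<tau> (snd (s d) - 2 * fst (s d)))) (s -` B)"
      unfolding cholomorphic_on_iff
    proof
      fix d assume "d \<in> s -` B"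
      hence "cdiff_at (\<lambda>d. (snd d, jac \<tau> (snd d - 2 * fst d))) (s d)" using B(3) by (simp add: cholomorphic_on_iff)
      moreover have "cdiff_at s d" unfolding s_def by (intro cdiff_intros)
      ultimately show "cdiff_at (\<lambda>d. (snd (s d), jac \<tau> (snd (s d) - 2 * fst (s d)))) d"
        by (rule_tac cdiff_at_compose[where f = "\<lambda>d. (snd d, jac \<tau> (snd d - 2 * fst d))" and g = s])
    qed
    moreover have "\<forall>d\<in>s -` B. \<phi> (pp d) = E (snd (s d), jac \<tau> (snd (s d) - 2 * fst (s d)))"
    proof
      fix d assume d: "d \<in> s -` B"
      have "pp (s d) = pp d" using torus_proj_add_lattice[OF x'(3)[folded l_def], of "snd d"]
        by (simp add: s_def map_prod_def case_prod_unfold)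
      thus "\<phi> (pp d) = E (snd (s d), jac \<tau> (snd (s d) - 2 * fst (s d)))" using B(4) d by (metis vimage_eq)
    qed
    ultimately show "\<exists>B G. open B \<and> a \<in> B \<and> B \<subseteq> UNIV \<and> G ` B \<subseteq> UNIV \<and> cholomorphic_on G B \<and> (\<forall>x\<in>B. \<phi> (pp x) = E (G x))"
      using os by (intro exI[of _ "s -` B"] exI[of _ "\<lambda>d. (snd (s d), jac \<tau> (snd (s d) - 2 * fst (s d)))"]) simp
  qed
qed

text \<open>In the coordinates of \<open>E\<close> the cover sends \<open>(q, x)\<close> to the pair
  of \<open>x\<close> and \<open>w = jac \<tau> (x - 2 * q)\<close>. Where the derivative of
  \<open>jac\<close> is nonzero, a local inverse \<open>g\<close> of it gives back
  \<open>q = (x - g w) / 2\<close>.\<close>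

lemma phi_locally_biholomorphic_finite:
  assumes an: "jac \<tau> analytic_on {x - 2 * q}" and u: "x - 2 * q \<notin> lattice \<tau>"
  shows "locally_biholomorphic_at CC S \<phi> (p q, p x)"
proof -
  have "has_ord (deriv (jac \<tau>)) (x - 2 * q) 0" using jac_fibre(2)[OF im_pos an] u by simp
  hence d0: "deriv (jac \<tau>) (x - 2 * q) \<noteq> 0"
    using has_ord_analytic_pos_iff[of "deriv (jac \<tau>)" "x - 2 * q" 0] analytic_deriv[OF an] by simp
  from phi_lift[OF an] obtain B0 where B0: "open B0" "(q, x) \<in> B0"
      "cholomorphic_on (\<lambda>d. (snd d, jac \<tau> (snd d - 2 * fst d))) B0"
      "\<forall>d\<in>B0. \<phi> (pp d) = E (snd d, jac \<tau> (snd d - 2 * fst d))" by (elim exE conjE)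
  obtain N0 where N0: "open N0" "x - 2 * q \<in> N0" "jac \<tau> holomorphic_on N0" using an analytic_at by blast
  obtain r where r: "r > 0" "ball (x - 2 * q) r \<subseteq> N0" "inj_on (jac \<tau>) (ball (x - 2 * q) r)"
    by (rule has_complex_derivative_locally_injective[OF N0(3) N0(2) N0(1) d0]) (rule that)
  define N where "N = ball (x - 2 * q) r"
  have hN: "jac \<tau> holomorphic_on N" using N0(3) r(2) holomorphic_on_subset unfolding N_def by blast
  have oN: "open N" and injN: "inj_on (jac \<tau>) N" using r by (simp_all add: N_def)
  have oJ: "open (jac \<tau> ` N)" by (rule open_mapping_thm3[OF hN oN injN])
  obtain g where g: "g holomorphic_on (jac \<tau> ` N)" "\<And>z. z \<in> N \<Longrightarrow> deriv (jac \<tau>) z * deriv g (jac \<tau> z) = 1"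
    "\<And>z. z \<in> N \<Longrightarrow> g (jac \<tau> z) = z"
    by (rule holomorphic_has_inverse[OF hN oN injN]) (rule that)
  define G where "G d = (snd d, jac \<tau> (snd d - 2 * fst d))" for d
  define B where "B = (\<lambda>d::complex \<times> complex. snd d - 2 * fst d) -` N"
  have anN: "jac \<tau> analytic_on {z}" if "z \<in> N" for z using hN oN that analytic_at by blast
  have GB: "G ` B = UNIV \<times> jac \<tau> ` N"
  proof
    show "G ` B \<subseteq> UNIV \<times> jac \<tau> ` N" by (auto simp: G_def B_def)
    show "UNIV \<times> jac \<tau> ` N \<subseteq> G ` B"
    proof
      fix v :: "complex \<times> complex" assume "v \<in> UNIV \<times> jac \<tau> ` N"
      then obtain b s where v: "v = (b, jac \<tau> s)" "s \<in> N" by auto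
      have "v = G ((b - s) / 2, b)" "((b - s) / 2, b) \<in> B" using v by (auto simp: G_def B_def field_simps)
      thus "v \<in> G ` B" by (rule image_eqI)
    qed
  qed
  have "locally_biholomorphic_at CC S \<phi> (pp (q, x))"
  proof (rule locally_biholomorphicI[OF uniformizes_CC uniformizes_surface, where B = B and G = G and K = "\<lambda>v. (1 / 2 * (fst v - g (snd v)), fst v)"])
    show "open B" unfolding B_def by (rule open_vimage[OF oN]) (intro continuous_intros)
    show "(q, x) \<in> B" using r(1) by (simp add: B_def N_def)
    show "cholomorphic_on G B"
      unfolding cholomorphic_on_iff
    proof
      fix d assume "d \<in> B"
      hence "cdiff_at (jac \<tau>) (snd d - 2 * fst d)" by (intro cdiff_at_analytic anN) (simp add: B_def)
      moreover have "cdiff_at (\<lambda>d. snd d - 2 * fst d) d" by (intro cdiff_intros)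
      ultimately have "cdiff_at (\<lambda>d. jac \<tau> (snd d - 2 * fst d)) d"
        by (rule_tac cdiff_at_compose[where f = "jac \<tau>" and g = "\<lambda>d. snd d - 2 * fst d"])
      thus "cdiff_at G d" unfolding G_def by (intro cdiff_at_Pair cdiff_at_snd)
    qed
    show "\<phi> (pp d) = E (G d)" if "d \<in> B" for d
    proof -
      have "jac \<tau> analytic_on {snd d - 2 * fst d}" using that by (intro anN) (simp add: B_def)
      thus ?thesis by (simp add: phi_pp E_def G_def proj_lift_def)
    qed
    show "open (G ` B)" unfolding GB using oJ by (intro open_Times) auto
    show "cholomorphic_on (\<lambda>v. (1 / 2 * (fst v - g (snd v)), fst v)) (G ` B)"
      unfolding cholomorphic_on_iff GB
    proof
      fix v :: "complex \<times> complex" assume "v \<in> UNIV \<times> jac \<tau> ` N"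
      hence "g analytic_on {snd v}" using g(1) oJ analytic_at by auto
      hence "cdiff_at (\<lambda>v. g (snd v)) v" by (rule cdiff_at_compose[OF cdiff_at_snd cdiff_at_analytic])
      thus "cdiff_at (\<lambda>v. (1 / 2 * (fst v - g (snd v)), fst v)) v" by (intro cdiff_intros)
    qed
    show "(1 / 2 * (fst (G d) - g (snd (G d))), fst (G d)) = d" if "d \<in> B" for d
      using g(3)[of "snd d - 2 * fst d"] that by (simp add: G_def B_def prod_eq_iff)
  qed auto
  thus ?thesis by simp
qed

text \<open>For the direct implication: if \<open>x - 2 * q\<close> lies in Lambda, the points given
  by \<open>(q + e, x)\<close> and \<open>(q - e, x)\<close> have the same image for every
  \<open>e\<close>, so the cover is not injective near the point given by
  \<open>(q, x)\<close>.\<close>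

lemma phi_locally_biholomorphic_iff:
  "locally_biholomorphic_at CC S \<phi> (p q, p x) \<longleftrightarrow> x - 2 * q \<notin> lattice \<tau>"
proof
  assume u: "x - 2 * q \<notin> lattice \<tau>"
  obtain x' where x': "p x' = p x" "jac \<tau> analytic_on {x' - 2 * q}" "x' - x \<in> lattice \<tau>"
    by (rule finite_branch_rep) (rule that)
  have "x' - 2 * q = (x - 2 * q) + (x' - x)" by simp
  hence "x' - 2 * q \<notin> lattice \<tau>" using u lattice_add_iff[OF x'(3), of "x - 2 * q"] by simp
  from phi_locally_biholomorphic_finite[OF x'(2) this] show "locally_biholomorphic_at CC S \<phi> (p q, p x)"
    unfolding x'(1) .
next
  assume lb: "locally_biholomorphic_at CC S \<phi> (p q, p x)"
  show "x - 2 * q \<notin> lattice \<tau>"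
  proof
    assume u: "x - 2 * q \<in> lattice \<tau>"
    obtain U V where U: "openin (mtop CC) U" "(p q, p x) \<in> U"
      "biholomorphic_map (restrict_atlas CC U) (restrict_atlas S V) \<phi>"
      using lb unfolding locally_biholomorphic_at_def by blast
    from U(3) obtain k where k: "\<forall>z\<in>points (restrict_atlas CC U). k (\<phi> z) = z"
      unfolding biholomorphic_map_def by blast
    have UC: "U \<subseteq> points CC" "open (pp -` U)" using U(1) unfolding uniformizes_openin[OF uniformizes_CC] by auto
    have pU: "U \<subseteq> points (restrict_atlas CC U)"
    proof
      fix z assume z: "z \<in> U"
      then obtain W f where W: "(W, f) \<in> CC" "z \<in> W" using UC(1) unfolding points_def by auto
      hence "(W \<inter> U, f) \<in> restrict_atlas CC U" unfolding restrict_atlas_def by force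
      thus "z \<in> points (restrict_atlas CC U)" unfolding points_def using W(2) z by force
    qed
    have "open ((\<lambda>e. (q + e, x)) -` (pp -` U))" by (rule open_vimage[OF UC(2)]) (intro continuous_intros)
    moreover have "0 \<in> (\<lambda>e. (q + e, x)) -` (pp -` U)" using U(2) by simp
    ultimately obtain r where r: "r > 0" "ball 0 r \<subseteq> (\<lambda>e. (q + e, x)) -` (pp -` U)"
      using open_contains_ball by blast
    \<comment> \<open>Small enough for both points to stay in \<open>U\<close>, and for
      \<open>2 * e\<close> to be shorter than every nonzero lattice vector, so that the two points
      are distinct on the curve.\<close>
    define e where "e = complex_of_real (min r (min 1 (Im \<tau>)) / 4)"
    have ne: "norm e = min r (min 1 (Im \<tau>)) / 4" unfolding e_def norm_of_real using r im_pos by simp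
    have e: "e \<noteq> 0" "norm e < r" "norm (2 * e) < min 1 (Im \<tau>)"
    proof -
      have "norm e > 0" unfolding ne using r im_pos by simp
      thus "e \<noteq> 0" by simp
      show "norm e < r" unfolding ne using r im_pos by (simp add: min_def)
      show "norm (2 * e) < min 1 (Im \<tau>)" unfolding norm_mult ne using r im_pos by (simp add: min_def)
    qed
    have "(p (q + e), p x) \<in> U" "(p (q - e), p x) \<in> U"
      using r(2) e(2) subsetD[OF r(2), of e] subsetD[OF r(2), of "- e"] by auto
    moreover have "x - (q + e) - (q - e) \<in> lattice \<tau>" using u by (simp add: algebra_simps)
    hence "\<phi> (p (q + e), p x) = \<phi> (p (q - e), p x)" unfolding phi_eq_iff ..
    ultimately have "(p (q + e), p x) = (p (q - e), p x)" using k pU by (metis subsetD)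
    hence "2 * e \<in> lattice \<tau>" by (simp add: torus_proj_eq_iff)
    from lattice_small[OF im_pos this e(3)] show False using e(1) by simp
  qed
qed

lemma branch_locus_eq: "branch_locus CC S \<phi> = {\<phi> (p q, p x) | q x. x - 2 * q \<in> lattice \<tau>}"
proof -
  have "{z \<in> points CC. \<not> locally_biholomorphic_at CC S \<phi> z} = {(p q, p x) | q x. x - 2 * q \<in> lattice \<tau>}"
    unfolding points_CC using phi_locally_biholomorphic_iff by (auto simp: image_iff)
  thus ?thesis unfolding branch_locus_def by auto
qed

text \<open>The source is compact, being the image of a product of two period cells, and the target
  is Hausdorff.\<close>

lemma phi_proper: "proper_map (mtop CC) (mtop S) \<phi>"
proof (rule continuous_imp_proper_map)
  have cont: "continuous_map euclidean (mtop CC) pp"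
    unfolding continuous_map_def uniformizes_topspace[OF uniformizes_CC]
    using uniformizes_openin[OF uniformizes_CC] points_CC by (auto simp: vimage_def)
  have "compactin euclidean (period_cell \<tau> \<times> period_cell \<tau>)"
    using compact_Times[OF compact_period_cell compact_period_cell] by simp
  from image_compactin[OF this cont] have "compactin (mtop CC) (pp ` (period_cell \<tau> \<times> period_cell \<tau>))" .
  moreover have "pp ` (period_cell \<tau> \<times> period_cell \<tau>) = points CC"
  proof -
    have "p ` period_cell \<tau> = range p"
    proof
      show "range p \<subseteq> p ` period_cell \<tau>"
      proof
        fix q assume "q \<in> range p"
        then obtain x where x: "q = p x" by blast
        obtain y where "y \<in> period_cell \<tau>" "x - y \<in> lattice \<tau>" using period_cell_rep[OF im_pos] by blast
        thus "q \<in> p ` period_cell \<tau>" using x torus_proj_eq_iff by blast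
      qed
    qed auto
    hence "pp ` (period_cell \<tau> \<times> period_cell \<tau>) = range p \<times> range p" by (rule_tac map_prod_surj_on)
    also have "\<dots> = points CC" unfolding points_CC by (auto simp: image_iff)
    finally show ?thesis .
  qed
  ultimately show "compact_space (mtop CC)"
    unfolding compact_space_def uniformizes_topspace[OF uniformizes_CC] by simp
  have "Hausdorff_space (mtop S)" using manifold unfolding complex_manifold_def by simp
  thus "kc_space (mtop S)" by (rule Hausdorff_imp_kc_space)
  show "continuous_map (mtop CC) (mtop S) \<phi>" using phi_holomorphic unfolding holomorphic_map_def by simp
qed

lemma phi_double_cover: "double_cover CC S \<phi>"
  unfolding double_cover_def
proof (intro conjI ballI)
  show "holomorphic_map CC S \<phi>" by (rule phi_holomorphic)
  show "proper_map (mtop CC) (mtop S) \<phi>" by (rule phi_proper)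
  show "\<phi> ` points CC = points S"
  proof
    show "\<phi> ` points CC \<subseteq> points S" unfolding points_CC using range_E(2) by (auto simp: phi_eq)
    show "points S \<subseteq> \<phi> ` points CC"
    proof
      fix y assume "y \<in> points S"
      then obtain x q where "y = \<phi> (p q, p x)" by (rule surface_pointE)
      hence "y = \<phi> (pp (q, x))" by simp
      thus "y \<in> \<phi> ` points CC" unfolding points_CC by blast
    qed
  qed
  show "finite {z \<in> points CC. \<phi> z = y}" if y: "y \<in> points S" for y
  proof -
    obtain x q where "y = \<phi> (p q, p x)" by (rule surface_pointE[OF y])
    thus ?thesis by (simp only: phi_fibre) simp
  qed
  show "card {z \<in> points CC. \<phi> z = y} = 2" if y: "y \<in> points S - branch_locus CC S \<phi>" for y
  proof -
    obtain x q where xq: "y = \<phi> (p q, p x)" using y by (blast elim: surface_pointE)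
    hence "x - 2 * q \<notin> lattice \<tau>" using y unfolding branch_locus_eq by blast
    hence "x - q - q \<notin> lattice \<tau>" by (simp add: algebra_simps)
    hence "p q \<noteq> p (x - q)" using torus_proj_eq_iff[of \<tau> "x - q" q] by auto
    thus ?thesis unfolding xq phi_fibre by simp
  qed
qed

section \<open>The leaves of the webs and their preimages\<close>

lemma rho_inj: "rho m n z = rho m n z' \<Longrightarrow> z = z'"
  by (metis rho_minus)

lemma Psi_in_horizontal_leaf: "Psi x z \<in> range (\<lambda>x. Psi x z') \<longleftrightarrow> (\<exists>m n. z = rho m n z')"
proof
  assume "Psi x z \<in> range (\<lambda>x. Psi x z')"
  then obtain x' where "Psi x' z' = Psi x z" by auto
  thus "\<exists>m n. z = rho m n z'" unfolding Psi_eq_iff by blast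
next
  assume "\<exists>m n. z = rho m n z'"
  then obtain m n where z: "z = rho m n z'" by blast
  have "Psi x z = Psi ((x - of_int m - of_int n * \<tau>) + of_int m + of_int n * \<tau>) (rho m n z')" by (simp add: z)
  also have "\<dots> = Psi (x - of_int m - of_int n * \<tau>) z'" by (rule Psi_shift)
  finally show "Psi x z \<in> range (\<lambda>x. Psi x z')" by blast
qed

lemma Psi_in_minimal_leaf: "Psi x z \<in> minimal_leaf c \<longleftrightarrow> J (x + c) = z"
proof
  assume "Psi x z \<in> minimal_leaf c"
  then obtain x' where "Psi x z = Psi x' (J (x' + c))" unfolding minimal_leaf_def by blast
  then obtain m n where mn: "x' = x + of_int m + of_int n * \<tau>" "J (x' + c) = rho m n z"
    unfolding Psi_eq_iff by blast
  have e: "x' + c = (x + c) + of_int m + of_int n * \<tau>" using mn(1) by simp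
  have "rho m n (J (x + c)) = rho m n z" using mn(2) unfolding e J_shift .
  thus "J (x + c) = z" by (rule rho_inj)
qed (auto simp: minimal_leaf_def)

lemma minimal_leaf_eq_iff: "minimal_leaf c = minimal_leaf c' \<longleftrightarrow> (c - c') / 2 \<in> lattice \<tau>"
proof
  assume eq: "minimal_leaf c = minimal_leaf c'"
  \<comment> \<open>At this point the half sum of \<open>x + c\<close> and \<open>x + c'\<close> is
    1/2, which is not in Lambda; so equal values of \<open>J\<close> leave only the alternative
    about the difference.\<close>
  define x where "x = 1 / 2 - (c + c') / 2"
  have "Psi x (J (x + c)) \<in> minimal_leaf c'" unfolding eq[symmetric] Psi_in_minimal_leaf ..
  hence "J (x + c) = J (x + c')" unfolding Psi_in_minimal_leaf by simp
  hence d: "(x + c - (x + c')) / 2 \<in> lattice \<tau> \<or> (x + c + (x + c')) / 2 \<in> lattice \<tau>" unfolding J_eq_iff .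
  have e: "(x + c + (x + c')) / 2 = 1 / 2" "x + c - (x + c') = c - c'" by (simp_all add: x_def field_simps)
  from d[unfolded e] show "(c - c') / 2 \<in> lattice \<tau>" using half_not_lattice[OF im_pos] by blast
next
  assume l: "(c - c') / 2 \<in> lattice \<tau>"
  have "J (x + c) = J (x + c')" for x
  proof -
    have "x + c' + 2 * ((c - c') / 2) = x + c" by (simp add: field_simps)
    thus ?thesis using jac_lift_periodic[OF im_pos l, of "x + c'"] by (simp only:)
  qed
  thus "minimal_leaf c = minimal_leaf c'" by (simp add: minimal_leaf_def)
qed

lemma phi_in_minimal_leaf:
  "\<phi> (p q, p x) \<in> minimal_leaf c \<longleftrightarrow> q - (- (c / 2)) \<in> lattice \<tau> \<or> x - q - (- (c / 2)) \<in> lattice \<tau>"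
proof -
  have "\<phi> (p q, p x) \<in> minimal_leaf c \<longleftrightarrow> J (x - 2 * q) = J (x + c)"
    unfolding phi_eq Psi_in_minimal_leaf by auto
  also have "\<dots> \<longleftrightarrow> - (q + c / 2) \<in> lattice \<tau> \<or> x - q + c / 2 \<in> lattice \<tau>"
  proof -
    have e: "(x - 2 * q - (x + c)) / 2 = - (q + c / 2)" "(x - 2 * q + (x + c)) / 2 = x - q + c / 2"
      by (simp_all add: field_simps)
    show ?thesis unfolding J_eq_iff e ..
  qed
  finally show ?thesis unfolding lattice_minus_iff by simp
qed

text \<open>The leaves through the image of \<open>(q, x)\<close> are those with the parameters
  \<open>- 2 * q\<close> and \<open>- 2 * (x - q)\<close>. They coincide exactly when
  \<open>x - 2 * q\<close> lies in Lambda, the condition that describes the branch locus.\<close>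

lemma discriminant_eq: "web_discriminant C S \<pi> = branch_locus CC S \<phi>"
proof -
  have iff: "(\<exists>!L. L \<in> range minimal_leaf \<and> \<phi> (p q, p x) \<in> L) \<longleftrightarrow> x - 2 * q \<in> lattice \<tau>" for q x
  proof
    have e: "q - (- (- 2 * q / 2)) = 0" "x - q - (- (- 2 * (x - q) / 2)) = 0"
      by (simp_all add: field_simps)
    have i1: "\<phi> (p q, p x) \<in> minimal_leaf (- 2 * q)" and i2: "\<phi> (p q, p x) \<in> minimal_leaf (- 2 * (x - q))"
      unfolding phi_in_minimal_leaf e by (simp_all only: lattice_0 simp_thms)
    {
      assume "\<exists>!L. L \<in> range minimal_leaf \<and> \<phi> (p q, p x) \<in> L"
      hence eq: "minimal_leaf (- 2 * q) = minimal_leaf (- 2 * (x - q))" using i1 i2 by blast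
      have "(- 2 * q - (- 2 * (x - q))) / 2 = x - 2 * q" by (simp add: field_simps)
      thus "x - 2 * q \<in> lattice \<tau>" using eq unfolding minimal_leaf_eq_iff by (simp only:)
    next
      assume u: "x - 2 * q \<in> lattice \<tau>"
      have "minimal_leaf c = minimal_leaf (- 2 * q)" if "\<phi> (p q, p x) \<in> minimal_leaf c" for c
      proof -
        have "q + c / 2 \<in> lattice \<tau> \<or> x - q + c / 2 \<in> lattice \<tau>"
          using that unfolding phi_in_minimal_leaf by simp
        moreover have "x - q + c / 2 = (q + c / 2) + (x - 2 * q)" by simp
        ultimately have "q + c / 2 \<in> lattice \<tau>" using lattice_add_iff[OF u, of "q + c / 2"] by auto
        moreover have "(c - (- 2 * q)) / 2 = q + c / 2" by (simp add: field_simps)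
        ultimately show ?thesis unfolding minimal_leaf_eq_iff by (simp only:)
      qed
      thus "\<exists>!L. L \<in> range minimal_leaf \<and> \<phi> (p q, p x) \<in> L" using i1 by blast
    }
  qed
  show ?thesis
  proof
    show "web_discriminant C S \<pi> \<subseteq> branch_locus CC S \<phi>"
    proof
      fix y assume "y \<in> web_discriminant C S \<pi>"
      hence y: "y \<in> points S" "\<exists>!L. L \<in> range minimal_leaf \<and> y \<in> L"
        unfolding web_discriminant_def minimal_section_web_eq by auto
      obtain x q where xq: "y = \<phi> (p q, p x)" by (rule surface_pointE[OF y(1)])
      have "x - 2 * q \<in> lattice \<tau>" using y(2) unfolding xq iff .
      thus "y \<in> branch_locus CC S \<phi>" unfolding branch_locus_eq xq by blast
    qed
    show "branch_locus CC S \<phi> \<subseteq> web_discriminant C S \<pi>"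
    proof
      fix y assume "y \<in> branch_locus CC S \<phi>"
      then obtain q x where xq: "y = \<phi> (p q, p x)" "x - 2 * q \<in> lattice \<tau>" unfolding branch_locus_eq by blast
      have "y \<in> points S" unfolding xq(1) phi_eq by (rule range_E(2))
      moreover have "\<exists>!L. L \<in> range minimal_leaf \<and> y \<in> L" unfolding xq(1) iff by (rule xq(2))
      ultimately show "y \<in> web_discriminant C S \<pi>"
        unfolding web_discriminant_def minimal_section_web_eq by blast
    qed
  qed
qed

text \<open>A leaf of Ric meets a fibre in an orbit of \<open>rho\<close>, which consists of the
  values of \<open>J\<close> on the coset of \<open>v\<close> modulo Lambda. Letting
  \<open>v\<close> run through this coset turns the condition modulo 2 Lambda of
  \<open>J_eq_iff\<close> into one modulo Lambda, and evenness of \<open>J\<close> adds the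
  sign.\<close>

lemma phi_in_horizontal_leaf:
  "\<phi> (p q, p x) \<in> range (\<lambda>x. Psi x (J v)) \<longleftrightarrow> x - 2 * q - v \<in> lattice \<tau> \<or> x - 2 * q + v \<in> lattice \<tau>"
proof -
  have "\<phi> (p q, p x) \<in> range (\<lambda>x. Psi x (J v)) \<longleftrightarrow> (\<exists>l\<in>lattice \<tau>. J (x - 2 * q) = J (v + l))"
    unfolding phi_eq Psi_in_horizontal_leaf J_shift[symmetric]
  proof
    assume "\<exists>m n. J (x - 2 * q) = J (v + of_int m + of_int n * \<tau>)"
    then obtain m n where "J (x - 2 * q) = J (v + (of_int m + of_int n * \<tau>))" unfolding add.assoc by blast
    thus "\<exists>l\<in>lattice \<tau>. J (x - 2 * q) = J (v + l)" using latticeI by blast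
  next
    assume "\<exists>l\<in>lattice \<tau>. J (x - 2 * q) = J (v + l)"
    thus "\<exists>m n. J (x - 2 * q) = J (v + of_int m + of_int n * \<tau>)"
      unfolding lattice_def add.assoc by blast
  qed
  also have "\<dots> \<longleftrightarrow> x - 2 * q - v \<in> lattice \<tau> \<or> x - 2 * q + v \<in> lattice \<tau>"
  proof
    assume "\<exists>l\<in>lattice \<tau>. J (x - 2 * q) = J (v + l)"
    then obtain l where l: "l \<in> lattice \<tau>"
      "(x - 2 * q - (v + l)) / 2 \<in> lattice \<tau> \<or> (x - 2 * q + (v + l)) / 2 \<in> lattice \<tau>"
      unfolding J_eq_iff by blast
    have dbl: "t \<in> lattice \<tau>" if "t / 2 \<in> lattice \<tau>" for t using lattice_add[OF that that] by simp
    from l(2) have "x - 2 * q - (v + l) \<in> lattice \<tau> \<or> x - 2 * q + (v + l) \<in> lattice \<tau>" using dbl by blast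
    thus "x - 2 * q - v \<in> lattice \<tau> \<or> x - 2 * q + v \<in> lattice \<tau>"
    proof
      assume "x - 2 * q - (v + l) \<in> lattice \<tau>"
      from lattice_add[OF this l(1)] show ?thesis by (simp add: algebra_simps)
    next
      assume "x - 2 * q + (v + l) \<in> lattice \<tau>"
      from lattice_diff[OF this l(1)] show ?thesis by (simp add: algebra_simps)
    qed
  next
    assume "x - 2 * q - v \<in> lattice \<tau> \<or> x - 2 * q + v \<in> lattice \<tau>"
    thus "\<exists>l\<in>lattice \<tau>. J (x - 2 * q) = J (v + l)"
    proof
      assume "x - 2 * q - v \<in> lattice \<tau>"
      thus ?thesis by (rule_tac bexI[of _ "x - 2 * q - v"]) simp_all
    next
      assume "x - 2 * q + v \<in> lattice \<tau>"
      hence "- (x - 2 * q + v) \<in> lattice \<tau>" by (rule lattice_minus)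
      moreover have "J (v + - (x - 2 * q + v)) = J (x - 2 * q)"
        using jac_lift_minus[OF im_pos, of "x - 2 * q"] by simp
      ultimately show ?thesis by metis
    qed
  qed
  finally show ?thesis .
qed

text \<open>On a pair \<open>(q, x)\<close> these forms are \<open>q\<close>, \<open>x - q\<close>,
  \<open>x\<close> and \<open>x - 2 * q\<close>.\<close>

definition four_forms :: "(complex \<times> complex) set"
  where "four_forms = {(1, 0), (- 1, 1), (0, 1), (- 2, 1)}"

lemma card_kernel_lines: "card (kernel_line ` four_forms) = 4"
proof -
  \<comment> \<open>Each of these test vectors separates one line from all later ones.\<close>
  have mem: "(0, 1) \<in> kernel_line (1, 0)" "(0, 1) \<notin> kernel_line (- 1, 1)" "(0, 1) \<notin> kernel_line (0, 1)"
    "(0, 1) \<notin> kernel_line (- 2, 1)" "(1, 1) \<in> kernel_line (- 1, 1)" "(1, 1) \<notin> kernel_line (0, 1)"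
    "(1, 1) \<notin> kernel_line (- 2, 1)" "(1, 0) \<in> kernel_line (0, 1)" "(1, 0) \<notin> kernel_line (- 2, 1)"
    by (simp_all add: kernel_line_def linear_form_def)
  have "kernel_line (1, 0) \<noteq> kernel_line (- 1, 1)" "kernel_line (1, 0) \<noteq> kernel_line (0, 1)"
    "kernel_line (1, 0) \<noteq> kernel_line (- 2, 1)" "kernel_line (- 1, 1) \<noteq> kernel_line (0, 1)"
    "kernel_line (- 1, 1) \<noteq> kernel_line (- 2, 1)" "kernel_line (0, 1) \<noteq> kernel_line (- 2, 1)"
    using mem by metis+
  thus ?thesis by (simp add: four_forms_def)
qed

lemma countable_lattice: "countable (lattice \<tau>)"
proof -
  have "lattice \<tau> = (\<lambda>(m, n). of_int m + of_int n * \<tau>) ` (UNIV :: (int \<times> int) set)"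
    by (auto simp: lattice_def)
  thus ?thesis by simp
qed

lemma countable_class: "countable {t. t - c \<in> lattice \<tau>}"
proof -
  have "{t. t - c \<in> lattice \<tau>} = (\<lambda>l. l + c) ` lattice \<tau>" by (force simp: image_iff)
  thus ?thesis using countable_lattice by simp
qed

lemma four_web_parallelizable:
  assumes R: "R = {range (\<lambda>x. Psi x z) | z. True}"
  shows "parallelizable_web 4 CC (pullback_web CC \<phi> (R \<union> minimal_section_web C S \<pi> \<union> fibration_web C S \<pi>))"
proof (rule parallelizable_webI[OF uniformizes_CC _ card_kernel_lines])
  show "finite four_forms" "0 \<notin> four_forms" by (auto simp: four_forms_def zero_prod_def)
  let ?W = "R \<union> minimal_section_web C S \<pi> \<union> fibration_web C S \<pi>"
  have pts: "pp d \<in> points CC" for d unfolding points_CC by blast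
  have mem: "pp d \<in> {x \<in> points CC. \<phi> x \<in> L} \<longleftrightarrow> \<phi> (p (fst d), p (snd d)) \<in> L" for d L
    using pts[of d] by (simp add: map_prod_def case_prod_unfold)
  have pb: "{x \<in> points CC. \<phi> x \<in> L} \<in> pullback_web CC \<phi> ?W" if "L \<in> ?W" for L
    unfolding pullback_web_def using that by blast
  have fib: "\<phi> (p q, p x) \<in> {s \<in> points S. \<pi> s = p y} \<longleftrightarrow> x - y \<in> lattice \<tau>" for q x y
    unfolding phi_eq using range_E(2) by (simp add: proj_Psi torus_proj_eq_iff)
  show "\<exists>A. (\<forall>w\<in>four_forms. countable (A w)) \<and> (\<forall>d. pp d \<in> L \<longleftrightarrow> (\<exists>w\<in>four_forms. linear_form w d \<in> A w))"
    if "L \<in> pullback_web CC \<phi> ?W" for L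
  proof -
    from that obtain L0 where L: "L = {x \<in> points CC. \<phi> x \<in> L0}" and L0: "L0 \<in> ?W"
      unfolding pullback_web_def by blast
    from L0 consider z where "L0 = range (\<lambda>x. Psi x z)" | c where "L0 = minimal_leaf c"
      | y where "L0 = {s \<in> points S. \<pi> s = p y}"
      unfolding R minimal_section_web_eq fibration_web_def points_C by blast
    thus ?thesis
    proof cases
      case (1 z)
      obtain v where v: "J v = z" using jac_surj[OF im_pos] by blast
      \<comment> \<open>Two cosets, because \<open>J\<close> is even: the preimage of one leaf of
        Ric contains the levels of both \<open>v\<close> and \<open>- v\<close>.\<close>
      define A where "A w = (if w = (- 2, 1) then {t. t - v \<in> lattice \<tau>} \<union> {t. t - (- v) \<in> lattice \<tau>} else {})" for w :: "complex \<times> complex"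
      have "\<forall>w\<in>four_forms. countable (A w)"
        unfolding A_def using countable_class[of v] countable_class[of "- v"] by simp
      moreover have "pp d \<in> L \<longleftrightarrow> (\<exists>w\<in>four_forms. linear_form w d \<in> A w)" for d
        unfolding L mem 1 v[symmetric] phi_in_horizontal_leaf
        by (auto simp: four_forms_def A_def linear_form_def algebra_simps)
      ultimately show ?thesis by blast
    next
      case (2 c)
      \<comment> \<open>The deck involution exchanges \<open>q\<close> and \<open>x - q\<close>, so
        the preimage of one minimal section consists of leaves of both families, at the same
        levels.\<close>
      define A where "A w = (if w = (1, 0) \<or> w = (- 1, 1) then {t. t - (- (c / 2)) \<in> lattice \<tau>} else {})" for w :: "complex \<times> complex"
      have "\<forall>w\<in>four_forms. countable (A w)" unfolding A_def using countable_class[of "- (c / 2)"] by simp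
      moreover have "pp d \<in> L \<longleftrightarrow> (\<exists>w\<in>four_forms. linear_form w d \<in> A w)" for d
        unfolding L mem 2 phi_in_minimal_leaf
        by (auto simp: four_forms_def A_def linear_form_def algebra_simps)
      ultimately show ?thesis by blast
    next
      case (3 y)
      define A where "A w = (if w = (0, 1) then {t. t - y \<in> lattice \<tau>} else {})" for w :: "complex \<times> complex"
      have "\<forall>w\<in>four_forms. countable (A w)" unfolding A_def using countable_class by simp
      moreover have "pp d \<in> L \<longleftrightarrow> (\<exists>w\<in>four_forms. linear_form w d \<in> A w)" for d
        unfolding L mem 3 fib
        by (auto simp: four_forms_def A_def linear_form_def algebra_simps)
      ultimately show ?thesis by blast
    qed
  qed
  show "\<exists>L\<in>pullback_web CC \<phi> ?W. \<forall>d. linear_form w d = \<alpha> \<longrightarrow> pp d \<in> L" if "w \<in> four_forms" for w \<alpha>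
  proof -
    have "\<exists>L0\<in>?W. \<forall>d. linear_form w d = \<alpha> \<longrightarrow> \<phi> (p (fst d), p (snd d)) \<in> L0"
    proof -
      from that consider "w = (1, 0) \<or> w = (- 1, 1)" | "w = (0, 1)" | "w = (- 2, 1)"
        unfolding four_forms_def by blast
      thus ?thesis
      proof cases
        case 1
        \<comment> \<open>The minimal section with parameter \<open>c\<close> has the level
          \<open>- (c / 2)\<close> for both forms, which is \<alpha> for this choice.\<close>
        have "\<forall>d. linear_form w d = \<alpha> \<longrightarrow> \<phi> (p (fst d), p (snd d)) \<in> minimal_leaf (- 2 * \<alpha>)"
          unfolding phi_in_minimal_leaf using 1 by (auto simp: linear_form_def lattice_0)
        thus ?thesis unfolding minimal_section_web_eq by blast
      next
        case 2
        have "\<forall>d. linear_form w d = \<alpha> \<longrightarrow> \<phi> (p (fst d), p (snd d)) \<in> {s \<in> points S. \<pi> s = p \<alpha>}"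
          unfolding fib using 2 by (auto simp: linear_form_def lattice_0)
        moreover have "{s \<in> points S. \<pi> s = p \<alpha>} \<in> fibration_web C S \<pi>"
          unfolding fibration_web_def points_C by blast
        ultimately show ?thesis by blast
      next
        case 3
        have "\<forall>d. linear_form w d = \<alpha> \<longrightarrow> \<phi> (p (fst d), p (snd d)) \<in> range (\<lambda>x. Psi x (J \<alpha>))"
          unfolding phi_in_horizontal_leaf using 3 by (auto simp: linear_form_def lattice_0)
        moreover have "range (\<lambda>x. Psi x (J \<alpha>)) \<in> R" unfolding R by blast
        ultimately show ?thesis by blast
      qed
    qed
    then obtain L0 where L0: "L0 \<in> ?W" "\<forall>d. linear_form w d = \<alpha> \<longrightarrow> \<phi> (p (fst d), p (snd d)) \<in> L0" by blast
    have "\<forall>d. linear_form w d = \<alpha> \<longrightarrow> pp d \<in> {x \<in> points CC. \<phi> x \<in> L0}" unfolding mem by (rule L0(2))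
    thus ?thesis using pb[OF L0(1)] by blast
  qed
qed

end

theorem theorem1p2:
  fixes \<tau> :: complex
    and S :: "('s, complex \<times> complex) atlas"
    and \<pi> :: "'s \<Rightarrow> complex set"
    and Ric :: "'s web"
  assumes "Im \<tau> > 0"
    and "stable_ruled_surface (elliptic_curve \<tau>) S \<pi>"
    and "riccati_foliation \<tau> S \<pi> Ric"
  shows "\<exists>\<phi>. double_cover (prod_atlas (elliptic_curve \<tau>) (elliptic_curve \<tau>)) S \<phi> \<and>
    branch_locus (prod_atlas (elliptic_curve \<tau>) (elliptic_curve \<tau>)) S \<phi> =
      web_discriminant (elliptic_curve \<tau>) S \<pi> \<and>
    parallelizable_web 4 (prod_atlas (elliptic_curve \<tau>) (elliptic_curve \<tau>))
      (pullback_web (prod_atlas (elliptic_curve \<tau>) (elliptic_curve \<tau>)) \<phi>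
        (Ric \<union> minimal_section_web (elliptic_curve \<tau>) S \<pi> \<union>
         fibration_web (elliptic_curve \<tau>) S \<pi>))"
proof -
  have manifold: "complex_manifold S"
    using assms(2) unfolding stable_ruled_surface_def ruled_surface_def by blast
  obtain \<psi> where \<psi>: "biholomorphic_map (suspension \<tau>) S \<psi>"
    "\<And>x z. \<pi> (\<psi> (suspension_proj \<tau> (x, z))) = torus_proj \<tau> x"
    "Ric = {range (\<lambda>x. \<psi> (suspension_proj \<tau> (x, z))) | z. True}"
    using assms(3) unfolding riccati_foliation_def by (elim exE conjE) blast
  interpret suspended_surface \<tau> S \<pi> \<psi>
    by unfold_locales (rule assms(1) manifold \<psi>(1,2))+
  have "Ric = {range (\<lambda>x. Psi x z) | z. True}" unfolding \<psi>(3) Psi_def ..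
  from four_web_parallelizable[OF this] phi_double_cover discriminant_eq[symmetric]
  show ?thesis by (intro exI[of _ \<phi>] conjI)
qed

end
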